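(* Let $a>0$ and consider the system of coupled Van der Pol oscillators $$\ddot x=(\alpha-x^2)\dot x-x+\frac a2\,\mathcal B\dot x,\qquad x\in\mathbb R^8,$$ with bifurcation parameter $\alpha$. All of the following branches of periodic solutions are born from the zero solution via supercritical Hopf bifurcations at the indicated values $\alpha_o$: (i) at $\alpha_o=0$: the branch with spatio-temporal symmetry group ${}^+S_4$ (1 branch); (ii) at $\alpha_o=a$: the branches whose spatio-temporal symmetry group is conjugate to one of ${}^-D_4^z$, ${}^-D_3^z$, ${}^-D_2^d$, ${}^-\mathbb Z_4^c$, ${}^-\mathbb Z_3^t$ (27 branches in total); (iii) at $\alpha_o=2a$: the branches whose spatio-temporal symmetry group is conjugate to one of ${}^+D_4^d$, ${}^+D_3$, ${}^+D_2^d$, ${}^+\mathbb Z_4^c$, ${}^+\mathbb Z_3^t$ (27 branches in total); (iv) at $\alpha_o=3a$: the branch with spatio-temporal symmetry group ${}^-S_4^-$ (1 branch).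
   Context: Products of vectors are componentwise: $(x\cdot y)_j=x_jy_j$, $x^2=x\cdot x$. The matrix is $$\mathcal B=\begin{pmatrix}-3&1&0&1&1&0&0&0\\1&-3&1&0&0&1&0&0\\0&1&-3&1&0&0&1&0\\1&0&1&-3&0&0&0&1\\1&0&0&0&-3&1&0&1\\0&1&0&0&1&-3&1&0\\0&0&1&0&0&1&-3&1\\0&0&0&1&1&0&1&-3\end{pmatrix},$$ i.e. $\mathcal B+3I$ is the adjacency matrix of the cube graph with vertices $1,\dots,8$ and edges $12,23,34,41,56,67,78,85,15,26,37,48$. Symmetries. $O_4$ is the group (of permutations of $\{1,\dots,8\}$) of all symmetries of this cube; $S_4<O_4$ is its subgroup of orientation-preserving symmetries (24 rotations). $()$ is the identity and $\iota=(17)(28)(35)(46)\in O_4$ is the antipodal map. $\mathbb Z_2=\{1,-1\}$, $S^1=\mathbb R/\mathbb Z$. For $h\in O_4$, $\mathscr T_h$ is its permutation matrix on $\mathbb R^8$, $\mathscr T_he_j=e_{h(j)}$. The system is equivariant under $\mathbb Z_2\times O_4$, with $(r,h)$ acting by $r\mathscr T_h$. The spatio-temporal symmetry group of a nonconstant periodic function $x(t)$ of minimal period $T$ is the set of all $(r,h,\theta)\in\mathbb Z_2\times O_4\times S^1$ with $r\mathscr T_hx(t-\theta T)=x(t)$ for all $t$. It is the graph $H^\varphi$ of a homomorphism $\varphi:H\to S^1$ defined on a subgroup $H<\mathbb Z_2\times O_4$. Groups. For a subgroup $L<S_4\times S^1$ (regarded as the subgroup $\{1\}\times L$ of $\mathbb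 Z_2\times O_4\times S^1$), ${}^+L$ and ${}^-L$ are the subgroups of all products of elements of $L$ with elements of, respectively, $$\{(1,(),0),(1,\iota,0),(-1,(),1/2),(-1,\iota,1/2)\}\quad\text{and}\quad\{(1,(),0),(-1,\iota,0),(-1,(),1/2),(1,\iota,1/2)\}.$$ The subgroups $L$ used are: $S_4=\{(g,0):g\in S_4\}$. $S_4^-=\{(g,\theta(g)):g\in S_4\}$, where $\theta(g)=1/2$ if $g$ is a quarter-turn about an axis through centers of opposite faces or a half-turn about an axis through midpoints of opposite edges, and $\theta(g)=0$ for all other $g$. $D_4^z=\{((),0),((1234)(5678),0),((13)(24)(57)(68),0),((1432)(5876),0),((17)(26)(35)(48),1/2),((18)(27)(36)(45),1/2),((15)(28)(37)(46),1/2),((16)(25)(38)(47),1/2)\}$. $D_3^z=\{((),0),((254)(368),0),((245)(386),0),((17)(26)(35)(48),1/2),((17)(28)(34)(56),1/2),((17)(23)(46)(58),1/2)\}$. $D_2^d=\{((),0),((17)(26)(35)(48),0),((13)(24)(57)(68),1/2),((15)(28)(37)(46),1/2)\}$. $\mathbb Z_4^c=\{((),0),((1234)(5678),1/4),((13)(24)(57)(68),1/2),((1432)(5876),3/4)\}$. $\mathbb Z_3^t=\{((),0),((254)(368),1/3),((245)(386),2/3)\}$. $D_4^d=\{((),0),((1234)(5678),1/2),((13)(24)(57)(68),0),((1432)(5876),1/2),((17)(26)(35)(48),0),((18)(27)(36)(45),1/2),((15)(28)(37)(46),0),((16)(25)(38)(47),1/2)\}$. $D_3=\{((),0),((254)(368),0),((245)(386),0),((17)(26)(35)(48),0),((17)(28)(34)(56),0),((17)(23)(46)(58),0)\}$.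 Branches. A branch with symmetry $H^\varphi$ bifurcating from $x=0$ at $\alpha_o$ is a family of nonconstant periodic solutions with spatio-temporal symmetry group $H^\varphi$ along which the amplitude tends to $0$, the parameter $\alpha$ tends to $\alpha_o$ and the period tends to $2\pi$. It is known from equivariant Hopf bifurcation theory that branches with the listed symmetries exist. The bifurcation is called supercritical if, near the bifurcation point, the periodic solutions of the branch occur for $\alpha>\alpha_o$. *)

theory Defs
  imports "HOL-Analysis.Analysis" "HOL-Algebra.Coset" "HOL-Combinatorics.Cycles"
begin

text \<open>The numeral type \<^typ>\<open>8\<close> indexes the vertices \<open>1, \<dots>, 8\<close> of the cube; in it \<open>8 = 0\<close>, so
  these eight labels are pairwise distinct and exhaust the type.  On \<^typ>\<open>real ^ 8\<close> the
  operations \<open>*\<close>, \<open>^\<close> and the constant \<open>1\<close> are componentwise.\<close>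

definition cube_matrix :: "real ^ 8 ^ 8"  where
  "cube_matrix = vector [
     vector [-3,  1,  0,  1,  1,  0,  0,  0],
     vector [ 1, -3,  1,  0,  0,  1,  0,  0],
     vector [ 0,  1, -3,  1,  0,  0,  1,  0],
     vector [ 1,  0,  1, -3,  0,  0,  0,  1],
     vector [ 1,  0,  0,  0, -3,  1,  0,  1],
     vector [ 0,  1,  0,  0,  1, -3,  1,  0],
     vector [ 0,  0,  1,  0,  0,  1, -3,  1],
     vector [ 0,  0,  0,  1,  1,  0,  1, -3]]"

definition vdp_solution :: "real \<Rightarrow> real \<Rightarrow> (real \<Rightarrow> real ^ 8) \<Rightarrow> bool" where
  "vdp_solution a \<alpha> x \<longleftrightarrow> (\<exists>v. \<forall>t.
     (x has_vector_derivative v t) (at t) \<and>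
     (v has_vector_derivative
        ((\<alpha> *\<^sub>R 1 - (x t)\<^sup>2) * v t - x t + (a / 2) *\<^sub>R (cube_matrix *v v t))) (at t))"

definition minimal_period :: "(real \<Rightarrow> 'a) \<Rightarrow> real \<Rightarrow> bool" where
  "minimal_period x T \<longleftrightarrow> T > 0 \<and> (\<forall>t. x (t + T) = x t) \<and>
     (\<forall>S. 0 < S \<and> S < T \<longrightarrow> \<not> (\<forall>t. x (t + S) = x t))"

definition periodic_vdp_solution :: "real \<Rightarrow> real \<Rightarrow> real \<Rightarrow> (real \<Rightarrow> real ^ 8) \<Rightarrow> bool" where
  "periodic_vdp_solution a \<alpha> T x \<longleftrightarrow>
     vdp_solution a \<alpha> x \<and> \<not> x constant_on UNIV \<and> minimal_period x T"

definition amplitude :: "(real \<Rightarrow> real ^ 8) \<Rightarrow> real" where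
  "amplitude x = (SUP t. norm (x t))"

text \<open>The cube is realised in \<^typ>\<open>real ^ 3\<close> with the vertices \<open>(\<plusminus>1, \<plusminus>1, \<plusminus>1)\<close>, numbered so that
  its edges are the ones listed in \<open>cube_edges\<close>.\<close>

definition cube_vertex :: "8 \<Rightarrow> real ^ 3" where
  "cube_vertex j = (vector [
     vector [ 1,  1,  1], vector [-1,  1,  1], vector [-1, -1,  1], vector [ 1, -1,  1],
     vector [ 1,  1, -1], vector [-1,  1, -1], vector [-1, -1, -1], vector [ 1, -1, -1]]
       :: real ^ 3 ^ 8) $ j"

definition cube_edges :: "8 set set" where
  "cube_edges = {{1,2}, {2,3}, {3,4}, {4,1}, {5,6}, {6,7}, {7,8}, {8,5}, {1,5}, {2,6}, {3,7}, {4,8}}"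

definition induces :: "real ^ 3 ^ 3 \<Rightarrow> (8 \<Rightarrow> 8) \<Rightarrow> bool" where
  "induces A h \<longleftrightarrow> (\<forall>j. A *v cube_vertex j = cube_vertex (h j))"

definition O4 :: "(8 \<Rightarrow> 8) set" where
  "O4 = {h. bij h \<and> (\<exists>A. orthogonal_matrix A \<and> induces A h)}"

definition S4 :: "(8 \<Rightarrow> 8) set" where
  "S4 = {h. bij h \<and> (\<exists>A. rotation_matrix A \<and> induces A h)}"

definition perm_matrix :: "(8 \<Rightarrow> 8) \<Rightarrow> real ^ 8 ^ 8" where
  "perm_matrix h = (\<chi> i j. if i = h j then 1 else 0)"

text \<open>Rotations about the line through \<open>0\<close> and \<open>w \<noteq> 0\<close>, by \<open>\<pi>/2\<close> (in either direction) and by \<open>\<pi>\<close>.\<close>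

definition quarter_turn :: "real ^ 3 ^ 3 \<Rightarrow> real ^ 3 \<Rightarrow> bool" where
  "quarter_turn A w \<longleftrightarrow> rotation_matrix A \<and> A *v w = w \<and>
     (\<forall>u. orthogonal u w \<longrightarrow> orthogonal (A *v u) u)"

definition half_turn :: "real ^ 3 ^ 3 \<Rightarrow> real ^ 3 \<Rightarrow> bool" where
  "half_turn A w \<longleftrightarrow> rotation_matrix A \<and> A *v w = w \<and>
     (\<forall>u. orthogonal u w \<longrightarrow> A *v u = - u)"

text \<open>The axes through centers of opposite faces are the coordinate axes; the midpoint of the edge
  \<open>{i, j}\<close> is a multiple of the sum of its end points.\<close>

definition face_quarter_turn :: "(8 \<Rightarrow> 8) \<Rightarrow> bool" where
  "face_quarter_turn h \<longleftrightarrow> (\<exists>A k. induces A h \<and> quarter_turn A (axis k 1))"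

definition edge_half_turn :: "(8 \<Rightarrow> 8) \<Rightarrow> bool" where
  "edge_half_turn h \<longleftrightarrow>
     (\<exists>A i j. induces A h \<and> {i, j} \<in> cube_edges \<and> half_turn A (cube_vertex i + cube_vertex j))"

text \<open>The group \<open>\<int>\<^sub>2 \<times> O\<^sub>4 \<times> S\<^sup>1\<close>.  Elements of \<open>S\<^sup>1 = \<real>/\<int>\<close> are represented by reals in
  \<open>[0, 1)\<close>, added modulo \<open>1\<close>.\<close>

type_synonym sym = "int \<times> (8 \<Rightarrow> 8) \<times> real"

definition SG :: "sym monoid" where
  "SG = \<lparr>carrier = {1, -1} \<times> O4 \<times> {0..<1},
         monoid.mult = (\<lambda>(r, h, \<theta>) (r', h', \<theta>'). (r * r', h \<circ> h', frac (\<theta> + \<theta>'))),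
         one = (1, id, 0)\<rparr>"

definition sym_group :: "(real \<Rightarrow> real ^ 8) \<Rightarrow> real \<Rightarrow> sym set" where
  "sym_group x T = {(r, h, \<theta>) \<in> carrier SG.
     \<forall>t. real_of_int r *\<^sub>R (perm_matrix h *v x (t - \<theta> * T)) = x t}"

definition conj_class :: "sym set \<Rightarrow> sym set set" where
  "conj_class K = (\<lambda>g. g <#\<^bsub>SG\<^esub> K #>\<^bsub>SG\<^esub> inv\<^bsub>SG\<^esub> g) ` carrier SG"

text \<open>Disjoint cycle notation; the empty list is the identity.\<close>

definition cyc :: "8 list list \<Rightarrow> 8 \<Rightarrow> 8" where
  "cyc css = foldr (\<lambda>c h. cycle_of_list c \<circ> h) css id"

definition antipode :: "8 \<Rightarrow> 8" where
  "antipode = cyc [[1,7],[2,8],[3,5],[4,6]]"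

definition plus_ext :: "((8 \<Rightarrow> 8) \<times> real) set \<Rightarrow> sym set" where
  "plus_ext L = ({1} \<times> L) <#>\<^bsub>SG\<^esub>
     {(1, id, 0), (1, antipode, 0), (-1, id, 1/2), (-1, antipode, 1/2)}"

definition minus_ext :: "((8 \<Rightarrow> 8) \<times> real) set \<Rightarrow> sym set" where
  "minus_ext L = ({1} \<times> L) <#>\<^bsub>SG\<^esub>
     {(1, id, 0), (-1, antipode, 0), (-1, id, 1/2), (1, antipode, 1/2)}"

definition L_S4 :: "((8 \<Rightarrow> 8) \<times> real) set" where
  "L_S4 = {(g, 0) | g. g \<in> S4}"

definition L_S4m :: "((8 \<Rightarrow> 8) \<times> real) set" where
  "L_S4m = {(g, if face_quarter_turn g \<or> edge_half_turn g then 1/2 else 0) | g. g \<in> S4}"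

definition L_D4z :: "((8 \<Rightarrow> 8) \<times> real) set" where
  "L_D4z = {(cyc [], 0), (cyc [[1,2,3,4],[5,6,7,8]], 0),
     (cyc [[1,3],[2,4],[5,7],[6,8]], 0), (cyc [[1,4,3,2],[5,8,7,6]], 0),
     (cyc [[1,7],[2,6],[3,5],[4,8]], 1/2), (cyc [[1,8],[2,7],[3,6],[4,5]], 1/2),
     (cyc [[1,5],[2,8],[3,7],[4,6]], 1/2), (cyc [[1,6],[2,5],[3,8],[4,7]], 1/2)}"

definition L_D3z :: "((8 \<Rightarrow> 8) \<times> real) set" where
  "L_D3z = {(cyc [], 0), (cyc [[2,5,4],[3,6,8]], 0), (cyc [[2,4,5],[3,8,6]], 0),
     (cyc [[1,7],[2,6],[3,5],[4,8]], 1/2), (cyc [[1,7],[2,8],[3,4],[5,6]], 1/2),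
     (cyc [[1,7],[2,3],[4,6],[5,8]], 1/2)}"

definition L_D2d :: "((8 \<Rightarrow> 8) \<times> real) set" where
  "L_D2d = {(cyc [], 0), (cyc [[1,7],[2,6],[3,5],[4,8]], 0),
     (cyc [[1,3],[2,4],[5,7],[6,8]], 1/2), (cyc [[1,5],[2,8],[3,7],[4,6]], 1/2)}"

definition L_Z4c :: "((8 \<Rightarrow> 8) \<times> real) set" where
  "L_Z4c = {(cyc [], 0), (cyc [[1,2,3,4],[5,6,7,8]], 1/4),
     (cyc [[1,3],[2,4],[5,7],[6,8]], 1/2), (cyc [[1,4,3,2],[5,8,7,6]], 3/4)}"

definition L_Z3t :: "((8 \<Rightarrow> 8) \<times> real) set" where
  "L_Z3t = {(cyc [], 0), (cyc [[2,5,4],[3,6,8]], 1/3), (cyc [[2,4,5],[3,8,6]], 2/3)}"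

definition L_D4d :: "((8 \<Rightarrow> 8) \<times> real) set" where
  "L_D4d = {(cyc [], 0), (cyc [[1,2,3,4],[5,6,7,8]], 1/2),
     (cyc [[1,3],[2,4],[5,7],[6,8]], 0), (cyc [[1,4,3,2],[5,8,7,6]], 1/2),
     (cyc [[1,7],[2,6],[3,5],[4,8]], 0), (cyc [[1,8],[2,7],[3,6],[4,5]], 1/2),
     (cyc [[1,5],[2,8],[3,7],[4,6]], 0), (cyc [[1,6],[2,5],[3,8],[4,7]], 1/2)}"

definition L_D3 :: "((8 \<Rightarrow> 8) \<times> real) set" where
  "L_D3 = {(cyc [], 0), (cyc [[2,5,4],[3,6,8]], 0), (cyc [[2,4,5],[3,8,6]], 0),
     (cyc [[1,7],[2,6],[3,5],[4,8]], 0), (cyc [[1,7],[2,8],[3,4],[5,6]], 0),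
     (cyc [[1,7],[2,3],[4,6],[5,8]], 0)}"

text \<open>A family of periodic solutions is a triple of functions \<open>(\<alpha>, T, x)\<close> of a parameter
  \<open>s \<in> (0, 1)\<close>: at parameter value \<open>\<alpha> s\<close> the system has the solution \<open>x s\<close> of minimal period
  \<open>T s\<close>.  The bifurcation point is approached as \<open>s \<rightarrow> 0\<close>.\<close>

type_synonym family = "(real \<Rightarrow> real) \<times> (real \<Rightarrow> real) \<times> (real \<Rightarrow> real \<Rightarrow> real ^ 8)"

fun is_branch :: "real \<Rightarrow> real \<Rightarrow> sym set \<Rightarrow> family \<Rightarrow> bool" where
  "is_branch a \<alpha>\<^sub>0 K (\<alpha>, T, x) \<longleftrightarrow>
     (\<forall>s\<in>{0<..<1}. periodic_vdp_solution a (\<alpha> s) (T s) (x s) \<and> sym_group (x s) (T s) = K) \<and>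
     continuous_on {0<..<1} \<alpha> \<and> continuous_on {0<..<1} T \<and>
     continuous_on ({0<..<1} \<times> UNIV) (\<lambda>(s, t). x s t) \<and>
     ((\<lambda>s. amplitude (x s)) \<longlongrightarrow> 0) (at_right 0) \<and>
     (\<alpha> \<longlongrightarrow> \<alpha>\<^sub>0) (at_right 0) \<and>
     (T \<longlongrightarrow> 2 * pi) (at_right 0)"

fun supercritical :: "real \<Rightarrow> family \<Rightarrow> bool" where
  "supercritical \<alpha>\<^sub>0 (\<alpha>, T, x) \<longleftrightarrow> (\<forall>\<^sub>F s in at_right 0. \<alpha> s > \<alpha>\<^sub>0)"

text \<open>Two families describe the same branch if, arbitrarily close to the bifurcation point, they
  run through the same periodic solutions up to a shift of time.  This identifies
  reparametrisations and forgets the family away from the bifurcation point.\<close>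

fun germ_le :: "family \<Rightarrow> family \<Rightarrow> bool" where
  "germ_le (\<alpha>, T, x) (\<alpha>', T', x') \<longleftrightarrow>
     (\<forall>\<epsilon>>0. \<forall>\<^sub>F s in at_right 0. \<exists>s'\<in>{0<..<\<epsilon>}.
        \<alpha> s = \<alpha>' s' \<and> T s = T' s' \<and> (\<exists>\<tau>. \<forall>t. x s t = x' s' (t + \<tau>)))"

definition same_branch :: "(family \<times> family) set" where
  "same_branch = {(\<gamma>, \<gamma>'). germ_le \<gamma> \<gamma>' \<and> germ_le \<gamma>' \<gamma>}"

definition branches :: "real \<Rightarrow> real \<Rightarrow> sym set set \<Rightarrow> family set" where
  "branches a \<alpha>\<^sub>0 \<K> = {\<gamma>. \<exists>K\<in>\<K>. is_branch a \<alpha>\<^sub>0 K \<gamma>}"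

definition supercritical_bifurcations :: "real \<Rightarrow> real \<Rightarrow> sym set set \<Rightarrow> nat \<Rightarrow> bool" where
  "supercritical_bifurcations a \<alpha>\<^sub>0 \<K> n \<longleftrightarrow>
     (\<forall>K\<in>\<K>. \<exists>\<gamma>. is_branch a \<alpha>\<^sub>0 K \<gamma>) \<and>
     (\<forall>\<gamma>\<in>branches a \<alpha>\<^sub>0 \<K>. supercritical \<alpha>\<^sub>0 \<gamma>) \<and>
     card (branches a \<alpha>\<^sub>0 \<K> // same_branch) = n"

end

theory Submission
  imports Defs "HOL-Library.Periodic_Fun"
begin

text \<open>Put \<open>N = \<alpha>\<^sub>0 + (a / 2) B\<close> for the coupling matrix \<open>B\<close>. With \<open>\<alpha> = \<alpha>\<^sub>0 + \<delta>\<close> the system reads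
  \<open>x'' = \<delta> x' - x\<^sup>2 x' - x + N x'\<close>. The monomials without squares in the coordinates of the vertices of
  the cube form an eigenbasis of \<open>B\<close>, and on those of degree \<open>d\<close> the matrix \<open>N\<close> is \<open>\<alpha>\<^sub>0 - a d\<close>. So at
  \<open>\<alpha>\<^sub>0 = k a\<close> the kernel of \<open>N\<close> consists of the monomials of degree \<open>k\<close>, and the solutions of period
  \<open>2 pi\<close> of the linearised system are the waves \<open>cos t p + sin t q\<close> with \<open>p\<close> and \<open>q\<close> in this kernel.

  A branch belongs to a wave that is determined by its spatio-temporal symmetry group \<open>K\<close> up to a
  factor and a shift of time (\<open>critical_pair\<close>). Among functions with the symmetry \<open>K\<close>, the linearised
  equation then has a two-dimensional solution space, spanned by the wave and its derivative. In a
  Lyapunov-Schmidt reduction, the projections of the equation to these two functions determine the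
  parameter and the period in terms of the solution, and what remains is a fixed point problem for
  the solution divided by its amplitude \<open>c\<close>. The linear problem is solved explicitly in each
  eigencomponent, the nonlinear terms are \<open>c\<^sup>2\<close> times a Lipschitz function, and the Banach fixed
  point theorem yields one solution for each small \<open>c\<close> (\<open>fixed_point_family\<close>). Conversely, every small
  solution with the symmetry \<open>K\<close> is a time shift of one of these (\<open>small_solution_normalised\<close>), so
  that \<open>K\<close> has one and only one branch (\<open>branch_exists\<close>, \<open>branch_unique\<close>).

  The direction of bifurcation does not require an expansion of the branch. On any periodic solution the
  nonlinear damping dissipates energy, which \<open>\<delta> x' + N x'\<close> has to supply. The noncritical components are
  so small, in comparison with the dissipation, that the energy must come from the critical ones,
  where \<open>N\<close> vanishes; hence \<open>\<delta> > 0\<close> (\<open>excess_positive\<close>).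

  It remains to find the groups. A wave is the real part of \<open>exp (\<i> t) w\<close> for a complex amplitude \<open>w\<close> on the
  vertices, and \<open>(r, h, \<theta>)\<close> fixes it if and only if \<open>r w = exp (2 pi \<i> \<theta>) (w \<circ> h)\<close>. In degrees \<open>0\<close> and
  \<open>3\<close> the kernel is one-dimensional. In degrees \<open>1\<close> and \<open>2\<close> an amplitude is a triple of complex
  coefficients, on which the rotations of the cube act by their matrices, up to a sign in degree \<open>2\<close>;
  each of the five groups is the group of one explicit triple (\<open>bases\<close>). It contains an
  element whose matrix has this triple as eigenvector to a simple eigenvalue, so the group determines
  the triple up to a factor (\<open>pinned_bases\<close>). Conjugate groups belong to the images of the triple under
  rotations. They make up orbits of \<open>3\<close>, \<open>4\<close>, \<open>6\<close>, \<open>6\<close> and \<open>8\<close> complex lines, \<open>27\<close> in total, and different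
  lines have different groups.\<close>

section \<open>Periodic functions and their integrals over one period\<close>

definition periodic_2pi :: "(real \<Rightarrow> 'a) \<Rightarrow> bool" where
  "periodic_2pi f \<longleftrightarrow> (\<forall>t. f (t + 2 * pi) = f t)"

abbreviation cycle_integral :: "(real \<Rightarrow> 'a::euclidean_space) \<Rightarrow> 'a" where
  "cycle_integral f \<equiv> integral {0..2 * pi} f"

lemma antiderivative_on_line:
  fixes f :: "real \<Rightarrow> 'a::euclidean_space"
  assumes "continuous_on UNIV f"
  obtains F where "\<And>t. (F has_vector_derivative f t) (at t)"
proof -
  have "\<exists>F. \<forall>x::real. -\<infinity> < ereal x \<longrightarrow> ereal x < \<infinity> \<longrightarrow> (F has_vector_derivative f x) (at x)"
    by (rule einterval_antiderivative) (use assms in \<open>auto simp: continuous_on_eq_continuous_at\<close>)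
  then show ?thesis using that by auto
qed

lemma vector_derivative_continuous_on:
  assumes "\<And>t. (f has_vector_derivative f' t) (at t)"
  shows "continuous_on A f"
  by (meson assms continuous_at_imp_continuous_on has_vector_derivative_continuous)

lemma has_integral_vector_derivative:
  fixes F :: "real \<Rightarrow> 'a::euclidean_space"
  assumes "a \<le> b" "\<And>t. (F has_vector_derivative f t) (at t)"
  shows "(f has_integral F b - F a) {a..b}"
  by (rule fundamental_theorem_of_calculus[OF assms(1)])
     (use assms(2) in \<open>auto intro: has_vector_derivative_at_within\<close>)

lemma integral_vector_derivative_eq_0:
  fixes F :: "real \<Rightarrow> 'a::euclidean_space"
  assumes "0 \<le> T" "\<And>t. (F has_vector_derivative f t) (at t)" "F T = F 0"
  shows "integral {0..T} f = 0"
  using has_integral_vector_derivative[OF assms(1,2)] assms(3) by (simp add: integral_unique)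

lemma vector_derivative_0_constant:
  fixes F :: "real \<Rightarrow> 'a::real_normed_vector"
  assumes "\<And>t. (F has_vector_derivative 0) (at t)"
  shows "F s = F t"
proof -
  have "\<exists>c. \<forall>x\<in>UNIV. F x = c"
    by (rule has_vector_derivative_zero_constant[of UNIV]) (use assms in auto)
  then show ?thesis by auto
qed

lemma has_vector_derivative_shift:
  assumes "(f has_vector_derivative f') (at (t + c))"
  shows "((\<lambda>t. f (t + c)) has_vector_derivative f') (at t)"
proof -
  have "((\<lambda>t. t + c) has_vector_derivative 1) (at t)"
    by (auto intro!: derivative_eq_intros)
  from vector_diff_chain_at[OF this, of f f'] show ?thesis using assms by (simp add: o_def)
qed

lemma cycle_integral_shift:
  fixes f :: "real \<Rightarrow> 'a::euclidean_space"
  assumes "continuous_on UNIV f" "periodic_2pi f"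
  shows "cycle_integral (\<lambda>t. f (t + c)) = cycle_integral f"
proof -
  obtain F where F: "\<And>t. (F has_vector_derivative f t) (at t)"
    using antiderivative_on_line[OF assms(1)] by blast
  have D: "((\<lambda>t. F (t + 2 * pi) - F t) has_vector_derivative 0) (at t)" for t
  proof -
    have "((\<lambda>t. F (t + 2 * pi) - F t) has_vector_derivative f (t + 2 * pi) - f t) (at t)"
      by (intro derivative_intros has_vector_derivative_shift F)
    then show ?thesis using assms(2) by (simp add: periodic_2pi_def)
  qed
  have "cycle_integral (\<lambda>t. f (t + c)) = F (2 * pi + c) - F (0 + c)"
    by (rule integral_unique, rule has_integral_vector_derivative)
       (auto intro!: has_vector_derivative_shift F)
  also have "\<dots> = F (0 + 2 * pi) - F 0"
    using vector_derivative_0_constant[OF D, of c 0] by (simp add: add.commute)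
  also have "\<dots> = cycle_integral f"
    using has_integral_vector_derivative[of 0 "2 * pi" F f] F by (simp add: integral_unique)
  finally show ?thesis .
qed

lemma cycle_integral_by_parts:
  fixes u w :: "real \<Rightarrow> 'a::euclidean_space"
  assumes u: "\<And>t. (u has_vector_derivative u' t) (at t)" and w: "\<And>t. (w has_vector_derivative w' t) (at t)"
    and cont: "continuous_on UNIV u'" "continuous_on UNIV w'"
    and per: "periodic_2pi u" "periodic_2pi w"
  shows "cycle_integral (\<lambda>t. u' t \<bullet> w t) = - cycle_integral (\<lambda>t. u t \<bullet> w' t)"
proof -
  have D: "((\<lambda>t. u t \<bullet> w t) has_vector_derivative u t \<bullet> w' t + u' t \<bullet> w t) (at t)" for t
    using bounded_bilinear.has_vector_derivative[OF bounded_bilinear_inner u w] .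
  have "u (2 * pi) = u 0" "w (2 * pi) = w 0"
    using per by (auto simp: periodic_2pi_def) (metis add_0)+
  then have "cycle_integral (\<lambda>t. u t \<bullet> w' t + u' t \<bullet> w t) = 0"
    by (intro integral_vector_derivative_eq_0[OF _ D]) auto
  moreover have "cycle_integral (\<lambda>t. u t \<bullet> w' t + u' t \<bullet> w t)
      = cycle_integral (\<lambda>t. u t \<bullet> w' t) + cycle_integral (\<lambda>t. u' t \<bullet> w t)"
    by (rule integral_add; rule integrable_continuous_interval)
       (intro continuous_intros continuous_on_subset[OF cont(1)] continuous_on_subset[OF cont(2)]
          vector_derivative_continuous_on[OF u] vector_derivative_continuous_on[OF w]; simp)+
  ultimately show ?thesis by simp
qed

section \<open>The scalar linear problem\<close>

text \<open>Variation of constants: \<open>exp (- l t) y(t)\<close> is an antiderivative of \<open>exp (- l t) f(t)\<close>, and a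
  suitable initial value makes \<open>y\<close> periodic because \<open>exp (- 2 pi l) \<noteq> 1\<close>.\<close>

lemma first_order_periodic_solution:
  fixes l :: complex
  assumes "exp (- (2 * pi * l)) \<noteq> 1"
  shows "\<exists>C\<ge>0. \<forall>f B. continuous_on UNIV f \<and> periodic_2pi f \<and> (\<forall>t. norm (f t) \<le> B) \<longrightarrow>
    (\<exists>y. periodic_2pi y \<and> (\<forall>t. (y has_vector_derivative l * y t + f t) (at t)) \<and>
      (\<forall>t. norm (y t) \<le> C * B))"
proof -
  define c where "c = 1 / (exp (- (2 * pi * l)) - 1)"
  define C where "C = norm c * (exp (2 * pi * norm l) * (2 * pi))"
  show ?thesis
  proof (intro exI[of _ C] conjI allI impI)
    show "0 \<le> C" by (simp add: C_def)
    fix f :: "real \<Rightarrow> complex" and B :: real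
    assume f: "continuous_on UNIV f \<and> periodic_2pi f \<and> (\<forall>t. norm (f t) \<le> B)"
    then have per: "f (t + 2 * pi) = f t" for t by (simp add: periodic_2pi_def)
    have cont: "continuous_on A f" for A using f continuous_on_subset by blast
    define y where "y t = c * cycle_integral (\<lambda>s. exp (- (l * s)) * f (s + t))" for t
    define h where "h t = exp (- (l * t)) * f t" for t
    obtain F where F: "\<And>t. (F has_vector_derivative h t) (at t)"
      by (rule antiderivative_on_line[of h]) (auto simp: h_def intro!: continuous_intros cont)
    have y_eq: "y t = c * exp (l * t) * (F (t + 2 * pi) - F t)" for t
    proof -
      have "((\<lambda>s. h (s + t)) has_integral F (2 * pi + t) - F (0 + t)) {0..2 * pi}"
        by (rule has_integral_vector_derivative) (auto intro!: has_vector_derivative_shift F)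
      then have "((\<lambda>s. exp (l * t) * h (s + t)) has_integral exp (l * t) * (F (2 * pi + t) - F (0 + t))) {0..2 * pi}"
        by (rule has_integral_mult_right)
      moreover have "exp (l * t) * h (s + t) = exp (- (l * s)) * f (s + t)" for s
        by (simp add: h_def exp_minus field_simps flip: exp_add)
      ultimately show ?thesis by (simp add: y_def integral_unique add.commute mult.assoc)
    qed
    show "\<exists>y. periodic_2pi y \<and> (\<forall>t. (y has_vector_derivative l * y t + f t) (at t)) \<and>
      (\<forall>t. norm (y t) \<le> C * B)"
    proof (intro exI[of _ y] conjI allI)
      show "periodic_2pi y"
        by (simp add: periodic_2pi_def y_def per add.assoc[symmetric])
      show "norm (y t) \<le> C * B" for t
      proof -
        have "norm (cycle_integral (\<lambda>s. exp (- (l * s)) * f (s + t))) \<le> (exp (2 * pi * norm l) * B) * (2 * pi - 0)"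
        proof (rule integral_bound)
          show "continuous_on {0..2 * pi} (\<lambda>s. exp (- (l * s)) * f (s + t))"
            by (intro continuous_intros continuous_on_compose2[OF cont[of UNIV]]) auto
          fix s assume s: "s \<in> {0..2 * pi}"
          have "Re (- (l * s)) \<le> norm (l * s)" by (metis complex_Re_le_cmod norm_minus_cancel)
          also have "\<dots> \<le> norm l * (2 * pi)" using s by (auto simp: norm_mult intro!: mult_left_mono)
          finally have "norm (exp (- (l * s))) \<le> exp (2 * pi * norm l)" by (simp add: mult.commute)
          then show "norm (exp (- (l * s)) * f (s + t)) \<le> exp (2 * pi * norm l) * B"
            using f by (auto simp: norm_mult intro!: mult_mono)
        qed simp
        then show ?thesis
          using mult_left_mono[of _ _ "norm c"] by (fastforce simp: y_def norm_mult C_def algebra_simps)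
      qed
      show "(y has_vector_derivative l * y t + f t) (at t)" for t
      proof -
        have E: "((\<lambda>t. exp (l * of_real t)) has_vector_derivative l * exp (l * t)) (at t)" for t
          by (rule has_vector_derivative_real_field) (auto intro!: derivative_eq_intros)
        have "((\<lambda>t. exp (l * of_real t) * (F (t + 2 * pi) - F t)) has_vector_derivative
            exp (l * t) * (h (t + 2 * pi) - h t) + l * exp (l * t) * (F (t + 2 * pi) - F t)) (at t)"
          by (intro has_vector_derivative_mult E derivative_intros has_vector_derivative_shift F)
        then have "((\<lambda>t. c * (exp (l * of_real t) * (F (t + 2 * pi) - F t))) has_vector_derivative
            c * (exp (l * t) * (h (t + 2 * pi) - h t) + l * exp (l * t) * (F (t + 2 * pi) - F t))) (at t)"
          by (rule has_vector_derivative_mult_right)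
        moreover have "c * (exp (l * t) * (h (t + 2 * pi) - h t)) = f t"
        proof -
          have "exp (l * t) * h (t + 2 * pi) = exp (- (2 * pi * l)) * f t"
          proof -
            have "l * t + - (l * of_real (t + 2 * pi)) = - (2 * pi * l)" by (simp add: algebra_simps)
            then show ?thesis unfolding h_def per by (simp only: mult.assoc[symmetric] exp_add[symmetric])
          qed
          moreover have "exp (l * t) * h t = f t"
            by (simp add: h_def exp_minus)
          ultimately have "exp (l * t) * (h (t + 2 * pi) - h t) = (exp (- (2 * pi * l)) - 1) * f t"
            by (simp add: algebra_simps)
          then show ?thesis using assms by (simp add: c_def)
        qed
        ultimately show ?thesis unfolding y_eq by (simp add: algebra_simps)
      qed
    qed
  qed
qed

lemma first_order_periodic_unique:
  fixes l :: complex
  assumes "exp (- (2 * pi * l)) \<noteq> 1" "periodic_2pi y" "\<And>t. (y has_vector_derivative l * y t) (at t)"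
  shows "y t = 0"
proof -
  have E: "((\<lambda>t. exp (- (l * of_real t))) has_vector_derivative - l * exp (- (l * t))) (at t)" for t
    by (rule has_vector_derivative_real_field) (auto intro!: derivative_eq_intros)
  have "((\<lambda>t. exp (- (l * of_real t)) * y t) has_vector_derivative 0) (at t)" for t
    using has_vector_derivative_mult[OF E assms(3), of t] by (simp add: algebra_simps)
  from vector_derivative_0_constant[OF this, of "t + 2 * pi" t]
  have "exp (- (l * (t + 2 * pi))) * y t = exp (- (l * t)) * y t"
    using assms(2) by (simp add: periodic_2pi_def)
  moreover have "exp (- (l * (t + 2 * pi))) = exp (- (l * t)) * exp (- (2 * pi * l))"
    by (simp add: algebra_simps flip: exp_add)
  ultimately show ?thesis using assms(1) by simp
qed

text \<open>If \<open>exp (- 2 pi l) = 1\<close>, then \<open>l = \<i> n\<close> for an integer \<open>n\<close>, and the real and imaginary part of the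
  quadratic equation give \<open>n\<^sup>2 = 1\<close> and \<open>k n = 0\<close>.\<close>

lemma characteristic_root_nonresonant:
  fixes l :: complex and k :: real
  assumes "k \<noteq> 0" "l\<^sup>2 - k * l + 1 = 0"
  shows "exp (- (2 * pi * l)) \<noteq> 1"
proof
  assume "exp (- (2 * pi * l)) = 1"
  then have "Re l = 0" by (simp add: exp_eq_1)
  with assms show False
    by (auto simp: complex_eq_iff power2_eq_square)
qed

lemma cycle_integrals_trig:
  "cycle_integral (\<lambda>t. cos t * cos t) = pi" "cycle_integral (\<lambda>t. sin t * sin t) = pi"
  "cycle_integral (\<lambda>t. cos t * sin t) = 0" "cycle_integral (\<lambda>t. sin t * cos t) = 0"
proof -
  have c: "((\<lambda>t. (t + sin t * cos t) / 2) has_vector_derivative cos t * cos t) (at t)" for t :: real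
    unfolding has_real_derivative_iff_has_vector_derivative[symmetric]
    by (auto intro!: derivative_eq_intros simp: field_simps sin_squared_eq power2_eq_square[symmetric])
  have s: "((\<lambda>t. (t - sin t * cos t) / 2) has_vector_derivative sin t * sin t) (at t)" for t :: real
    unfolding has_real_derivative_iff_has_vector_derivative[symmetric]
    by (auto intro!: derivative_eq_intros simp: field_simps cos_squared_eq power2_eq_square[symmetric])
  have m: "((\<lambda>t. (sin t * sin t) / 2) has_vector_derivative sin t * cos t) (at t)" for t :: real
    unfolding has_real_derivative_iff_has_vector_derivative[symmetric]
    by (auto intro!: derivative_eq_intros simp: field_simps)
  show "cycle_integral (\<lambda>t. cos t * cos t) = pi" "cycle_integral (\<lambda>t. sin t * sin t) = pi"
    using has_integral_vector_derivative[of 0 "2 * pi", OF _ c]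
      has_integral_vector_derivative[of 0 "2 * pi", OF _ s] by (simp_all add: integral_unique)
  show "cycle_integral (\<lambda>t. sin t * cos t) = 0" 
    using has_integral_vector_derivative[of 0 "2 * pi", OF _ m] by (simp add: integral_unique)
  then show "cycle_integral (\<lambda>t. cos t * sin t) = 0" by (simp add: mult.commute)
qed

text \<open>For \<open>k \<noteq> 0\<close> the operator factors into two first-order operators with the characteristic
  roots \<open>l\<close> and \<open>1 / l\<close>; inverting one after the other also covers the double roots.\<close>

lemma nonresonant_solution:
  fixes k :: real
  assumes "k \<noteq> 0"
  shows "\<exists>C\<ge>0. \<forall>f B. continuous_on UNIV f \<and> periodic_2pi f \<and> (\<forall>t. \<bar>f t\<bar> \<le> B) \<longrightarrow>
    (\<exists>z v. periodic_2pi z \<and> periodic_2pi v \<and>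
      (\<forall>t. (z has_vector_derivative k * z t + v t + f t) (at t)) \<and>
      (\<forall>t. (v has_vector_derivative - z t) (at t)) \<and> (\<forall>t. \<bar>z t\<bar> \<le> C * B \<and> \<bar>v t\<bar> \<le> C * B))"
proof -
  define l where "l = (k + csqrt ((complex_of_real k)\<^sup>2 - 4)) / 2"
  have l: "l\<^sup>2 - k * l + 1 = 0"
    by (simp add: l_def power2_eq_square field_simps flip: power2_csqrt[of "(complex_of_real k)\<^sup>2 - 4"])
       (simp add: algebra_simps flip: power2_eq_square)
  then have l0: "l \<noteq> 0" by auto
  have k: "complex_of_real k = l + 1 / l" using l l0 by (simp add: field_simps power2_eq_square)
  have m: "(1 / l)\<^sup>2 - k * (1 / l) + 1 = 0" using l0 by (simp add: k power2_eq_square field_simps)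
  obtain C1 where C1: "C1 \<ge> 0" and sol1: "\<And>f B. continuous_on UNIV f \<Longrightarrow> periodic_2pi f \<Longrightarrow> \<forall>t. norm (f t) \<le> B \<Longrightarrow>
      \<exists>y. periodic_2pi y \<and> (\<forall>t. (y has_vector_derivative l * y t + f t) (at t)) \<and> (\<forall>t. norm (y t) \<le> C1 * B)"
    using first_order_periodic_solution[OF characteristic_root_nonresonant[OF assms l]] by blast
  obtain C2 where C2: "C2 \<ge> 0" and sol2: "\<And>f B. continuous_on UNIV f \<Longrightarrow> periodic_2pi f \<Longrightarrow> \<forall>t. norm (f t) \<le> B \<Longrightarrow>
      \<exists>y. periodic_2pi y \<and> (\<forall>t. (y has_vector_derivative (1 / l) * y t + f t) (at t)) \<and> (\<forall>t. norm (y t) \<le> C2 * B)"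
    using first_order_periodic_solution[OF characteristic_root_nonresonant[OF assms m]] by blast
  define K1 where "K1 = C1 * norm l"
  define K2 where "K2 = C2 * (K1 / norm l)"
  define K where "K = K2 + (K1 + K2) / norm l"
  have K0: "K1 \<ge> 0" "K2 \<ge> 0" "(K1 + K2) / norm l \<ge> 0" using C1 C2 by (auto simp: K1_def K2_def)
  show ?thesis
  proof (intro exI[of _ K] conjI allI impI)
    show "0 \<le> K" using K0 by (simp add: K_def)
    fix f :: "real \<Rightarrow> real" and B :: real
    assume f: "continuous_on UNIV f \<and> periodic_2pi f \<and> (\<forall>t. \<bar>f t\<bar> \<le> B)"
    then have B: "B \<ge> 0" by (meson abs_ge_zero order_trans)
    have 1: "continuous_on UNIV (\<lambda>t. l * of_real (f t))" "periodic_2pi (\<lambda>t. l * of_real (f t))"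
      "\<forall>t. norm (l * of_real (f t)) \<le> norm l * B"
      using f by (auto simp: periodic_2pi_def norm_mult intro!: continuous_intros mult_left_mono)
    from sol1[OF 1] obtain y where y: "periodic_2pi y"
      "\<And>t. (y has_vector_derivative l * y t + l * of_real (f t)) (at t)" "\<And>t. norm (y t) \<le> K1 * B"
      by (auto simp: K1_def mult.assoc)
    have 2: "continuous_on UNIV (\<lambda>t. - (y t / l))" "periodic_2pi (\<lambda>t. - (y t / l))"
      "\<forall>t. norm (- (y t / l)) \<le> K1 / norm l * B"
      using y l0 by (auto simp: periodic_2pi_def norm_divide field_simps
          intro!: continuous_intros vector_derivative_continuous_on[OF y(2)])
    from sol2[OF 2] obtain w where w: "periodic_2pi w"
      "\<And>t. (w has_vector_derivative (1 / l) * w t + - (y t / l)) (at t)" "\<And>t. norm (w t) \<le> K2 * B"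
      by (auto simp: K2_def mult.assoc)
    define q where "q t = (y t - w t) / l" for t
    have w': "(w has_vector_derivative - q t) (at t)" for t
    proof -
      have "(1 / l) * w t + - (y t / l) = - q t" by (simp add: q_def diff_divide_distrib)
      then show ?thesis using w(2)[of t] by simp
    qed
    have q': "(q has_vector_derivative k * q t + w t + f t) (at t)" for t
    proof -
      have "(q has_vector_derivative (l * y t + l * of_real (f t) - - q t) / l) (at t)"
        unfolding q_def[abs_def] by (intro has_vector_derivative_divide derivative_intros y(2) w'[unfolded q_def])
      moreover have "(l * y t + l * of_real (f t) - - q t) / l = k * q t + w t + f t"
        using l0 by (simp add: q_def k field_simps)
      ultimately show ?thesis by simp
    qed
    have nq: "norm (q t) \<le> (K1 + K2) / norm l * B" for t
    proof -
      have "norm (y t - w t) \<le> (K1 + K2) * B"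
        using norm_triangle_ineq4[of "y t" "w t"] y(3)[of t] w(3)[of t] by (simp add: algebra_simps)
      then show ?thesis by (simp add: q_def norm_divide divide_right_mono)
    qed
    show "\<exists>z v. periodic_2pi z \<and> periodic_2pi v \<and>
      (\<forall>t. (z has_vector_derivative k * z t + v t + f t) (at t)) \<and>
      (\<forall>t. (v has_vector_derivative - z t) (at t)) \<and> (\<forall>t. \<bar>z t\<bar> \<le> K * B \<and> \<bar>v t\<bar> \<le> K * B)"
    proof (rule exI[of _ "\<lambda>t. Re (q t)"], rule exI[of _ "\<lambda>t. Re (w t)"], intro conjI allI)
      show "periodic_2pi (\<lambda>t. Re (q t))" "periodic_2pi (\<lambda>t. Re (w t))"
        using y(1) w(1) by (auto simp: periodic_2pi_def q_def)
      show "((\<lambda>t. Re (q t)) has_vector_derivative k * Re (q t) + Re (w t) + f t) (at t)" for t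
        using bounded_linear.has_vector_derivative[OF bounded_linear_Re q'] by simp
      show "((\<lambda>t. Re (w t)) has_vector_derivative - Re (q t)) (at t)" for t
        using bounded_linear.has_vector_derivative[OF bounded_linear_Re w'] by simp
      have "0 \<le> K2 * B" "0 \<le> (K1 + K2) / norm l * B" using K0 B by (auto intro!: mult_nonneg_nonneg)
      then show "\<bar>Re (q t)\<bar> \<le> K * B" "\<bar>Re (w t)\<bar> \<le> K * B" for t
        using nq[of t] w(3)[of t] abs_Re_le_cmod[of "q t"] abs_Re_le_cmod[of "w t"]
        by (auto simp: K_def distrib_right)
    qed
  qed
qed

lemma nonresonant_unique:
  fixes z v :: "real \<Rightarrow> real"
  assumes "k \<noteq> 0" and per: "periodic_2pi z" "periodic_2pi v"
    and z: "\<And>t. (z has_vector_derivative k * z t + v t) (at t)"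
    and v: "\<And>t. (v has_vector_derivative - z t) (at t)"
  shows "z t = 0 \<and> v t = 0"
proof -
  define l where "l = (k + csqrt ((complex_of_real k)\<^sup>2 - 4)) / 2"
  have l: "l\<^sup>2 - k * l + 1 = 0"
    by (simp add: l_def power2_eq_square field_simps flip: power2_csqrt[of "(complex_of_real k)\<^sup>2 - 4"])
       (simp add: algebra_simps flip: power2_eq_square)
  then have l0: "l \<noteq> 0" by auto
  have k: "complex_of_real k = l + 1 / l" using l l0 by (simp add: field_simps power2_eq_square)
  have m: "(1 / l)\<^sup>2 - k * (1 / l) + 1 = 0" using l0 by (simp add: k power2_eq_square field_simps)
  have zc: "((\<lambda>t. complex_of_real (z t)) has_vector_derivative of_real (k * z t + v t)) (at t)" for t
    by (rule bounded_linear.has_vector_derivative[OF bounded_linear_of_real z])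
  have vc: "((\<lambda>t. complex_of_real (v t)) has_vector_derivative - of_real (z t)) (at t)" for t
    using bounded_linear.has_vector_derivative[OF bounded_linear_of_real v] by simp
  have "((\<lambda>t. l * of_real (z t) + of_real (v t)) has_vector_derivative
      l * (l * of_real (z t) + of_real (v t))) (at t)" for t
  proof -
    have "((\<lambda>t. l * of_real (z t) + of_real (v t)) has_vector_derivative
        l * of_real (k * z t + v t) + - of_real (z t)) (at t)"
      by (intro has_vector_derivative_add has_vector_derivative_mult_right zc vc)
    moreover have "l * complex_of_real (k * z t + v t) + - of_real (z t) = l * (l * of_real (z t) + of_real (v t))"
      using l0 by (simp add: k field_simps)
    ultimately show ?thesis by simp
  qed
  then have 1: "l * of_real (z t) + of_real (v t) = 0" for t
    by (intro first_order_periodic_unique[OF characteristic_root_nonresonant[OF assms(1) l],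
          of "\<lambda>t. l * of_real (z t) + of_real (v t)"])
       (use per in \<open>auto simp: periodic_2pi_def\<close>)
  then have "complex_of_real (- z t) = 1 / l * of_real (v t)" for t
    using l0 by (simp add: field_simps) (metis add.commute add_eq_0_iff mult.commute)
  then have "complex_of_real (v t) = 0"
    by (intro first_order_periodic_unique[OF characteristic_root_nonresonant[OF assms(1) m],
          of "\<lambda>t. of_real (v t)"])
       (use per vc in \<open>auto simp: periodic_2pi_def\<close>)
  with 1[of t] l0 show ?thesis by simp
qed

lemma periodic_reduce:
  fixes f :: "real \<Rightarrow> 'a"
  assumes "periodic_2pi f"
  obtains s where "s \<in> {0..2 * pi}" "f s = f t"
proof -
  interpret periodic_fun_simple f "2 * pi"
    by unfold_locales (use assms in \<open>simp add: periodic_2pi_def\<close>)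
  define s where "s = 2 * pi * frac (t / (2 * pi))"
  have "t = s + of_int \<lfloor>t / (2 * pi)\<rfloor> * (2 * pi)"
    by (simp add: s_def frac_def field_simps)
  then have "f s = f t" by (metis plus_of_int)
  moreover have "s \<in> {0..2 * pi}"
    using frac_lt_1[of "t / (2 * pi)"] by (auto simp: s_def intro: mult_left_le order_less_imp_le)
  ultimately show ?thesis using that by blast
qed

lemma cycle_integral_abs_bound:
  fixes f g :: "real \<Rightarrow> real"
  assumes "continuous_on UNIV f" "\<And>t. \<bar>f t\<bar> \<le> B"
  shows "\<bar>cycle_integral f\<bar> \<le> 2 * pi * B"
  using integral_bound[of 0 "2 * pi" f B] assms
  by (auto intro: continuous_on_subset simp: mult.commute)

text \<open>For \<open>k = 0\<close> the unknown \<open>y = v + \<i> z\<close> satisfies \<open>y' = \<i> y + \<i> f\<close>, so that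
  \<open>exp (- \<i> t) y(t)\<close> is an antiderivative of \<open>\<i> exp (- \<i> t) f(t)\<close>; the orthogonality conditions make
  it periodic.\<close>

lemma resonant_solution:
  "\<exists>C\<ge>0. \<forall>f B. continuous_on UNIV f \<and> periodic_2pi f \<and> (\<forall>t. \<bar>f t\<bar> \<le> B) \<and>
    cycle_integral (\<lambda>t. f t * cos t) = 0 \<and> cycle_integral (\<lambda>t. f t * sin t) = 0 \<longrightarrow>
    (\<exists>z v. periodic_2pi z \<and> periodic_2pi v \<and>
      (\<forall>t. (z has_vector_derivative v t + f t) (at t)) \<and>
      (\<forall>t. (v has_vector_derivative - z t) (at t)) \<and>
      cycle_integral (\<lambda>t. z t * cos t) = 0 \<and> cycle_integral (\<lambda>t. z t * sin t) = (0::real) \<and>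
      (\<forall>t. \<bar>z t\<bar> \<le> C * B \<and> \<bar>v t\<bar> \<le> C * B))"
proof (intro exI[of _ "20 * pi"] conjI allI impI)
  fix f :: "real \<Rightarrow> real" and B :: real
  assume f: "continuous_on UNIV f \<and> periodic_2pi f \<and> (\<forall>t. \<bar>f t\<bar> \<le> B) \<and>
    cycle_integral (\<lambda>t. f t * cos t) = 0 \<and> cycle_integral (\<lambda>t. f t * sin t) = 0"
  have cont: "continuous_on A f" for A using f continuous_on_subset by blast
  have per: "f (t + 2 * pi) = f t" for t using f by (auto simp: periodic_2pi_def)
  have orth: "cycle_integral (\<lambda>t. f t * cos t) = 0" "cycle_integral (\<lambda>t. f t * sin t) = 0" using f by auto
  obtain P where P: "\<And>t. (P has_vector_derivative f t * cos t) (at t)"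
    by (rule antiderivative_on_line[of "\<lambda>t. f t * cos t"]) (auto intro!: continuous_intros cont)
  obtain Q where Q: "\<And>t. (Q has_vector_derivative f t * sin t) (at t)"
    by (rule antiderivative_on_line[of "\<lambda>t. f t * sin t"]) (auto intro!: continuous_intros cont)
  have antiderivative_bound: "periodic_2pi F \<and> (\<forall>t. \<bar>F t - F 0\<bar> \<le> 2 * pi * B)"
    if F: "\<And>t. (F has_vector_derivative g t) (at t)" and g: "continuous_on UNIV g" "periodic_2pi g"
      "cycle_integral g = 0" "\<And>t. \<bar>g t\<bar> \<le> B" for F g :: "real \<Rightarrow> real"
  proof
    have "F (t + 2 * pi) = F t" for t
    proof -
      have "((\<lambda>s. g (s + t)) has_integral F (2 * pi + t) - F (0 + t)) {0..2 * pi}"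
        by (rule has_integral_vector_derivative) (auto intro!: has_vector_derivative_shift F)
      then show ?thesis
        using cycle_integral_shift[OF g(1,2), of t] g(3) by (simp add: integral_unique add.commute)
    qed
    then show F': "periodic_2pi F" by (simp add: periodic_2pi_def)
    show "\<forall>t. \<bar>F t - F 0\<bar> \<le> 2 * pi * B"
    proof
      fix t
      obtain s where s: "s \<in> {0..2 * pi}" "F s = F t" using periodic_reduce[OF F'] .
      have "\<bar>integral {0..s} g\<bar> \<le> B * (s - 0)"
        using integral_bound[of 0 s g B] g s by (auto intro: continuous_on_subset)
      moreover have "integral {0..s} g = F s - F 0"
        using has_integral_vector_derivative[of 0 s F g] F s by (auto simp: integral_unique)
      moreover have "B * s \<le> B * (2 * pi)" 
        using s g(4)[of 0] by (intro mult_left_mono) auto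
      ultimately show "\<bar>F t - F 0\<bar> \<le> 2 * pi * B" using s by (simp add: mult.commute)
    qed
  qed
  have trig: "\<bar>f t * cos t\<bar> \<le> B" "\<bar>f t * sin t\<bar> \<le> B" for t
    using f abs_cos_le_one[of t] abs_sin_le_one[of t] mult_mono[of "\<bar>f t\<bar>" B "\<bar>cos t\<bar>" 1]
      mult_mono[of "\<bar>f t\<bar>" B "\<bar>sin t\<bar>" 1]
    by (auto simp: abs_mult intro: order_trans[OF abs_ge_zero])
  have P': "periodic_2pi P \<and> (\<forall>t. \<bar>P t - P 0\<bar> \<le> 2 * pi * B)"
    by (rule antiderivative_bound[OF P])
       (use orth trig per in \<open>auto simp: periodic_2pi_def intro!: continuous_intros cont\<close>)
  have Q': "periodic_2pi Q \<and> (\<forall>t. \<bar>Q t - Q 0\<bar> \<le> 2 * pi * B)"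
    by (rule antiderivative_bound[OF Q])
       (use orth trig per in \<open>auto simp: periodic_2pi_def intro!: continuous_intros cont\<close>)
  define z0 where "z0 t = cos t * (P t - P 0) + sin t * (Q t - Q 0)" for t
  define v0 where "v0 t = cos t * (Q t - Q 0) - sin t * (P t - P 0)" for t
  have C: "((\<lambda>t. cos t) has_vector_derivative - sin t) (at t)" for t :: real
    unfolding has_real_derivative_iff_has_vector_derivative[symmetric] by (rule DERIV_cos)
  have S: "((\<lambda>t. sin t) has_vector_derivative cos t) (at t)" for t :: real
    unfolding has_real_derivative_iff_has_vector_derivative[symmetric] by (rule DERIV_sin)
  have cs: "cos t * (cos t * x) + sin t * (sin t * x) = x" for t x :: real
  proof -
    have "cos t * (cos t * x) + sin t * (sin t * x) = ((sin t)\<^sup>2 + (cos t)\<^sup>2) * x"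
      unfolding power2_eq_square by argo
    then show ?thesis by (simp only: sin_cos_squared_add mult_1)
  qed
  have z0': "(z0 has_vector_derivative v0 t + f t) (at t)" for t
  proof -
    have "(z0 has_vector_derivative (cos t * (f t * cos t - 0) + - sin t * (P t - P 0)) +
        (sin t * (f t * sin t - 0) + cos t * (Q t - Q 0))) (at t)"
      unfolding z0_def[abs_def] by (intro derivative_intros has_vector_derivative_mult C S P Q)
    moreover have "(cos t * (f t * cos t - 0) + - sin t * (P t - P 0)) +
        (sin t * (f t * sin t - 0) + cos t * (Q t - Q 0)) = v0 t + f t"
      using cs[of t "f t"] by (simp add: v0_def algebra_simps)
    ultimately show ?thesis by simp
  qed
  have v0': "(v0 has_vector_derivative - z0 t) (at t)" for t
  proof -
    have "(v0 has_vector_derivative (cos t * (f t * sin t - 0) + - sin t * (Q t - Q 0)) -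
        (sin t * (f t * cos t - 0) + cos t * (P t - P 0))) (at t)"
      unfolding v0_def[abs_def] by (intro derivative_intros has_vector_derivative_mult C S P Q)
    then show ?thesis by (simp add: z0_def algebra_simps)
  qed
  have combo: "\<bar>cos t * x + sin t * y\<bar> \<le> 2 * K" if "\<bar>x\<bar> \<le> K" "\<bar>y\<bar> \<le> K" for t x y K :: real
  proof -
    have "\<bar>cos t * x\<bar> \<le> 1 * K" "\<bar>sin t * y\<bar> \<le> 1 * K"
      unfolding abs_mult by (rule mult_mono; use that abs_cos_le_one abs_sin_le_one in auto)+
    then show ?thesis using abs_triangle_ineq[of "cos t * x" "sin t * y"] by linarith
  qed
  have z0b: "\<bar>z0 t\<bar> \<le> 4 * pi * B" for t
    unfolding z0_def using combo[of "P t - P 0" "2 * pi * B" "Q t - Q 0" t] P' Q' by (simp add: algebra_simps)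
  have v0b: "\<bar>v0 t\<bar> \<le> 4 * pi * B" for t
  proof -
    have "\<bar>Q t - Q 0\<bar> \<le> 2 * pi * B" "\<bar>- (P t - P 0)\<bar> \<le> 2 * pi * B"
      using P' Q' by (simp_all only: abs_minus_cancel)
    from combo[OF this, of t] show ?thesis by (simp add: v0_def right_diff_distrib)
  qed
  have contz: "continuous_on A z0" for A by (rule vector_derivative_continuous_on[OF z0'])
  define c where "c = cycle_integral (\<lambda>t. z0 t * cos t) / pi"
  define d where "d = cycle_integral (\<lambda>t. z0 t * sin t) / pi"
  have "\<bar>cycle_integral (\<lambda>t. z0 t * cos t)\<bar> \<le> 2 * pi * (4 * pi * B)"
    using z0b mult_mono[OF z0b abs_cos_le_one] order_trans[OF abs_ge_zero z0b]
    by (intro cycle_integral_abs_bound) (auto intro!: continuous_intros contz simp: abs_mult)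
  then have cb: "\<bar>c\<bar> \<le> 8 * pi * B" by (simp add: c_def field_simps)
  have "\<bar>cycle_integral (\<lambda>t. z0 t * sin t)\<bar> \<le> 2 * pi * (4 * pi * B)"
    using z0b mult_mono[OF z0b abs_sin_le_one] order_trans[OF abs_ge_zero z0b]
    by (intro cycle_integral_abs_bound) (auto intro!: continuous_intros contz simp: abs_mult)
  then have db: "\<bar>d\<bar> \<le> 8 * pi * B" by (simp add: d_def field_simps)
  \<comment> \<open>Subtracting a solution of the homogeneous equation normalises the first harmonic.\<close>
  define z where "z t = z0 t - (cos t * c + sin t * d)" for t
  define v where "v t = v0 t - (cos t * d + sin t * (- c))" for t
  show "\<exists>z v. periodic_2pi z \<and> periodic_2pi v \<and>
      (\<forall>t. (z has_vector_derivative v t + f t) (at t)) \<and>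
      (\<forall>t. (v has_vector_derivative - z t) (at t)) \<and>
      cycle_integral (\<lambda>t. z t * cos t) = 0 \<and> cycle_integral (\<lambda>t. z t * sin t) = (0::real) \<and>
      (\<forall>t. \<bar>z t\<bar> \<le> 20 * pi * B \<and> \<bar>v t\<bar> \<le> 20 * pi * B)"
  proof (rule exI[of _ z], rule exI[of _ v], intro conjI allI)
    show "periodic_2pi z" "periodic_2pi v"
      using P' Q' by (auto simp: periodic_2pi_def z_def v_def z0_def v0_def)
    show "\<bar>z t\<bar> \<le> 20 * pi * B" "\<bar>v t\<bar> \<le> 20 * pi * B" for t
      unfolding z_def v_def
      using combo[OF cb db, of t] combo[of d "8 * pi * B" "- c" t] cb db z0b[of t] v0b[of t] by linarith+
    show "(z has_vector_derivative v t + f t) (at t)" for t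
    proof -
      have "(z has_vector_derivative v0 t + f t - (- sin t * c + cos t * d)) (at t)"
        unfolding z_def[abs_def] by (intro derivative_intros z0' has_vector_derivative_mult_left C S)
      then show ?thesis by (simp add: v_def algebra_simps)
    qed
    show "(v has_vector_derivative - z t) (at t)" for t
    proof -
      have "(v has_vector_derivative - z0 t - (- sin t * d + cos t * (- c))) (at t)"
        unfolding v_def[abs_def] by (intro derivative_intros v0' has_vector_derivative_mult_left C S)
      then show ?thesis by (simp add: z_def algebra_simps)
    qed
    have int: "(\<lambda>t. z0 t * cos t) integrable_on {0..2 * pi}" "(\<lambda>t. z0 t * sin t) integrable_on {0..2 * pi}"
      "(\<lambda>t. c * (cos t * cos t)) integrable_on {0..2 * pi}" "(\<lambda>t. d * (sin t * cos t)) integrable_on {0..2 * pi}"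
      "(\<lambda>t. c * (cos t * sin t)) integrable_on {0..2 * pi}" "(\<lambda>t. d * (sin t * sin t)) integrable_on {0..2 * pi}"
      by (auto intro!: integrable_continuous_interval continuous_intros contz)
    have "cycle_integral (\<lambda>t. z t * cos t) =
        cycle_integral (\<lambda>t. z0 t * cos t - (c * (cos t * cos t) + d * (sin t * cos t)))"
      by (simp add: z_def algebra_simps)
    also have "\<dots> = 0" using int
      by (simp add: integral_diff integral_add integrable_add cycle_integrals_trig c_def)
    finally show "cycle_integral (\<lambda>t. z t * cos t) = 0" .
    have "cycle_integral (\<lambda>t. z t * sin t) =
        cycle_integral (\<lambda>t. z0 t * sin t - (c * (cos t * sin t) + d * (sin t * sin t)))"
      by (simp add: z_def algebra_simps)
    also have "\<dots> = 0" using int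
      by (simp add: integral_diff integral_add integrable_add cycle_integrals_trig d_def)
    finally show "cycle_integral (\<lambda>t. z t * sin t) = 0" .
  qed
qed simp

text \<open>Homogeneous solutions are multiples of the first harmonic, which the two integrals exclude.\<close>

lemma resonant_unique:
  fixes z v :: "real \<Rightarrow> real"
  assumes z: "\<And>t. (z has_vector_derivative v t) (at t)" and v: "\<And>t. (v has_vector_derivative - z t) (at t)"
    and orth: "cycle_integral (\<lambda>t. z t * cos t) = 0" "cycle_integral (\<lambda>t. z t * sin t) = 0"
  shows "z t = 0 \<and> v t = 0"
proof -
  have C: "((\<lambda>t. cos t) has_vector_derivative - sin t) (at t)" for t :: real
    unfolding has_real_derivative_iff_has_vector_derivative[symmetric] by (rule DERIV_cos)
  have S: "((\<lambda>t. sin t) has_vector_derivative cos t) (at t)" for t :: real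
    unfolding has_real_derivative_iff_has_vector_derivative[symmetric] by (rule DERIV_sin)
  have "((\<lambda>t. z t * cos t - v t * sin t) has_vector_derivative 0) (at t)" for t
    using has_vector_derivative_diff[OF has_vector_derivative_mult[OF z C] has_vector_derivative_mult[OF v S], of t]
    by (simp add: algebra_simps)
  from vector_derivative_0_constant[OF this, of _ 0] have 1: "z t * cos t - v t * sin t = z 0" for t by simp
  have "((\<lambda>t. z t * sin t + v t * cos t) has_vector_derivative 0) (at t)" for t
    using has_vector_derivative_add[OF has_vector_derivative_mult[OF z S] has_vector_derivative_mult[OF v C], of t]
    by (simp add: algebra_simps)
  from vector_derivative_0_constant[OF this, of _ 0] have 2: "z t * sin t + v t * cos t = v 0" for t by simp
  have zt: "z t = z 0 * cos t + v 0 * sin t" for t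
  proof -
    have "z t * ((sin t)\<^sup>2 + (cos t)\<^sup>2) = (z t * cos t - v t * sin t) * cos t + (z t * sin t + v t * cos t) * sin t"
      unfolding power2_eq_square by argo
    then show ?thesis by (simp only: 1 2 sin_cos_squared_add mult_1_right)
  qed
  have int: "(\<lambda>t. z 0 * (cos t * cos t)) integrable_on {0..2 * pi}" "(\<lambda>t. v 0 * (sin t * cos t)) integrable_on {0..2 * pi}"
      "(\<lambda>t. z 0 * (cos t * sin t)) integrable_on {0..2 * pi}" "(\<lambda>t. v 0 * (sin t * sin t)) integrable_on {0..2 * pi}"
    by (auto intro!: integrable_continuous_interval continuous_intros)
  have "cycle_integral (\<lambda>t. z t * cos t) = cycle_integral (\<lambda>t. z 0 * (cos t * cos t) + v 0 * (sin t * cos t))"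
    by (subst zt) (simp add: algebra_simps)
  also have "\<dots> = z 0 * pi" using int by (simp add: integral_add cycle_integrals_trig)
  finally have z0: "z 0 = 0" using orth by simp
  have "cycle_integral (\<lambda>t. z t * sin t) = cycle_integral (\<lambda>t. z 0 * (cos t * sin t) + v 0 * (sin t * sin t))"
    by (subst zt) (simp add: algebra_simps)
  also have "\<dots> = v 0 * pi" using int by (simp add: integral_add cycle_integrals_trig)
  finally have v0: "v 0 = 0" using orth by simp
  have "sin t * v t = 0" "cos t * v t = 0"
    using 1[of t] 2[of t] z0 v0 zt[of t] by auto
  then have "v t = 0" using sin_zero_abs_cos_one[of t] by auto
  then show ?thesis using zt[of t] z0 v0 by simp
qed

lemma scalar_solution:
  fixes k :: real
  shows "\<exists>C\<ge>0. \<forall>f B. continuous_on UNIV f \<and> periodic_2pi f \<and> (\<forall>t. \<bar>f t\<bar> \<le> B) \<and>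
    (k = 0 \<longrightarrow> cycle_integral (\<lambda>t. f t * cos t) = 0 \<and> cycle_integral (\<lambda>t. f t * sin t) = 0) \<longrightarrow>
    (\<exists>z v. periodic_2pi z \<and> periodic_2pi v \<and>
      (\<forall>t. (z has_vector_derivative k * z t + v t + f t) (at t)) \<and>
      (\<forall>t. (v has_vector_derivative - z t) (at t)) \<and>
      (k = 0 \<longrightarrow> cycle_integral (\<lambda>t. z t * cos t) = 0 \<and> cycle_integral (\<lambda>t. z t * sin t) = (0::real)) \<and>
      (\<forall>t. \<bar>z t\<bar> \<le> C * B \<and> \<bar>v t\<bar> \<le> C * B))"
proof (cases "k = 0")
  case True
  then show ?thesis using resonant_solution by simp
next
  case False
  then show ?thesis using nonresonant_solution[OF False] by simp
qed

lemma scalar_unique: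
  fixes z v :: "real \<Rightarrow> real"
  assumes "periodic_2pi z" "periodic_2pi v"
    and "\<And>t. (z has_vector_derivative k * z t + v t) (at t)"
    and "\<And>t. (v has_vector_derivative - z t) (at t)"
    and "k = 0 \<longrightarrow> cycle_integral (\<lambda>t. z t * cos t) = 0 \<and> cycle_integral (\<lambda>t. z t * sin t) = 0"
  shows "z t = 0 \<and> v t = 0"
  using assms nonresonant_unique[of k z v t] resonant_unique[of z v t] by (cases "k = 0") auto

text \<open>Orthogonality to the first harmonic is also necessary for the resonant problem.\<close>

lemma resonant_orthogonality:
  fixes z v f :: "real \<Rightarrow> real"
  assumes per: "periodic_2pi z" "periodic_2pi v" and f: "continuous_on UNIV f"
    and z: "\<And>t. (z has_vector_derivative v t + f t) (at t)" and v: "\<And>t. (v has_vector_derivative - z t) (at t)"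
  shows "cycle_integral (\<lambda>t. f t * cos t) = 0 \<and> cycle_integral (\<lambda>t. f t * sin t) = 0"
proof -
  have C: "((\<lambda>t. cos t) has_vector_derivative - sin t) (at t)" for t :: real
    unfolding has_real_derivative_iff_has_vector_derivative[symmetric] by (rule DERIV_cos)
  have S: "((\<lambda>t. sin t) has_vector_derivative cos t) (at t)" for t :: real
    unfolding has_real_derivative_iff_has_vector_derivative[symmetric] by (rule DERIV_sin)
  have "z (2 * pi) = z 0" "v (2 * pi) = v 0"
    using per by (auto simp: periodic_2pi_def) (metis add_0)+
  then have ends: "z (2 * pi) * cos (2 * pi) - v (2 * pi) * sin (2 * pi) = z 0 * cos 0 - v 0 * sin 0"
     "z (2 * pi) * sin (2 * pi) + v (2 * pi) * cos (2 * pi) = z 0 * sin 0 + v 0 * cos 0" by simp_all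
  have "((\<lambda>t. z t * cos t - v t * sin t) has_vector_derivative f t * cos t) (at t)" for t
    using has_vector_derivative_diff[OF has_vector_derivative_mult[OF z C] has_vector_derivative_mult[OF v S], of t]
    by (simp add: algebra_simps)
  moreover have "((\<lambda>t. z t * sin t + v t * cos t) has_vector_derivative f t * sin t) (at t)" for t
    using has_vector_derivative_add[OF has_vector_derivative_mult[OF z S] has_vector_derivative_mult[OF v C], of t]
    by (simp add: algebra_simps)
  ultimately show ?thesis
    by (intro conjI integral_vector_derivative_eq_0[OF _ _ ends(1)] integral_vector_derivative_eq_0[OF _ _ ends(2)]) auto
qed

section \<open>Harmonic waves\<close>

definition wave :: "real ^ 'n \<Rightarrow> real ^ 'n \<Rightarrow> real \<Rightarrow> real ^ 'n" where
  "wave p q t = cos t *\<^sub>R p + sin t *\<^sub>R q"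

lemma has_vector_derivative_wave: "(wave p q has_vector_derivative wave q (- p) t) (at t)"
proof -
  have C: "((\<lambda>t. cos t) has_vector_derivative - sin t) (at t)"
    unfolding has_real_derivative_iff_has_vector_derivative[symmetric] by (rule DERIV_cos)
  have S: "((\<lambda>t. sin t) has_vector_derivative cos t) (at t)"
    unfolding has_real_derivative_iff_has_vector_derivative[symmetric] by (rule DERIV_sin)
  have "(wave p q has_vector_derivative - sin t *\<^sub>R p + cos t *\<^sub>R q) (at t)"
    unfolding wave_def[abs_def]
    by (intro has_vector_derivative_add bounded_linear.has_vector_derivative[OF bounded_linear_scaleR_left] C S)
  then show ?thesis by (simp add: wave_def algebra_simps)
qed

lemma continuous_wave: "continuous_on A (wave p q)"
  by (rule vector_derivative_continuous_on[OF has_vector_derivative_wave])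

lemma periodic_wave: "periodic_2pi (wave p q)"
  by (simp add: periodic_2pi_def wave_def)

lemma wave_shift: "wave p q (t + c) = cos c *\<^sub>R wave p q t + sin c *\<^sub>R wave q (- p) t"
  by (simp add: wave_def cos_add sin_add algebra_simps)

lemma wave_at: "wave p q 0 = p" "wave p q (pi / 2) = q"
  by (simp_all add: wave_def)

lemma norm_wave_le: "norm (wave p q t) \<le> norm p + norm q"
proof -
  have "norm (wave p q t) \<le> \<bar>cos t\<bar> * norm p + \<bar>sin t\<bar> * norm q"
    unfolding wave_def using norm_triangle_ineq[of "cos t *\<^sub>R p" "sin t *\<^sub>R q"] by simp
  also have "\<dots> \<le> 1 * norm p + 1 * norm q"
    by (intro add_mono mult_right_mono) auto
  finally show ?thesis by simp
qed

lemma integrable_on_cycle: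
  fixes f :: "real \<Rightarrow> 'a::euclidean_space"
  assumes "continuous_on UNIV f"
  shows "f integrable_on {0..2 * pi}"
  by (rule integrable_continuous_interval) (rule continuous_on_subset[OF assms], simp)

lemma periodic_attains_max:
  fixes f :: "real \<Rightarrow> 'a::real_normed_vector"
  assumes "continuous_on UNIV f" "periodic_2pi f"
  obtains m where "\<And>t. norm (f t) \<le> norm (f m)"
proof -
  have "\<exists>m\<in>{0..2 * pi}. \<forall>t\<in>{0..2 * pi}. norm (f t) \<le> norm (f m)"
    by (rule continuous_attains_sup) (auto intro!: continuous_intros continuous_on_subset[OF assms(1)])
  then obtain m where "\<And>t. t \<in> {0..2 * pi} \<Longrightarrow> norm (f t) \<le> norm (f m)" by blast
  then show ?thesis using periodic_reduce[OF assms(2)] that by metis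
qed

section \<open>The linear problem in an eigenbasis\<close>

text \<open>An eigenbasis of \<open>N\<close> splits the linear problem into the scalar problems above; the resonant ones
  belong to the kernel of \<open>N\<close>.\<close>

locale eigenbasis =
  fixes N :: "real ^ 'n ^ 'n" and b :: "'n \<Rightarrow> real ^ 'n" and \<nu> :: "'n \<Rightarrow> real"
  assumes orthonormal: "b i \<bullet> b j = (if i = j then 1 else 0)"
    and expansion: "(\<Sum>i\<in>UNIV. (b i \<bullet> x) *\<^sub>R b i) = x"
    and eigen: "N *v b i = \<nu> i *\<^sub>R b i"
begin

lemma coeff_sum: "b j \<bullet> (\<Sum>i\<in>UNIV. c i *\<^sub>R b i) = c j"
  by (simp add: inner_sum_right orthonormal if_distrib cong: if_cong)

lemma basis_eqI:
  assumes "\<And>i. b i \<bullet> x = b i \<bullet> y"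
  shows "x = y"
proof -
  have "(\<Sum>i\<in>UNIV. (b i \<bullet> x) *\<^sub>R b i) = (\<Sum>i\<in>UNIV. (b i \<bullet> y) *\<^sub>R b i)"
    by (simp only: assms)
  then show ?thesis by (simp only: expansion)
qed

lemma norm_basis: "norm (b i) = 1"
  by (simp add: norm_eq_sqrt_inner orthonormal)

lemma coeff_bound: "\<bar>b i \<bullet> x\<bar> \<le> norm x"
  using Cauchy_Schwarz_ineq2[of "b i" x] by (simp add: norm_basis)

lemma coeff_mult: "b i \<bullet> (N *v x) = \<nu> i * (b i \<bullet> x)"
proof -
  have "N *v x = (\<Sum>j\<in>UNIV. (\<nu> j * (b j \<bullet> x)) *\<^sub>R b j)"
    by (subst (1) expansion[of x, symmetric])
       (simp add: linear_sum[OF matrix_vector_mul_linear] matrix_vector_mult_scaleR eigen mult.commute)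
  then show ?thesis by (simp add: coeff_sum)
qed

lemma kernel_iff: "N *v x = 0 \<longleftrightarrow> (\<forall>i. \<nu> i \<noteq> 0 \<longrightarrow> b i \<bullet> x = 0)"
proof
  assume "N *v x = 0"
  then show "\<forall>i. \<nu> i \<noteq> 0 \<longrightarrow> b i \<bullet> x = 0" using coeff_mult[of _ x] by auto
next
  assume "\<forall>i. \<nu> i \<noteq> 0 \<longrightarrow> b i \<bullet> x = 0"
  then show "N *v x = 0" by (intro basis_eqI) (auto simp: coeff_mult)
qed

definition kernel_proj :: "real ^ 'n \<Rightarrow> real ^ 'n" where
  "kernel_proj x = (\<Sum>i | \<nu> i = 0. (b i \<bullet> x) *\<^sub>R b i)"

lemma coeff_kernel_proj: "b i \<bullet> kernel_proj x = (if \<nu> i = 0 then b i \<bullet> x else 0)"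
proof -
  have "kernel_proj x = (\<Sum>i\<in>UNIV. (if \<nu> i = 0 then b i \<bullet> x else 0) *\<^sub>R b i)"
    unfolding kernel_proj_def by (rule sum.mono_neutral_cong_left) auto
  then show ?thesis by (simp only: coeff_sum)
qed

lemma linear_kernel_proj: "linear kernel_proj"
  by (rule linearI; rule basis_eqI; simp add: coeff_kernel_proj inner_add_right)

lemma mult_kernel_proj: "N *v kernel_proj x = 0"
  by (simp add: kernel_iff coeff_kernel_proj)

lemma kernel_proj_mult: "kernel_proj (N *v x) = 0"
  by (rule basis_eqI) (simp add: coeff_kernel_proj coeff_mult)

lemma kernel_proj_id: "N *v x = 0 \<Longrightarrow> kernel_proj x = x"
  by (rule basis_eqI) (auto simp: coeff_kernel_proj kernel_iff)

lemma inner_eq_sum: "x \<bullet> y = (\<Sum>i\<in>UNIV. (b i \<bullet> x) * (b i \<bullet> y))"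
  by (subst (1) expansion[of x, symmetric]) (simp add: inner_sum_left)

lemma inner_kernel_proj:
  assumes "N *v y = 0"
  shows "kernel_proj x \<bullet> y = x \<bullet> y"
proof -
  have "(\<Sum>i\<in>UNIV. (b i \<bullet> kernel_proj x) * (b i \<bullet> y)) = (\<Sum>i\<in>UNIV. (b i \<bullet> x) * (b i \<bullet> y))"
    by (rule sum.cong) (use assms in \<open>auto simp: coeff_kernel_proj kernel_iff\<close>)
  then show ?thesis by (simp only: inner_eq_sum[symmetric])
qed

text \<open>The orthogonal complement of the kernel is the range, so a linear map commuting with \<open>N\<close>
  respects both summands.\<close>

lemma kernel_proj_commute:
  assumes "linear R" and comm: "\<And>x. R (N *v x) = N *v R x"
  shows "R (kernel_proj x) = kernel_proj (R x)"
proof -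
  define y where "y = (\<Sum>i\<in>UNIV. (if \<nu> i = 0 then 0 else (b i \<bullet> x) / \<nu> i) *\<^sub>R b i)"
  have "x = kernel_proj x + N *v y"
    by (rule basis_eqI) (simp add: inner_add_right coeff_kernel_proj coeff_mult y_def coeff_sum)
  then have "R x = R (kernel_proj x) + N *v R y"
    using linear_add[OF assms(1)] comm by metis
  then have "kernel_proj (R x) = kernel_proj (R (kernel_proj x)) + kernel_proj (N *v R y)"
    using linear_add[OF linear_kernel_proj] by metis
  moreover have "N *v R (kernel_proj x) = 0"
    by (simp add: comm[symmetric] mult_kernel_proj linear_0[OF assms(1)])
  ultimately show ?thesis by (simp add: kernel_proj_mult kernel_proj_id)
qed

definition no_critical_harmonic :: "(real \<Rightarrow> real ^ 'n) \<Rightarrow> bool" where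
  "no_critical_harmonic f \<longleftrightarrow> kernel_proj (cycle_integral (\<lambda>t. cos t *\<^sub>R f t)) = 0 \<and>
     kernel_proj (cycle_integral (\<lambda>t. sin t *\<^sub>R f t)) = 0"

lemma coeff_cycle_integral:
  assumes "continuous_on UNIV f" "continuous_on UNIV c"
  shows "b i \<bullet> cycle_integral (\<lambda>t. c t *\<^sub>R f t) = cycle_integral (\<lambda>t. (b i \<bullet> f t) * c t)"
proof -
  have "(\<lambda>t. c t *\<^sub>R f t) integrable_on {0..2 * pi}"
    by (intro integrable_continuous_interval continuous_intros continuous_on_subset[OF assms(1)]
        continuous_on_subset[OF assms(2)]) auto
  then have "cycle_integral ((\<lambda>x. b i \<bullet> x) \<circ> (\<lambda>t. c t *\<^sub>R f t)) = b i \<bullet> cycle_integral (\<lambda>t. c t *\<^sub>R f t)"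
    by (rule integral_linear[OF _ bounded_linear_inner_right])
  then show ?thesis by (simp add: o_def mult.commute)
qed

lemma no_critical_harmonic_iff:
  assumes "continuous_on UNIV f"
  shows "no_critical_harmonic f \<longleftrightarrow> (\<forall>i. \<nu> i = 0 \<longrightarrow>
    cycle_integral (\<lambda>t. (b i \<bullet> f t) * cos t) = 0 \<and> cycle_integral (\<lambda>t. (b i \<bullet> f t) * sin t) = 0)"
proof -
  have "kernel_proj x = 0 \<longleftrightarrow> (\<forall>i. \<nu> i = 0 \<longrightarrow> b i \<bullet> x = 0)" for x
  proof
    assume "kernel_proj x = 0"
    then show "\<forall>i. \<nu> i = 0 \<longrightarrow> b i \<bullet> x = 0" using coeff_kernel_proj[of _ x] by (metis inner_zero_right)
  qed (auto intro: basis_eqI simp: coeff_kernel_proj)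
  then show ?thesis
    by (auto simp: no_critical_harmonic_def coeff_cycle_integral[OF assms] continuous_on_cos continuous_on_sin)
qed

text \<open>The equation \<open>z'' = N z' - z + f'\<close> in Lienard form. The last condition singles out one solution,
  since the critical harmonics are the homogeneous solutions.\<close>

definition linear_solution :: "(real \<Rightarrow> real ^ 'n) \<Rightarrow> (real \<Rightarrow> real ^ 'n) \<Rightarrow> (real \<Rightarrow> real ^ 'n) \<Rightarrow> bool" where
  "linear_solution f z v \<longleftrightarrow> periodic_2pi z \<and> periodic_2pi v \<and>
     (\<forall>t. (z has_vector_derivative N *v z t + v t + f t) (at t)) \<and>
     (\<forall>t. (v has_vector_derivative - z t) (at t)) \<and> no_critical_harmonic z"

lemma linear_solution_exists:
  "\<exists>C\<ge>0. \<forall>f B. continuous_on UNIV f \<and> periodic_2pi f \<and> (\<forall>t. norm (f t) \<le> B) \<and> no_critical_harmonic f \<longrightarrow>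
     (\<exists>z v. linear_solution f z v \<and> (\<forall>t. norm (z t) \<le> C * B \<and> norm (v t) \<le> C * B))"
proof -
  have "\<exists>C. \<forall>i. C i \<ge> 0 \<and> (\<forall>f B. continuous_on UNIV f \<and> periodic_2pi f \<and> (\<forall>t. \<bar>f t\<bar> \<le> B) \<and>
    (\<nu> i = 0 \<longrightarrow> cycle_integral (\<lambda>t. f t * cos t) = 0 \<and> cycle_integral (\<lambda>t. f t * sin t) = 0) \<longrightarrow>
    (\<exists>z v. periodic_2pi z \<and> periodic_2pi v \<and>
      (\<forall>t. (z has_vector_derivative \<nu> i * z t + v t + f t) (at t)) \<and>
      (\<forall>t. (v has_vector_derivative - z t) (at t)) \<and>
      (\<nu> i = 0 \<longrightarrow> cycle_integral (\<lambda>t. z t * cos t) = 0 \<and> cycle_integral (\<lambda>t. z t * sin t) = (0::real)) \<and>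
      (\<forall>t. \<bar>z t\<bar> \<le> C i * B \<and> \<bar>v t\<bar> \<le> C i * B)))"
    by (rule choice) (use scalar_solution in blast)
  then obtain C where C: "\<And>i. C i \<ge> 0" and sol: "\<And>i f B. continuous_on UNIV f \<Longrightarrow> periodic_2pi f \<Longrightarrow> \<forall>t. \<bar>f t\<bar> \<le> B \<Longrightarrow>
    (\<nu> i = 0 \<longrightarrow> cycle_integral (\<lambda>t. f t * cos t) = 0 \<and> cycle_integral (\<lambda>t. f t * sin t) = 0) \<Longrightarrow>
    (\<exists>z v. periodic_2pi z \<and> periodic_2pi v \<and>
      (\<forall>t. (z has_vector_derivative \<nu> i * z t + v t + f t) (at t)) \<and>
      (\<forall>t. (v has_vector_derivative - z t) (at t)) \<and>
      (\<nu> i = 0 \<longrightarrow> cycle_integral (\<lambda>t. z t * cos t) = 0 \<and> cycle_integral (\<lambda>t. z t * sin t) = (0::real)) \<and>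
      (\<forall>t. \<bar>z t\<bar> \<le> C i * B \<and> \<bar>v t\<bar> \<le> C i * B))" by blast
  show ?thesis
  proof (rule exI[of _ "sum C UNIV"], intro conjI allI impI)
    show "0 \<le> sum C UNIV" by (simp add: C sum_nonneg)
    fix f :: "real \<Rightarrow> real ^ 'n" and B :: real
    assume f: "continuous_on UNIV f \<and> periodic_2pi f \<and> (\<forall>t. norm (f t) \<le> B) \<and> no_critical_harmonic f"
    have B: "B \<ge> 0" using f norm_ge_zero order_trans by blast
    have "\<exists>zv. \<forall>i. periodic_2pi (fst (zv i)) \<and> periodic_2pi (snd (zv i)) \<and>
      (\<forall>t. (fst (zv i) has_vector_derivative \<nu> i * fst (zv i) t + snd (zv i) t + b i \<bullet> f t) (at t)) \<and>
      (\<forall>t. (snd (zv i) has_vector_derivative - fst (zv i) t) (at t)) \<and>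
      (\<nu> i = 0 \<longrightarrow> cycle_integral (\<lambda>t. fst (zv i) t * cos t) = 0 \<and> cycle_integral (\<lambda>t. fst (zv i) t * sin t) = (0::real)) \<and>
      (\<forall>t. \<bar>fst (zv i) t\<bar> \<le> C i * B \<and> \<bar>snd (zv i) t\<bar> \<le> C i * B)"
    proof (rule choice, rule allI)
      fix i
      have "\<forall>t. \<bar>b i \<bullet> f t\<bar> \<le> B" using f coeff_bound order_trans by blast
      moreover have "continuous_on UNIV (\<lambda>t. b i \<bullet> f t)" "periodic_2pi (\<lambda>t. b i \<bullet> f t)"
        using f by (auto simp: periodic_2pi_def intro!: continuous_intros)
      moreover have "\<nu> i = 0 \<longrightarrow> cycle_integral (\<lambda>t. (b i \<bullet> f t) * cos t) = 0 \<and>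
          cycle_integral (\<lambda>t. (b i \<bullet> f t) * sin t) = 0"
        using f no_critical_harmonic_iff[of f] by blast
      ultimately obtain z v where "periodic_2pi z \<and> periodic_2pi v \<and>
      (\<forall>t. (z has_vector_derivative \<nu> i * z t + v t + b i \<bullet> f t) (at t)) \<and>
      (\<forall>t. (v has_vector_derivative - z t) (at t)) \<and>
      (\<nu> i = 0 \<longrightarrow> cycle_integral (\<lambda>t. z t * cos t) = 0 \<and> cycle_integral (\<lambda>t. z t * sin t) = (0::real)) \<and>
      (\<forall>t. \<bar>z t\<bar> \<le> C i * B \<and> \<bar>v t\<bar> \<le> C i * B)"
        using sol[of "\<lambda>t. b i \<bullet> f t" B i] by blast
      then show "\<exists>zv. periodic_2pi (fst zv) \<and> periodic_2pi (snd zv) \<and>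
      (\<forall>t. (fst zv has_vector_derivative \<nu> i * fst zv t + snd zv t + b i \<bullet> f t) (at t)) \<and>
      (\<forall>t. (snd zv has_vector_derivative - fst zv t) (at t)) \<and>
      (\<nu> i = 0 \<longrightarrow> cycle_integral (\<lambda>t. fst zv t * cos t) = 0 \<and> cycle_integral (\<lambda>t. fst zv t * sin t) = (0::real)) \<and>
      (\<forall>t. \<bar>fst zv t\<bar> \<le> C i * B \<and> \<bar>snd zv t\<bar> \<le> C i * B)"
        by (intro exI[of _ "(z, v)"]) simp
    qed
    then obtain zv where zv: "\<And>i. periodic_2pi (fst (zv i))" "\<And>i. periodic_2pi (snd (zv i))"
      "\<And>i t. (fst (zv i) has_vector_derivative \<nu> i * fst (zv i) t + snd (zv i) t + b i \<bullet> f t) (at t)"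
      "\<And>i t. (snd (zv i) has_vector_derivative - fst (zv i) t) (at t)"
      "\<And>i. \<nu> i = 0 \<longrightarrow> cycle_integral (\<lambda>t. fst (zv i) t * cos t) = 0 \<and> cycle_integral (\<lambda>t. fst (zv i) t * sin t) = (0::real)"
      "\<And>i t. \<bar>fst (zv i) t\<bar> \<le> C i * B" "\<And>i t. \<bar>snd (zv i) t\<bar> \<le> C i * B"
      by blast
    define z where "z t = (\<Sum>i\<in>UNIV. fst (zv i) t *\<^sub>R b i)" for t
    define v where "v t = (\<Sum>i\<in>UNIV. snd (zv i) t *\<^sub>R b i)" for t
    have z_coeff: "b i \<bullet> z t = fst (zv i) t" and v_coeff: "b i \<bullet> v t = snd (zv i) t" for i t
      by (simp_all add: z_def v_def coeff_sum)
    have "(z has_vector_derivative (\<Sum>i\<in>UNIV. (\<nu> i * fst (zv i) t + snd (zv i) t + b i \<bullet> f t) *\<^sub>R b i)) (at t)" for t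
      unfolding z_def[abs_def]
      by (intro has_vector_derivative_sum bounded_linear.has_vector_derivative[OF bounded_linear_scaleR_left zv(3)])
    moreover have "(\<Sum>i\<in>UNIV. (\<nu> i * fst (zv i) t + snd (zv i) t + b i \<bullet> f t) *\<^sub>R b i) = N *v z t + v t + f t" for t
      by (rule basis_eqI) (simp only: coeff_sum inner_add_right coeff_mult z_coeff v_coeff)
    ultimately have z': "(z has_vector_derivative N *v z t + v t + f t) (at t)" for t by simp
    have "(v has_vector_derivative (\<Sum>i\<in>UNIV. (- fst (zv i) t) *\<^sub>R b i)) (at t)" for t
      unfolding v_def[abs_def]
      by (intro has_vector_derivative_sum bounded_linear.has_vector_derivative[OF bounded_linear_scaleR_left zv(4)])
    then have v': "(v has_vector_derivative - z t) (at t)" for t by (simp add: z_def sum_negf)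
    show "\<exists>z v. linear_solution f z v \<and> (\<forall>t. norm (z t) \<le> sum C UNIV * B \<and> norm (v t) \<le> sum C UNIV * B)"
    proof (rule exI[of _ z], rule exI[of _ v], intro conjI allI)
      show "linear_solution f z v"
        unfolding linear_solution_def
        using zv(1,2,5) z' v'
        by (auto simp: no_critical_harmonic_iff[OF vector_derivative_continuous_on[OF z']] z_coeff)
           (auto simp: z_def v_def periodic_2pi_def)
      show "norm (z t) \<le> sum C UNIV * B" "norm (v t) \<le> sum C UNIV * B" for t
        unfolding z_def v_def sum_distrib_right
        by (rule sum_norm_le; simp add: norm_basis zv)+
    qed
  qed
qed

text \<open>A solution exists only if \<open>f\<close> has no critical harmonic, and it is then unique, so it obeys the bound
  of the solution constructed above.\<close>

lemma linear_solution_bound: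
  "\<exists>C\<ge>0. \<forall>f B z v. continuous_on UNIV f \<and> periodic_2pi f \<and> (\<forall>t. norm (f t) \<le> B) \<and> linear_solution f z v \<longrightarrow>
     (\<forall>t. norm (z t) \<le> C * B \<and> norm (v t) \<le> C * B)"
proof -
  obtain C where C: "C \<ge> 0" "\<And>f B. continuous_on UNIV f \<Longrightarrow> periodic_2pi f \<Longrightarrow> \<forall>t. norm (f t) \<le> B \<Longrightarrow> no_critical_harmonic f \<Longrightarrow>
     \<exists>z v. linear_solution f z v \<and> (\<forall>t. norm (z t) \<le> C * B \<and> norm (v t) \<le> C * B)"
    using linear_solution_exists by blast
  have "norm (z t) \<le> C * B \<and> norm (v t) \<le> C * B"
    if f: "continuous_on UNIV f" "periodic_2pi f" "\<forall>t. norm (f t) \<le> B" and s: "linear_solution f z v" for f B z v t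
  proof -
    have z': "(z has_vector_derivative N *v z t + v t + f t) (at t)" for t using s by (simp add: linear_solution_def)
    have v': "(v has_vector_derivative - z t) (at t)" for t using s by (simp add: linear_solution_def)
    have bz: "((\<lambda>t. b i \<bullet> z t) has_vector_derivative \<nu> i * (b i \<bullet> z t) + b i \<bullet> v t + b i \<bullet> f t) (at t)" for i t
      using bounded_linear.has_vector_derivative[OF bounded_linear_inner_right z', of "b i" t]
      by (simp add: inner_add_right coeff_mult)
    have bv: "((\<lambda>t. b i \<bullet> v t) has_vector_derivative - (b i \<bullet> z t)) (at t)" for i t
      using bounded_linear.has_vector_derivative[OF bounded_linear_inner_right v', of "b i" t] by simp
    have per: "periodic_2pi z" "periodic_2pi v" using s by (auto simp: linear_solution_def)
    have "no_critical_harmonic f"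
      unfolding no_critical_harmonic_iff[OF f(1)]
    proof (intro allI impI)
      fix i assume "\<nu> i = 0"
      then show "cycle_integral (\<lambda>t. (b i \<bullet> f t) * cos t) = 0 \<and> cycle_integral (\<lambda>t. (b i \<bullet> f t) * sin t) = 0"
        using bz[of i] bv[of i] per f(1)
        by (intro resonant_orthogonality[of "\<lambda>t. b i \<bullet> z t" "\<lambda>t. b i \<bullet> v t"])
           (auto simp: periodic_2pi_def intro!: continuous_intros)
    qed
    from C(2)[OF f this] obtain y w where yw: "linear_solution f y w" "\<And>t. norm (y t) \<le> C * B" "\<And>t. norm (w t) \<le> C * B"
      by blast
    have y': "(y has_vector_derivative N *v y t + w t + f t) (at t)" for t using yw by (simp add: linear_solution_def)
    have w': "(w has_vector_derivative - y t) (at t)" for t using yw by (simp add: linear_solution_def)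
    have by': "((\<lambda>t. b i \<bullet> y t) has_vector_derivative \<nu> i * (b i \<bullet> y t) + b i \<bullet> w t + b i \<bullet> f t) (at t)" for i t
      using bounded_linear.has_vector_derivative[OF bounded_linear_inner_right y', of "b i" t]
      by (simp add: inner_add_right coeff_mult)
    have bw: "((\<lambda>t. b i \<bullet> w t) has_vector_derivative - (b i \<bullet> y t)) (at t)" for i t
      using bounded_linear.has_vector_derivative[OF bounded_linear_inner_right w', of "b i" t] by simp
    have per': "periodic_2pi y" "periodic_2pi w" using yw by (auto simp: linear_solution_def)
    have cont: "continuous_on A z" "continuous_on A y" for A
      by (rule vector_derivative_continuous_on[OF z'], rule vector_derivative_continuous_on[OF y'])
    have "b i \<bullet> z t - b i \<bullet> y t = 0 \<and> b i \<bullet> v t - b i \<bullet> w t = 0" for i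
    proof (rule scalar_unique[of "\<lambda>t. b i \<bullet> z t - b i \<bullet> y t" "\<lambda>t. b i \<bullet> v t - b i \<bullet> w t" "\<nu> i"])
      show "periodic_2pi (\<lambda>t. b i \<bullet> z t - b i \<bullet> y t)" "periodic_2pi (\<lambda>t. b i \<bullet> v t - b i \<bullet> w t)"
        using per per' by (auto simp: periodic_2pi_def)
      show "((\<lambda>t. b i \<bullet> z t - b i \<bullet> y t) has_vector_derivative
         \<nu> i * (b i \<bullet> z t - b i \<bullet> y t) + (b i \<bullet> v t - b i \<bullet> w t)) (at t)" for t
        using has_vector_derivative_diff[OF bz[of i t] by'[of i t]] by (simp add: algebra_simps)
      show "((\<lambda>t. b i \<bullet> v t - b i \<bullet> w t) has_vector_derivative - (b i \<bullet> z t - b i \<bullet> y t)) (at t)" for t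
        using has_vector_derivative_diff[OF bv[of i t] bw[of i t]] by simp
      have int: "(\<lambda>t. (b i \<bullet> u t) * c t) integrable_on {0..2 * pi}"
        if "u \<in> {z, y}" "c \<in> {cos, sin}" for u and c :: "real \<Rightarrow> real"
        using that by (auto intro!: integrable_continuous_interval continuous_intros cont)
      have "no_critical_harmonic z" "no_critical_harmonic y" using s yw by (auto simp: linear_solution_def)
      then show "\<nu> i = 0 \<longrightarrow> cycle_integral (\<lambda>t. (b i \<bullet> z t - b i \<bullet> y t) * cos t) = 0 \<and>
          cycle_integral (\<lambda>t. (b i \<bullet> z t - b i \<bullet> y t) * sin t) = 0"
        by (simp add: no_critical_harmonic_iff cont left_diff_distrib integral_diff int)
    qed
    then have "z t = y t" "v t = w t" by (auto intro!: basis_eqI)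
    then show ?thesis using yw by simp
  qed
  then show ?thesis using C(1) by blast
qed

section \<open>The critical first harmonic\<close>

text \<open>The kernel component of the first Fourier coefficient of \<open>f\<close>, as a function of time; it is
  \<open>pi\<close> times the orthogonal projection of \<open>f\<close> to the periodic solutions of the linearised system.\<close>

definition critical_harmonic :: "(real \<Rightarrow> real ^ 'n) \<Rightarrow> real \<Rightarrow> real ^ 'n" where
  "critical_harmonic f = wave (kernel_proj (cycle_integral (\<lambda>t. cos t *\<^sub>R f t)))
     (kernel_proj (cycle_integral (\<lambda>t. sin t *\<^sub>R f t)))"

lemma inner_wave:
  assumes "N *v p = 0" "N *v q = 0" "continuous_on UNIV f"
  shows "cycle_integral (\<lambda>t. f t \<bullet> wave p q t) =
    kernel_proj (cycle_integral (\<lambda>t. cos t *\<^sub>R f t)) \<bullet> p + kernel_proj (cycle_integral (\<lambda>t. sin t *\<^sub>R f t)) \<bullet> q"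
proof -
  have lin: "cycle_integral (\<lambda>t. g t \<bullet> p) = cycle_integral g \<bullet> p" if "continuous_on UNIV g" for g :: "real \<Rightarrow> real ^ 'n" and p
    using integral_linear[OF integrable_on_cycle[OF that] bounded_linear_inner_left, of p] by (simp add: o_def)
  have "cycle_integral (\<lambda>t. f t \<bullet> wave p q t) =
      cycle_integral (\<lambda>t. (cos t *\<^sub>R f t) \<bullet> p + (sin t *\<^sub>R f t) \<bullet> q)"
    by (simp add: wave_def inner_add_right)
  also have "\<dots> = cycle_integral (\<lambda>t. (cos t *\<^sub>R f t) \<bullet> p) + cycle_integral (\<lambda>t. (sin t *\<^sub>R f t) \<bullet> q)"
    by (rule integral_add; rule integrable_on_cycle; intro continuous_intros assms(3))
  also have "\<dots> = cycle_integral (\<lambda>t. cos t *\<^sub>R f t) \<bullet> p + cycle_integral (\<lambda>t. sin t *\<^sub>R f t) \<bullet> q"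
    by (subst (1 2) lin) (auto intro!: continuous_intros assms(3))
  finally show ?thesis by (simp add: inner_kernel_proj assms)
qed

lemma inner_wave_wave:
  assumes "N *v p = 0" "N *v q = 0"
  shows "cycle_integral (\<lambda>t. wave p q t \<bullet> wave r s t) = pi * (p \<bullet> r + q \<bullet> s)"
proof -
  have int: "(\<lambda>t. c * (f t * g t)) integrable_on {0..2 * pi}"
    if "f \<in> {cos, sin}" "g \<in> {cos, sin}" for f g :: "real \<Rightarrow> real" and c
    using that by (intro integrable_on_cycle) (auto intro!: continuous_intros)
  have "cycle_integral (\<lambda>t. wave p q t \<bullet> wave r s t) =
     cycle_integral (\<lambda>t. ((p \<bullet> r) * (cos t * cos t) + (p \<bullet> s) * (cos t * sin t)) +
       ((q \<bullet> r) * (sin t * cos t) + (q \<bullet> s) * (sin t * sin t)))"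
    by (simp add: wave_def inner_add_left inner_add_right algebra_simps)
  also have "\<dots> = (p \<bullet> r) * pi + (q \<bullet> s) * pi"
    using int by (simp add: integral_add integrable_add cycle_integrals_trig)
  finally show ?thesis by (simp add: algebra_simps)
qed

text \<open>Written as a convolution, the critical harmonic visibly commutes with time shifts.\<close>

lemma critical_harmonic_eq:
  assumes "continuous_on UNIV f"
  shows "critical_harmonic f t = kernel_proj (cycle_integral (\<lambda>s. cos (t - s) *\<^sub>R f s))"
proof -
  have int: "(\<lambda>s. cos s *\<^sub>R f s) integrable_on {0..2 * pi}" "(\<lambda>s. sin s *\<^sub>R f s) integrable_on {0..2 * pi}"
    by (auto intro!: integrable_on_cycle continuous_intros assms)
  have "cycle_integral (\<lambda>s. cos (t - s) *\<^sub>R f s) =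
      cycle_integral (\<lambda>s. cos t *\<^sub>R (cos s *\<^sub>R f s) + sin t *\<^sub>R (sin s *\<^sub>R f s))"
    by (simp add: cos_diff scaleR_add_left)
  also have "\<dots> = cos t *\<^sub>R cycle_integral (\<lambda>s. cos s *\<^sub>R f s) + sin t *\<^sub>R cycle_integral (\<lambda>s. sin s *\<^sub>R f s)"
    by (simp only: integral_add[OF integrable_cmul integrable_cmul, OF int] integral_cmul)
  finally show ?thesis
    by (simp add: critical_harmonic_def wave_def linear_add[OF linear_kernel_proj] linear_cmul[OF linear_kernel_proj])
qed

lemma critical_harmonic_transform:
  assumes f: "continuous_on UNIV f" "periodic_2pi f"
    and R: "linear R" "\<And>x. R (N *v x) = N *v R x"
  shows "critical_harmonic (\<lambda>t. R (f (t - c))) t = R (critical_harmonic f (t - c))"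
proof -
  have bR: "bounded_linear R" using R(1) by (simp add: linear_conv_bounded_linear)
  have cont: "continuous_on UNIV (\<lambda>t. R (f (t - c)))"
    by (intro bounded_linear.continuous_on[OF bR] continuous_on_compose2[OF f(1)] continuous_intros) auto
  define g where "g s = cos (t - s) *\<^sub>R R (f (s - c))" for s
  have "f (s + 2 * pi - c) = f (s - c)" for s
    using f(2) by (simp add: periodic_2pi_def diff_add_eq[symmetric])
  then have g: "continuous_on UNIV g" "periodic_2pi g"
    by (auto simp: g_def periodic_2pi_def cos_diff intro!: continuous_intros cont)
  have "cycle_integral g = cycle_integral (\<lambda>s. g (s + c))" by (rule cycle_integral_shift[OF g, symmetric])
  also have "\<dots> = cycle_integral (\<lambda>s. R (cos (t - c - s) *\<^sub>R f s))"
    by (simp add: linear_cmul[OF R(1)] g_def diff_diff_eq add.commute)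
  also have "\<dots> = R (cycle_integral (\<lambda>s. cos (t - c - s) *\<^sub>R f s))"
  proof -
    have "continuous_on UNIV (\<lambda>s. cos (t - c - s) *\<^sub>R f s)" by (intro continuous_intros f(1))
    then show ?thesis
      using integral_linear[OF integrable_on_cycle bR, of "\<lambda>s. cos (t - c - s) *\<^sub>R f s"]
      by (simp only: o_def)
  qed
  finally show ?thesis
    by (simp add: critical_harmonic_eq[OF f(1)] critical_harmonic_eq[OF cont] kernel_proj_commute[OF R] g_def[abs_def])
qed

lemma no_critical_harmonic_iff_0: "no_critical_harmonic f \<longleftrightarrow> (\<forall>t. critical_harmonic f t = 0)"
proof
  assume "\<forall>t. critical_harmonic f t = 0"
  then show "no_critical_harmonic f"
    using wave_at unfolding no_critical_harmonic_def critical_harmonic_def by metis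
qed (simp add: no_critical_harmonic_def critical_harmonic_def wave_def)

lemma inner_mult_kernel: "N *v y = 0 \<Longrightarrow> (N *v x) \<bullet> y = 0"
  using inner_kernel_proj[of y "N *v x"] by (simp add: kernel_proj_mult)

lemma no_critical_harmonic_diff:
  assumes "no_critical_harmonic f" "no_critical_harmonic g" "continuous_on UNIV f" "continuous_on UNIV g"
  shows "no_critical_harmonic (\<lambda>t. f t - g t)"
proof -
  have "cycle_integral (\<lambda>t. c t *\<^sub>R (f t - g t)) = cycle_integral (\<lambda>t. c t *\<^sub>R f t) - cycle_integral (\<lambda>t. c t *\<^sub>R g t)"
    if "continuous_on UNIV c" for c :: "real \<Rightarrow> real"
    unfolding scaleR_diff_right
    by (rule integral_diff; rule integrable_on_cycle; intro continuous_intros that assms)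
  then show ?thesis
    using assms(1,2)
    by (simp add: no_critical_harmonic_def continuous_on_cos continuous_on_sin linear_diff[OF linear_kernel_proj])
qed

lemma linear_solution_diff:
  assumes "linear_solution f z v" "linear_solution g y u"
  shows "linear_solution (\<lambda>t. f t - g t) (\<lambda>t. z t - y t) (\<lambda>t. v t - u t)"
proof -
  have z: "(z has_vector_derivative N *v z t + v t + f t) (at t)" for t using assms by (simp add: linear_solution_def)
  have y: "(y has_vector_derivative N *v y t + u t + g t) (at t)" for t using assms by (simp add: linear_solution_def)
  show ?thesis
    unfolding linear_solution_def
  proof (intro conjI allI)
    show "periodic_2pi (\<lambda>t. z t - y t)" "periodic_2pi (\<lambda>t. v t - u t)"
      using assms by (auto simp: linear_solution_def periodic_2pi_def)
    show "((\<lambda>t. z t - y t) has_vector_derivative N *v (z t - y t) + (v t - u t) + (f t - g t)) (at t)" for t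
      using has_vector_derivative_diff[OF z[of t] y[of t]] by (simp add: matrix_vector_mult_diff_distrib algebra_simps)
    show "((\<lambda>t. v t - u t) has_vector_derivative - (z t - y t)) (at t)" for t
      using assms has_vector_derivative_diff[of v "- z t" "at t" u "- y t"] by (simp add: linear_solution_def)
    show "no_critical_harmonic (\<lambda>t. z t - y t)"
      using assms by (intro no_critical_harmonic_diff vector_derivative_continuous_on[OF z] vector_derivative_continuous_on[OF y])
        (auto simp: linear_solution_def)
  qed
qed

lemma linear_solution_transform:
  assumes s: "linear_solution f z v" and R: "linear R" "\<And>x. R (N *v x) = N *v R x"
  shows "linear_solution (\<lambda>t. R (f (t - c))) (\<lambda>t. R (z (t - c))) (\<lambda>t. R (v (t - c)))"
proof -
  have bR: "bounded_linear R" using R(1) by (simp add: linear_conv_bounded_linear)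
  have z: "(z has_vector_derivative N *v z t + v t + f t) (at t)" for t using s by (simp add: linear_solution_def)
  have v: "(v has_vector_derivative - z t) (at t)" for t using s by (simp add: linear_solution_def)
  have zp: "z (t + 2 * pi) = z t" for t using s by (simp add: linear_solution_def periodic_2pi_def)
  have vp: "v (t + 2 * pi) = v t" for t using s by (simp add: linear_solution_def periodic_2pi_def)
  have z': "((\<lambda>t. z (t - c)) has_vector_derivative N *v z (t - c) + v (t - c) + f (t - c)) (at t)" for t
    using has_vector_derivative_shift[of z _ t "- c"] z by simp
  have v': "((\<lambda>t. v (t - c)) has_vector_derivative - z (t - c)) (at t)" for t
    using has_vector_derivative_shift[of v _ t "- c"] v by simp
  show ?thesis
    unfolding linear_solution_def
  proof (intro conjI allI)
    show "periodic_2pi (\<lambda>t. R (z (t - c)))" "periodic_2pi (\<lambda>t. R (v (t - c)))"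
      using zp[of "_ - c"] vp[of "_ - c"] by (simp_all add: periodic_2pi_def diff_add_eq)
    show "((\<lambda>t. R (z (t - c))) has_vector_derivative N *v R (z (t - c)) + R (v (t - c)) + R (f (t - c))) (at t)" for t
      using bounded_linear.has_vector_derivative[OF bR z'] by (simp add: linear_add[OF R(1)] R(2))
    show "((\<lambda>t. R (v (t - c))) has_vector_derivative - R (z (t - c))) (at t)" for t
      using bounded_linear.has_vector_derivative[OF bR v'] by (simp add: linear_neg[OF R(1)])
    show "no_critical_harmonic (\<lambda>t. R (z (t - c)))"
      using s critical_harmonic_transform[OF vector_derivative_continuous_on[OF z] _ R]
      by (simp add: no_critical_harmonic_iff_0 linear_solution_def linear_0[OF R(1)])
  qed
qed

lemma no_critical_harmonic_inner_wave:
  assumes "no_critical_harmonic f" "continuous_on UNIV f" "N *v p = 0" "N *v q = 0"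
  shows "cycle_integral (\<lambda>t. f t \<bullet> wave p q t) = 0"
  using assms by (simp add: inner_wave no_critical_harmonic_def)

end

section \<open>Uniformly bounded Lipschitz families\<close>

text \<open>The nonlinear terms below depend on a point \<open>x\<close> of a metric space and, in addition, on the time
  \<open>i\<close>. Bounds and Lipschitz constants that are uniform in \<open>i\<close> pass through sums, products and
  integrals over \<open>i\<close>, which gives the contraction estimate without any computation.\<close>

definition uniformly_BL :: "'p::metric_space set \<Rightarrow> ('i \<Rightarrow> 'p \<Rightarrow> 'b::real_normed_vector) \<Rightarrow> bool" where
  "uniformly_BL D \<Phi> \<longleftrightarrow> (\<exists>B\<ge>0. \<forall>i. \<forall>x\<in>D. norm (\<Phi> i x) \<le> B \<and>
     (\<forall>y\<in>D. norm (\<Phi> i x - \<Phi> i y) \<le> B * dist x y))"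

lemma uniformly_BLI:
  assumes "B \<ge> 0" "L \<ge> 0" "\<And>i x. x \<in> D \<Longrightarrow> norm (\<Phi> i x) \<le> B"
    "\<And>i x y. x \<in> D \<Longrightarrow> y \<in> D \<Longrightarrow> norm (\<Phi> i x - \<Phi> i y) \<le> L * dist x y"
  shows "uniformly_BL D \<Phi>"
  unfolding uniformly_BL_def
proof (intro exI[of _ "B + L"] conjI allI ballI)
  show "norm (\<Phi> i x) \<le> B + L" if "x \<in> D" for i x using assms(2) assms(3)[OF that, of i] by simp
  show "norm (\<Phi> i x - \<Phi> i y) \<le> (B + L) * dist x y" if "x \<in> D" "y \<in> D" for i x y
    using assms(4)[OF that, of i] mult_nonneg_nonneg[OF assms(1) zero_le_dist[of x y]]
    by (simp add: distrib_right)
qed (use assms in simp)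

lemma uniformly_BLE:
  assumes "uniformly_BL D \<Phi>"
  obtains B where "B \<ge> 0" "\<And>i x. x \<in> D \<Longrightarrow> norm (\<Phi> i x) \<le> B"
    "\<And>i x y. x \<in> D \<Longrightarrow> y \<in> D \<Longrightarrow> norm (\<Phi> i x - \<Phi> i y) \<le> B * dist x y"
  using assms unfolding uniformly_BL_def by blast

lemma uniformly_BL_const: "uniformly_BL D (\<lambda>i x. c)"
  by (rule uniformly_BLI[of "norm c" 0]) auto

lemma uniformly_BL_index:
  assumes "\<And>i. norm (c i) \<le> B"
  shows "uniformly_BL D (\<lambda>i x. c i)"
  by (rule uniformly_BLI[of "\<bar>B\<bar>" 0]) (use assms order_trans[OF assms abs_ge_self] in auto)

lemma uniformly_BL_add:
  assumes "uniformly_BL D \<Phi>" "uniformly_BL D \<Psi>"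
  shows "uniformly_BL D (\<lambda>i x. \<Phi> i x + \<Psi> i x)"
proof -
  from assms obtain B C where B: "B \<ge> 0" "\<And>i x. x \<in> D \<Longrightarrow> norm (\<Phi> i x) \<le> B"
      "\<And>i x y. x \<in> D \<Longrightarrow> y \<in> D \<Longrightarrow> norm (\<Phi> i x - \<Phi> i y) \<le> B * dist x y"
    and C: "C \<ge> 0" "\<And>i x. x \<in> D \<Longrightarrow> norm (\<Psi> i x) \<le> C"
      "\<And>i x y. x \<in> D \<Longrightarrow> y \<in> D \<Longrightarrow> norm (\<Psi> i x - \<Psi> i y) \<le> C * dist x y"
    by (metis uniformly_BLE)
  show ?thesis
  proof (rule uniformly_BLI[of "B + C" "B + C"])
    show "norm (\<Phi> i x + \<Psi> i x) \<le> B + C" if "x \<in> D" for i x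
      using B(2)[OF that, of i] C(2)[OF that, of i] norm_triangle_ineq[of "\<Phi> i x" "\<Psi> i x"] by linarith
    show "norm (\<Phi> i x + \<Psi> i x - (\<Phi> i y + \<Psi> i y)) \<le> (B + C) * dist x y" if "x \<in> D" "y \<in> D" for i x y
      using B(3)[OF that, of i] C(3)[OF that, of i] norm_triangle_ineq[of "\<Phi> i x - \<Phi> i y" "\<Psi> i x - \<Psi> i y"]
      by (simp add: add_diff_add distrib_right)
  qed (use B(1) C(1) in auto)
qed

lemma uniformly_BL_bilinear:
  assumes "bounded_bilinear prd" "uniformly_BL D \<Phi>" "uniformly_BL D \<Psi>"
  shows "uniformly_BL D (\<lambda>i x. prd (\<Phi> i x) (\<Psi> i x))"
proof -
  interpret bounded_bilinear prd by fact
  obtain K where K: "K > 0" "\<And>a b. norm (prd a b) \<le> norm a * norm b * K" using pos_bounded by blast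
  from assms obtain B C where B: "B \<ge> 0" "\<And>i x. x \<in> D \<Longrightarrow> norm (\<Phi> i x) \<le> B"
      "\<And>i x y. x \<in> D \<Longrightarrow> y \<in> D \<Longrightarrow> norm (\<Phi> i x - \<Phi> i y) \<le> B * dist x y"
    and C: "C \<ge> 0" "\<And>i x. x \<in> D \<Longrightarrow> norm (\<Psi> i x) \<le> C"
      "\<And>i x y. x \<in> D \<Longrightarrow> y \<in> D \<Longrightarrow> norm (\<Psi> i x - \<Psi> i y) \<le> C * dist x y"
    by (metis uniformly_BLE)
  show ?thesis
  proof (rule uniformly_BLI[of "B * C * K" "2 * (B * C * K)"])
    show "norm (prd (\<Phi> i x) (\<Psi> i x)) \<le> B * C * K" if "x \<in> D" for i x
      by (rule order_trans[OF K(2)]) (use B C K(1) that in \<open>auto intro!: mult_mono\<close>)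
    show "norm (prd (\<Phi> i x) (\<Psi> i x) - prd (\<Phi> i y) (\<Psi> i y)) \<le> 2 * (B * C * K) * dist x y"
      if "x \<in> D" "y \<in> D" for i x y
    proof -
      have "prd (\<Phi> i x) (\<Psi> i x) - prd (\<Phi> i y) (\<Psi> i y) =
          prd (\<Phi> i x) (\<Psi> i x - \<Psi> i y) + prd (\<Phi> i x - \<Phi> i y) (\<Psi> i y)"
        by (simp add: diff_left diff_right)
      moreover have "norm (prd (\<Phi> i x) (\<Psi> i x - \<Psi> i y)) \<le> B * (C * dist x y) * K"
        by (rule order_trans[OF K(2)], rule mult_right_mono, rule mult_mono[OF B(2)[OF that(1)] C(3)[OF that]])
           (use B C K(1) in auto)
      moreover have "norm (prd (\<Phi> i x - \<Phi> i y) (\<Psi> i y)) \<le> B * dist x y * C * K"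
        by (rule order_trans[OF K(2)], rule mult_right_mono, rule mult_mono[OF B(3)[OF that] C(2)[OF that(2)]])
           (use B C K(1) in auto)
      ultimately show ?thesis
        using norm_triangle_ineq[of "prd (\<Phi> i x) (\<Psi> i x - \<Psi> i y)" "prd (\<Phi> i x - \<Phi> i y) (\<Psi> i y)"]
        by (simp add: algebra_simps)
    qed
  qed (use B(1) C(1) K(1) in auto)
qed

lemma uniformly_BL_compose:
  assumes "\<And>a b. norm (f a - f b) \<le> L * norm (a - b)" "uniformly_BL D \<Phi>"
  shows "uniformly_BL D (\<lambda>i x. f (\<Phi> i x))"
proof -
  from assms obtain B where B: "B \<ge> 0" "\<And>i x. x \<in> D \<Longrightarrow> norm (\<Phi> i x) \<le> B"
      "\<And>i x y. x \<in> D \<Longrightarrow> y \<in> D \<Longrightarrow> norm (\<Phi> i x - \<Phi> i y) \<le> B * dist x y"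
    by (metis uniformly_BLE)
  have L: "norm (f a - f b) \<le> \<bar>L\<bar> * norm (a - b)" for a b
    by (rule order_trans[OF assms(1)]) (auto intro: mult_right_mono)
  show ?thesis
  proof (rule uniformly_BLI[of "norm (f 0) + \<bar>L\<bar> * B" "\<bar>L\<bar> * B"])
    show "norm (f (\<Phi> i x)) \<le> norm (f 0) + \<bar>L\<bar> * B" if "x \<in> D" for i x
      using L[of "\<Phi> i x" 0] mult_left_mono[OF B(2)[OF that, of i], of "\<bar>L\<bar>"] norm_triangle_sub[of "f (\<Phi> i x)" "f 0"]
      by simp
    show "norm (f (\<Phi> i x) - f (\<Phi> i y)) \<le> \<bar>L\<bar> * B * dist x y" if "x \<in> D" "y \<in> D" for i x y
      using L[of "\<Phi> i x" "\<Phi> i y"] mult_left_mono[OF B(3)[OF that, of i], of "\<bar>L\<bar>"] by simp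
  qed (use B(1) in auto)
qed

lemma uniformly_BL_linear:
  assumes "bounded_linear f" "uniformly_BL D \<Phi>"
  shows "uniformly_BL D (\<lambda>i x. f (\<Phi> i x))"
proof -
  obtain K where "\<And>x. norm (f x) \<le> norm x * K" using bounded_linear.bounded[OF assms(1)] by blast
  then show ?thesis
    by (intro uniformly_BL_compose[OF _ assms(2), of f K])
       (metis bounded_linear.axioms(1) assms(1) linear_diff mult.commute)
qed

lemma uniformly_BL_integral:
  fixes \<Phi> :: "real \<Rightarrow> 'p::metric_space \<Rightarrow> 'b::euclidean_space"
  assumes "uniformly_BL D \<Phi>" and cont: "\<And>x. x \<in> D \<Longrightarrow> continuous_on UNIV (\<lambda>t. \<Phi> t x)"
  shows "uniformly_BL D (\<lambda>i x. cycle_integral (\<lambda>t. \<Phi> t x))"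
proof -
  from assms obtain B where B: "B \<ge> 0" "\<And>i x. x \<in> D \<Longrightarrow> norm (\<Phi> i x) \<le> B"
      "\<And>i x y. x \<in> D \<Longrightarrow> y \<in> D \<Longrightarrow> norm (\<Phi> i x - \<Phi> i y) \<le> B * dist x y"
    by (metis uniformly_BLE)
  have cont': "continuous_on {0..2 * pi} (\<lambda>t. \<Phi> t x)" if "x \<in> D" for x
    by (rule continuous_on_subset[OF cont[OF that]]) simp
  show ?thesis
  proof (rule uniformly_BLI[of "B * (2 * pi)" "B * (2 * pi)"])
    show "norm (cycle_integral (\<lambda>t. \<Phi> t x)) \<le> B * (2 * pi)" if "x \<in> D" for x
      using integral_bound[OF _ cont'[OF that], of B] B(2)[OF that] by simp
    show "norm (cycle_integral (\<lambda>t. \<Phi> t x) - cycle_integral (\<lambda>t. \<Phi> t y)) \<le> B * (2 * pi) * dist x y"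
      if "x \<in> D" "y \<in> D" for x y
    proof -
      have "cycle_integral (\<lambda>t. \<Phi> t x) - cycle_integral (\<lambda>t. \<Phi> t y) = cycle_integral (\<lambda>t. \<Phi> t x - \<Phi> t y)"
        by (rule integral_diff[symmetric]; rule integrable_continuous_interval; rule cont'; rule that)
      also have "norm \<dots> \<le> (B * dist x y) * (2 * pi - 0)"
        by (rule integral_bound) (use B(3)[OF that] in \<open>auto intro!: continuous_on_diff cont' that\<close>)
      finally show ?thesis by (simp add: algebra_simps)
    qed
  qed (use B(1) in auto)
qed

lemma uniformly_BL_continuous:
  assumes "uniformly_BL D \<Phi>"
  shows "continuous_on D (\<Phi> i)"
proof -
  from assms obtain B where B: "B \<ge> 0" "\<And>i x y. x \<in> D \<Longrightarrow> y \<in> D \<Longrightarrow> norm (\<Phi> i x - \<Phi> i y) \<le> B * dist x y"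
    by (metis uniformly_BLE)
  show ?thesis
    by (rule lipschitz_on_continuous_on[of B]) (use B in \<open>auto simp: lipschitz_on_def dist_norm\<close>)
qed

lemma bounded_bilinear_vec_mult: "bounded_bilinear (\<lambda>x y :: real ^ 'n. x * y)"
proof
  show "\<exists>K. \<forall>a b :: real ^ 'n. norm (a * b) \<le> norm a * norm b * K"
  proof (intro exI[of _ 1] allI)
    fix a b :: "real ^ 'n"
    have "norm (a * b) \<le> norm (norm b *\<^sub>R a)"
      by (rule norm_le_componentwise_cart)
         (auto simp: abs_mult mult.commute[of "norm b"] intro!: mult_left_mono component_le_norm_cart)
    then show "norm (a * b) \<le> norm a * norm b * 1" by (simp add: mult.commute)
  qed
qed (auto simp: vec_eq_iff algebra_simps)

lemma sqrt_Lipschitz: "norm (sqrt (1 + a\<^sup>2) - sqrt (1 + b\<^sup>2)) \<le> 1 * norm (a - b)" for a b :: real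
proof -
  have "\<bar>norm (1::real, a) - norm (1::real, b)\<bar> \<le> norm ((1::real, a) - (1, b))"
    by (rule norm_triangle_ineq3)
  then show ?thesis by (simp add: norm_Pair)
qed

lemma inverse_Lipschitz: "norm (1 / (1 + \<bar>a\<bar>) - 1 / (1 + \<bar>b\<bar>)) \<le> 1 * norm (a - b)" for a b :: real
proof -
  have "1 / (1 + \<bar>a\<bar>) - 1 / (1 + \<bar>b\<bar>) = (\<bar>b\<bar> - \<bar>a\<bar>) / ((1 + \<bar>a\<bar>) * (1 + \<bar>b\<bar>))"
    by (simp add: field_simps)
  also have "\<bar>\<dots>\<bar> \<le> \<bar>\<bar>b\<bar> - \<bar>a\<bar>\<bar> / 1"
    unfolding abs_divide
    by (rule divide_left_mono) (auto simp: abs_mult intro: mult_ge1_I)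
  finally show ?thesis by (simp add: abs_minus_commute) linarith
qed

section \<open>Reduction to a contraction\<close>

abbreviation cube :: "real ^ 'n \<Rightarrow> real ^ 'n" where
  "cube x \<equiv> x * x * x"

text \<open>A state consists of the position and the momentum as bounded continuous functions of time. The
  metric of this complete space is the one in which the iteration below contracts.\<close>

type_synonym 'm state = "(real, (real ^ 'm) \<times> (real ^ 'm)) bcontfun"

text \<open>An element \<open>(R, \<theta>)\<close> of \<open>\<Gamma>\<close> acts on functions of period \<open>2 pi\<close> by \<open>R\<close> and a shift of time by the
  fraction \<open>\<theta>\<close> of the period. The assumption \<open>span\<close> says that the waves in the kernel of \<open>N\<close> with the
  symmetry \<open>\<Gamma>\<close> form only the plane spanned by one wave and its derivative, so that on symmetric
  functions the bifurcation has a simple pair of critical eigenvalues. By \<open>half_period\<close>, symmetric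
  functions change sign after half a period.\<close>

locale hopf = eigenbasis N b \<nu> for N :: "real ^ 'n ^ 'n" and b \<nu> +
  fixes \<Gamma> :: "((real ^ 'n \<Rightarrow> real ^ 'n) \<times> real) set" and p0 q0 :: "real ^ 'n"
  assumes linear_action: "(R, \<theta>) \<in> \<Gamma> \<Longrightarrow> linear R"
    and action_commute: "(R, \<theta>) \<in> \<Gamma> \<Longrightarrow> R (N *v x) = N *v R x"
    and action_cube: "(R, \<theta>) \<in> \<Gamma> \<Longrightarrow> R (cube x) = cube (R x)"
    and half_period: "(uminus, 1 / 2) \<in> \<Gamma>"
    and critical: "N *v p0 = 0" "N *v q0 = 0"
    and nonzero: "p0 \<noteq> 0 \<or> q0 \<noteq> 0"
    and wave_action: "(R, \<theta>) \<in> \<Gamma> \<Longrightarrow> R (wave p0 q0 (t - 2 * pi * \<theta>)) = wave p0 q0 t"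
    and span: "N *v p = 0 \<Longrightarrow> N *v q = 0 \<Longrightarrow>
      (\<And>R \<theta> t. (R, \<theta>) \<in> \<Gamma> \<Longrightarrow> R (wave p q (t - 2 * pi * \<theta>)) = wave p q t) \<Longrightarrow>
      \<exists>c d. p = c *\<^sub>R p0 + d *\<^sub>R q0 \<and> q = c *\<^sub>R q0 - d *\<^sub>R p0"
begin

definition symmetric :: "(real \<Rightarrow> real ^ 'n) \<Rightarrow> bool" where
  "symmetric f \<longleftrightarrow> (\<forall>R \<theta> t. (R, \<theta>) \<in> \<Gamma> \<longrightarrow> R (f (t - 2 * pi * \<theta>)) = f t)"

abbreviation z0 :: "real \<Rightarrow> real ^ 'n" where "z0 \<equiv> wave p0 q0"
abbreviation z1 :: "real \<Rightarrow> real ^ 'n" where "z1 \<equiv> wave q0 (- p0)"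

definition nsq :: real where "nsq = pi * (p0 \<bullet> p0 + q0 \<bullet> q0)"

lemma nsq_pos: "nsq > 0"
  using nonzero by (auto simp: nsq_def add_pos_nonneg add_nonneg_pos)

lemma critical': "N *v (- p0) = 0" "N *v (- q0) = 0"
  using critical matrix_vector_mult_scaleR[of N "- 1"] by auto

lemma wave_derivatives:
  "(z0 has_vector_derivative z1 t) (at t)" "(z1 has_vector_derivative - z0 t) (at t)"
  using has_vector_derivative_wave[of p0 q0 t] has_vector_derivative_wave[of q0 "- p0" t]
  by (simp_all add: wave_def)

lemma wave_inner:
  "cycle_integral (\<lambda>t. z0 t \<bullet> z0 t) = nsq" "cycle_integral (\<lambda>t. z1 t \<bullet> z1 t) = nsq"
  "cycle_integral (\<lambda>t. z0 t \<bullet> z1 t) = 0" "cycle_integral (\<lambda>t. z1 t \<bullet> z0 t) = 0"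
  using critical critical' by (simp_all add: inner_wave_wave nsq_def inner_commute[of q0 p0])

lemma symmetricI:
  "(\<And>R \<theta> t. (R, \<theta>) \<in> \<Gamma> \<Longrightarrow> R (f (t - 2 * pi * \<theta>)) = f t) \<Longrightarrow> symmetric f"
  unfolding symmetric_def by blast

lemma symmetricD: "symmetric f \<Longrightarrow> (R, \<theta>) \<in> \<Gamma> \<Longrightarrow> R (f (t - 2 * pi * \<theta>)) = f t"
  unfolding symmetric_def by blast

lemma symmetric_z0: "symmetric z0"
  by (rule symmetricI) (rule wave_action)

lemma symmetric_derivative:
  assumes sym: "symmetric f" and f: "\<And>t. (f has_vector_derivative f' t) (at t)"
  shows "symmetric f'"
proof (rule symmetricI)
  fix R \<theta> t assume R: "(R, \<theta>) \<in> \<Gamma>"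
  have bR: "bounded_linear R" using linear_action[OF R] by (simp add: linear_conv_bounded_linear)
  have "((\<lambda>t. f (t - 2 * pi * \<theta>)) has_vector_derivative f' (t - 2 * pi * \<theta>)) (at t)"
    using has_vector_derivative_shift[of f _ t "- (2 * pi * \<theta>)"] f by simp
  from bounded_linear.has_vector_derivative[OF bR this]
  have "(f has_vector_derivative R (f' (t - 2 * pi * \<theta>))) (at t)"
    unfolding symmetricD[OF sym R] .
  then show "R (f' (t - 2 * pi * \<theta>)) = f' t" using f vector_derivative_unique_at by blast
qed

lemma symmetric_z1: "symmetric z1"
  by (rule symmetric_derivative[OF symmetric_z0 wave_derivatives(1)])

lemma symmetric_add: "symmetric f \<Longrightarrow> symmetric g \<Longrightarrow> symmetric (\<lambda>t. f t + g t)"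
  by (rule symmetricI) (simp only: linear_add[OF linear_action] symmetricD)

lemma symmetric_diff: "symmetric f \<Longrightarrow> symmetric g \<Longrightarrow> symmetric (\<lambda>t. f t - g t)"
  by (rule symmetricI) (simp only: linear_diff[OF linear_action] symmetricD)

lemma symmetric_scaleR: "symmetric f \<Longrightarrow> symmetric (\<lambda>t. c *\<^sub>R f t)"
  by (rule symmetricI) (simp only: linear_cmul[OF linear_action] symmetricD)

lemma symmetric_mult: "symmetric f \<Longrightarrow> symmetric (\<lambda>t. N *v f t)"
  by (rule symmetricI) (simp only: action_commute symmetricD)

lemma symmetric_cube: "symmetric f \<Longrightarrow> symmetric (\<lambda>t. cube (f t))"
  by (rule symmetricI) (simp only: action_cube symmetricD)

lemma symmetric_shift:
  assumes "symmetric f"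
  shows "symmetric (\<lambda>t. f (t + c))"
proof (rule symmetricI)
  fix R \<theta> t assume R: "(R, \<theta>) \<in> \<Gamma>"
  show "R (f (t - 2 * pi * \<theta> + c)) = f (t + c)"
    using symmetricD[OF assms R, of "t + c"] by (simp only: diff_add_eq)
qed

text \<open>Symmetry forces the critical first harmonic into the plane spanned by \<open>z0\<close> and \<open>z1\<close>.\<close>

lemma no_critical_harmonicI:
  assumes f: "continuous_on UNIV f" "periodic_2pi f" "symmetric f"
    and orth: "cycle_integral (\<lambda>t. f t \<bullet> z0 t) = 0" "cycle_integral (\<lambda>t. f t \<bullet> z1 t) = 0"
  shows "no_critical_harmonic f"
proof -
  define p where "p = kernel_proj (cycle_integral (\<lambda>t. cos t *\<^sub>R f t))"
  define q where "q = kernel_proj (cycle_integral (\<lambda>t. sin t *\<^sub>R f t))"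
  have pq: "critical_harmonic f = wave p q" by (simp add: critical_harmonic_def p_def q_def)
  have inv: "R (wave p q (t - 2 * pi * \<theta>)) = wave p q t" if R: "(R, \<theta>) \<in> \<Gamma>" for R \<theta> t
  proof -
    have "(\<lambda>t. R (f (t - 2 * pi * \<theta>))) = f" by (rule ext) (rule symmetricD[OF f(3) R])
    then show ?thesis
      using critical_harmonic_transform[OF f(1,2) linear_action[OF R] action_commute[OF R], of "2 * pi * \<theta>" t]
      by (simp add: pq)
  qed
  have "\<exists>c d. p = c *\<^sub>R p0 + d *\<^sub>R q0 \<and> q = c *\<^sub>R q0 - d *\<^sub>R p0"
  proof (rule span)
    show "N *v p = 0" "N *v q = 0" by (simp_all add: p_def q_def mult_kernel_proj)
  qed (rule inv)
  then obtain c d where cd: "p = c *\<^sub>R p0 + d *\<^sub>R q0" "q = c *\<^sub>R q0 - d *\<^sub>R p0" by blast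
  have "p \<bullet> p0 + q \<bullet> q0 = 0" "p \<bullet> q0 - q \<bullet> p0 = 0"
    using orth inner_wave[OF critical f(1)] inner_wave[OF critical(2) critical'(1) f(1)]
    by (simp_all add: p_def q_def)
  then have "c * (p0 \<bullet> p0 + q0 \<bullet> q0) = 0" "d * (p0 \<bullet> p0 + q0 \<bullet> q0) = 0"
    by (simp_all add: cd algebra_simps inner_commute)
  then have "c = 0" "d = 0" using nsq_pos by (auto simp: nsq_def)
  then show ?thesis using cd by (simp add: no_critical_harmonic_def p_def q_def)
qed

subsection \<open>The nonlinear terms\<close>

text \<open>A solution of amplitude \<open>c\<close> is written as \<open>c\<close> times the first component of \<open>w\<close>. Projecting
  the equation to \<open>z0\<close> and \<open>z1\<close> expresses the parameter and the period through \<open>w\<close> and \<open>s = c\<^sup>2\<close>: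
  the parameter exceeds its critical value by \<open>s\<close> times \<open>excess w\<close>, and the period is \<open>2 pi\<close> times
  the positive root of \<open>p\<^sup>2 - 1 = 2 p s (detuning w)\<close>.\<close>

definition pos :: "'n state \<Rightarrow> real \<Rightarrow> real ^ 'n" where "pos w t = fst (apply_bcontfun w t)"
definition mom :: "'n state \<Rightarrow> real \<Rightarrow> real ^ 'n" where "mom w t = snd (apply_bcontfun w t)"

definition excess :: "'n state \<Rightarrow> real" where
  "excess w = 1 / (3 * nsq) * cycle_integral (\<lambda>t. cube (pos w t) \<bullet> z0 t)"

definition detuning :: "'n state \<Rightarrow> real" where
  "detuning w = 1 / (6 * nsq) * cycle_integral (\<lambda>t. cube (pos w t) \<bullet> z1 t)"

definition period_ratio :: "real \<times> 'n state \<Rightarrow> real" where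
  "period_ratio x = fst x * detuning (snd x) + sqrt (1 + (fst x * detuning (snd x))\<^sup>2)"

text \<open>The perturbation, divided by \<open>s\<close>, of the linear equation \<open>z' = N z + v\<close>: the coefficients
  \<open>p\<^sup>2 - 1\<close> of \<open>v\<close> and \<open>p - 1\<close> of \<open>N z\<close> are multiples of \<open>s\<close> by the equation for the period \<open>p\<close>.\<close>

definition force :: "real \<Rightarrow> real \<times> 'n state \<Rightarrow> real ^ 'n" where
  "force t x = period_ratio x *\<^sub>R
     ((2 * detuning (snd x)) *\<^sub>R mom (snd x) t
      + (2 * detuning (snd x) * (1 / (1 + period_ratio x))) *\<^sub>R (N *v pos (snd x) t)
      + excess (snd x) *\<^sub>R pos (snd x) t + (- 1 / 3) *\<^sub>R cube (pos (snd x) t))"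

definition w0 :: "'n state" where "w0 = Bcontfun (\<lambda>t. (z0 t, z1 t))"

lemma apply_w0: "apply_bcontfun w0 t = (z0 t, z1 t)"
proof -
  have "norm (z0 t, z1 t) \<le> 2 * (norm p0 + norm q0)" for t
    using norm_wave_le[of p0 q0 t] norm_wave_le[of q0 "- p0" t] norm_Pair_le[of "z0 t" "z1 t"] by simp
  then have "(\<lambda>t. (z0 t, z1 t)) \<in> bcontfun"
    by (intro bcontfun_normI) (auto intro!: continuous_intros continuous_wave)
  then show ?thesis by (simp add: w0_def Bcontfun_inverse)
qed

lemma pos_w0: "pos w0 = z0" and mom_w0: "mom w0 = z1"
  by (auto simp: pos_def mom_def apply_w0)

lemma continuous_pos: "continuous_on A (pos w)" and continuous_mom: "continuous_on A (mom w)"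
  unfolding pos_def[abs_def] mom_def[abs_def] by (intro continuous_intros; simp)+

lemma pos_diff_le: "norm (pos w t - pos w' t) \<le> dist w w'"
  and mom_diff_le: "norm (mom w t - mom w' t) \<le> dist w w'"
  using dist_bounded[of w t w'] dist_fst_le[of "apply_bcontfun w t" "apply_bcontfun w' t"]
    dist_snd_le[of "apply_bcontfun w t" "apply_bcontfun w' t"]
  by (auto simp: pos_def mom_def dist_norm)

lemma dist_state_le:
  assumes "\<And>t. norm (pos w t - pos w' t) \<le> B" "\<And>t. norm (mom w t - mom w' t) \<le> B"
  shows "dist w w' \<le> 2 * B"
proof (rule dist_bound)
  fix t
  have "norm (apply_bcontfun w t - apply_bcontfun w' t) \<le> norm (pos w t - pos w' t) + norm (mom w t - mom w' t)"
    using norm_Pair_le[of "pos w t - pos w' t" "mom w t - mom w' t"]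
    by (simp add: pos_def mom_def flip: fst_diff snd_diff)
  then show "dist (apply_bcontfun w t) (apply_bcontfun w' t) \<le> 2 * B"
    using assms[of t] by (simp add: dist_norm)
qed

definition region :: "(real \<times> 'n state) set" where "region = {0..1} \<times> cball w0 1"

lemma region_BL_fst: "uniformly_BL region (\<lambda>i. fst)"
proof (rule uniformly_BLI[of 1 1])
  show "norm (fst x - fst y) \<le> 1 * dist x y" for x y :: "real \<times> 'n state"
    using dist_fst_le[of x y] by (simp add: dist_norm)
qed (auto simp: region_def)

lemma region_BL_pos: "uniformly_BL region (\<lambda>t x. pos (snd x) t)"
  and region_BL_mom: "uniformly_BL region (\<lambda>t x. mom (snd x) t)"
proof -
  have *: "dist (snd x) 0 \<le> norm w0 + 1" if "x \<in> region" for x :: "real \<times> 'n state"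
    using that dist_triangle[of "snd x" 0 w0] by (auto simp: region_def dist_commute mem_Times_iff)
  have 0: "pos 0 t = 0" "mom 0 t = 0" for t by (auto simp: pos_def mom_def zero_bcontfun.rep_eq)
  show "uniformly_BL region (\<lambda>t x. pos (snd x) t)"
  proof (rule uniformly_BLI[of "norm w0 + 1" 1])
    show "norm (pos (snd x) t) \<le> norm w0 + 1" if "x \<in> region" for t and x :: "real \<times> 'n state"
      using pos_diff_le[of "snd x" t 0] *[OF that] by (simp add: 0)
    show "norm (pos (snd x) t - pos (snd y) t) \<le> 1 * dist x y" for t and x y :: "real \<times> 'n state"
      using pos_diff_le[of "snd x" t "snd y"] dist_snd_le[of x y] by simp
  qed auto
  show "uniformly_BL region (\<lambda>t x. mom (snd x) t)"
  proof (rule uniformly_BLI[of "norm w0 + 1" 1])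
    show "norm (mom (snd x) t) \<le> norm w0 + 1" if "x \<in> region" for t and x :: "real \<times> 'n state"
      using mom_diff_le[of "snd x" t 0] *[OF that] by (simp add: 0)
    show "norm (mom (snd x) t - mom (snd y) t) \<le> 1 * dist x y" for t and x y :: "real \<times> 'n state"
      using mom_diff_le[of "snd x" t "snd y"] dist_snd_le[of x y] by simp
  qed auto
qed

lemmas BL_mult = uniformly_BL_bilinear[OF bounded_bilinear_mult]
lemmas BL_scaleR = uniformly_BL_bilinear[OF bounded_bilinear_scaleR]
lemmas BL_inner = uniformly_BL_bilinear[OF bounded_bilinear_inner]
lemmas BL_vec_mult = uniformly_BL_bilinear[OF bounded_bilinear_vec_mult]

lemma continuous_cube: "continuous_on A f \<Longrightarrow> continuous_on A (\<lambda>t. cube (f t :: real ^ 'n))"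
  by (intro bounded_bilinear.continuous_on[OF bounded_bilinear_vec_mult])

lemma region_BL_cube: "uniformly_BL region (\<lambda>t x. cube (pos (snd x) t))"
  by (intro BL_vec_mult region_BL_pos)

lemma region_BL_wave: "uniformly_BL region (\<lambda>t x. wave p q t)"
  by (rule uniformly_BL_index[OF norm_wave_le])

lemma region_BL_excess: "uniformly_BL region (\<lambda>i::real. \<lambda>x. excess (snd x))"
  and region_BL_detuning: "uniformly_BL region (\<lambda>i::real. \<lambda>x. detuning (snd x))"
  unfolding excess_def detuning_def
  by (intro BL_mult uniformly_BL_const uniformly_BL_integral BL_inner region_BL_cube region_BL_wave
      continuous_on_inner continuous_cube continuous_pos continuous_wave)+

lemma region_BL_period_ratio: "uniformly_BL region (\<lambda>i::real. period_ratio)"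
  unfolding period_ratio_def[abs_def]
  by (intro uniformly_BL_add uniformly_BL_compose[OF sqrt_Lipschitz] BL_mult region_BL_fst region_BL_detuning)

lemma period_ratio_pos: "period_ratio x > 0"
proof -
  have "\<bar>fst x * detuning (snd x)\<bar> < sqrt (1 + (fst x * detuning (snd x))\<^sup>2)"
    by (rule real_less_rsqrt) simp
  then show ?thesis unfolding period_ratio_def by linarith
qed

lemma period_ratio_eq: "(period_ratio x)\<^sup>2 - 1 = 2 * period_ratio x * (fst x * detuning (snd x))"
proof -
  define u where "u = fst x * detuning (snd x)"
  have "(u + sqrt (1 + u\<^sup>2))\<^sup>2 = u\<^sup>2 + 2 * u * sqrt (1 + u\<^sup>2) + (1 + u\<^sup>2)"
    by (simp add: power2_sum)
  then show ?thesis by (simp add: period_ratio_def u_def[symmetric] power2_eq_square algebra_simps)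
qed

lemma region_BL_force: "uniformly_BL region force"
proof -
  have "uniformly_BL region (\<lambda>i::real. \<lambda>x. 1 / (1 + \<bar>period_ratio x\<bar>))"
    by (rule uniformly_BL_compose[OF inverse_Lipschitz region_BL_period_ratio])
  then have "uniformly_BL region (\<lambda>i::real. \<lambda>x. 1 / (1 + period_ratio x))"
    using period_ratio_pos by (simp add: abs_of_pos)
  then show ?thesis
    unfolding force_def[abs_def]
    by (intro BL_scaleR uniformly_BL_add BL_mult uniformly_BL_const region_BL_period_ratio region_BL_detuning
      region_BL_excess region_BL_pos region_BL_mom region_BL_cube
      uniformly_BL_linear[OF matrix_vector_mul_bounded_linear])
qed

subsection \<open>The contraction\<close>

text \<open>The integrals normalise amplitude and phase: position and momentum have the same critical harmonic
  as \<open>z0\<close> and \<open>z1\<close>.\<close>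

definition admissible :: "'n state set" where
  "admissible = {w. (\<forall>t. apply_bcontfun w (t + 2 * pi) = apply_bcontfun w t) \<and>
     symmetric (pos w) \<and> symmetric (mom w) \<and>
     cycle_integral (\<lambda>t. pos w t \<bullet> z0 t) = nsq \<and> cycle_integral (\<lambda>t. pos w t \<bullet> z1 t) = 0 \<and>
     cycle_integral (\<lambda>t. mom w t \<bullet> z0 t) = 0 \<and> cycle_integral (\<lambda>t. mom w t \<bullet> z1 t) = nsq}"

text \<open>The nonlinear terms are evaluated at the old state \<open>w\<close>, and the linear equation is solved for \<open>w'\<close>.\<close>

definition step :: "real \<Rightarrow> 'n state \<Rightarrow> 'n state \<Rightarrow> bool" where
  "step s w w' \<longleftrightarrow> linear_solution (\<lambda>t. s *\<^sub>R force t (s, w)) (\<lambda>t. pos w' t - z0 t) (\<lambda>t. mom w' t - z1 t)"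

lemma admissibleD:
  assumes "w \<in> admissible"
  shows "periodic_2pi (pos w)" "periodic_2pi (mom w)" "symmetric (pos w)" "symmetric (mom w)"
    "cycle_integral (\<lambda>t. pos w t \<bullet> z0 t) = nsq" "cycle_integral (\<lambda>t. pos w t \<bullet> z1 t) = 0"
    "cycle_integral (\<lambda>t. mom w t \<bullet> z0 t) = 0" "cycle_integral (\<lambda>t. mom w t \<bullet> z1 t) = nsq"
  using assms by (auto simp: admissible_def periodic_2pi_def pos_def mom_def)

lemma admissibleI:
  assumes "periodic_2pi (pos w)" "periodic_2pi (mom w)" "symmetric (pos w)" "symmetric (mom w)"
    "cycle_integral (\<lambda>t. pos w t \<bullet> z0 t) = nsq" "cycle_integral (\<lambda>t. pos w t \<bullet> z1 t) = 0"
    "cycle_integral (\<lambda>t. mom w t \<bullet> z0 t) = 0" "cycle_integral (\<lambda>t. mom w t \<bullet> z1 t) = nsq"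
  shows "w \<in> admissible"
  using assms by (auto simp: admissible_def periodic_2pi_def pos_def mom_def prod_eq_iff)

lemma w0_admissible: "w0 \<in> admissible"
  by (rule admissibleI)
     (simp_all add: pos_w0 mom_w0 periodic_wave symmetric_z0 symmetric_z1 wave_inner)

lemma continuous_state_pos: "continuous_on A (\<lambda>w. pos w t)"
  and continuous_state_mom: "continuous_on A (\<lambda>w. mom w t)"
  by (rule lipschitz_on_continuous_on[of 1];
      use pos_diff_le mom_diff_le in \<open>auto simp: lipschitz_on_def dist_norm\<close>)+

lemma continuous_state_integral:
  "continuous_on A (\<lambda>w. cycle_integral (\<lambda>t. pos w t \<bullet> wave p q t))"
  "continuous_on A (\<lambda>w. cycle_integral (\<lambda>t. mom w t \<bullet> wave p q t))"
proof -
  have *: "continuous_on A (\<lambda>w. cycle_integral (\<lambda>t. f w t \<bullet> wave p q t))"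
    if f: "\<And>w w' t. norm (f w t - f w' t) \<le> dist w w'" "\<And>w. continuous_on UNIV (f w)" for f :: "'n state \<Rightarrow> real \<Rightarrow> real ^ 'n"
  proof (rule lipschitz_on_continuous_on[of "(norm p + norm q) * (2 * pi)"], rule lipschitz_onI)
    fix w w' :: "'n state"
    have int: "(\<lambda>t. f w t \<bullet> wave p q t) integrable_on {0..2 * pi}" for w
      by (intro integrable_on_cycle continuous_intros f continuous_wave)
    have "cycle_integral (\<lambda>t. f w t \<bullet> wave p q t) - cycle_integral (\<lambda>t. f w' t \<bullet> wave p q t)
        = cycle_integral (\<lambda>t. (f w t - f w' t) \<bullet> wave p q t)"
      by (simp add: inner_diff_left integral_diff int)
    also have "norm \<dots> \<le> (dist w w' * (norm p + norm q)) * (2 * pi - 0)"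
    proof (rule integral_bound)
      show "continuous_on {0..2 * pi} (\<lambda>t. (f w t - f w' t) \<bullet> wave p q t)"
        by (intro continuous_intros continuous_on_subset[OF f(2)] continuous_wave) auto
      show "norm ((f w t - f w' t) \<bullet> wave p q t) \<le> dist w w' * (norm p + norm q)" for t
      proof -
        have "\<bar>(f w t - f w' t) \<bullet> wave p q t\<bar> \<le> norm (f w t - f w' t) * norm (wave p q t)"
          by (rule Cauchy_Schwarz_ineq2)
        also have "\<dots> \<le> dist w w' * (norm p + norm q)"
          by (rule mult_mono[OF f(1) norm_wave_le]) auto
        finally show ?thesis by simp
      qed
    qed simp
    finally show "dist (cycle_integral (\<lambda>t. f w t \<bullet> wave p q t)) (cycle_integral (\<lambda>t. f w' t \<bullet> wave p q t))
        \<le> (norm p + norm q) * (2 * pi) * dist w w'"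
      by (simp add: dist_norm algebra_simps)
  qed simp
  show "continuous_on A (\<lambda>w. cycle_integral (\<lambda>t. pos w t \<bullet> wave p q t))"
    by (rule *[OF pos_diff_le continuous_pos])
  show "continuous_on A (\<lambda>w. cycle_integral (\<lambda>t. mom w t \<bullet> wave p q t))"
    by (rule *[OF mom_diff_le continuous_mom])
qed

lemma closed_admissible: "closed admissible"
proof -
  have R: "bounded_linear R" if "(R, \<theta>) \<in> \<Gamma>" for R \<theta>
    using linear_action[OF that] by (simp add: linear_conv_bounded_linear)
  have sym: "closed {w. symmetric (f w)}" if "\<And>t. continuous_on UNIV (\<lambda>w. f w t)"
    for f :: "'n state \<Rightarrow> real \<Rightarrow> real ^ 'n"
  proof -
    have "{w. symmetric (f w)} = (\<Inter>x\<in>\<Gamma>. \<Inter>t. {w. fst x (f w (t - 2 * pi * snd x)) = f w t})"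
    proof (intro Set.set_eqI iffI)
      fix w assume "w \<in> {w. symmetric (f w)}"
      then have s: "symmetric (f w)" by simp
      show "w \<in> (\<Inter>x\<in>\<Gamma>. \<Inter>t. {w. fst x (f w (t - 2 * pi * snd x)) = f w t})"
      proof (intro INT_I CollectI)
        fix x t assume "x \<in> \<Gamma>"
        then show "fst x (f w (t - 2 * pi * snd x)) = f w t"
          by (intro symmetricD[OF s]) (simp only: prod.collapse)
      qed
    next
      fix w assume h: "w \<in> (\<Inter>x\<in>\<Gamma>. \<Inter>t. {w. fst x (f w (t - 2 * pi * snd x)) = f w t})"
      show "w \<in> {w. symmetric (f w)}"
      proof (intro CollectI symmetricI)
        fix R \<theta> t assume "(R, \<theta>) \<in> \<Gamma>"
        with h have "w \<in> {w. fst (R, \<theta>) (f w (t - 2 * pi * snd (R, \<theta>))) = f w t}" by blast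
        then show "R (f w (t - 2 * pi * \<theta>)) = f w t" by simp
      qed
    qed
    also have "closed \<dots>"
    proof (intro closed_INT ballI closed_Collect_eq)
      fix x t assume "x \<in> \<Gamma>"
      then show "continuous_on UNIV (\<lambda>w. fst x (f w (t - 2 * pi * snd x)))"
        by (intro bounded_linear.continuous_on[OF R[of "fst x" "snd x"] that]) simp
    qed (rule that)
    finally show ?thesis .
  qed
  have "admissible = (\<Inter>t. {w. pos w (t + 2 * pi) = pos w t}) \<inter> (\<Inter>t. {w. mom w (t + 2 * pi) = mom w t}) \<inter>
     {w. symmetric (pos w)} \<inter> {w. symmetric (mom w)} \<inter>
     {w. cycle_integral (\<lambda>t. pos w t \<bullet> z0 t) = nsq} \<inter> {w. cycle_integral (\<lambda>t. pos w t \<bullet> z1 t) = 0} \<inter>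
     {w. cycle_integral (\<lambda>t. mom w t \<bullet> z0 t) = 0} \<inter> {w. cycle_integral (\<lambda>t. mom w t \<bullet> z1 t) = nsq}"
    by (auto simp: admissible_def pos_def mom_def prod_eq_iff)
  then show ?thesis
    by (simp only:) (intro closed_Int closed_INT ballI closed_Collect_eq sym continuous_state_pos
        continuous_state_mom continuous_state_integral continuous_on_const)
qed

lemma continuous_force: "continuous_on A (\<lambda>t. force t x)"
  unfolding force_def
  by (intro continuous_intros continuous_pos continuous_mom continuous_cube
      bounded_linear.continuous_on[OF matrix_vector_mul_bounded_linear])

lemma periodic_force: "w \<in> admissible \<Longrightarrow> periodic_2pi (\<lambda>t. force t (s, w))"
  using admissibleD(1,2)[of w] by (simp add: force_def periodic_2pi_def)

lemma symmetric_force: "w \<in> admissible \<Longrightarrow> symmetric (\<lambda>t. force t (s, w))"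
  unfolding force_def snd_conv
  by (intro symmetric_add symmetric_scaleR symmetric_mult symmetric_cube admissibleD)

lemma force_inner_wave:
  assumes "N *v p = 0" "N *v q = 0"
  shows "cycle_integral (\<lambda>t. force t (s, w) \<bullet> wave p q t) = period_ratio (s, w) *
    (2 * detuning w * cycle_integral (\<lambda>t. mom w t \<bullet> wave p q t)
      + excess w * cycle_integral (\<lambda>t. pos w t \<bullet> wave p q t)
      - 1 / 3 * cycle_integral (\<lambda>t. cube (pos w t) \<bullet> wave p q t))"
proof -
  have int: "(\<lambda>t. mom w t \<bullet> wave p q t) integrable_on {0..2 * pi}"
    "(\<lambda>t. pos w t \<bullet> wave p q t) integrable_on {0..2 * pi}"
    "(\<lambda>t. cube (pos w t) \<bullet> wave p q t) integrable_on {0..2 * pi}"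
    by (intro integrable_on_cycle continuous_on_inner continuous_cube continuous_wave continuous_pos continuous_mom)+
  have N: "(N *v x) \<bullet> wave p q t = 0" for x t
    by (rule inner_mult_kernel) (simp add: wave_def assms matrix_vector_right_distrib matrix_vector_mult_scaleR)
  have "cycle_integral (\<lambda>t. force t (s, w) \<bullet> wave p q t) =
     cycle_integral (\<lambda>t. period_ratio (s, w) * (2 * detuning w * (mom w t \<bullet> wave p q t)
       + excess w * (pos w t \<bullet> wave p q t) - 1 / 3 * (cube (pos w t) \<bullet> wave p q t)))"
    unfolding force_def inner_scaleR_left inner_add_left N by simp
  also have "\<dots> = period_ratio (s, w) * cycle_integral (\<lambda>t. 2 * detuning w * (mom w t \<bullet> wave p q t)
       + excess w * (pos w t \<bullet> wave p q t) - 1 / 3 * (cube (pos w t) \<bullet> wave p q t))"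
    by (rule integral_mult_right)
  also have "cycle_integral (\<lambda>t. 2 * detuning w * (mom w t \<bullet> wave p q t)
       + excess w * (pos w t \<bullet> wave p q t) - 1 / 3 * (cube (pos w t) \<bullet> wave p q t)) =
     2 * detuning w * cycle_integral (\<lambda>t. mom w t \<bullet> wave p q t)
      + excess w * cycle_integral (\<lambda>t. pos w t \<bullet> wave p q t)
      - 1 / 3 * cycle_integral (\<lambda>t. cube (pos w t) \<bullet> wave p q t)"
  proof -
    have i: "(\<lambda>t. 2 * detuning w * (mom w t \<bullet> wave p q t)) integrable_on {0..2 * pi}"
      "(\<lambda>t. excess w * (pos w t \<bullet> wave p q t)) integrable_on {0..2 * pi}"
      "(\<lambda>t. 1 / 3 * (cube (pos w t) \<bullet> wave p q t)) integrable_on {0..2 * pi}"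
      by (intro integrable_on_mult_right int)+
    show ?thesis
      unfolding integral_diff[OF integrable_add[OF i(1,2)] i(3)] integral_add[OF i(1,2)] integral_mult_right ..
  qed
  finally show ?thesis .
qed

text \<open>The definitions of \<open>excess\<close> and \<open>detuning\<close> are exactly these two solvability conditions.\<close>

lemma no_critical_harmonic_force:
  assumes w: "w \<in> admissible"
  shows "no_critical_harmonic (\<lambda>t. s *\<^sub>R force t (s, w))"
proof (rule no_critical_harmonicI)
  show "continuous_on UNIV (\<lambda>t. s *\<^sub>R force t (s, w))" by (intro continuous_intros continuous_force)
  show "periodic_2pi (\<lambda>t. s *\<^sub>R force t (s, w))" using periodic_force[OF w] by (simp add: periodic_2pi_def)
  show "symmetric (\<lambda>t. s *\<^sub>R force t (s, w))" by (intro symmetric_scaleR symmetric_force w)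
  show "cycle_integral (\<lambda>t. (s *\<^sub>R force t (s, w)) \<bullet> z0 t) = 0"
    using nsq_pos by (simp add: force_inner_wave critical admissibleD[OF w] excess_def)
  show "cycle_integral (\<lambda>t. (s *\<^sub>R force t (s, w)) \<bullet> z1 t) = 0"
    using nsq_pos by (simp add: force_inner_wave critical critical' admissibleD[OF w] detuning_def)
qed

lemma state_of_pair:
  assumes "continuous_on UNIV z" "continuous_on UNIV v" "\<And>t. norm (z t) \<le> B" "\<And>t. norm (v t) \<le> B"
  obtains w :: "'n state" where "pos w = z" "mom w = v"
proof -
  have "(\<lambda>t. (z t, v t)) \<in> bcontfun"
  proof (rule bcontfun_normI)
    show "continuous_on UNIV (\<lambda>t. (z t, v t))" by (intro continuous_intros assms)
    show "norm (z t, v t) \<le> B + B" for t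
      using norm_Pair_le[of "z t" "v t"] assms(3,4)[of t] by linarith
  qed
  then have "pos (Bcontfun (\<lambda>t. (z t, v t))) = z" "mom (Bcontfun (\<lambda>t. (z t, v t))) = v"
    by (auto simp: pos_def mom_def Bcontfun_inverse)
  then show ?thesis using that by blast
qed

text \<open>A symmetry carries solutions for \<open>f\<close> to solutions for the transformed \<open>f\<close>, which is \<open>f\<close> itself;
  uniqueness does the rest.\<close>

lemma linear_solution_symmetric:
  assumes f: "continuous_on UNIV f" "periodic_2pi f" "symmetric f" and s: "linear_solution f z v"
  shows "symmetric z" "symmetric v"
proof -
  have "R (z (t - 2 * pi * \<theta>)) = z t \<and> R (v (t - 2 * pi * \<theta>)) = v t" if R: "(R, \<theta>) \<in> \<Gamma>" for R \<theta> t
  proof -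
    have "(\<lambda>t. R (f (t - 2 * pi * \<theta>))) = f" by (rule ext) (rule symmetricD[OF f(3) R])
    with linear_solution_transform[OF s linear_action[OF R] action_commute[OF R], of "2 * pi * \<theta>"]
    have "linear_solution f (\<lambda>t. R (z (t - 2 * pi * \<theta>))) (\<lambda>t. R (v (t - 2 * pi * \<theta>)))" by simp
    from linear_solution_diff[OF this s]
    have D: "linear_solution (\<lambda>t. 0) (\<lambda>t. R (z (t - 2 * pi * \<theta>)) - z t) (\<lambda>t. R (v (t - 2 * pi * \<theta>)) - v t)"
      by simp
    obtain C where "C \<ge> 0" and C: "\<And>f B z v t. continuous_on UNIV f \<Longrightarrow> periodic_2pi f \<Longrightarrow> \<forall>t. norm (f t) \<le> B \<Longrightarrow>
        linear_solution f z v \<Longrightarrow> norm (z t) \<le> C * B \<and> norm (v t) \<le> C * B"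
      using linear_solution_bound by blast
    show ?thesis using C[OF _ _ _ D, of 0 t] by (simp add: periodic_2pi_def)
  qed
  then show "symmetric z" "symmetric v" by (auto intro!: symmetricI)
qed

lemma step_exists:
  assumes w: "w \<in> admissible"
  obtains w' where "w' \<in> admissible" "step s w w'"
proof -
  let ?f = "\<lambda>t. s *\<^sub>R force t (s, w)"
  have f: "continuous_on UNIV ?f" "periodic_2pi ?f" "symmetric ?f" "no_critical_harmonic ?f"
    using periodic_force[OF w]
    by (auto simp: periodic_2pi_def intro!: continuous_intros continuous_force symmetric_scaleR
      symmetric_force w no_critical_harmonic_force)
  obtain m where "\<And>t. norm (?f t) \<le> norm (?f m)" using periodic_attains_max[OF f(1,2)] by blast
  then obtain C z v where zv: "linear_solution ?f z v" and "\<And>t. norm (z t) \<le> C" "\<And>t. norm (v t) \<le> C"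
    using linear_solution_exists f by meson
  have z': "(z has_vector_derivative N *v z t + v t + ?f t) (at t)" for t using zv by (simp add: linear_solution_def)
  have v': "(v has_vector_derivative - z t) (at t)" for t using zv by (simp add: linear_solution_def)
  have cont: "continuous_on A z" "continuous_on A v" for A
    by (rule vector_derivative_continuous_on[OF z'], rule vector_derivative_continuous_on[OF v'])
  have "norm (z0 t + z t) \<le> norm p0 + norm q0 + C" for t
    using norm_triangle_ineq[of "z0 t" "z t"] norm_wave_le[of p0 q0 t] \<open>norm (z t) \<le> C\<close> by linarith
  moreover have "norm (z1 t + v t) \<le> norm p0 + norm q0 + C" for t
    using norm_triangle_ineq[of "z1 t" "v t"] norm_wave_le[of q0 "- p0" t] \<open>norm (v t) \<le> C\<close> by simp
  moreover have "continuous_on UNIV (\<lambda>t. z0 t + z t)" "continuous_on UNIV (\<lambda>t. z1 t + v t)"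
    by (intro continuous_intros cont continuous_wave)+
  ultimately obtain w' where w': "pos w' = (\<lambda>t. z0 t + z t)" "mom w' = (\<lambda>t. z1 t + v t)"
    using state_of_pair[of "\<lambda>t. z0 t + z t" "\<lambda>t. z1 t + v t"] by blast
  have per: "periodic_2pi z" "periodic_2pi v" and nz: "no_critical_harmonic z" using zv by (auto simp: linear_solution_def)
  have iz: "cycle_integral (\<lambda>t. z t \<bullet> z0 t) = 0" "cycle_integral (\<lambda>t. z t \<bullet> z1 t) = 0"
    by (rule no_critical_harmonic_inner_wave[OF nz cont(1)]; rule critical critical')+
  have "cycle_integral (\<lambda>t. - z t \<bullet> z0 t) = - cycle_integral (\<lambda>t. v t \<bullet> z1 t)"
    "cycle_integral (\<lambda>t. - z t \<bullet> z1 t) = - cycle_integral (\<lambda>t. v t \<bullet> - z0 t)"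
    by (rule cycle_integral_by_parts; (rule v' wave_derivatives per periodic_wave)?;
        intro continuous_intros cont continuous_wave)+
  then have iv: "cycle_integral (\<lambda>t. v t \<bullet> z0 t) = 0" "cycle_integral (\<lambda>t. v t \<bullet> z1 t) = 0"
    by (simp_all add: iz)
  have add: "cycle_integral (\<lambda>t. (f t + g t) \<bullet> h t) = cycle_integral (\<lambda>t. f t \<bullet> h t) + cycle_integral (\<lambda>t. g t \<bullet> h t)"
    if "continuous_on UNIV f" "continuous_on UNIV g" "continuous_on UNIV h" for f g h :: "real \<Rightarrow> real ^ 'n"
    unfolding inner_add_left
    by (rule integral_add; rule integrable_on_cycle; intro continuous_intros that)
  have "w' \<in> admissible"
  proof (rule admissibleI)
    show "periodic_2pi (pos w')" "periodic_2pi (mom w')"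
      using per periodic_wave[of p0 q0] periodic_wave[of q0 "- p0"] by (simp_all add: w' periodic_2pi_def)
    show "symmetric (pos w')" "symmetric (mom w')"
      unfolding w' by (intro symmetric_add symmetric_z0 symmetric_z1 linear_solution_symmetric[OF f(1-3) zv])+
  qed (simp_all add: w' add cont continuous_wave iz iv wave_inner)
  moreover have "step s w w'" using zv by (simp add: step_def w')
  ultimately show ?thesis using that by blast
qed

text \<open>The factor \<open>r\<close> in front of \<open>dist w v\<close> makes the step a contraction for small parameters, and the first
  estimate keeps it inside the unit ball around \<open>w0\<close>.\<close>

lemma step_Lipschitz:
  obtains L where "L \<ge> 0"
    "\<And>s w w'. s \<in> {0..1} \<Longrightarrow> w \<in> admissible \<inter> cball w0 1 \<Longrightarrow> step s w w' \<Longrightarrow> dist w0 w' \<le> L * s"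
    "\<And>s w w' r v v'. s \<in> {0..1} \<Longrightarrow> r \<in> {0..1} \<Longrightarrow> w \<in> admissible \<inter> cball w0 1 \<Longrightarrow> v \<in> admissible \<inter> cball w0 1 \<Longrightarrow>
       step s w w' \<Longrightarrow> step r v v' \<Longrightarrow> dist w' v' \<le> L * (\<bar>s - r\<bar> + r * dist w v)"
proof -
  obtain B where B: "B \<ge> 0" "\<And>t x. x \<in> region \<Longrightarrow> norm (force t x) \<le> B"
      "\<And>t x y. x \<in> region \<Longrightarrow> y \<in> region \<Longrightarrow> norm (force t x - force t y) \<le> B * dist x y"
    using uniformly_BLE[OF region_BL_force] by metis
  obtain C where C0: "C \<ge> 0" and C: "\<And>f B z v t. continuous_on UNIV f \<Longrightarrow> periodic_2pi f \<Longrightarrow> \<forall>t. norm (f t) \<le> B \<Longrightarrow>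
      linear_solution f z v \<Longrightarrow> norm (z t) \<le> C * B \<and> norm (v t) \<le> C * B"
    using linear_solution_bound by blast
  have cont: "continuous_on UNIV (\<lambda>t. s *\<^sub>R force t (s, w))" for s w by (intro continuous_intros continuous_force)
  have per: "periodic_2pi (\<lambda>t. s *\<^sub>R force t (s, w))" if "w \<in> admissible" for s w
    using periodic_force[OF that] by (simp add: periodic_2pi_def)
  define L where "L = 4 * C * B"
  show ?thesis
  proof (rule that[of L])
    show "L \<ge> 0" using C0 B by (simp add: L_def)
    fix s w w' assume s: "s \<in> {0..1}" and w: "w \<in> admissible \<inter> cball w0 1" and st: "step s w w'"
    have reg: "(s, w) \<in> region" using s w by (simp add: region_def)
    have "\<forall>t. norm (s *\<^sub>R force t (s, w)) \<le> s * B"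
      using s B(2)[OF reg] by (auto intro!: mult_left_mono)
    from C[OF cont per this st[unfolded step_def]] w
    have b: "norm (pos w' t - z0 t) \<le> C * (s * B)" "norm (mom w' t - z1 t) \<le> C * (s * B)" for t by auto
    have "dist w' w0 \<le> 2 * (C * (s * B))" by (rule dist_state_le) (use b in \<open>simp_all add: pos_w0 mom_w0\<close>)
    also have "\<dots> \<le> L * s" using C0 B(1) s by (auto simp: L_def algebra_simps)
    finally show "dist w0 w' \<le> L * s" by (simp add: dist_commute)
  next
    fix s w w' r v v' assume s: "s \<in> {0..1}" "r \<in> {0..1}" and w: "w \<in> admissible \<inter> cball w0 1"
      and v: "v \<in> admissible \<inter> cball w0 1" and st: "step s w w'" "step r v v'"
    have reg: "(s, w) \<in> region" "(r, v) \<in> region" using s w v by (auto simp: region_def)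
    have d: "dist (s, w) (r, v) \<le> \<bar>s - r\<bar> + dist w v"
      using sqrt_sum_squares_le_sum_abs[of "s - r" "dist w v"] by (simp add: dist_Pair_Pair dist_real_def)
    let ?K = "B * (2 * \<bar>s - r\<bar> + r * dist w v)"
    have "norm (s *\<^sub>R force t (s, w) - r *\<^sub>R force t (r, v)) \<le> ?K" for t
    proof -
      have "s *\<^sub>R force t (s, w) - r *\<^sub>R force t (r, v) =
          (s - r) *\<^sub>R force t (s, w) + r *\<^sub>R (force t (s, w) - force t (r, v))"
        by (simp add: algebra_simps)
      also have "norm \<dots> \<le> \<bar>s - r\<bar> * norm (force t (s, w)) + r * norm (force t (s, w) - force t (r, v))"
        using norm_triangle_ineq[of "(s - r) *\<^sub>R force t (s, w)" "r *\<^sub>R (force t (s, w) - force t (r, v))"] s by simp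
      also have "\<dots> \<le> \<bar>s - r\<bar> * B + r * (B * (\<bar>s - r\<bar> + dist w v))"
        using s B(2)[OF reg(1), of t] order_trans[OF B(3)[OF reg, of t] mult_left_mono[OF d B(1)]]
        by (intro add_mono mult_left_mono) auto
      also have "\<dots> \<le> ?K"
      proof -
        have "r * (B * \<bar>s - r\<bar>) \<le> 1 * (B * \<bar>s - r\<bar>)" using s B(1) by (intro mult_right_mono) auto
        then show ?thesis by (simp add: algebra_simps)
      qed
      finally show ?thesis .
    qed
    then have bd: "\<forall>t. norm (s *\<^sub>R force t (s, w) - r *\<^sub>R force t (r, v)) \<le> ?K" by blast
    have "periodic_2pi (\<lambda>t. s *\<^sub>R force t (s, w) - r *\<^sub>R force t (r, v))"
      using periodic_force[of w s] periodic_force[of v r] w v by (simp add: periodic_2pi_def)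
    from C[OF continuous_on_diff[OF cont cont] this bd linear_solution_diff[OF st[unfolded step_def]]]
    have b: "norm (pos w' t - pos v' t) \<le> C * ?K" "norm (mom w' t - mom v' t) \<le> C * ?K" for t by auto
    have "dist w' v' \<le> 2 * (C * ?K)" by (rule dist_state_le) (rule b)+
    also have "\<dots> \<le> L * (\<bar>s - r\<bar> + r * dist w v)"
    proof -
      have "C * (B * (r * dist w v)) \<ge> 0" using C0 B(1) s by auto
      then show ?thesis by (simp add: L_def algebra_simps)
    qed
    finally show "dist w' v' \<le> L * (\<bar>s - r\<bar> + r * dist w v)" .
  qed
qed

text \<open>The Banach fixed point theorem applies once \<open>L s \<le> 1 / 2\<close>; the same estimate, at two parameters, bounds the
  dependence of the fixed point on the parameter.\<close>

lemma fixed_point_family: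
  obtains s0 L W where "0 < s0" "s0 \<le> 1" "L \<ge> 0"
    "\<And>s. s \<in> {0..s0} \<Longrightarrow> W s \<in> admissible \<inter> cball w0 1 \<and> step s (W s) (W s)"
    "\<And>s w. s \<in> {0..s0} \<Longrightarrow> w \<in> admissible \<inter> cball w0 1 \<Longrightarrow> step s w w \<Longrightarrow> w = W s"
    "\<And>s r. s \<in> {0..s0} \<Longrightarrow> r \<in> {0..s0} \<Longrightarrow> dist (W s) (W r) \<le> L * \<bar>s - r\<bar>"
proof -
  obtain L where L: "L \<ge> 0"
    "\<And>s w w'. s \<in> {0..1} \<Longrightarrow> w \<in> admissible \<inter> cball w0 1 \<Longrightarrow> step s w w' \<Longrightarrow> dist w0 w' \<le> L * s"
    "\<And>s w w' r v v'. s \<in> {0..1} \<Longrightarrow> r \<in> {0..1} \<Longrightarrow> w \<in> admissible \<inter> cball w0 1 \<Longrightarrow> v \<in> admissible \<inter> cball w0 1 \<Longrightarrow>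
       step s w w' \<Longrightarrow> step r v v' \<Longrightarrow> dist w' v' \<le> L * (\<bar>s - r\<bar> + r * dist w v)"
    using step_Lipschitz by metis
  define s0 where "s0 = 1 / (2 * L + 1)"
  have s0: "0 < s0" "s0 \<le> 1" "L * s0 \<le> 1 / 2" using L(1) by (auto simp: s0_def field_simps)
  have Ls: "L * s \<le> 1 / 2" if "s \<in> {0..s0}" for s
    using mult_left_mono[OF _ L(1), of s s0] that s0(3) by auto
  let ?S = "admissible \<inter> cball w0 1"
  have compl: "complete ?S" by (simp add: complete_eq_closed closed_Int closed_admissible)
  have ne: "?S \<noteq> {}" using w0_admissible by auto
  have ex: "\<exists>w'. w' \<in> ?S \<and> step s w w'" if s: "s \<in> {0..s0}" and w: "w \<in> ?S" for s w
  proof -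
    obtain w' where w': "w' \<in> admissible" "step s w w'" using step_exists w by blast
    moreover have "dist w0 w' \<le> 1" using L(2)[OF _ w w'(2)] Ls[OF s] s s0 by auto
    ultimately show ?thesis by auto
  qed
  define T where "T s w = (SOME w'. w' \<in> ?S \<and> step s w w')" for s w
  have T: "T s w \<in> ?S" "step s w (T s w)" if "s \<in> {0..s0}" "w \<in> ?S" for s w
    using someI_ex[OF ex[OF that]] unfolding T_def by auto
  have unique: "w' = w''" if "s \<in> {0..s0}" "w \<in> ?S" "step s w w'" "step s w w''" for s w w' w''
    using L(3)[of s s w w w' w''] that s0 by auto
  have "\<exists>!w. w \<in> ?S \<and> T s w = w" if s: "s \<in> {0..s0}" for s
  proof -
    have "\<exists>!w\<in>?S. T s w = w"
    proof (rule Banach_fix[OF compl ne, of "1 / 2"])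
      show "T s ` ?S \<subseteq> ?S" using T(1)[OF s] by blast
      show "dist (T s w) (T s v) \<le> 1 / 2 * dist w v" if "w \<in> ?S" "v \<in> ?S" for w v
      proof -
        have "dist (T s w) (T s v) \<le> L * (\<bar>s - s\<bar> + s * dist w v)"
          using L(3)[OF _ _ that T(2)[OF s that(1)] T(2)[OF s that(2)]] s s0 by auto
        also have "\<dots> \<le> 1 / 2 * dist w v"
          using mult_right_mono[OF Ls[OF s], of "dist w v"] by (simp add: mult.assoc)
        finally show ?thesis .
      qed
    qed auto
    then show ?thesis by blast
  qed
  then obtain W where W: "\<And>s. s \<in> {0..s0} \<Longrightarrow> W s \<in> ?S \<and> T s (W s) = W s"
    and W_unique: "\<And>s w. s \<in> {0..s0} \<Longrightarrow> w \<in> ?S \<Longrightarrow> T s w = w \<Longrightarrow> w = W s"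
    by metis
  have stepW: "step s (W s) (W s)" if "s \<in> {0..s0}" for s
    using T(2)[OF that, of "W s"] W[OF that] by simp
  show ?thesis
  proof (rule that[of s0 "2 * L" W])
    show "w = W s" if "s \<in> {0..s0}" "w \<in> ?S" "step s w w" for s w
      using W_unique[OF that(1,2)] unique[OF that(1,2) T(2)[OF that(1,2)] that(3)] by blast
    show "dist (W s) (W r) \<le> 2 * L * \<bar>s - r\<bar>" if sr: "s \<in> {0..s0}" "r \<in> {0..s0}" for s r
    proof -
      have "dist (W s) (W r) \<le> L * (\<bar>s - r\<bar> + r * dist (W s) (W r))"
        using L(3)[OF _ _ _ _ stepW[OF sr(1)] stepW[OF sr(2)]] W[OF sr(1)] W[OF sr(2)] sr s0 by auto
      moreover have "L * r * dist (W s) (W r) \<le> 1 / 2 * dist (W s) (W r)"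
        by (rule mult_right_mono[OF Ls[OF sr(2)]]) simp
      ultimately show ?thesis by (simp add: algebra_simps)
    qed
  qed (use s0 L W stepW in auto)
qed

section \<open>The branch of symmetric periodic solutions\<close>

text \<open>The oscillator equation in Lienard form, with time rescaled so that the period is \<open>2 pi\<close> and the
  actual period is \<open>2 pi p\<close>.\<close>

definition cycle_solution :: "real \<Rightarrow> real \<Rightarrow> (real \<Rightarrow> real ^ 'n) \<Rightarrow> (real \<Rightarrow> real ^ 'n) \<Rightarrow> bool" where
  "cycle_solution \<delta> p u v \<longleftrightarrow> periodic_2pi u \<and> periodic_2pi v \<and>
     (\<forall>t. (u has_vector_derivative p\<^sup>2 *\<^sub>R v t + p *\<^sub>R (\<delta> *\<^sub>R u t + N *v u t - (1 / 3) *\<^sub>R cube (u t))) (at t)) \<and>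
     (\<forall>t. (v has_vector_derivative - u t) (at t))"

lemma cube_scaleR: "cube (c *\<^sub>R x) = (c ^ 3) *\<^sub>R cube (x :: real ^ 'n)"
  by (simp add: vec_eq_iff power3_eq_cube)

text \<open>A fixed point for the parameter \<open>c\<^sup>2\<close>, multiplied by \<open>c\<close>, is a solution of amplitude \<open>c\<close>.\<close>

lemma step_cycle_solution:
  assumes w: "w \<in> admissible" and st: "step (c\<^sup>2) w w"
  shows "cycle_solution (c\<^sup>2 * excess w) (period_ratio (c\<^sup>2, w)) (\<lambda>t. c *\<^sub>R pos w t) (\<lambda>t. c *\<^sub>R mom w t)"
proof -
  define p where "p = period_ratio (c\<^sup>2, w)"
  have p0: "1 + p > 0" using period_ratio_pos[of "(c\<^sup>2, w)"] by (simp add: p_def)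
  have p2: "p\<^sup>2 - 1 = 2 * p * (c\<^sup>2 * detuning w)" using period_ratio_eq[of "(c\<^sup>2, w)"] by (simp add: p_def)
  have p3: "p - 1 = p * (2 * (c\<^sup>2 * detuning w) * (1 / (1 + p)))"
  proof -
    have "(p - 1) * (1 + p) = 2 * p * (c\<^sup>2 * detuning w)" using p2 by (simp add: algebra_simps power2_eq_square)
    then show ?thesis using p0 by (simp add: field_simps)
  qed
  have z: "((\<lambda>t. pos w t - z0 t) has_vector_derivative
      N *v (pos w t - z0 t) + (mom w t - z1 t) + c\<^sup>2 *\<^sub>R force t (c\<^sup>2, w)) (at t)" for t
    using st by (simp add: step_def linear_solution_def)
  have v: "((\<lambda>t. mom w t - z1 t) has_vector_derivative - (pos w t - z0 t)) (at t)" for t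
    using st by (simp add: step_def linear_solution_def)
  have N0: "N *v z0 t = 0" for t
    by (simp add: wave_def critical matrix_vector_right_distrib matrix_vector_mult_scaleR)
  have "((\<lambda>t. pos w t - z0 t + z0 t) has_vector_derivative
      N *v (pos w t - z0 t) + (mom w t - z1 t) + c\<^sup>2 *\<^sub>R force t (c\<^sup>2, w) + z1 t) (at t)" for t
    by (intro has_vector_derivative_add z wave_derivatives)
  then have z': "(pos w has_vector_derivative N *v pos w t + mom w t + c\<^sup>2 *\<^sub>R force t (c\<^sup>2, w)) (at t)" for t
    by (simp add: matrix_vector_mult_diff_distrib N0 add.assoc)
  have force: "c\<^sup>2 *\<^sub>R force t (c\<^sup>2, w) = (p\<^sup>2 - 1) *\<^sub>R mom w t + (p - 1) *\<^sub>R (N *v pos w t) +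
      (p * (c\<^sup>2 * excess w)) *\<^sub>R pos w t - (p * c\<^sup>2 / 3) *\<^sub>R cube (pos w t)" for t
    unfolding p2 by (subst p3) (simp add: force_def p_def[symmetric] scaleR_add_right scaleR_diff_right mult_ac)
  have "((\<lambda>t. mom w t - z1 t + z1 t) has_vector_derivative - (pos w t - z0 t) + - z0 t) (at t)" for t
    by (intro has_vector_derivative_add v wave_derivatives)
  then have v': "(mom w has_vector_derivative - pos w t) (at t)" for t by simp
  show ?thesis
    unfolding cycle_solution_def p_def[symmetric]
  proof (intro conjI allI)
    show "periodic_2pi (\<lambda>t. c *\<^sub>R pos w t)" "periodic_2pi (\<lambda>t. c *\<^sub>R mom w t)"
      using admissibleD(1,2)[OF w] by (auto simp: periodic_2pi_def)
    show "((\<lambda>t. c *\<^sub>R mom w t) has_vector_derivative - (c *\<^sub>R pos w t)) (at t)" for t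
      using bounded_linear.has_vector_derivative[OF bounded_linear_scaleR_right v', of c t] by simp
    show "((\<lambda>t. c *\<^sub>R pos w t) has_vector_derivative
       p\<^sup>2 *\<^sub>R c *\<^sub>R mom w t + p *\<^sub>R ((c\<^sup>2 * excess w) *\<^sub>R c *\<^sub>R pos w t + N *v (c *\<^sub>R pos w t) - (1 / 3) *\<^sub>R cube (c *\<^sub>R pos w t))) (at t)" for t
    proof -
      have "((\<lambda>t. c *\<^sub>R pos w t) has_vector_derivative
          c *\<^sub>R (N *v pos w t + mom w t + c\<^sup>2 *\<^sub>R force t (c\<^sup>2, w))) (at t)"
        by (rule bounded_linear.has_vector_derivative[OF bounded_linear_scaleR_right z'])
      moreover have "c *\<^sub>R (N *v pos w t + mom w t + c\<^sup>2 *\<^sub>R force t (c\<^sup>2, w)) =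
         p\<^sup>2 *\<^sub>R c *\<^sub>R mom w t + p *\<^sub>R ((c\<^sup>2 * excess w) *\<^sub>R c *\<^sub>R pos w t + N *v (c *\<^sub>R pos w t) - (1 / 3) *\<^sub>R cube (c *\<^sub>R pos w t))"
        unfolding force cube_scaleR
        by (simp add: matrix_vector_mult_scaleR algebra_simps power2_eq_square power3_eq_cube)
      ultimately show ?thesis by simp
    qed
  qed
qed

lemma symmetric_momentum:
  assumes "cycle_solution \<delta> p u v" "symmetric u" "p > 0"
  shows "symmetric v"
proof -
  let ?g = "\<lambda>t. p\<^sup>2 *\<^sub>R v t + p *\<^sub>R (\<delta> *\<^sub>R u t + N *v u t - (1 / 3) *\<^sub>R cube (u t))"
  have "symmetric ?g"
    using assms by (intro symmetric_derivative[OF assms(2)]) (simp add: cycle_solution_def)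
  moreover have "symmetric (\<lambda>t. p *\<^sub>R (\<delta> *\<^sub>R u t + N *v u t - (1 / 3) *\<^sub>R cube (u t)))"
    by (intro symmetric_scaleR symmetric_diff symmetric_add symmetric_mult symmetric_cube assms)
  ultimately have "symmetric (\<lambda>t. (1 / p\<^sup>2) *\<^sub>R (?g t - p *\<^sub>R (\<delta> *\<^sub>R u t + N *v u t - (1 / 3) *\<^sub>R cube (u t))))"
    by (rule symmetric_scaleR[OF symmetric_diff])
  then show ?thesis using assms(3) by simp
qed

text \<open>Since \<open>v\<close> changes sign after half a period, \<open>2 v(t)\<close> is the increment of \<open>v\<close> over a time \<open>pi\<close>.\<close>

lemma momentum_bound:
  assumes v: "\<And>t. (v has_vector_derivative - u t) (at t)" and sym: "symmetric v"
    and u: "continuous_on UNIV u" "\<And>t. norm (u t) \<le> U"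
  shows "norm (v t) \<le> 2 * U"
proof -
  have "- v (t - 2 * pi * (1 / 2)) = v t" by (rule symmetricD[OF sym half_period])
  then have "2 *\<^sub>R v t = v t - v (t - pi)" by (simp add: scaleR_2)
  also have "\<dots> = integral {t - pi..t} (\<lambda>t. - u t)"
    by (rule integral_unique[symmetric], rule has_integral_vector_derivative[OF _ v]) simp
  also have "norm \<dots> \<le> U * (t - (t - pi))"
    by (rule integral_bound) (auto intro!: continuous_intros continuous_on_subset[OF u(1)] u(2))
  finally have "2 * norm (v t) \<le> U * pi" by simp
  also have "\<dots> \<le> U * 4" using pi_less_4 order_trans[OF norm_ge_zero u(2)[of 0]] by (intro mult_left_mono) auto
  finally show ?thesis by simp
qed

text \<open>A small symmetric solution whose phase is normalised is the solution found by the contraction: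
  the linear estimate bounds its component off the critical plane by a small multiple of
  the solution itself, so after division by its critical amplitude \<open>c\<close> it lies in the domain of the contraction.\<close>

lemma small_solution_normalised:
  assumes s0: "0 < s0" and W: "\<And>s w. s \<in> {0..s0} \<Longrightarrow> w \<in> admissible \<inter> cball w0 1 \<Longrightarrow> step s w w \<Longrightarrow> w = W s"
  shows "\<exists>\<eta>. 0 < \<eta> \<and> \<eta> \<le> 1 / 2 \<and> (\<forall>\<delta> p u v c. cycle_solution \<delta> p u v \<and> symmetric u \<and> \<bar>\<delta>\<bar> \<le> \<eta> \<and> \<bar>p - 1\<bar> \<le> \<eta> \<and>
    (\<forall>t. norm (u t) \<le> \<eta>) \<and> (\<exists>t. u t \<noteq> 0) \<and> c \<ge> 0 \<and>
    cycle_integral (\<lambda>t. u t \<bullet> z0 t) = c * nsq \<and> cycle_integral (\<lambda>t. u t \<bullet> z1 t) = 0 \<longrightarrow>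
    0 < c \<and> c\<^sup>2 \<le> s0 \<and> \<delta> = c\<^sup>2 * excess (W (c\<^sup>2)) \<and> p = period_ratio (c\<^sup>2, W (c\<^sup>2)) \<and>
    (\<forall>t. u t = c *\<^sub>R pos (W (c\<^sup>2)) t))"
proof -
  obtain C where C0: "C \<ge> 0" and C: "\<And>f B z v t. continuous_on UNIV f \<Longrightarrow> periodic_2pi f \<Longrightarrow> \<forall>t. norm (f t) \<le> B \<Longrightarrow>
      linear_solution f z v \<Longrightarrow> norm (z t) \<le> C * B \<and> norm (v t) \<le> C * B"
    using linear_solution_bound by blast
  obtain A where A0: "A > 0" and A: "\<And>x. norm (N *v x) \<le> norm x * A"
    using bounded_linear.pos_bounded[OF matrix_vector_mul_bounded_linear[of N]] by blast
  define n0 where "n0 = norm p0 + norm q0"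
  have n0: "n0 > 0" using nonzero by (auto simp: n0_def add_pos_nonneg add_nonneg_pos)
  have z0n: "norm (z0 t) \<le> n0" "norm (z1 t) \<le> n0" for t
    using norm_wave_le[of p0 q0 t] norm_wave_le[of q0 "- p0" t] by (simp_all add: n0_def add.commute)
  define K where "K = 9 + A"
  define \<eta> where "\<eta> = min (1 / 2) (min (1 / (4 * (C * K * (1 + n0)) + 1)) (sqrt s0 * nsq / (2 * pi * n0)))"
  have CK: "C * K * (1 + n0) \<ge> 0" using C0 A0 n0 by (simp add: K_def)
  have \<eta>: "\<eta> > 0" "\<eta> \<le> 1 / 2" "\<eta> * (2 * pi * n0) \<le> sqrt s0 * nsq" "C * K * \<eta> * (1 + n0) \<le> 1 / 4"
  proof -
    show "\<eta> > 0" using s0 n0 nsq_pos CK by (simp add: \<eta>_def)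
    show "\<eta> \<le> 1 / 2" by (simp add: \<eta>_def)
    have "\<eta> \<le> sqrt s0 * nsq / (2 * pi * n0)" by (simp add: \<eta>_def)
    then show "\<eta> * (2 * pi * n0) \<le> sqrt s0 * nsq" using n0 by (simp add: pos_le_divide_eq)
    have "\<eta> \<le> 1 / (4 * (C * K * (1 + n0)) + 1)" by (simp add: \<eta>_def)
    then have "\<eta> * (4 * (C * K * (1 + n0)) + 1) \<le> 1" using CK by (simp add: pos_le_divide_eq)
    then show "C * K * \<eta> * (1 + n0) \<le> 1 / 4" using \<open>\<eta> > 0\<close> by (simp add: algebra_simps)
  qed
  have CK\<eta>: "C * K * \<eta> \<le> 1 / 4" "C * K * \<eta> * n0 \<le> 1 / 4"
  proof -
    have 1: "0 \<le> C * K * \<eta>" using \<eta>(1) C0 A0 by (simp add: K_def)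
    have "0 \<le> C * K * \<eta> * n0" by (rule mult_nonneg_nonneg[OF 1]) (use n0 in simp)
    moreover have "C * K * \<eta> + C * K * \<eta> * n0 \<le> 1 / 4" using \<eta>(4) by (simp only: distrib_left mult_1_right)
    ultimately show "C * K * \<eta> \<le> 1 / 4" "C * K * \<eta> * n0 \<le> 1 / 4" using 1 by linarith+
  qed
  show ?thesis
  proof (rule exI[of _ \<eta>], intro conjI allI impI)
    show "0 < \<eta>" "\<eta> \<le> 1 / 2" by fact+
  next
    fix \<delta> p u v c
    assume h: "cycle_solution \<delta> p u v \<and> symmetric u \<and> \<bar>\<delta>\<bar> \<le> \<eta> \<and> \<bar>p - 1\<bar> \<le> \<eta> \<and>
      (\<forall>t. norm (u t) \<le> \<eta>) \<and> (\<exists>t. u t \<noteq> 0) \<and> c \<ge> 0 \<and>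
      cycle_integral (\<lambda>t. u t \<bullet> z0 t) = c * nsq \<and> cycle_integral (\<lambda>t. u t \<bullet> z1 t) = 0"
    then have sol: "cycle_solution \<delta> p u v" and sym: "symmetric u" and \<delta>: "\<bar>\<delta>\<bar> \<le> \<eta>" and p: "\<bar>p - 1\<bar> \<le> \<eta>"
      and small: "\<And>t. norm (u t) \<le> \<eta>" and nz: "\<exists>t. u t \<noteq> 0" and c: "c \<ge> 0"
      and ip: "cycle_integral (\<lambda>t. u t \<bullet> z0 t) = c * nsq" "cycle_integral (\<lambda>t. u t \<bullet> z1 t) = 0"
      by blast+
    have pp: "1 / 2 \<le> p" "p \<le> 3 / 2" using p \<eta>(2) by (auto simp: abs_le_iff)
    define g where "g t = p\<^sup>2 *\<^sub>R v t + p *\<^sub>R (\<delta> *\<^sub>R u t + N *v u t - (1 / 3) *\<^sub>R cube (u t))" for t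
    have u': "(u has_vector_derivative g t) (at t)" for t using sol by (simp add: cycle_solution_def g_def)
    have v': "(v has_vector_derivative - u t) (at t)" for t using sol by (simp add: cycle_solution_def)
    have per: "periodic_2pi u" "periodic_2pi v" using sol by (auto simp: cycle_solution_def)
    have cont: "continuous_on S u" "continuous_on S v" for S
      by (rule vector_derivative_continuous_on[OF u'], rule vector_derivative_continuous_on[OF v'])
    have contN: "continuous_on S (\<lambda>t. N *v u t)" for S
      by (rule bounded_linear.continuous_on[OF matrix_vector_mul_bounded_linear cont(1)])
    have symv: "symmetric v" using symmetric_momentum[OF sol sym] pp by simp
    have contg: "continuous_on S g" for S
      unfolding g_def[abs_def] by (intro continuous_intros cont contN continuous_cube)
    obtain m where m: "\<And>t. norm (u t) \<le> norm (u m)" using periodic_attains_max[OF cont(1) per(1)] by blast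
    define U where "U = norm (u m)"
    have U: "\<And>t. norm (u t) \<le> U" "U \<le> \<eta>" "U > 0"
      using m small[of m] nz by (auto simp: U_def)
    have vU: "norm (v t) \<le> 2 * U" for t by (rule momentum_bound[OF v' symv cont(1) U(1)])
    define f where "f t = (p\<^sup>2 - 1) *\<^sub>R v t + (p - 1) *\<^sub>R (N *v u t) + (p * \<delta>) *\<^sub>R u t + (- (p / 3)) *\<^sub>R cube (u t)" for t
    have gf: "g t = N *v u t + v t + f t" for t by (simp add: g_def f_def algebra_simps)
    have contf: "continuous_on S f" for S
      unfolding f_def[abs_def] by (intro continuous_intros cont contN continuous_cube)
    have perf: "periodic_2pi f" using per by (simp add: periodic_2pi_def f_def)
    have fb: "norm (f t) \<le> K * \<eta> * U" for t
    proof -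
      have 1: "norm ((p\<^sup>2 - 1) *\<^sub>R v t) \<le> (3 * \<eta>) * (2 * U)"
      proof -
        have "p\<^sup>2 - 1 = (p + 1) * (p - 1)" by (simp add: power2_eq_square algebra_simps)
        then have "\<bar>p\<^sup>2 - 1\<bar> \<le> 3 * \<eta>" using pp p by (auto simp: abs_mult intro!: mult_mono)
        then show ?thesis unfolding norm_scaleR by (intro mult_mono vU) (use \<eta>(1) in auto)
      qed
      have 2: "norm ((p - 1) *\<^sub>R (N *v u t)) \<le> \<eta> * (U * A)"
        unfolding norm_scaleR using p order_trans[OF A mult_right_mono[OF U(1)]] A0 \<eta>(1) by (intro mult_mono) auto
      have 3: "norm ((p * \<delta>) *\<^sub>R u t) \<le> (2 * \<eta>) * U"
        unfolding norm_scaleR abs_mult using pp \<delta> U(1)[of t] \<eta>(1) by (intro mult_mono) auto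
      have nm: "norm (x * y) \<le> norm x * norm y" for x y :: "real ^ 'n"
      proof -
        have "norm (x * y) \<le> norm (norm y *\<^sub>R x)"
          by (rule norm_le_componentwise_cart)
             (auto simp: abs_mult mult.commute[of "norm y"] intro!: mult_left_mono component_le_norm_cart)
        then show ?thesis by (simp add: mult.commute)
      qed
      have "norm (cube (u t)) \<le> norm (u t) * norm (u t) * norm (u t)"
        by (rule order_trans[OF nm]) (intro mult_right_mono nm; simp)
      also have "\<dots> \<le> \<eta> * 1 * U"
        using small[of t] \<eta>(1,2) U(1)[of t] by (intro mult_mono) (auto intro: order_trans)
      finally have n4: "norm (cube (u t)) \<le> \<eta> * U" by simp
      have 4: "norm ((- (p / 3)) *\<^sub>R cube (u t)) \<le> 1 * (\<eta> * U)"
        unfolding norm_scaleR by (rule mult_mono[OF _ n4]) (use pp in auto)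
      have "norm (f t) \<le> norm ((p\<^sup>2 - 1) *\<^sub>R v t) + norm ((p - 1) *\<^sub>R (N *v u t)) + norm ((p * \<delta>) *\<^sub>R u t)
          + norm ((- (p / 3)) *\<^sub>R cube (u t))"
        unfolding f_def by (intro norm_triangle_le add_mono order_refl)
      also have "\<dots> \<le> K * \<eta> * U"
        using 1 2 3 4 by (simp add: K_def algebra_simps)
      finally show ?thesis .
    qed
    have int: "h integrable_on {0..2 * pi}" if "continuous_on UNIV h" for h :: "real \<Rightarrow> real" by (rule integrable_on_cycle[OF that])
    have ls: "linear_solution f (\<lambda>t. u t - c *\<^sub>R z0 t) (\<lambda>t. v t - c *\<^sub>R z1 t)"
      unfolding linear_solution_def
    proof (intro conjI allI)
      show "periodic_2pi (\<lambda>t. u t - c *\<^sub>R z0 t)" "periodic_2pi (\<lambda>t. v t - c *\<^sub>R z1 t)"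
        using per periodic_wave[of p0 q0] periodic_wave[of q0 "- p0"] by (simp_all add: periodic_2pi_def)
      have cz0: "((\<lambda>t. c *\<^sub>R z0 t) has_vector_derivative c *\<^sub>R z1 t) (at t)" for t
        by (rule bounded_linear.has_vector_derivative[OF bounded_linear_scaleR_right wave_derivatives(1)])
      have cz1: "((\<lambda>t. c *\<^sub>R z1 t) has_vector_derivative c *\<^sub>R (- z0 t)) (at t)" for t
        by (rule bounded_linear.has_vector_derivative[OF bounded_linear_scaleR_right wave_derivatives(2)])
      have N0: "N *v z0 t = 0" for t
        by (simp add: wave_def critical matrix_vector_right_distrib matrix_vector_mult_scaleR)
      show "((\<lambda>t. u t - c *\<^sub>R z0 t) has_vector_derivative N *v (u t - c *\<^sub>R z0 t) + (v t - c *\<^sub>R z1 t) + f t) (at t)" for t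
        using has_vector_derivative_diff[OF u'[of t] cz0[of t]]
        by (simp add: gf matrix_vector_mult_diff_distrib matrix_vector_mult_scaleR N0 algebra_simps)
      show "((\<lambda>t. v t - c *\<^sub>R z1 t) has_vector_derivative - (u t - c *\<^sub>R z0 t)) (at t)" for t
        using has_vector_derivative_diff[OF v'[of t] cz1[of t]] by simp
      have diff: "cycle_integral (\<lambda>t. (u t - c *\<^sub>R z0 t) \<bullet> wave r q t) =
          cycle_integral (\<lambda>t. u t \<bullet> wave r q t) - c * cycle_integral (\<lambda>t. z0 t \<bullet> wave r q t)" for r q
        unfolding inner_diff_left inner_scaleR_left
        by (subst integral_diff) (auto intro!: int integrable_on_mult_right continuous_intros cont continuous_wave)
      show "no_critical_harmonic (\<lambda>t. u t - c *\<^sub>R z0 t)"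
      proof (rule no_critical_harmonicI)
        show "continuous_on UNIV (\<lambda>t. u t - c *\<^sub>R z0 t)" by (intro continuous_intros cont continuous_wave)
        show "periodic_2pi (\<lambda>t. u t - c *\<^sub>R z0 t)" by fact
        show "symmetric (\<lambda>t. u t - c *\<^sub>R z0 t)" by (intro symmetric_diff symmetric_scaleR sym symmetric_z0)
      qed (simp_all add: diff ip wave_inner)
    qed
    have rem: "norm (u t - c *\<^sub>R z0 t) \<le> C * (K * \<eta> * U)" "norm (v t - c *\<^sub>R z1 t) \<le> C * (K * \<eta> * U)" for t
      using C[OF contf perf _ ls, of "K * \<eta> * U" t] fb by auto
    have quarter: "C * (K * \<eta> * U) \<le> U / 4"
    proof -
      have "C * (K * \<eta> * U) = (C * K * \<eta>) * U" by (simp only: mult.assoc)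
      also have "\<dots> \<le> 1 / 4 * U" by (rule mult_right_mono[OF CK\<eta>(1)]) (use U(3) in simp)
      finally show ?thesis by simp
    qed
    have "U \<le> norm (c *\<^sub>R z0 m) + norm (u m - c *\<^sub>R z0 m)"
      unfolding U_def using norm_triangle_sub[of "u m" "c *\<^sub>R z0 m"] by simp
    also have "\<dots> \<le> c * n0 + U / 4"
      by (rule add_mono) (use order_trans[OF rem(1)[of m] quarter] mult_left_mono[OF z0n(1)[of m] c] c in simp_all)
    finally have Uc: "U \<le> 2 * c * n0" using mult_nonneg_nonneg[OF c less_imp_le[OF n0]] U(3) by simp
    have cpos: "c > 0"
    proof (rule ccontr)
      assume "\<not> c > 0"
      then show False using c Uc U(3) by simp
    qed
    have cs: "c\<^sup>2 \<le> s0"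
    proof -
      have "\<bar>cycle_integral (\<lambda>t. u t \<bullet> z0 t)\<bar> \<le> 2 * pi * (\<eta> * n0)"
      proof (rule cycle_integral_abs_bound)
        show "continuous_on UNIV (\<lambda>t. u t \<bullet> z0 t)" by (intro continuous_intros cont continuous_wave)
        show "\<bar>u t \<bullet> z0 t\<bar> \<le> \<eta> * n0" for t
          by (rule order_trans[OF Cauchy_Schwarz_ineq2]) (use small z0n \<eta> in \<open>auto intro!: mult_mono\<close>)
      qed
      also have "\<dots> \<le> sqrt s0 * nsq" using \<eta>(3) by (simp add: algebra_simps)
      finally have "c \<le> sqrt s0" using nsq_pos c by (simp add: ip)
      then have "c\<^sup>2 \<le> (sqrt s0)\<^sup>2" using c by (intro power_mono) auto
      then show ?thesis using s0 by simp
    qed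
    obtain w :: "'n state" where w: "pos w = (\<lambda>t. (1 / c) *\<^sub>R u t)" "mom w = (\<lambda>t. (1 / c) *\<^sub>R v t)"
    proof (rule state_of_pair[of "\<lambda>t. (1 / c) *\<^sub>R u t" "\<lambda>t. (1 / c) *\<^sub>R v t" "(1 / c) * (2 * U)"])
      show "norm ((1 / c) *\<^sub>R u t) \<le> (1 / c) * (2 * U)" "norm ((1 / c) *\<^sub>R v t) \<le> (1 / c) * (2 * U)" for t
        using U(1)[of t] U(3) vU[of t] cpos by (auto simp: divide_right_mono)
    qed (auto intro!: continuous_intros cont)
    have uw: "u t = c *\<^sub>R pos w t" "v t = c *\<^sub>R mom w t" for t using cpos by (simp_all add: w)
    have "cycle_integral (\<lambda>t. - u t \<bullet> z0 t) = - cycle_integral (\<lambda>t. v t \<bullet> z1 t)"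
      by (rule cycle_integral_by_parts[OF v' wave_derivatives(1)])
         (intro per periodic_wave continuous_intros cont continuous_wave)+
    then have iv1: "cycle_integral (\<lambda>t. v t \<bullet> z1 t) = c * nsq" by (simp add: ip)
    have "cycle_integral (\<lambda>t. - u t \<bullet> z1 t) = - cycle_integral (\<lambda>t. v t \<bullet> - z0 t)"
      by (rule cycle_integral_by_parts[OF v' wave_derivatives(2)])
         (intro per periodic_wave continuous_intros cont continuous_wave)+
    then have iv0: "cycle_integral (\<lambda>t. v t \<bullet> z0 t) = 0" by (simp add: ip)
    have adm: "w \<in> admissible"
    proof (rule admissibleI)
      show "periodic_2pi (pos w)" "periodic_2pi (mom w)" using per by (simp_all add: w periodic_2pi_def)
      show "symmetric (pos w)" "symmetric (mom w)" unfolding w by (intro symmetric_scaleR sym symv)+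
    qed (use cpos in \<open>simp_all add: w ip iv0 iv1\<close>)
    have ball: "dist w0 w \<le> 1"
    proof -
      have *: "norm ((1 / c) *\<^sub>R x - z) \<le> 1 / 2" if "norm (x - c *\<^sub>R z) \<le> C * (K * \<eta> * U)" for x z :: "real ^ 'n"
      proof -
        have "norm ((1 / c) *\<^sub>R x - z) = (1 / c) * norm (x - c *\<^sub>R z)"
        proof -
          have "(1 / c) *\<^sub>R x - z = (1 / c) *\<^sub>R (x - c *\<^sub>R z)" using cpos by (simp add: scaleR_diff_right)
          then show ?thesis using cpos by simp
        qed
        also have "\<dots> \<le> (1 / c) * (C * (K * \<eta> * (2 * c * n0)))"
        proof -
          have "C * (K * \<eta> * U) \<le> C * (K * \<eta> * (2 * c * n0))"
            using C0 A0 \<eta>(1) by (intro mult_left_mono Uc) (auto simp: K_def)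
          then show ?thesis using that cpos by (intro mult_left_mono) auto
        qed
        also have "\<dots> = 2 * (C * K * \<eta> * n0)" using cpos by simp
        finally show ?thesis using CK\<eta>(2) by simp
      qed
      have "dist w w0 \<le> 2 * (1 / 2)"
        by (rule dist_state_le) (simp_all only: w pos_w0 mom_w0, (rule * rem)+)
      then show ?thesis by (simp add: dist_commute)
    qed
    have fip: "cycle_integral (\<lambda>t. f t \<bullet> wave r q t) = (p\<^sup>2 - 1) * cycle_integral (\<lambda>t. v t \<bullet> wave r q t) +
        (p * \<delta>) * cycle_integral (\<lambda>t. u t \<bullet> wave r q t) +
        (- (p / 3) * c ^ 3) * cycle_integral (\<lambda>t. cube (pos w t) \<bullet> wave r q t)"
      if "N *v r = 0" "N *v q = 0" for r q
    proof -
      have N: "(N *v x) \<bullet> wave r q t = 0" for x t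
        by (rule inner_mult_kernel) (simp add: wave_def that matrix_vector_right_distrib matrix_vector_mult_scaleR)
      have i: "(\<lambda>t. (p\<^sup>2 - 1) * (v t \<bullet> wave r q t)) integrable_on {0..2 * pi}"
        "(\<lambda>t. (p * \<delta>) * (u t \<bullet> wave r q t)) integrable_on {0..2 * pi}"
        "(\<lambda>t. (- (p / 3) * c ^ 3) * (cube (pos w t) \<bullet> wave r q t)) integrable_on {0..2 * pi}"
        by (intro integrable_on_mult_right int continuous_on_inner continuous_cube continuous_pos cont continuous_wave)+
      have "(\<lambda>t. f t \<bullet> wave r q t) = (\<lambda>t. (p\<^sup>2 - 1) * (v t \<bullet> wave r q t) + (p * \<delta>) * (u t \<bullet> wave r q t) +
         (- (p / 3) * c ^ 3) * (cube (pos w t) \<bullet> wave r q t))"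
        unfolding f_def inner_add_left inner_scaleR_left N
        by (rule ext) (simp add: uw(1) cube_scaleR power3_eq_cube)
      then show ?thesis
        by (simp only: integral_add[OF integrable_add[OF i(1,2)] i(3)] integral_add[OF i(1,2)] integral_mult_right)
    qed
    have fip0: "cycle_integral (\<lambda>t. f t \<bullet> wave r q t) = cycle_integral (\<lambda>t. g t \<bullet> wave r q t) - cycle_integral (\<lambda>t. v t \<bullet> wave r q t)"
      if "N *v r = 0" "N *v q = 0" for r q
    proof -
      have N: "(N *v x) \<bullet> wave r q t = 0" for x t
        by (rule inner_mult_kernel) (simp add: wave_def that matrix_vector_right_distrib matrix_vector_mult_scaleR)
      have "(\<lambda>t. f t \<bullet> wave r q t) = (\<lambda>t. g t \<bullet> wave r q t - v t \<bullet> wave r q t)"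
        by (simp add: gf inner_add_left N)
      then show ?thesis
        by (simp add: integral_diff int contg cont continuous_wave continuous_on_inner)
    qed
    have "cycle_integral (\<lambda>t. g t \<bullet> z0 t) = - cycle_integral (\<lambda>t. u t \<bullet> z1 t)"
      by (rule cycle_integral_by_parts[OF u' wave_derivatives(1)])
         (intro per periodic_wave continuous_intros contg continuous_wave)+
    then have f0: "cycle_integral (\<lambda>t. f t \<bullet> z0 t) = 0"
      using fip0[OF critical] by (simp add: ip iv0)
    define X where "X = cycle_integral (\<lambda>t. cube (pos w t) \<bullet> z0 t)"
    have "0 = (p\<^sup>2 - 1) * 0 + p * \<delta> * (c * nsq) + - (p / 3) * c ^ 3 * X"
      using fip[OF critical] unfolding f0 ip iv0 X_def .
    moreover have "p * (\<delta> * (c * nsq) - c ^ 3 / 3 * X) = (p\<^sup>2 - 1) * 0 + p * \<delta> * (c * nsq) + - (p / 3) * c ^ 3 * X"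
      by (simp add: algebra_simps)
    ultimately have "p * (\<delta> * (c * nsq) - c ^ 3 / 3 * X) = 0" by (simp only:)
    then have "\<delta> * (c * nsq) = c ^ 3 / 3 * cycle_integral (\<lambda>t. cube (pos w t) \<bullet> z0 t)"
      using pp by (simp add: X_def)
    then have \<delta>w: "\<delta> = c\<^sup>2 * excess w"
      using cpos nsq_pos by (simp add: excess_def field_simps power2_eq_square power3_eq_cube)
    have "cycle_integral (\<lambda>t. g t \<bullet> z1 t) = - cycle_integral (\<lambda>t. u t \<bullet> - z0 t)"
      by (rule cycle_integral_by_parts[OF u' wave_derivatives(2)])
         (intro per periodic_wave continuous_intros contg continuous_wave)+
    then have f1: "cycle_integral (\<lambda>t. f t \<bullet> z1 t) = 0"
      using fip0[OF critical(2) critical'(1)] by (simp add: ip iv1)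
    define Y where "Y = cycle_integral (\<lambda>t. cube (pos w t) \<bullet> z1 t)"
    have "0 = (p\<^sup>2 - 1) * (c * nsq) + p * \<delta> * 0 + - (p / 3) * c ^ 3 * Y"
      using fip[OF critical(2) critical'(1)] unfolding f1 ip iv1 Y_def .
    moreover have "c * ((p\<^sup>2 - 1) * nsq - p / 3 * c\<^sup>2 * Y) = (p\<^sup>2 - 1) * (c * nsq) + p * \<delta> * 0 + - (p / 3) * c ^ 3 * Y"
      by (simp add: algebra_simps power2_eq_square power3_eq_cube)
    ultimately have "c * ((p\<^sup>2 - 1) * nsq - p / 3 * c\<^sup>2 * Y) = 0" by (simp only:)
    then have "(p\<^sup>2 - 1) * nsq = p / 3 * c\<^sup>2 * Y" using cpos by simp
    then have "p\<^sup>2 - 1 = p / 3 * c\<^sup>2 * Y / nsq" using nsq_pos by (simp add: eq_divide_eq)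
    also have "\<dots> = 2 * p * (c\<^sup>2 * detuning w)" by (simp add: detuning_def Y_def)
    finally have pw2: "p\<^sup>2 - 1 = 2 * p * (c\<^sup>2 * detuning w)" .
    have pw: "p = period_ratio (c\<^sup>2, w)"
    proof -
      define e where "e = c\<^sup>2 * detuning w"
      have pe: "p\<^sup>2 = 1 + 2 * p * e" using pw2 unfolding e_def by linarith
      have "(p - e)\<^sup>2 = 1 + e\<^sup>2" using pe by (simp add: power2_diff)
      moreover have "p - e \<ge> 0"
      proof -
        have "2 * p * (p - e) = 2 * p\<^sup>2 - 2 * p * e" by (simp add: power2_eq_square algebra_simps)
        then have "2 * p * (p - e) = p\<^sup>2 + 1" using pe by simp
        then have "0 \<le> 2 * p * (p - e)" by simp
        then show ?thesis using pp by (simp add: zero_le_mult_iff)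
      qed
      ultimately have "p - e = sqrt (1 + e\<^sup>2)" by (metis real_sqrt_unique)
      then show ?thesis by (simp add: period_ratio_def e_def)
    qed
    have st: "step (c\<^sup>2) w w"
    proof -
      have "p - 1 = p * (2 * (c\<^sup>2 * detuning w) * (1 / (1 + p)))"
      proof -
        have "(p - 1) * (1 + p) = 2 * p * (c\<^sup>2 * detuning w)" using pw2 by (simp add: algebra_simps power2_eq_square)
        then show ?thesis using pp by (simp add: field_simps)
      qed
      then have F: "(1 / c) *\<^sub>R f t = c\<^sup>2 *\<^sub>R force t (c\<^sup>2, w)" for t
        unfolding f_def force_def pw[symmetric] uw cube_scaleR matrix_vector_mult_scaleR fst_conv snd_conv
        using cpos pw2 \<delta>w by (simp add: scaleR_add_right scaleR_diff_right mult_ac power3_eq_cube power2_eq_square)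
      have "linear_solution (\<lambda>t. (1 / c) *\<^sub>R f (t - 0)) (\<lambda>t. (1 / c) *\<^sub>R (u (t - 0) - c *\<^sub>R z0 (t - 0)))
          (\<lambda>t. (1 / c) *\<^sub>R (v (t - 0) - c *\<^sub>R z1 (t - 0)))"
        by (rule linear_solution_transform[OF ls]) (simp_all add: matrix_vector_mult_scaleR)
      then show ?thesis using cpos by (simp add: step_def F w scaleR_diff_right)
    qed
    have "w = W (c\<^sup>2)" by (rule W[OF _ _ st]) (use cs adm ball in auto)
    then show "0 < c" "c\<^sup>2 \<le> s0" "\<delta> = c\<^sup>2 * excess (W (c\<^sup>2))" "p = period_ratio (c\<^sup>2, W (c\<^sup>2))"
       "u t = c *\<^sub>R pos (W (c\<^sup>2)) t" for t
      using cpos cs \<delta>w pw uw(1) by auto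
  qed
qed

section \<open>Amplitude and phase\<close>

text \<open>The length of the projection of \<open>u\<close> to the plane of \<open>z0\<close> and \<open>z1\<close>, in units of \<open>z0\<close>; it is invariant
  under time shifts.\<close>

definition critical_amplitude :: "(real \<Rightarrow> real ^ 'n) \<Rightarrow> real" where
  "critical_amplitude u = sqrt ((cycle_integral (\<lambda>t. u t \<bullet> z0 t))\<^sup>2 + (cycle_integral (\<lambda>t. u t \<bullet> z1 t))\<^sup>2) / nsq"

lemma cycle_solution_shift:
  assumes "cycle_solution \<delta> p u v"
  shows "cycle_solution \<delta> p (\<lambda>t. u (t + \<phi>)) (\<lambda>t. v (t + \<phi>))"
  using assms unfolding cycle_solution_def
  by (auto simp: periodic_2pi_def add.assoc add.commute[of "2 * pi"] intro!: has_vector_derivative_shift)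
     (simp_all add: add.assoc[symmetric])

text \<open>A time shift rotates the plane of \<open>z0\<close> and \<open>z1\<close>, so the phase can be normalised.\<close>

lemma normalise_phase:
  assumes u: "continuous_on UNIV u" "periodic_2pi u"
  obtains \<phi> where "cycle_integral (\<lambda>t. u (t + \<phi>) \<bullet> z0 t) = critical_amplitude u * nsq"
    "cycle_integral (\<lambda>t. u (t + \<phi>) \<bullet> z1 t) = 0"
proof -
  define x where "x = cycle_integral (\<lambda>t. u t \<bullet> z0 t)"
  define y where "y = cycle_integral (\<lambda>t. u t \<bullet> z1 t)"
  have i: "(\<lambda>t. a * (u t \<bullet> wave p q t)) integrable_on {0..2 * pi}" for a p q
    by (intro integrable_on_cycle continuous_intros u continuous_wave)
  obtain \<phi> where \<phi>: "Complex x (- y) = rcis (cmod (Complex x (- y))) \<phi>"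
    by (metis rcis_cmod_Arg)
  define r where "r = cmod (Complex x (- y))"
  have xy: "x = r * cos \<phi>" "y = - (r * sin \<phi>)"
    using \<phi> by (simp_all add: rcis_def complex_eq_iff r_def)
  have r: "r = critical_amplitude u * nsq"
    using nsq_pos by (simp add: critical_amplitude_def r_def x_def y_def complex_norm)
  have shift: "cycle_integral (\<lambda>t. u (t + \<phi>) \<bullet> wave p q t) = cycle_integral (\<lambda>t. u t \<bullet> wave p q (t + (- \<phi>)))" for p q
  proof -
    have "cycle_integral (\<lambda>t. u (t + \<phi>) \<bullet> wave p q (t + \<phi> + (- \<phi>))) = cycle_integral (\<lambda>t. u t \<bullet> wave p q (t + (- \<phi>)))"
      by (rule cycle_integral_shift)
         (use u(2) periodic_wave[of p q] in \<open>auto simp: periodic_2pi_def diff_add_eq[symmetric] intro!: continuous_intros u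
            continuous_on_compose2[OF continuous_wave[of UNIV]]\<close>)
    then show ?thesis by simp
  qed
  have "cycle_integral (\<lambda>t. u (t + \<phi>) \<bullet> z0 t) = cycle_integral (\<lambda>t. cos \<phi> * (u t \<bullet> z0 t) - sin \<phi> * (u t \<bullet> z1 t))"
    unfolding shift wave_shift by (simp add: inner_diff_right)
  also have "\<dots> = cos \<phi> * x - sin \<phi> * y"
    unfolding integral_diff[OF i i] by (simp add: x_def y_def)
  also have "\<dots> = r"
    unfolding xy by (simp add: algebra_simps) (metis mult.commute mult.left_commute mult.right_neutral power2_eq_square ring_class.ring_distribs(1) sin_cos_squared_add2)
  finally have 1: "cycle_integral (\<lambda>t. u (t + \<phi>) \<bullet> z0 t) = r" .
  have w: "wave (- p0) (- q0) t = - z0 t" for t by (simp add: wave_def)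
  have "cycle_integral (\<lambda>t. u (t + \<phi>) \<bullet> z1 t) = cycle_integral (\<lambda>t. cos \<phi> * (u t \<bullet> z1 t) - (- sin \<phi>) * (u t \<bullet> z0 t))"
    unfolding shift wave_shift by (simp add: inner_add_right w)
  also have "\<dots> = cos \<phi> * y + sin \<phi> * x"
    unfolding integral_diff[OF i i] by (simp add: x_def y_def)
  also have "\<dots> = 0" unfolding xy by simp
  finally show ?thesis using that 1 r by simp
qed

lemma continuous_apply_state: "continuous_on A (\<lambda>x. pos (fst x) (snd x))"
proof -
  have "continuous_on UNIV (\<lambda>x. pos (fst x) (snd x))"
    unfolding continuous_on_iff
  proof (intro ballI allI impI)
    fix x :: "'n state \<times> real" and e :: real assume e: "e > 0"
    have "continuous_on UNIV (pos (fst x))" by (rule continuous_pos)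
    then obtain d where d: "d > 0" "\<And>t. dist t (snd x) < d \<Longrightarrow> dist (pos (fst x) t) (pos (fst x) (snd x)) < e / 2"
      using e unfolding continuous_on_iff by (metis UNIV_I half_gt_zero)
    show "\<exists>d>0. \<forall>x'\<in>UNIV. dist x' x < d \<longrightarrow> dist (pos (fst x') (snd x')) (pos (fst x) (snd x)) < e"
    proof (intro exI[of _ "min d (e / 2)"] conjI ballI impI)
      fix x' assume x': "dist x' x < min d (e / 2)"
      have "dist (pos (fst x') (snd x')) (pos (fst x) (snd x')) < e / 2"
        using pos_diff_le[of "fst x'" "snd x'" "fst x"] dist_fst_le[of x' x] x' by (simp add: dist_norm)
      moreover have "dist (pos (fst x) (snd x')) (pos (fst x) (snd x)) < e / 2"
        using d(2)[of "snd x'"] dist_snd_le[of x' x] x' by simp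
      ultimately show "dist (pos (fst x') (snd x')) (pos (fst x) (snd x)) < e"
        using dist_triangle_half_r by (metis dist_commute dist_triangle_half_l)
    qed (use d e in auto)
  qed
  then show ?thesis by (rule continuous_on_subset) simp
qed

lemma critical_harmonic_wave:
  assumes "N *v p = 0" "N *v q = 0"
  shows "critical_harmonic (wave p q) t = pi *\<^sub>R wave p q t"
proof -
  have i: "(\<lambda>s. (g s * h s) *\<^sub>R x) integrable_on {0..2 * pi}"
    if "g \<in> {cos, sin}" "h \<in> {cos, sin}" for g h :: "real \<Rightarrow> real" and x :: "real ^ 'n"
    using that by (intro integrable_on_cycle) (auto intro!: continuous_intros)
  have v: "cycle_integral (\<lambda>s. (g s * h s) *\<^sub>R x) = cycle_integral (\<lambda>s. g s * h s) *\<^sub>R x"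
    if "g \<in> {cos, sin}" "h \<in> {cos, sin}" for g h :: "real \<Rightarrow> real" and x :: "real ^ 'n"
  proof -
    have "(\<lambda>s. g s * h s) integrable_on {0..2 * pi}"
      using that by (intro integrable_on_cycle) (auto intro!: continuous_intros)
    from integral_linear[OF this bounded_linear_scaleR_left, of x] show ?thesis by (simp add: o_def)
  qed
  have "cycle_integral (\<lambda>s. cos s *\<^sub>R wave p q s) = cycle_integral (\<lambda>s. (cos s * cos s) *\<^sub>R p + (cos s * sin s) *\<^sub>R q)"
    by (simp add: wave_def scaleR_add_right)
  also have "\<dots> = pi *\<^sub>R p" by (subst integral_add) (simp_all add: i v cycle_integrals_trig)
  finally have 1: "cycle_integral (\<lambda>s. cos s *\<^sub>R wave p q s) = pi *\<^sub>R p" .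
  have "cycle_integral (\<lambda>s. sin s *\<^sub>R wave p q s) = cycle_integral (\<lambda>s. (sin s * cos s) *\<^sub>R p + (sin s * sin s) *\<^sub>R q)"
    by (simp add: wave_def scaleR_add_right)
  also have "\<dots> = pi *\<^sub>R q" by (subst integral_add) (simp_all add: i v cycle_integrals_trig)
  finally have 2: "cycle_integral (\<lambda>s. sin s *\<^sub>R wave p q s) = pi *\<^sub>R q" .
  show ?thesis
    unfolding critical_harmonic_def 1 2
    by (simp add: linear_cmul[OF linear_kernel_proj] kernel_proj_id assms wave_def scaleR_add_right mult.commute)
qed

text \<open>Every symmetry of an admissible function is a symmetry of its critical harmonic \<open>z0\<close>.\<close>

lemma admissible_symmetry_wave:
  assumes w: "w \<in> admissible" and R: "linear R" "\<And>x. R (N *v x) = N *v R x"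
    and sym: "\<And>t. R (pos w (t - c)) = pos w t"
  shows "R (z0 (t - c)) = z0 t"
proof -
  have "no_critical_harmonic (\<lambda>t. pos w t - z0 t)"
  proof (rule no_critical_harmonicI)
    have i: "(\<lambda>t. pos w t \<bullet> wave p q t) integrable_on {0..2 * pi}" "(\<lambda>t. z0 t \<bullet> wave p q t) integrable_on {0..2 * pi}" for p q
      by (intro integrable_on_cycle continuous_intros continuous_pos continuous_wave)+
    show "cycle_integral (\<lambda>t. (pos w t - z0 t) \<bullet> z0 t) = 0" "cycle_integral (\<lambda>t. (pos w t - z0 t) \<bullet> z1 t) = 0"
      unfolding inner_diff_left integral_diff[OF i] by (simp_all add: admissibleD[OF w] wave_inner)
    show "continuous_on UNIV (\<lambda>t. pos w t - z0 t)" by (intro continuous_intros continuous_pos continuous_wave)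
    show "periodic_2pi (\<lambda>t. pos w t - z0 t)" using admissibleD(1)[OF w] periodic_wave[of p0 q0] by (simp add: periodic_2pi_def)
    show "symmetric (\<lambda>t. pos w t - z0 t)" by (intro symmetric_diff admissibleD[OF w] symmetric_z0)
  qed
  moreover have "cycle_integral (\<lambda>t. g t *\<^sub>R (pos w t - z0 t)) =
      cycle_integral (\<lambda>t. g t *\<^sub>R pos w t) - cycle_integral (\<lambda>t. g t *\<^sub>R z0 t)" if "continuous_on UNIV g" for g
    unfolding scaleR_diff_right
    by (rule integral_diff; rule integrable_on_cycle; intro continuous_intros that continuous_pos continuous_wave)
  ultimately have "critical_harmonic (pos w) = critical_harmonic z0"
    by (simp add: no_critical_harmonic_def critical_harmonic_def continuous_on_cos continuous_on_sin linear_diff[OF linear_kernel_proj])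
  then have ch: "critical_harmonic (pos w) t = pi *\<^sub>R z0 t" for t by (simp add: critical_harmonic_wave critical)
  have inv: "(\<lambda>t. R (pos w (t - c))) = pos w" by (rule ext) (rule sym)
  have "pi *\<^sub>R z0 t = R (pi *\<^sub>R z0 (t - c))"
    using critical_harmonic_transform[OF continuous_pos admissibleD(1)[OF w] R, of c t] unfolding inv ch .
  then have "pi *\<^sub>R z0 t = pi *\<^sub>R R (z0 (t - c))" unfolding linear_cmul[OF R(1)] .
  then show ?thesis by simp
qed

text \<open>The branch, parametrised by its critical amplitude \<open>c\<close>, and its local uniqueness.\<close>

theorem branch:
  obtains c0 \<eta> M :: real and \<delta> p :: "real \<Rightarrow> real" and u :: "real \<Rightarrow> real \<Rightarrow> real ^ 'n" where
    "c0 > 0" "\<eta> > 0"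
    "\<And>c. c \<in> {0<..c0} \<Longrightarrow> \<exists>v. cycle_solution (\<delta> c) (p c) (u c) v"
    "\<And>c. c \<in> {0<..c0} \<Longrightarrow> symmetric (u c)" "\<And>c. c \<in> {0<..c0} \<Longrightarrow> p c > 0"
    "\<And>c R \<theta> t. c \<in> {0<..c0} \<Longrightarrow> linear R \<Longrightarrow> (\<And>x. R (N *v x) = N *v R x) \<Longrightarrow>
       (\<And>t. R (u c (t - \<theta>)) = u c t) \<Longrightarrow> R (z0 (t - \<theta>)) = z0 t"
    "\<And>c t. c \<in> {0<..c0} \<Longrightarrow> norm (u c t) \<le> M * c"
    "continuous_on {0..c0} \<delta>" "continuous_on {0..c0} p" "continuous_on ({0..c0} \<times> UNIV) (\<lambda>(c, t). u c t)"
    "\<delta> 0 = 0" "p 0 = 1"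
    "\<And>\<delta>' p' w v. cycle_solution \<delta>' p' w v \<Longrightarrow> symmetric w \<Longrightarrow> \<bar>\<delta>'\<bar> \<le> \<eta> \<Longrightarrow> \<bar>p' - 1\<bar> \<le> \<eta> \<Longrightarrow> (\<And>t. norm (w t) \<le> \<eta>) \<Longrightarrow>
       \<exists>t. w t \<noteq> 0 \<Longrightarrow> \<exists>c \<phi>. c = critical_amplitude w \<and> c \<in> {0<..c0} \<and> \<delta>' = \<delta> c \<and> p' = p c \<and> (\<forall>t. w (t + \<phi>) = u c t)"
proof -
  obtain s0 L W where s0: "0 < s0" "s0 \<le> 1" and L: "L \<ge> 0"
    and W: "\<And>s. s \<in> {0..s0} \<Longrightarrow> W s \<in> admissible \<inter> cball w0 1 \<and> step s (W s) (W s)"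
    and W_unique: "\<And>s w. s \<in> {0..s0} \<Longrightarrow> w \<in> admissible \<inter> cball w0 1 \<Longrightarrow> step s w w \<Longrightarrow> w = W s"
    and W_Lipschitz: "\<And>s r. s \<in> {0..s0} \<Longrightarrow> r \<in> {0..s0} \<Longrightarrow> dist (W s) (W r) \<le> L * \<bar>s - r\<bar>"
    by (rule fixed_point_family) (rule that; assumption)
  obtain \<eta> where \<eta>: "\<eta> > 0" "\<eta> \<le> 1 / 2"
    and uniq: "\<And>\<delta> p u v c. cycle_solution \<delta> p u v \<and> symmetric u \<and> \<bar>\<delta>\<bar> \<le> \<eta> \<and> \<bar>p - 1\<bar> \<le> \<eta> \<and>
       (\<forall>t. norm (u t) \<le> \<eta>) \<and> (\<exists>t. u t \<noteq> 0) \<and> c \<ge> 0 \<and>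
       cycle_integral (\<lambda>t. u t \<bullet> z0 t) = c * nsq \<and> cycle_integral (\<lambda>t. u t \<bullet> z1 t) = 0 \<Longrightarrow>
       0 < c \<and> c\<^sup>2 \<le> s0 \<and> \<delta> = c\<^sup>2 * excess (W (c\<^sup>2)) \<and> p = period_ratio (c\<^sup>2, W (c\<^sup>2)) \<and>
       (\<forall>t. u t = c *\<^sub>R pos (W (c\<^sup>2)) t)"
    using small_solution_normalised[of s0 W, OF s0(1) W_unique] by blast
  define c0 where "c0 = sqrt s0"
  define \<delta> where "\<delta> c = c\<^sup>2 * excess (W (c\<^sup>2))" for c
  define p where "p c = period_ratio (c\<^sup>2, W (c\<^sup>2))" for c
  define u where "u c t = c *\<^sub>R pos (W (c\<^sup>2)) t" for c t
  have sq: "c\<^sup>2 \<in> {0..s0}" if "c \<in> {0..c0}" for c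
    using that s0 power_mono[of c "sqrt s0" 2] by (auto simp: c0_def)
  have sq': "c\<^sup>2 \<in> {0..s0}" if "c \<in> {0<..c0}" for c using sq[of c] that by auto
  have contW: "continuous_on {0..s0} W"
    by (rule lipschitz_on_continuous_on[of L]) (use W_Lipschitz L in \<open>auto simp: lipschitz_on_def dist_real_def\<close>)
  have contW2: "continuous_on {0..c0} (\<lambda>c. W (c\<^sup>2))"
    by (rule continuous_on_compose2[OF contW]) (use sq in \<open>auto intro!: continuous_intros\<close>)
  have contpair: "continuous_on {0..c0} (\<lambda>c. (c\<^sup>2, W (c\<^sup>2)))" by (intro continuous_intros contW2)
  have region: "(\<lambda>c. (c\<^sup>2, W (c\<^sup>2))) ` {0..c0} \<subseteq> region"
  proof (rule image_subsetI)
    fix c assume "c \<in> {0..c0}"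
    from sq[OF this] W[OF sq[OF this]] show "(c\<^sup>2, W (c\<^sup>2)) \<in> region" using s0 by (auto simp: region_def)
  qed
  show ?thesis
  proof (rule that[of c0 \<eta> \<delta> p u "norm w0 + 1"])
    show "c0 > 0" using s0 by (simp add: c0_def)
    show "\<eta> > 0" by fact
    show "\<exists>v. cycle_solution (\<delta> c) (p c) (u c) v" if "c \<in> {0<..c0}" for c
      using step_cycle_solution[of "W (c\<^sup>2)" c] W[OF sq'[OF that]]
      unfolding \<delta>_def p_def u_def by blast
    show "symmetric (u c)" if "c \<in> {0<..c0}" for c
      using W[OF sq'[OF that]] unfolding u_def by (intro symmetric_scaleR admissibleD(3)) simp
    show "p c > 0" for c by (simp add: p_def period_ratio_pos)
    show "norm (u c t) \<le> (norm w0 + 1) * c" if c: "c \<in> {0<..c0}" for c t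
    proof -
      have 0: "pos 0 t = 0" by (simp add: pos_def zero_bcontfun.rep_eq)
      have "norm (pos (W (c\<^sup>2)) t) \<le> norm w0 + 1"
        using pos_diff_le[of "W (c\<^sup>2)" t 0] dist_triangle[of "W (c\<^sup>2)" 0 w0] W[OF sq'[OF c]] by (simp add: 0 dist_commute)
      then show ?thesis using c by (simp add: u_def mult.commute)
    qed
    show "R (z0 (t - \<theta>)) = z0 t"
      if c: "c \<in> {0<..c0}" and R: "linear R" "\<And>x. R (N *v x) = N *v R x" and sym: "\<And>t. R (u c (t - \<theta>)) = u c t" for c R \<theta> t
    proof (rule admissible_symmetry_wave[OF _ R])
      show "W (c\<^sup>2) \<in> admissible" using W[OF sq'[OF c]] by simp
      show "R (pos (W (c\<^sup>2)) (t - \<theta>)) = pos (W (c\<^sup>2)) t" for t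
        using sym[of t] c unfolding u_def linear_cmul[OF R(1)] by simp
    qed
    show "continuous_on {0..c0} \<delta>"
      unfolding \<delta>_def[abs_def]
      using continuous_on_compose2[OF uniformly_BL_continuous[OF region_BL_excess] contpair region]
      by (auto intro!: continuous_intros)
    show "continuous_on {0..c0} p"
      unfolding p_def[abs_def]
      by (rule continuous_on_compose2[OF uniformly_BL_continuous[OF region_BL_period_ratio] contpair region])
    have "continuous_on ({0..c0} \<times> UNIV) (\<lambda>x. (W ((fst x)\<^sup>2), snd x))"
      by (intro continuous_on_Pair continuous_on_compose2[OF contW2, of _ fst] continuous_intros) auto
    from continuous_on_compose2[OF continuous_apply_state[of UNIV] this]
    show "continuous_on ({0..c0} \<times> UNIV) (\<lambda>(c, t). u c t)"
      unfolding u_def split_beta by (auto intro!: continuous_intros)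
    show "\<delta> 0 = 0" "p 0 = 1" by (simp_all add: \<delta>_def p_def period_ratio_def)
    show "\<exists>c \<phi>. c = critical_amplitude w \<and> c \<in> {0<..c0} \<and> \<delta>' = \<delta> c \<and> p' = p c \<and> (\<forall>t. w (t + \<phi>) = u c t)"
      if sol: "cycle_solution \<delta>' p' w v" and sym: "symmetric w" and small: "\<bar>\<delta>'\<bar> \<le> \<eta>" "\<bar>p' - 1\<bar> \<le> \<eta>" "\<And>t. norm (w t) \<le> \<eta>"
        and nz: "\<exists>t. w t \<noteq> 0" for \<delta>' p' w v
    proof -
      have "continuous_on UNIV w" "periodic_2pi w"
        using sol unfolding cycle_solution_def by (auto intro!: vector_derivative_continuous_on)
      then obtain \<phi> where \<phi>: "cycle_integral (\<lambda>t. w (t + \<phi>) \<bullet> z0 t) = critical_amplitude w * nsq"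
        "cycle_integral (\<lambda>t. w (t + \<phi>) \<bullet> z1 t) = 0"
        by (rule normalise_phase)
      have "critical_amplitude w \<ge> 0" using nsq_pos by (simp add: critical_amplitude_def)
      moreover have "\<exists>t. w (t + \<phi>) \<noteq> 0" using nz by (metis diff_add_cancel)
      ultimately have *: "0 < critical_amplitude w \<and> (critical_amplitude w)\<^sup>2 \<le> s0 \<and>
          \<delta>' = \<delta> (critical_amplitude w) \<and> p' = p (critical_amplitude w) \<and> (\<forall>t. w (t + \<phi>) = u (critical_amplitude w) t)"
        unfolding \<delta>_def p_def u_def
        using cycle_solution_shift[OF sol] symmetric_shift[OF sym] small \<phi> by (intro uniq) blast
      then have "critical_amplitude w \<le> c0" by (simp add: c0_def real_le_rsqrt)
      with * show ?thesis by auto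
    qed
  qed
qed

end

section \<open>The energy balance\<close>

context eigenbasis
begin

text \<open>Multiplying the equation for each eigencomponent by its velocity and integrating over a period
  gives \<open>(\<delta> + \<nu> i) I i = J i\<close>, where \<open>I i\<close> is the mean square velocity and the \<open>J i\<close> add up to the
  positive dissipation \<open>Q\<close> of the nonlinear damping. For the noncritical components the same identity
  shows that \<open>I i\<close> is a small multiple of \<open>Q\<close>, so \<open>\<delta>\<close> times the critical part of the velocity is positive.\<close>

lemma excess_positive:
  "\<exists>\<eta>>0. \<forall>\<delta> T x y. T > 0 \<and> x T = x 0 \<and> y T = y 0 \<and> (\<forall>t. (x has_vector_derivative y t) (at t)) \<and>
     (\<forall>t. (y has_vector_derivative (\<delta> *\<^sub>R y t - x t * x t * y t - x t + N *v y t)) (at t)) \<and>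
     \<bar>\<delta>\<bar> \<le> \<eta> \<and> (\<forall>t. norm (x t) \<le> \<eta>) \<and> (\<exists>t\<in>{0..T}. x t \<noteq> x 0) \<longrightarrow> \<delta> > 0"
proof -
  define d where "d = Min (insert 1 ((\<lambda>i. \<bar>\<nu> i\<bar>) ` {i. \<nu> i \<noteq> 0})) / 2"
  define D where "D = d + (\<Sum>i\<in>UNIV. \<bar>\<nu> i\<bar>)"
  have d: "d > 0" "\<And>i. \<nu> i \<noteq> 0 \<Longrightarrow> 2 * d \<le> \<bar>\<nu> i\<bar>"
    by (auto simp: d_def)
  have D: "\<And>i. d + \<bar>\<nu> i\<bar> \<le> D" "D > 0"
  proof -
    show *: "d + \<bar>\<nu> i\<bar> \<le> D" for i
      unfolding D_def using member_le_sum[of i UNIV "\<lambda>i. \<bar>\<nu> i\<bar>"] by simp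
    show "D > 0" using *[of undefined] d(1) abs_ge_zero[of "\<nu> undefined"] by linarith
  qed
  define m where "m = real (CARD('n))"
  have m: "m > 0" by (simp add: m_def)
  define \<eta> where "\<eta> = min d (sqrt (d\<^sup>2 / (2 * m * D)))"
  have \<eta>: "\<eta> > 0" "\<eta> \<le> d" "m * (D * (\<eta>\<^sup>2 / d\<^sup>2)) < 1"
  proof -
    show "\<eta> > 0" "\<eta> \<le> d" using d(1) D(2) m by (auto simp: \<eta>_def)
    have "\<eta>\<^sup>2 \<le> (sqrt (d\<^sup>2 / (2 * m * D)))\<^sup>2" using \<open>\<eta> > 0\<close> by (intro power_mono) (auto simp: \<eta>_def)
    then have "\<eta>\<^sup>2 \<le> d\<^sup>2 / (2 * m * D)" using m D(2) by simp
    then have "\<eta>\<^sup>2 * (2 * m * D) \<le> d\<^sup>2" using m D(2) by (simp add: pos_le_divide_eq)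
    then have "2 * (m * (D * (\<eta>\<^sup>2 / d\<^sup>2))) \<le> 1" using d(1) by (simp add: divide_le_eq mult_ac)
    then show "m * (D * (\<eta>\<^sup>2 / d\<^sup>2)) < 1" by simp
  qed
  have "\<delta> > 0" if T: "T > 0" and ends: "x T = x 0" "y T = y 0" and x: "\<And>t. (x has_vector_derivative y t) (at t)"
     and y: "\<And>t. (y has_vector_derivative (\<delta> *\<^sub>R y t - x t * x t * y t - x t + N *v y t)) (at t)"
     and \<delta>: "\<bar>\<delta>\<bar> \<le> \<eta>" and small: "\<And>t. norm (x t) \<le> \<eta>" and nc: "\<exists>t\<in>{0..T}. x t \<noteq> x 0" for \<delta> T x y
  proof -
    define g where "g t = x t * x t * y t" for t
    have cont: "continuous_on S x" "continuous_on S y" for S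
      by (rule vector_derivative_continuous_on[OF x], rule vector_derivative_continuous_on[OF y])
    have contg: "continuous_on S g" for S
      unfolding g_def[abs_def] by (intro bounded_bilinear.continuous_on[OF bounded_bilinear_vec_mult] cont)
    have int: "h integrable_on {0..T}" if "continuous_on UNIV h" for h :: "real \<Rightarrow> real"
      by (rule integrable_continuous_interval) (rule continuous_on_subset[OF that], simp)
    have int': "h integrable_on {0..T}" if "continuous_on {0..T} h" for h :: "real \<Rightarrow> real"
      by (rule integrable_continuous_interval) (rule that)
    define Q where "Q = integral {0..T} (\<lambda>t. y t \<bullet> g t)"
    define I where "I i = integral {0..T} (\<lambda>t. (b i \<bullet> y t)\<^sup>2)" for i
    define J where "J i = integral {0..T} (\<lambda>t. (b i \<bullet> y t) * (b i \<bullet> g t))" for i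
    have I0: "I i \<ge> 0" for i unfolding I_def
      by (rule integral_nonneg) (auto intro!: int continuous_intros cont)
    have balance: "(\<delta> + \<nu> i) * I i = J i" for i
    proof -
      have bx: "((\<lambda>t. b i \<bullet> x t) has_vector_derivative b i \<bullet> y t) (at t)" for t
        by (rule bounded_linear.has_vector_derivative[OF bounded_linear_inner_right x])
      have by': "((\<lambda>t. b i \<bullet> y t) has_vector_derivative (\<delta> + \<nu> i) * (b i \<bullet> y t) - b i \<bullet> g t - b i \<bullet> x t) (at t)" for t
        using bounded_linear.has_vector_derivative[OF bounded_linear_inner_right y, of "b i" t]
        by (simp add: inner_add_right inner_diff_right coeff_mult g_def algebra_simps)
      have "((\<lambda>t. ((b i \<bullet> x t) * (b i \<bullet> x t) + (b i \<bullet> y t) * (b i \<bullet> y t)) / 2) has_vector_derivative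
          (\<delta> + \<nu> i) * (b i \<bullet> y t)\<^sup>2 - (b i \<bullet> y t) * (b i \<bullet> g t)) (at t)" for t
        using has_vector_derivative_divide[OF has_vector_derivative_add[OF has_vector_derivative_mult[OF bx bx]
            has_vector_derivative_mult[OF by' by']], of 2 t]
        by (simp add: algebra_simps power2_eq_square add_divide_distrib diff_divide_distrib)
      from integral_vector_derivative_eq_0[OF _ this] T ends
      have "integral {0..T} (\<lambda>t. (\<delta> + \<nu> i) * (b i \<bullet> y t)\<^sup>2 - (b i \<bullet> y t) * (b i \<bullet> g t)) = 0" by simp
      then have "integral {0..T} (\<lambda>t. (\<delta> + \<nu> i) * (b i \<bullet> y t)\<^sup>2) - J i = 0"
        unfolding J_def by (subst (asm) integral_diff) (auto intro!: int' continuous_intros cont contg)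
      then show ?thesis by (simp add: I_def)
    qed
    have QJ: "Q = (\<Sum>i\<in>UNIV. J i)"
      unfolding Q_def J_def
      by (subst integral_sum[symmetric]) (auto intro!: int' continuous_intros cont contg simp: inner_eq_sum[symmetric])
    have yg: "y t \<bullet> g t = (\<Sum>i\<in>UNIV. (x t $ i * y t $ i)\<^sup>2)" for t
      by (simp add: inner_vec_def g_def power2_eq_square mult_ac)
    have yg0: "y t \<bullet> g t \<ge> 0" for t unfolding yg by (simp add: sum_nonneg)
    have gg: "g t \<bullet> g t \<le> \<eta>\<^sup>2 * (y t \<bullet> g t)" for t
    proof -
      have "(x t $ i)\<^sup>2 \<le> \<eta>\<^sup>2" for i
        using component_le_norm_cart[of "x t" i] small[of t] by (simp add: abs_le_square_iff[symmetric])
      then have "(x t $ i)\<^sup>2 * (x t $ i * y t $ i)\<^sup>2 \<le> \<eta>\<^sup>2 * (x t $ i * y t $ i)\<^sup>2" for i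
        by (rule mult_right_mono) simp
      moreover have "g t \<bullet> g t = (\<Sum>i\<in>UNIV. (x t $ i)\<^sup>2 * (x t $ i * y t $ i)\<^sup>2)"
        by (simp add: inner_vec_def g_def power2_eq_square mult_ac)
      ultimately show ?thesis unfolding yg sum_distrib_left by (simp add: sum_mono)
    qed
    have small_I: "I i \<le> \<eta>\<^sup>2 / d\<^sup>2 * Q" if "\<nu> i \<noteq> 0" for i
    proof -
      have "d * I i \<le> \<bar>\<delta> + \<nu> i\<bar> * I i"
        using d(2)[OF that] \<delta> \<eta>(2) by (intro mult_right_mono I0) linarith
      also have "\<dots> = \<bar>J i\<bar>" using balance[of i] I0[of i] by (metis abs_mult abs_of_nonneg)
      also have "\<dots> \<le> integral {0..T} (\<lambda>t. d / 2 * (b i \<bullet> y t)\<^sup>2 + \<eta>\<^sup>2 / (2 * d) * (y t \<bullet> g t))"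
        unfolding J_def real_norm_def[symmetric]
      proof (rule integral_norm_bound_integral)
        show "(\<lambda>t. (b i \<bullet> y t) * (b i \<bullet> g t)) integrable_on {0..T}"
          "(\<lambda>t. d / 2 * (b i \<bullet> y t)\<^sup>2 + \<eta>\<^sup>2 / (2 * d) * (y t \<bullet> g t)) integrable_on {0..T}"
          using d(1) by (auto intro!: int' continuous_intros cont contg)
        fix t
        have "(b i \<bullet> g t)\<^sup>2 \<le> (norm (g t))\<^sup>2"
          using coeff_bound[of i "g t"] by (simp add: abs_le_square_iff[symmetric])
        then have 1: "(b i \<bullet> g t)\<^sup>2 \<le> \<eta>\<^sup>2 * (y t \<bullet> g t)" using gg[of t] by (simp add: power2_norm_eq_inner)
        define u where "u = \<bar>b i \<bullet> y t\<bar>"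
        define w where "w = \<bar>b i \<bullet> g t\<bar>"
        have "u * w \<le> d / 2 * u\<^sup>2 + w\<^sup>2 / (2 * d)"
        proof -
          have "0 \<le> (d * u - w)\<^sup>2" by simp
          also have "(d * u - w)\<^sup>2 = 2 * d * (d / 2 * u\<^sup>2 + w\<^sup>2 / (2 * d)) - 2 * d * (u * w)"
            using d(1) by (simp add: power2_eq_square field_simps)
          finally have "2 * d * (u * w) \<le> 2 * d * (d / 2 * u\<^sup>2 + w\<^sup>2 / (2 * d))" by simp
          then show ?thesis using d(1) by simp
        qed
        also have "\<dots> \<le> d / 2 * u\<^sup>2 + \<eta>\<^sup>2 * (y t \<bullet> g t) / (2 * d)"
          using 1 d(1) by (simp add: w_def divide_right_mono)
        finally show "norm ((b i \<bullet> y t) * (b i \<bullet> g t)) \<le> d / 2 * (b i \<bullet> y t)\<^sup>2 + \<eta>\<^sup>2 / (2 * d) * (y t \<bullet> g t)"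
          by (simp add: u_def w_def abs_mult)
      qed
      also have "\<dots> = d / 2 * I i + \<eta>\<^sup>2 / (2 * d) * Q"
        unfolding I_def Q_def
        by (subst integral_add) (use d(1) in \<open>auto intro!: int' continuous_intros cont contg\<close>)
      finally have "d / 2 * I i \<le> \<eta>\<^sup>2 / (2 * d) * Q" by linarith
      then have "2 / d * (d / 2 * I i) \<le> 2 / d * (\<eta>\<^sup>2 / (2 * d) * Q)" using d(1) by (intro mult_left_mono) auto
      then show ?thesis using d(1) by (simp add: power2_eq_square)
    qed
    have Q: "Q > 0"
    proof (rule ccontr)
      assume "\<not> Q > 0"
      have Q0: "Q = 0"
        using \<open>\<not> Q > 0\<close> integral_nonneg[of "\<lambda>t. y t \<bullet> g t" "{0..T}"] yg0
        by (force simp: Q_def intro!: int' continuous_intros cont contg)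
      have "((\<lambda>t. y t \<bullet> g t) has_integral 0) {0..T}"
        using Q0 unfolding Q_def by (metis int' integrable_integral continuous_on_inner cont(2) contg)
      then have z: "y t \<bullet> g t = 0" if "t \<in> {0..T}" for t
        using has_integral_0_cbox_imp_0[of 0 T "\<lambda>t. y t \<bullet> g t" t] that T yg0
        by (auto intro!: continuous_intros cont contg)
      have xy: "x t $ i * y t $ i = 0" if "t \<in> {0..T}" for t i
        using z[OF that] unfolding yg by (simp add: sum_nonneg_eq_0_iff)
      have dx: "((\<lambda>t. x t $ i) has_vector_derivative y t $ i) (at t within A)" for t i A
        by (rule has_vector_derivative_at_within)
           (rule bounded_linear.has_vector_derivative[OF bounded_linear_vec_nth x])
      have sq: "(x t $ i)\<^sup>2 = (x 0 $ i)\<^sup>2" if "t \<in> {0..T}" for t i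
      proof -
        have "((\<lambda>t. x t $ i * x t $ i) has_vector_derivative 0) (at t within {0..T})" if "t \<in> {0..T}" for t
          using has_vector_derivative_mult[OF dx[of i t "{0..T}"] dx[of i t "{0..T}"]] xy[OF that] by (simp add: mult.commute)
        then obtain c where "\<And>t. t \<in> {0..T} \<Longrightarrow> x t $ i * x t $ i = c"
          using has_vector_derivative_zero_constant[of "{0..T}" "\<lambda>t. x t $ i * x t $ i"] by auto
        then show ?thesis using that T by (simp add: power2_eq_square)
      qed
      have "x t $ i = x 0 $ i" if t: "t \<in> {0..T}" for t i
      proof (cases "x 0 $ i = 0")
        case True
        then show ?thesis using sq[OF t, of i] by simp
      next
        case False
        then have "y s $ i = 0" if "s \<in> {0..T}" for s
          using xy[OF that, of i] sq[OF that, of i] by auto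
        then have "((\<lambda>t. x t $ i) has_vector_derivative 0) (at s within {0..T})" if "s \<in> {0..T}" for s
          using dx[of i s "{0..T}"] that by simp
        then obtain c where "\<And>t. t \<in> {0..T} \<Longrightarrow> x t $ i = c"
          using has_vector_derivative_zero_constant[of "{0..T}" "\<lambda>t. x t $ i"] by auto
        then show ?thesis using t T by simp
      qed
      then have "x t = x 0" if "t \<in> {0..T}" for t unfolding vec_eq_iff using that by blast
      then show False using nc by blast
    qed
    have "Q = (\<Sum>i\<in>UNIV. (\<delta> + \<nu> i) * I i)" unfolding QJ balance ..
    also have "\<dots> = (\<Sum>i | \<nu> i = 0. (\<delta> + \<nu> i) * I i) + (\<Sum>i | \<nu> i \<noteq> 0. (\<delta> + \<nu> i) * I i)"
    proof -
      have "(\<Sum>i\<in>{i. \<nu> i = 0} \<union> {i. \<nu> i \<noteq> 0}. (\<delta> + \<nu> i) * I i) =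
          (\<Sum>i | \<nu> i = 0. (\<delta> + \<nu> i) * I i) + (\<Sum>i | \<nu> i \<noteq> 0. (\<delta> + \<nu> i) * I i)"
        by (rule sum.union_disjoint) auto
      moreover have "{i. \<nu> i = 0} \<union> {i. \<nu> i \<noteq> 0} = UNIV" by auto
      ultimately show ?thesis by (simp only:)
    qed
    also have "(\<Sum>i | \<nu> i = 0. (\<delta> + \<nu> i) * I i) = \<delta> * (\<Sum>i | \<nu> i = 0. I i)"
      by (simp add: sum_distrib_left)
    also have "(\<Sum>i | \<nu> i \<noteq> 0. (\<delta> + \<nu> i) * I i) \<le> (\<Sum>i | \<nu> i \<noteq> 0. D * (\<eta>\<^sup>2 / d\<^sup>2 * Q))"
    proof (rule sum_mono)
      fix i assume "i \<in> {i. \<nu> i \<noteq> 0}"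
      then have "I i \<le> \<eta>\<^sup>2 / d\<^sup>2 * Q" using small_I by simp
      moreover have "\<delta> + \<nu> i \<le> D" using D(1)[of i] \<delta> \<eta>(2) by linarith
      ultimately show "(\<delta> + \<nu> i) * I i \<le> D * (\<eta>\<^sup>2 / d\<^sup>2 * Q)"
        using I0[of i] D(2) by (intro mult_mono) auto
    qed
    also have "\<dots> \<le> m * (D * (\<eta>\<^sup>2 / d\<^sup>2 * Q))"
      using D(2) Q unfolding m_def sum_constant
      by (intro mult_right_mono of_nat_mono card_mono) auto
    finally have "Q * (1 - m * (D * (\<eta>\<^sup>2 / d\<^sup>2))) \<le> \<delta> * (\<Sum>i | \<nu> i = 0. I i)" by (simp add: algebra_simps)
    moreover have "Q * (1 - m * (D * (\<eta>\<^sup>2 / d\<^sup>2))) > 0" using Q \<eta>(3) by simp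
    moreover have "(\<Sum>i | \<nu> i = 0. I i) \<ge> 0" by (intro sum_nonneg I0)
    ultimately show "\<delta> > 0"
      using mult_nonpos_nonneg[of \<delta> "\<Sum>i | \<nu> i = 0. I i"] by linarith
  qed
  then show ?thesis using \<eta>(1) by blast
qed

end

section \<open>The eigenbasis of the cube\<close>

lemma exhaust_8: "x = 1 \<or> x = 2 \<or> x = 3 \<or> x = 4 \<or> x = 5 \<or> x = 6 \<or> x = 7 \<or> x = 8" for x :: 8
proof (induct x)
  case (of_int z)
  then have "0 \<le> z" and "z < 8" by simp_all
  then have "z = 0 \<or> z = 1 \<or> z = 2 \<or> z = 3 \<or> z = 4 \<or> z = 5 \<or> z = 6 \<or> z = 7" by arith
  then show ?case by auto
qed

lemma forall_8: "(\<forall>i::8. P i) \<longleftrightarrow> P 1 \<and> P 2 \<and> P 3 \<and> P 4 \<and> P 5 \<and> P 6 \<and> P 7 \<and> P 8"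
  by (metis exhaust_8)

lemma UNIV_8: "UNIV = {1 :: 8, 2, 3, 4, 5, 6, 7, 8}"
  using exhaust_8 by auto

lemma sum_8: "sum f (UNIV :: 8 set) = f 1 + f 2 + f 3 + f 4 + f 5 + f 6 + f 7 + f 8"
  unfolding UNIV_8 by (simp add: ac_simps)

lemma vector_8:
  "(vector [a, b, c, d, e, f, g, h] :: 'a::zero ^ 8) $ 1 = a"
  "(vector [a, b, c, d, e, f, g, h] :: 'a::zero ^ 8) $ 2 = b"
  "(vector [a, b, c, d, e, f, g, h] :: 'a::zero ^ 8) $ 3 = c"
  "(vector [a, b, c, d, e, f, g, h] :: 'a::zero ^ 8) $ 4 = d"
  "(vector [a, b, c, d, e, f, g, h] :: 'a::zero ^ 8) $ 5 = e"
  "(vector [a, b, c, d, e, f, g, h] :: 'a::zero ^ 8) $ 6 = f"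
  "(vector [a, b, c, d, e, f, g, h] :: 'a::zero ^ 8) $ 7 = g"
  "(vector [a, b, c, d, e, f, g, h] :: 'a::zero ^ 8) $ 8 = h"
  unfolding vector_def by auto

lemma cube_vertex_simps:
  "cube_vertex 1 $ 1 = 1" "cube_vertex 1 $ 2 = 1" "cube_vertex 1 $ 3 = 1"
  "cube_vertex 2 $ 1 = - 1" "cube_vertex 2 $ 2 = 1" "cube_vertex 2 $ 3 = 1"
  "cube_vertex 3 $ 1 = - 1" "cube_vertex 3 $ 2 = - 1" "cube_vertex 3 $ 3 = 1"
  "cube_vertex 4 $ 1 = 1" "cube_vertex 4 $ 2 = - 1" "cube_vertex 4 $ 3 = 1"
  "cube_vertex 5 $ 1 = 1" "cube_vertex 5 $ 2 = 1" "cube_vertex 5 $ 3 = - 1"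
  "cube_vertex 6 $ 1 = - 1" "cube_vertex 6 $ 2 = 1" "cube_vertex 6 $ 3 = - 1"
  "cube_vertex 7 $ 1 = - 1" "cube_vertex 7 $ 2 = - 1" "cube_vertex 7 $ 3 = - 1"
  "cube_vertex 8 $ 1 = 1" "cube_vertex 8 $ 2 = - 1" "cube_vertex 8 $ 3 = - 1"
  by (simp_all add: cube_vertex_def vector_8)

text \<open>The monomials without squares in the three coordinates of a vertex, which are the characters of
  the cube graph as a Cayley graph of the group of sign changes. A monomial of degree \<open>d\<close> has the
  eigenvalue \<open>- 2 d\<close>.\<close>

definition walsh :: "8 \<Rightarrow> real ^ 8" where
  "walsh m = (\<chi> j. (vector [1, cube_vertex j $ 1, cube_vertex j $ 2, cube_vertex j $ 3,
     cube_vertex j $ 2 * cube_vertex j $ 3, cube_vertex j $ 3 * cube_vertex j $ 1, cube_vertex j $ 1 * cube_vertex j $ 2,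
     cube_vertex j $ 1 * cube_vertex j $ 2 * cube_vertex j $ 3] :: real ^ 8) $ m)"

definition walsh_degree :: "8 \<Rightarrow> real" where
  "walsh_degree m = (vector [0, 1, 1, 1, 2, 2, 2, 3] :: real ^ 8) $ m"

lemma walsh_simps:
  "walsh 1 $ j = 1" "walsh 2 $ j = cube_vertex j $ 1" "walsh 3 $ j = cube_vertex j $ 2"
  "walsh 4 $ j = cube_vertex j $ 3" "walsh 5 $ j = cube_vertex j $ 2 * cube_vertex j $ 3"
  "walsh 6 $ j = cube_vertex j $ 3 * cube_vertex j $ 1" "walsh 7 $ j = cube_vertex j $ 1 * cube_vertex j $ 2"
  "walsh 8 $ j = cube_vertex j $ 1 * cube_vertex j $ 2 * cube_vertex j $ 3"
  unfolding walsh_def by (simp_all only: vec_lambda_beta vector_8)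

lemma walsh_degree_simps:
  "walsh_degree 1 = 0" "walsh_degree 2 = 1" "walsh_degree 3 = 1" "walsh_degree 4 = 1"
  "walsh_degree 5 = 2" "walsh_degree 6 = 2" "walsh_degree 7 = 2" "walsh_degree 8 = 3"
  unfolding walsh_degree_def by (simp_all only: vector_8)

lemma walsh_orthogonal: "walsh m \<bullet> walsh n = (if m = n then 8 else 0)"
proof -
  have "\<forall>m n. walsh m \<bullet> walsh n = (if m = n then 8 else 0)"
    unfolding forall_8 by (simp add: inner_vec_def sum_8 walsh_simps cube_vertex_simps)
  then show ?thesis by blast
qed

lemma walsh_complete: "(\<Sum>m\<in>UNIV. walsh m $ i * walsh m $ j) = (if i = j then 8 else 0)"
proof -
  have "\<forall>i j. (\<Sum>m\<in>UNIV. walsh m $ i * walsh m $ j) = (if i = j then 8 else 0)"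
    unfolding forall_8 sum_8 by (simp add: walsh_simps cube_vertex_simps)
  then show ?thesis by blast
qed

lemma cube_matrix_walsh: "cube_matrix *v walsh m = (- 2 * walsh_degree m) *\<^sub>R walsh m"
proof -
  have "\<forall>m. \<forall>i. (cube_matrix *v walsh m) $ i = (- 2 * walsh_degree m) * walsh m $ i"
    unfolding forall_8
    by (simp add: matrix_vector_mult_def sum_8 cube_matrix_def vector_8 walsh_simps walsh_degree_simps cube_vertex_simps)
  then show ?thesis by (simp add: vec_eq_iff)
qed

section \<open>The symmetries of the cube\<close>

lemma orthogonal_matrix_inner:
  fixes A :: "real ^ 'n ^ 'n"
  assumes "orthogonal_matrix A"
  shows "(A *v x) \<bullet> (A *v y) = x \<bullet> y"
proof -
  have "orthogonal_transformation ((*v) A)"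
    using assms by (simp add: orthogonal_transformation_matrix matrix_vector_mul_linear)
  then show ?thesis by (simp add: orthogonal_transformation_def)
qed

lemma O4_inner:
  assumes "h \<in> O4"
  shows "cube_vertex (h i) \<bullet> cube_vertex (h j) = cube_vertex i \<bullet> cube_vertex j"
proof -
  obtain A where "orthogonal_matrix A" "\<And>j. A *v cube_vertex j = cube_vertex (h j)"
    using assms by (auto simp: O4_def induces_def)
  then show ?thesis using orthogonal_matrix_inner by metis
qed

text \<open>Neighbouring vertices have the inner product \<open>1\<close>, so the matrix depends only on inner products, which
  the symmetries of the cube preserve.\<close>

lemma cube_matrix_eq:
  "cube_matrix $ i $ j = (if cube_vertex i \<bullet> cube_vertex j = 3 then - 3 else if cube_vertex i \<bullet> cube_vertex j = 1 then 1 else 0)"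
proof -
  have "\<forall>i j. cube_matrix $ i $ j = (if cube_vertex i \<bullet> cube_vertex j = 3 then - 3 else if cube_vertex i \<bullet> cube_vertex j = 1 then 1 else 0)"
    unfolding forall_8 by (simp add: cube_matrix_def vector_8 inner_vec_def sum_3 cube_vertex_simps)
  then show ?thesis by blast
qed

lemma perm_matrix_nth: "bij h \<Longrightarrow> (perm_matrix h *v x) $ h j = x $ j"
  by (simp add: matrix_vector_mult_def perm_matrix_def bij_is_inj inj_eq if_distrib[of "\<lambda>c. c * _"] cong: if_cong)

lemma perm_matrix_mult:
  assumes "h \<in> O4"
  shows "cube_matrix *v (perm_matrix h *v x) = perm_matrix h *v (cube_matrix *v x)"
proof -
  have h: "bij h" using assms by (simp add: O4_def)
  have "(cube_matrix *v (perm_matrix h *v x)) $ i = (perm_matrix h *v (cube_matrix *v x)) $ i" for i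
  proof -
    obtain k where k: "i = h k" using h by (metis bij_pointE)
    have "(cube_matrix *v (perm_matrix h *v x)) $ h k = (\<Sum>j\<in>UNIV. cube_matrix $ h k $ j * (perm_matrix h *v x) $ j)"
      by (simp add: matrix_vector_mult_def)
    also have "\<dots> = (\<Sum>j\<in>UNIV. cube_matrix $ h k $ h j * (perm_matrix h *v x) $ h j)"
      by (rule sum.reindex_bij_betw[OF h, symmetric])
    also have "\<dots> = (\<Sum>j\<in>UNIV. cube_matrix $ k $ j * x $ j)"
      by (simp only: perm_matrix_nth[OF h] cube_matrix_eq O4_inner[OF assms])
    also have "\<dots> = (perm_matrix h *v (cube_matrix *v x)) $ h k"
      by (simp add: perm_matrix_nth[OF h] matrix_vector_mult_def[of cube_matrix])
    finally show ?thesis by (simp add: k)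
  qed
  then show ?thesis by (simp add: vec_eq_iff)
qed

definition act :: "int \<Rightarrow> (8 \<Rightarrow> 8) \<Rightarrow> real ^ 8 \<Rightarrow> real ^ 8" where
  "act r h x = real_of_int r *\<^sub>R (perm_matrix h *v x)"

lemma linear_act: "linear (act r h)"
  by (rule linearI) (simp_all add: act_def matrix_vector_right_distrib matrix_vector_mult_scaleR scaleR_add_right)

lemma act_nth: "bij h \<Longrightarrow> act r h x $ h j = real_of_int r * x $ j"
  by (simp add: act_def perm_matrix_nth)

lemma act_cube:
  assumes "bij h" "r \<in> {1, - 1}"
  shows "act r h (cube x) = cube (act r h x)"
proof -
  have "act r h (cube x) $ i = cube (act r h x) $ i" for i
  proof -
    obtain k where k: "i = h k" using assms(1) by (metis bij_pointE)
    then show ?thesis using assms(2) by (auto simp: act_nth[OF assms(1)])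
  qed
  then show ?thesis by (simp add: vec_eq_iff)
qed

lemma id_O4: "id \<in> O4"
  by (auto simp: O4_def induces_def intro!: exI[of _ "mat 1"] simp: orthogonal_matrix_id)

lemma act_id: "act 1 id x = x" "act (- 1) id x = - x"
proof -
  have "act r id x $ id j = real_of_int r * x $ j" for r j by (rule act_nth) simp
  then show "act 1 id x = x" "act (- 1) id x = - x" by (simp_all add: vec_eq_iff)
qed

section \<open>Linearisation at a bifurcation point\<close>

definition linearisation :: "real \<Rightarrow> real \<Rightarrow> real ^ 8 ^ 8" where
  "linearisation a \<alpha>\<^sub>0 = \<alpha>\<^sub>0 *\<^sub>R mat 1 + (a / 2) *\<^sub>R cube_matrix"

lemma linearisation_mult: "linearisation a \<alpha>\<^sub>0 *v x = \<alpha>\<^sub>0 *\<^sub>R x + (a / 2) *\<^sub>R (cube_matrix *v x)"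
  by (simp add: linearisation_def matrix_vector_mult_add_rdistrib scaleR_matrix_vector_assoc[symmetric])

definition eigenvec :: "8 \<Rightarrow> real ^ 8" where "eigenvec m = (1 / sqrt 8) *\<^sub>R walsh m"

definition growth :: "real \<Rightarrow> real \<Rightarrow> 8 \<Rightarrow> real" where "growth a \<alpha>\<^sub>0 m = \<alpha>\<^sub>0 - a * walsh_degree m"

lemma eigenbasis_cube: "eigenbasis (linearisation a \<alpha>\<^sub>0) eigenvec (growth a \<alpha>\<^sub>0)"
proof
  show "eigenvec i \<bullet> eigenvec j = (if i = j then 1 else 0)" for i j
    by (simp add: eigenvec_def walsh_orthogonal)
  show "(\<Sum>i\<in>UNIV. (eigenvec i \<bullet> x) *\<^sub>R eigenvec i) = x" for x
  proof -
    have "(\<Sum>i\<in>UNIV. (eigenvec i \<bullet> x) *\<^sub>R eigenvec i) $ k = x $ k" for k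
    proof -
      have eq: "(eigenvec i \<bullet> x) * eigenvec i $ k = (walsh i \<bullet> x) * walsh i $ k / 8" for i
        by (simp add: eigenvec_def)
      have "(\<Sum>i\<in>UNIV. (eigenvec i \<bullet> x) *\<^sub>R eigenvec i) $ k = (\<Sum>i\<in>UNIV. (eigenvec i \<bullet> x) * eigenvec i $ k)"
        by simp
      also have "\<dots> = (\<Sum>i\<in>UNIV. (walsh i \<bullet> x) * walsh i $ k) / 8"
        by (simp only: eq sum_divide_distrib)
      also have "\<dots> = (\<Sum>i\<in>UNIV. (\<Sum>j\<in>UNIV. walsh i $ j * x $ j) * walsh i $ k) / 8"
        by (simp add: inner_vec_def)
      also have "(\<Sum>i\<in>UNIV. (\<Sum>j\<in>UNIV. walsh i $ j * x $ j) * walsh i $ k) =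
          (\<Sum>j\<in>UNIV. x $ j * (\<Sum>i\<in>UNIV. walsh i $ j * walsh i $ k))"
        unfolding sum_distrib_left sum_distrib_right by (subst sum.swap) (simp add: mult_ac)
      also have "\<dots> = 8 * x $ k" by (simp add: walsh_complete if_distrib cong: if_cong)
      finally show ?thesis by simp
    qed
    then show ?thesis by (simp add: vec_eq_iff)
  qed
  show "linearisation a \<alpha>\<^sub>0 *v eigenvec i = growth a \<alpha>\<^sub>0 i *\<^sub>R eigenvec i" for i
    unfolding linearisation_mult eigenvec_def growth_def matrix_vector_mult_scaleR cube_matrix_walsh
    by (simp add: vec_eq_iff algebra_simps add_divide_distrib diff_divide_distrib)
qed

lemma act_linearisation: "h \<in> O4 \<Longrightarrow> act r h (linearisation a \<alpha>\<^sub>0 *v x) = linearisation a \<alpha>\<^sub>0 *v act r h x"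
  by (simp add: act_def linearisation_mult perm_matrix_mult[symmetric] matrix_vector_right_distrib
      matrix_vector_mult_scaleR scaleR_add_right mult.commute)

definition wave_group :: "real ^ 8 \<Rightarrow> real ^ 8 \<Rightarrow> sym set" where
  "wave_group p q = sym_group (wave p q) (2 * pi)"

definition actions :: "sym set \<Rightarrow> ((real ^ 8 \<Rightarrow> real ^ 8) \<times> real) set" where
  "actions K = (\<lambda>(r, h, \<theta>). (act r h, \<theta>)) ` K"

text \<open>The wave solves the linearised equation, and its symmetries determine it there up to a factor and a
  shift of time: these two freedoms are the modulus and the argument of \<open>c + \<i> d\<close>.\<close>

definition critical_pair :: "real \<Rightarrow> real \<Rightarrow> real ^ 8 \<Rightarrow> real ^ 8 \<Rightarrow> bool" where
  "critical_pair a \<alpha>\<^sub>0 p q \<longleftrightarrow> linearisation a \<alpha>\<^sub>0 *v p = 0 \<and> linearisation a \<alpha>\<^sub>0 *v q = 0 \<and> (p \<noteq> 0 \<or> q \<noteq> 0) \<and>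
     (\<forall>p' q'. linearisation a \<alpha>\<^sub>0 *v p' = 0 \<and> linearisation a \<alpha>\<^sub>0 *v q' = 0 \<and> wave_group p q \<subseteq> wave_group p' q' \<longrightarrow>
       (\<exists>c d. p' = c *\<^sub>R p + d *\<^sub>R q \<and> q' = c *\<^sub>R q - d *\<^sub>R p))"

lemma sym_group_iff:
  "(r, h, \<theta>) \<in> sym_group x T \<longleftrightarrow> r \<in> {1, - 1} \<and> h \<in> O4 \<and> \<theta> \<in> {0..<1} \<and> (\<forall>t. act r h (x (t - \<theta> * T)) = x t)"
  by (auto simp: sym_group_def SG_def act_def)

lemma wave_group_iff:
  "(r, h, \<theta>) \<in> wave_group p q \<longleftrightarrow> r \<in> {1, - 1} \<and> h \<in> O4 \<and> \<theta> \<in> {0..<1} \<and>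
     (\<forall>t. act r h (wave p q (t - 2 * pi * \<theta>)) = wave p q t)"
  by (simp add: wave_group_def sym_group_iff mult.commute)

lemma hopf_critical_pair:
  assumes "critical_pair a \<alpha>\<^sub>0 p q"
  shows "hopf (linearisation a \<alpha>\<^sub>0) eigenvec (growth a \<alpha>\<^sub>0) (actions (wave_group p q)) p q"
proof (intro hopf.intro hopf_axioms.intro eigenbasis_cube)
  have E: "\<exists>r h. R = act r h \<and> (r, h, \<theta>) \<in> wave_group p q" if "(R, \<theta>) \<in> actions (wave_group p q)" for R \<theta>
    using that by (auto simp: actions_def)
  show "linear R" if R: "(R, \<theta>) \<in> actions (wave_group p q)" for R \<theta>
    using E[OF R] linear_act by blast
  show "R (linearisation a \<alpha>\<^sub>0 *v x) = linearisation a \<alpha>\<^sub>0 *v R x" if R: "(R, \<theta>) \<in> actions (wave_group p q)" for R \<theta> x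
  proof -
    obtain r h where "R = act r h" "(r, h, \<theta>) \<in> wave_group p q" using E[OF R] by blast
    then show ?thesis using act_linearisation by (simp add: wave_group_iff)
  qed
  show "R (cube x) = cube (R x)" if R: "(R, \<theta>) \<in> actions (wave_group p q)" for R \<theta> x
  proof -
    obtain r h where "R = act r h" "(r, h, \<theta>) \<in> wave_group p q" using E[OF R] by blast
    moreover from this(2) have "r \<in> {1, - 1}" "bij h" unfolding wave_group_iff O4_def by blast+
    ultimately show ?thesis using act_cube by blast
  qed
  have "(- 1, id, 1 / 2) \<in> wave_group p q"
    by (simp add: wave_group_iff id_O4 act_id wave_def)
  moreover have "act (- 1) id = uminus" by (rule ext) (rule act_id)
  ultimately show "(uminus, 1 / 2) \<in> actions (wave_group p q)" unfolding actions_def by force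
  show "linearisation a \<alpha>\<^sub>0 *v p = 0" "linearisation a \<alpha>\<^sub>0 *v q = 0" "p \<noteq> 0 \<or> q \<noteq> 0"
    using assms by (auto simp: critical_pair_def)
  show "R (wave p q (t - 2 * pi * \<theta>)) = wave p q t" if R: "(R, \<theta>) \<in> actions (wave_group p q)" for R \<theta> t
  proof -
    obtain r h where "R = act r h" "(r, h, \<theta>) \<in> wave_group p q" using E[OF R] by blast
    then show ?thesis unfolding wave_group_iff by blast
  qed
  show "\<exists>c d. p' = c *\<^sub>R p + d *\<^sub>R q \<and> q' = c *\<^sub>R q - d *\<^sub>R p"
    if pq: "linearisation a \<alpha>\<^sub>0 *v p' = 0" "linearisation a \<alpha>\<^sub>0 *v q' = 0"
      and inv: "\<And>R \<theta> t. (R, \<theta>) \<in> actions (wave_group p q) \<Longrightarrow> R (wave p' q' (t - 2 * pi * \<theta>)) = wave p' q' t" for p' q'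
  proof -
    have "wave_group p q \<subseteq> wave_group p' q'"
    proof
      fix x assume x: "x \<in> wave_group p q"
      obtain r h \<theta> where rh: "x = (r, h, \<theta>)" by (metis prod.exhaust)
      have "(act r h, \<theta>) \<in> actions (wave_group p q)" using x rh by (force simp: actions_def)
      from inv[OF this] show "x \<in> wave_group p' q'"
        using x unfolding rh wave_group_iff by blast
    qed
    then show ?thesis using assms pq by (auto simp: critical_pair_def)
  qed
qed

section \<open>Translation to the oscillator system\<close>

lemma has_vector_derivative_scale:
  fixes f :: "real \<Rightarrow> 'a::real_normed_vector"
  assumes "(f has_vector_derivative f') (at (c * t))"
  shows "((\<lambda>t. f (c * t)) has_vector_derivative c *\<^sub>R f') (at t)"
proof -
  have "((*) c has_vector_derivative c) (at t)"
    unfolding has_real_derivative_iff_has_vector_derivative[symmetric] by (auto intro!: derivative_eq_intros)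
  from vector_diff_chain_at[OF this assms] show ?thesis by (simp add: o_def)
qed

lemma has_vector_derivative_cube:
  fixes u :: "real \<Rightarrow> real ^ 'n"
  assumes "(u has_vector_derivative u') (at t)"
  shows "((\<lambda>t. (1 / 3) *\<^sub>R cube (u t)) has_vector_derivative u t * u t * u') (at t)"
proof -
  have "((\<lambda>t. cube (u t)) has_vector_derivative (u t * u t) * u' + (u t * u' + u' * u t) * u t) (at t)"
    by (intro bounded_bilinear.has_vector_derivative[OF bounded_bilinear_vec_mult] assms)
  from bounded_linear.has_vector_derivative[OF bounded_linear_scaleR_right this, of "1 / 3"]
  have "((\<lambda>t. (1 / 3) *\<^sub>R cube (u t)) has_vector_derivative (1 / 3) *\<^sub>R ((u t * u t) * u' + (u t * u' + u' * u t) * u t)) (at t)" .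
  moreover have "(1 / 3) *\<^sub>R ((u t * u t) * u' + (u t * u' + u' * u t) * u t) = u t * u t * u'"
    by (simp add: vec_eq_iff algebra_simps)
  ultimately show ?thesis by (simp only:)
qed

lemma vdp_acceleration:
  "(\<alpha> *\<^sub>R 1 - x\<^sup>2) * v - x + (a / 2) *\<^sub>R (cube_matrix *v v) =
   (\<alpha> - \<alpha>\<^sub>0) *\<^sub>R v - x * x * v - x + linearisation a \<alpha>\<^sub>0 *v v"
  by (simp add: linearisation_mult vec_eq_iff power2_eq_square algebra_simps)

locale cube_branch =
  fixes a \<alpha>\<^sub>0 :: real and p0 q0 :: "real ^ 8"
  assumes critical_pair: "critical_pair a \<alpha>\<^sub>0 p0 q0"
begin

sublocale hopf "linearisation a \<alpha>\<^sub>0" eigenvec "growth a \<alpha>\<^sub>0" "actions (wave_group p0 q0)" p0 q0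
  by (rule hopf_critical_pair[OF critical_pair])

text \<open>Differentiating the Lienard form gives the oscillator equation, because \<open>x\<^sup>2 x'\<close> is the derivative
  of \<open>x\<^sup>3 / 3\<close>.\<close>

lemma vdp_of_cycle_solution:
  assumes sol: "cycle_solution \<delta> p u v" and p: "p > 0"
  shows "vdp_solution a (\<alpha>\<^sub>0 + \<delta>) (\<lambda>t. u (t / p))"
proof -
  let ?N = "linearisation a \<alpha>\<^sub>0"
  define x where "x t = u (t / p)" for t
  define w where "w t = p *\<^sub>R v (t / p) + \<delta> *\<^sub>R x t + ?N *v x t - (1 / 3) *\<^sub>R cube (x t)" for t
  have u': "(u has_vector_derivative p\<^sup>2 *\<^sub>R v t + p *\<^sub>R (\<delta> *\<^sub>R u t + ?N *v u t - (1 / 3) *\<^sub>R cube (u t))) (at t)" for t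
    using sol by (simp add: cycle_solution_def)
  have v': "(v has_vector_derivative - u t) (at t)" for t using sol by (simp add: cycle_solution_def)
  have x': "(x has_vector_derivative w t) (at t)" for t
  proof -
    have "(x has_vector_derivative (1 / p) *\<^sub>R (p\<^sup>2 *\<^sub>R v (t / p) + p *\<^sub>R (\<delta> *\<^sub>R u (t / p) + ?N *v u (t / p) - (1 / 3) *\<^sub>R cube (u (t / p))))) (at t)"
      using has_vector_derivative_scale[of u _ "1 / p" t] u'[of "t / p"] by (simp add: x_def[abs_def])
    moreover have "(1 / p) *\<^sub>R (p\<^sup>2 *\<^sub>R v (t / p) + p *\<^sub>R (\<delta> *\<^sub>R u (t / p) + ?N *v u (t / p) - (1 / 3) *\<^sub>R cube (u (t / p)))) = w t"
      unfolding w_def x_def scaleR_add_right scaleR_diff_right scaleR_scaleR using p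
      by (simp add: power2_eq_square)
    ultimately show ?thesis by simp
  qed
  have "((\<lambda>t. v (t / p)) has_vector_derivative (1 / p) *\<^sub>R (- x t)) (at t)" for t
    using has_vector_derivative_scale[of v "- u (t / p)" "1 / p" t] v'[of "t / p"] by (simp add: x_def)
  then have "((\<lambda>t. p *\<^sub>R v (t / p)) has_vector_derivative p *\<^sub>R (1 / p) *\<^sub>R (- x t)) (at t)" for t
    by (rule bounded_linear.has_vector_derivative[OF bounded_linear_scaleR_right])
  then have pv: "((\<lambda>t. p *\<^sub>R v (t / p)) has_vector_derivative - x t) (at t)" for t using p by simp
  have w': "(w has_vector_derivative - x t + \<delta> *\<^sub>R w t + ?N *v w t - x t * x t * w t) (at t)" for t
    unfolding w_def[abs_def]
    by (intro has_vector_derivative_add has_vector_derivative_diff pv has_vector_derivative_cube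
        bounded_linear.has_vector_derivative[OF bounded_linear_scaleR_right]
        bounded_linear.has_vector_derivative[OF matrix_vector_mul_bounded_linear] x'[unfolded w_def])
  have "(w has_vector_derivative ((\<alpha>\<^sub>0 + \<delta>) *\<^sub>R 1 - (x t)\<^sup>2) * w t - x t + (a / 2) *\<^sub>R (cube_matrix *v w t)) (at t)" for t
    using w'[of t] unfolding vdp_acceleration[of _ _ _ _ \<alpha>\<^sub>0] by (simp add: algebra_simps)
  with x' have "vdp_solution a (\<alpha>\<^sub>0 + \<delta>) x" unfolding vdp_solution_def by blast
  then show ?thesis by (simp add: x_def[abs_def])
qed

lemma cycle_solution_of_vdp:
  assumes sol: "vdp_solution a \<alpha> x" and per: "\<And>t. x (t + T) = x t" and T: "T > 0"
  obtains v where "cycle_solution (\<alpha> - \<alpha>\<^sub>0) (T / (2 * pi)) (\<lambda>t. x (T / (2 * pi) * t)) v"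
proof -
  let ?N = "linearisation a \<alpha>\<^sub>0"
  define p where "p = T / (2 * pi)"
  have p: "p > 0" using T by (simp add: p_def)
  define \<delta> where "\<delta> = \<alpha> - \<alpha>\<^sub>0"
  obtain w where x': "\<And>t. (x has_vector_derivative w t) (at t)"
    and w: "\<And>t. (w has_vector_derivative (\<alpha> *\<^sub>R 1 - (x t)\<^sup>2) * w t - x t + (a / 2) *\<^sub>R (cube_matrix *v w t)) (at t)"
    using sol unfolding vdp_solution_def by blast
  have w': "(w has_vector_derivative \<delta> *\<^sub>R w t - x t * x t * w t - x t + ?N *v w t) (at t)" for t
    using w[of t] unfolding vdp_acceleration[of _ _ _ _ \<alpha>\<^sub>0] \<delta>_def .
  have wper: "w (t + T) = w t" for t
  proof -
    have "((\<lambda>t. x (t + T)) has_vector_derivative w (t + T)) (at t)" by (rule has_vector_derivative_shift[OF x'])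
    then have "(x has_vector_derivative w (t + T)) (at t)" by (simp add: per)
    then show ?thesis using x' vector_derivative_unique_at by blast
  qed
  define e where "e t = w t - \<delta> *\<^sub>R x t - ?N *v x t + (1 / 3) *\<^sub>R cube (x t)" for t
  have e': "(e has_vector_derivative - x t) (at t)" for t
  proof -
    have "(e has_vector_derivative (\<delta> *\<^sub>R w t - x t * x t * w t - x t + ?N *v w t) - \<delta> *\<^sub>R w t - ?N *v w t + x t * x t * w t) (at t)"
      unfolding e_def[abs_def]
      by (intro has_vector_derivative_add has_vector_derivative_diff w' has_vector_derivative_cube x'
        bounded_linear.has_vector_derivative[OF bounded_linear_scaleR_right]
        bounded_linear.has_vector_derivative[OF matrix_vector_mul_bounded_linear])
    then show ?thesis by (simp add: algebra_simps)
  qed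
  have pT: "p * (t + 2 * pi) = p * t + T" for t by (simp add: p_def field_simps)
  have "cycle_solution \<delta> p (\<lambda>t. x (p * t)) (\<lambda>t. (1 / p) *\<^sub>R e (p * t))"
    unfolding cycle_solution_def
  proof (intro conjI allI)
    show "periodic_2pi (\<lambda>t. x (p * t))" "periodic_2pi (\<lambda>t. (1 / p) *\<^sub>R e (p * t))"
      by (simp_all only: periodic_2pi_def pT e_def per wper simp_thms)
    show "((\<lambda>t. x (p * t)) has_vector_derivative p\<^sup>2 *\<^sub>R (1 / p) *\<^sub>R e (p * t) +
        p *\<^sub>R (\<delta> *\<^sub>R x (p * t) + ?N *v x (p * t) - (1 / 3) *\<^sub>R cube (x (p * t)))) (at t)" for t
      using has_vector_derivative_scale[OF x', of p t] p
      by (simp add: e_def power2_eq_square scaleR_add_right scaleR_diff_right)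
    show "((\<lambda>t. (1 / p) *\<^sub>R e (p * t)) has_vector_derivative - x (p * t)) (at t)" for t
      using bounded_linear.has_vector_derivative[OF bounded_linear_scaleR_right has_vector_derivative_scale[OF e', of p t], of "1 / p"] p
      by simp
  qed
  then show ?thesis using that by (simp add: p_def \<delta>_def)
qed

lemma symmetric_iff: "symmetric f \<longleftrightarrow> (\<forall>(r, h, \<theta>)\<in>wave_group p0 q0. \<forall>t. act r h (f (t - 2 * pi * \<theta>)) = f t)"
proof
  assume s: "symmetric f"
  show "\<forall>(r, h, \<theta>)\<in>wave_group p0 q0. \<forall>t. act r h (f (t - 2 * pi * \<theta>)) = f t"
  proof (intro ballI, clarify)
    fix r h \<theta> t assume "(r, h, \<theta>) \<in> wave_group p0 q0"
    then have "(act r h, \<theta>) \<in> actions (wave_group p0 q0)" by (force simp: actions_def)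
    then show "act r h (f (t - 2 * pi * \<theta>)) = f t" by (rule symmetricD[OF s])
  qed
next
  assume s: "\<forall>(r, h, \<theta>)\<in>wave_group p0 q0. \<forall>t. act r h (f (t - 2 * pi * \<theta>)) = f t"
  show "symmetric f"
  proof (rule symmetricI)
    fix R \<theta> t assume "(R, \<theta>) \<in> actions (wave_group p0 q0)"
    then obtain r h where "R = act r h" "(r, h, \<theta>) \<in> wave_group p0 q0" by (auto simp: actions_def)
    then show "R (f (t - 2 * pi * \<theta>)) = f t" using s by blast
  qed
qed

text \<open>A time shift by \<open>\<theta>\<close> rotates the plane of \<open>z0\<close> and \<open>z1\<close> by the angle \<open>\<theta>\<close>.\<close>

lemma wave_not_periodic:
  assumes "0 < \<theta>" "\<theta> < 2 * pi" "\<And>t. z0 (t - \<theta>) = z0 t"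
  shows False
proof -
  have 1: "cos \<theta> *\<^sub>R p0 - sin \<theta> *\<^sub>R q0 = p0"
    using assms(3)[of 0] by (simp add: wave_def)
  have 2: "sin \<theta> *\<^sub>R p0 + cos \<theta> *\<^sub>R q0 = q0"
    using assms(3)[of "pi / 2"] by (simp add: wave_def cos_diff sin_diff)
  have "p0 \<bullet> p0 + q0 \<bullet> q0 = (cos \<theta> *\<^sub>R p0 - sin \<theta> *\<^sub>R q0) \<bullet> p0 + (sin \<theta> *\<^sub>R p0 + cos \<theta> *\<^sub>R q0) \<bullet> q0"
    unfolding 1 2 ..
  also have "\<dots> = cos \<theta> * (p0 \<bullet> p0 + q0 \<bullet> q0)" by (simp add: inner_diff_left inner_add_left inner_commute algebra_simps)
  finally have "(1 - cos \<theta>) * (p0 \<bullet> p0 + q0 \<bullet> q0) = 0" unfolding left_diff_distrib by simp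
  then have "cos \<theta> = 1" using nsq_pos by (simp add: nsq_def zero_less_mult_iff)
  then obtain n :: int where n: "\<theta> = of_int n * (2 * pi)" using cos_one_2pi_int by auto
  then have "0 < n" "n < 1" using assms(1,2) by (auto simp: zero_less_mult_iff)
  then show False by simp
qed

text \<open>The solutions have at least the symmetries of \<open>z0\<close> by construction. They have no further ones and no
  smaller period, because every symmetry of a solution is one of its critical harmonic \<open>z0\<close>.\<close>

lemma branch_exists: "\<exists>\<gamma>. is_branch a \<alpha>\<^sub>0 (wave_group p0 q0) \<gamma>"
proof (rule branch)
  fix c0 \<eta> M :: real and \<delta> p :: "real \<Rightarrow> real" and u :: "real \<Rightarrow> real \<Rightarrow> real ^ 8"
  assume c0: "c0 > 0"
    and sol: "\<And>c. c \<in> {0<..c0} \<Longrightarrow> \<exists>v. cycle_solution (\<delta> c) (p c) (u c) v"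
    and sym: "\<And>c. c \<in> {0<..c0} \<Longrightarrow> symmetric (u c)" and p: "\<And>c. c \<in> {0<..c0} \<Longrightarrow> p c > 0"
    and reflect: "\<And>c R \<theta> t. c \<in> {0<..c0} \<Longrightarrow> linear R \<Longrightarrow> (\<And>x. R (linearisation a \<alpha>\<^sub>0 *v x) = linearisation a \<alpha>\<^sub>0 *v R x) \<Longrightarrow>
       (\<And>t. R (u c (t - \<theta>)) = u c t) \<Longrightarrow> R (z0 (t - \<theta>)) = z0 t"
    and bound: "\<And>c t. c \<in> {0<..c0} \<Longrightarrow> norm (u c t) \<le> M * c"
    and cont: "continuous_on {0..c0} \<delta>" "continuous_on {0..c0} p" "continuous_on ({0..c0} \<times> UNIV) (\<lambda>(c, t). u c t)"
    and at0: "\<delta> 0 = 0" "p 0 = 1"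
  have cs: "c0 * s \<in> {0<..c0}" if "s \<in> {0<..<1}" for s using that c0 by (auto intro: mult_left_le)
  have cs': "c0 * s \<in> {0..c0}" if "s \<in> {0..1}" for s using that c0 by (auto intro: mult_left_le)
  define \<alpha> where "\<alpha> s = \<alpha>\<^sub>0 + \<delta> (c0 * s)" for s
  define T where "T s = 2 * pi * p (c0 * s)" for s
  define x where "x s t = u (c0 * s) (t / p (c0 * s))" for s t
  have lim: "((\<lambda>s. f (c0 * s)) \<longlongrightarrow> f 0) (at_right 0)" if "continuous_on {0..c0} f" for f :: "real \<Rightarrow> real"
  proof -
    have "continuous_on {0..1} (\<lambda>s. f (c0 * s))"
      by (rule continuous_on_compose2[OF that]) (use cs' in \<open>auto intro!: continuous_intros\<close>)
    then have "((\<lambda>s. f (c0 * s)) \<longlongrightarrow> f (c0 * 0)) (at 0 within {0..1})"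
      by (auto simp: continuous_on_def dest!: bspec[of _ _ 0])
    then show ?thesis by (simp add: at_within_Icc_at_right)
  qed
  have contc: "continuous_on {0<..<1} (\<lambda>s. f (c0 * s))" if "continuous_on {0..c0} f" for f :: "real \<Rightarrow> real"
    by (rule continuous_on_compose2[OF that]) (use cs' in \<open>auto intro!: continuous_intros\<close>)
  have main: "periodic_vdp_solution a (\<alpha> s) (T s) (x s) \<and> sym_group (x s) (T s) = wave_group p0 q0"
    if s: "s \<in> {0<..<1}" for s
  proof -
    define c where "c = c0 * s"
    have c: "c \<in> {0<..c0}" using cs[OF s] by (simp add: c_def)
    have pc: "p c > 0" by (rule p[OF c])
    have xs: "x s = (\<lambda>t. u c (t / p c))" and Ts: "T s = 2 * pi * p c" by (auto simp: x_def c_def T_def)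
    obtain v where v: "cycle_solution (\<delta> c) (p c) (u c) v" using sol[OF c] by blast
    have per: "u c (t + 2 * pi) = u c t" for t using v by (simp add: cycle_solution_def periodic_2pi_def)
    have no_period: False if "0 < \<theta>" "\<theta> < 2 * pi" and shift: "\<And>t. u c (t + \<theta>) = u c t" for \<theta>
    proof (rule wave_not_periodic[OF that(1,2)])
      have inv: "u c (t - \<theta>) = u c t" for t using shift[of "t - \<theta>"] by simp
      show "z0 (t - \<theta>) = z0 t" for t
        using reflect[OF c linear_id, of \<theta> t] inv by simp
    qed
    have "periodic_vdp_solution a (\<alpha> s) (T s) (x s)"
      unfolding periodic_vdp_solution_def minimal_period_def
    proof (intro conjI allI impI)
      show "vdp_solution a (\<alpha> s) (x s)"
        using vdp_of_cycle_solution[OF v pc] by (simp add: \<alpha>_def c_def[symmetric] xs)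
      show "T s > 0" using pc by (simp add: Ts)
      show "x s (t + T s) = x s t" for t
        using per[of "t / p c"] pc by (simp add: xs Ts add_divide_distrib)
      show "\<not> (\<forall>t. x s (t + S) = x s t)" if S: "0 < S \<and> S < T s" for S
      proof
        assume h: "\<forall>t. x s (t + S) = x s t"
        show False
        proof (rule no_period[of "S / p c"])
          show "0 < S / p c" "S / p c < 2 * pi" using S pc by (auto simp: Ts field_simps)
          show "u c (t + S / p c) = u c t" for t
            using h[rule_format, of "p c * t"] pc by (simp add: xs add_divide_distrib)
        qed
      qed
      show "\<not> x s constant_on UNIV"
      proof
        assume "x s constant_on UNIV"
        then obtain y where y: "\<And>t. x s t = y" by (auto simp: constant_on_def)
        have "u c t = y" for t using y[of "p c * t"] pc by (simp add: xs)
        then show False using no_period[of pi] by simp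
      qed
    qed
    moreover have "sym_group (x s) (T s) = wave_group p0 q0"
    proof -
      have shift: "(\<forall>t. act r h (x s (t - \<theta> * T s)) = x s t) \<longleftrightarrow> (\<forall>t. act r h (u c (t - 2 * pi * \<theta>)) = u c t)" for r h \<theta>
      proof
        assume *: "\<forall>t. act r h (x s (t - \<theta> * T s)) = x s t"
        show "\<forall>t. act r h (u c (t - 2 * pi * \<theta>)) = u c t"
        proof
          fix t
          have "(p c * t - \<theta> * T s) / p c = t - 2 * pi * \<theta>" "p c * t / p c = t"
            using pc by (simp_all add: Ts diff_divide_distrib)
          then show "act r h (u c (t - 2 * pi * \<theta>)) = u c t" using *[rule_format, of "p c * t"] by (simp only: xs)
        qed
      next
        assume *: "\<forall>t. act r h (u c (t - 2 * pi * \<theta>)) = u c t"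
        show "\<forall>t. act r h (x s (t - \<theta> * T s)) = x s t"
        proof
          fix t
          have "(t - \<theta> * T s) / p c = t / p c - 2 * pi * \<theta>"
            using pc by (simp add: Ts diff_divide_distrib)
          then show "act r h (x s (t - \<theta> * T s)) = x s t" using *[rule_format, of "t / p c"] by (simp only: xs)
        qed
      qed
      have "(r, h, \<theta>) \<in> sym_group (x s) (T s) \<longleftrightarrow> (r, h, \<theta>) \<in> wave_group p0 q0" for r h \<theta>
      proof
        assume "(r, h, \<theta>) \<in> sym_group (x s) (T s)"
        then have rh: "r \<in> {1, - 1}" "h \<in> O4" "\<theta> \<in> {0..<1}" and inv: "\<And>t. act r h (u c (t - 2 * pi * \<theta>)) = u c t"
          unfolding sym_group_iff shift by blast+
        have "act r h (z0 (t - 2 * pi * \<theta>)) = z0 t" for t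
          by (rule reflect[OF c linear_act act_linearisation[OF rh(2)] inv])
        then show "(r, h, \<theta>) \<in> wave_group p0 q0" using rh unfolding wave_group_iff by blast
      next
        assume w: "(r, h, \<theta>) \<in> wave_group p0 q0"
        then have "\<forall>t. act r h (u c (t - 2 * pi * \<theta>)) = u c t"
          using sym[OF c] unfolding symmetric_iff by blast
        then show "(r, h, \<theta>) \<in> sym_group (x s) (T s)"
          using w unfolding sym_group_iff shift wave_group_iff by blast
      qed
      then show ?thesis by auto
    qed
    ultimately show ?thesis by blast
  qed
  have "is_branch a \<alpha>\<^sub>0 (wave_group p0 q0) (\<alpha>, T, x)"
    unfolding is_branch.simps
  proof (intro conjI ballI)
    show "periodic_vdp_solution a (\<alpha> s) (T s) (x s)" "sym_group (x s) (T s) = wave_group p0 q0" if "s \<in> {0<..<1}" for s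
      using main[OF that] by blast+
    show "continuous_on {0<..<1} \<alpha>" "continuous_on {0<..<1} T"
      unfolding \<alpha>_def[abs_def] T_def[abs_def] by (intro continuous_intros contc cont)+
    show "(\<alpha> \<longlongrightarrow> \<alpha>\<^sub>0) (at_right 0)"
      unfolding \<alpha>_def[abs_def] using tendsto_add[OF tendsto_const lim[OF cont(1)]] at0 by fastforce
    show "(T \<longlongrightarrow> 2 * pi) (at_right 0)"
      unfolding T_def[abs_def] using tendsto_mult[OF tendsto_const lim[OF cont(2)]] at0 by fastforce
    have "continuous_on ({0<..<1} \<times> UNIV) (\<lambda>y. (c0 * fst y, snd y / p (c0 * fst y)))"
      using p[OF cs] by (intro continuous_intros continuous_on_compose2[OF contc[OF cont(2)], of _ fst]) (auto, force)
    moreover have "(\<lambda>y. (c0 * fst y, snd y / p (c0 * fst y))) ` ({0<..<1} \<times> UNIV) \<subseteq> {0..c0} \<times> UNIV"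
      by (rule image_subsetI) (use cs' in force)
    ultimately show "continuous_on ({0<..<1} \<times> UNIV) (\<lambda>(s, t). x s t)"
      using continuous_on_compose2[OF cont(3)] by (fastforce simp: x_def split_beta)
    show "((\<lambda>s. amplitude (x s)) \<longlongrightarrow> 0) (at_right 0)"
    proof (rule tendsto_sandwich)
      have b: "norm (x s t) \<le> M * (c0 * s)" if "s \<in> {0<..<1}" for s t
        using bound[OF cs[OF that]] by (simp add: x_def)
      have ev: "\<forall>\<^sub>F s in at_right 0. s \<in> {0<..<1::real}" by (rule eventually_at_right_real) simp
      show "\<forall>\<^sub>F s in at_right 0. 0 \<le> amplitude (x s)"
        using ev
      proof eventually_elim
        case (elim s)
        have "norm (x s 0) \<le> amplitude (x s)"
          unfolding amplitude_def by (rule cSUP_upper) (use b[OF elim] in \<open>auto intro!: bdd_aboveI\<close>)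
        then show ?case using norm_ge_zero order_trans by blast
      qed
      show "\<forall>\<^sub>F s in at_right 0. amplitude (x s) \<le> M * (c0 * s)"
        using ev
      proof eventually_elim
        case (elim s)
        show ?case unfolding amplitude_def by (rule cSUP_least) (use b[OF elim] in auto)
      qed
      have "((\<lambda>s. M * (c0 * s)) \<longlongrightarrow> M * (c0 * 0)) (at_right 0)" by (intro tendsto_intros)
      then show "((\<lambda>s. M * (c0 * s)) \<longlongrightarrow> 0) (at_right 0)" by simp
    qed auto
  qed
  then show ?thesis by blast
qed

section \<open>Uniqueness and direction of branches\<close>

lemma branch_cycle:
  assumes br: "is_branch a \<alpha>\<^sub>0 (wave_group p0 q0) (\<alpha>, T, x)" and s: "s \<in> {0<..<1}"
  shows "T s > 0" "\<exists>v. cycle_solution (\<alpha> s - \<alpha>\<^sub>0) (T s / (2 * pi)) (\<lambda>t. x s (T s / (2 * pi) * t)) v"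
    "symmetric (\<lambda>t. x s (T s / (2 * pi) * t))" "norm (x s t) \<le> amplitude (x s)"
    "\<exists>t. x s (T s / (2 * pi) * t) \<noteq> 0"
proof -
  have per: "periodic_vdp_solution a (\<alpha> s) (T s) (x s)" and sym: "sym_group (x s) (T s) = wave_group p0 q0"
    using br s by auto
  show T: "T s > 0" using per by (simp add: periodic_vdp_solution_def minimal_period_def)
  define p where "p = T s / (2 * pi)"
  have p: "p > 0" and Tp: "T s = p * (2 * pi)" using T by (simp_all add: p_def)
  have vdp: "vdp_solution a (\<alpha> s) (x s)" and shift: "\<And>t. x s (t + T s) = x s t" and nc: "\<not> x s constant_on UNIV"
    using per by (auto simp: periodic_vdp_solution_def minimal_period_def)
  obtain v where v: "cycle_solution (\<alpha> s - \<alpha>\<^sub>0) p (\<lambda>t. x s (p * t)) v"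
    using cycle_solution_of_vdp[OF vdp shift T] unfolding p_def by blast
  then show "\<exists>v. cycle_solution (\<alpha> s - \<alpha>\<^sub>0) (T s / (2 * pi)) (\<lambda>t. x s (T s / (2 * pi) * t)) v"
    unfolding p_def by blast
  show "symmetric (\<lambda>t. x s (T s / (2 * pi) * t))"
    unfolding symmetric_iff p_def[symmetric]
  proof (intro ballI, clarify)
    fix r h \<theta> t assume "(r, h, \<theta>) \<in> wave_group p0 q0"
    then have "\<forall>t. act r h (x s (t - \<theta> * T s)) = x s t" unfolding sym[symmetric] sym_group_iff by blast
    then have "act r h (x s (p * t - \<theta> * T s)) = x s (p * t)" by blast
    moreover have "p * t - \<theta> * T s = p * (t - 2 * pi * \<theta>)" by (simp add: Tp algebra_simps)
    ultimately show "act r h (x s (p * (t - 2 * pi * \<theta>))) = x s (p * t)" by simp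
  qed
  have x_eq: "x s t = x s (p * (t / p))" for t using p by simp
  have u: "continuous_on UNIV (\<lambda>t. x s (p * t))" "periodic_2pi (\<lambda>t. x s (p * t))"
    using v unfolding cycle_solution_def by (auto intro!: vector_derivative_continuous_on)
  obtain m where m: "\<And>t. norm (x s (p * t)) \<le> norm (x s (p * m))" using periodic_attains_max[OF u] by blast
  then have "norm (x s t) \<le> norm (x s (p * m))" for t by (subst x_eq) (rule m)
  then show "norm (x s t) \<le> amplitude (x s)"
    unfolding amplitude_def by (intro cSUP_upper bdd_aboveI[of _ "norm (x s (p * m))"]) auto
  show "\<exists>t. x s (T s / (2 * pi) * t) \<noteq> 0"
  proof (rule ccontr)
    assume "\<not> ?thesis"
    then have "x s (p * t) = 0" for t unfolding p_def by blast
    then have "x s t = 0" for t by (subst x_eq)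
    then show False using nc by (auto simp: constant_on_def)
  qed
qed

lemma critical_amplitude_continuous:
  assumes br: "is_branch a \<alpha>\<^sub>0 (wave_group p0 q0) (\<alpha>, T, x)"
  shows "continuous_on {0<..<1} (\<lambda>s. critical_amplitude (\<lambda>t. x s (T s / (2 * pi) * t)))"
proof -
  have T: "continuous_on {0<..<1} T" and x: "continuous_on ({0<..<1} \<times> UNIV) (\<lambda>(s, t). x s t)" using br by auto
  have "continuous_on ({0<..<1} \<times> cbox 0 (2 * pi)) (\<lambda>y. (fst y, T (fst y) / (2 * pi) * snd y))"
    by (intro continuous_intros continuous_on_compose2[OF T, of _ fst]) auto
  from continuous_on_compose2[OF x this]
  have "continuous_on ({0<..<1} \<times> cbox 0 (2 * pi)) (\<lambda>(s, t). x s (T s / (2 * pi) * t))"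
    by (force simp: split_beta)
  then have "continuous_on ({0<..<1} \<times> cbox 0 (2 * pi)) (\<lambda>(s, t). x s (T s / (2 * pi) * t) \<bullet> wave p q t)" for p q
    unfolding split_beta by (intro continuous_intros continuous_on_compose2[OF continuous_wave[of UNIV], of _ snd]) auto
  from integral_continuous_on_param[OF this]
  have "continuous_on {0<..<1} (\<lambda>s. cycle_integral (\<lambda>t. x s (T s / (2 * pi) * t) \<bullet> wave p q t))" for p q
    by (simp add: cbox_interval)
  then show ?thesis unfolding critical_amplitude_def using nsq_pos by (intro continuous_intros) auto
qed

lemma critical_amplitude_bound:
  assumes "continuous_on UNIV u" "\<And>t. norm (u t) \<le> B"
  shows "critical_amplitude u \<le> 4 * pi * (norm p0 + norm q0) / nsq * B"
proof -
  have b: "\<bar>cycle_integral (\<lambda>t. u t \<bullet> wave p q t)\<bar> \<le> 2 * pi * (B * (norm p + norm q))" for p q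
  proof (rule cycle_integral_abs_bound)
    show "continuous_on UNIV (\<lambda>t. u t \<bullet> wave p q t)" by (intro continuous_intros assms continuous_wave)
    show "\<bar>u t \<bullet> wave p q t\<bar> \<le> B * (norm p + norm q)" for t
      by (rule order_trans[OF Cauchy_Schwarz_ineq2 mult_mono[OF assms(2) norm_wave_le]])
         (use order_trans[OF norm_ge_zero assms(2)] in auto)
  qed
  have "critical_amplitude u \<le> (\<bar>cycle_integral (\<lambda>t. u t \<bullet> z0 t)\<bar> + \<bar>cycle_integral (\<lambda>t. u t \<bullet> z1 t)\<bar>) / nsq"
    unfolding critical_amplitude_def using nsq_pos by (intro divide_right_mono sqrt_sum_squares_le_sum_abs) auto
  also have "\<dots> \<le> (2 * pi * (B * (norm p0 + norm q0)) + 2 * pi * (B * (norm q0 + norm (- p0)))) / nsq"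
    using nsq_pos by (intro divide_right_mono add_mono b) auto
  also have "\<dots> = 4 * pi * (norm p0 + norm q0) / nsq * B" by (simp add: algebra_simps)
  finally show ?thesis .
qed

text \<open>Close to the bifurcation point both families run, up to time shifts, through the solutions found
  above, which are indexed by their critical amplitude. Along each family this amplitude is continuous and
  tends to \<open>0\<close>, so by the intermediate value theorem it takes all small positive values, and each family
  meets every small solution of the other.\<close>

lemma branch_unique:
  assumes "is_branch a \<alpha>\<^sub>0 (wave_group p0 q0) \<gamma>" "is_branch a \<alpha>\<^sub>0 (wave_group p0 q0) \<gamma>'"
  shows "germ_le \<gamma> \<gamma>'"
proof (rule branch)
  fix c0 \<eta> M :: real and \<delta> p :: "real \<Rightarrow> real" and u :: "real \<Rightarrow> real \<Rightarrow> real ^ 8"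
  assume \<eta>: "\<eta> > 0"
    and uniq: "\<And>\<delta>' p' w v. cycle_solution \<delta>' p' w v \<Longrightarrow> symmetric w \<Longrightarrow> \<bar>\<delta>'\<bar> \<le> \<eta> \<Longrightarrow> \<bar>p' - 1\<bar> \<le> \<eta> \<Longrightarrow> (\<And>t. norm (w t) \<le> \<eta>) \<Longrightarrow>
       \<exists>t. w t \<noteq> 0 \<Longrightarrow> \<exists>c \<phi>. c = critical_amplitude w \<and> c \<in> {0<..c0} \<and> \<delta>' = \<delta> c \<and> p' = p c \<and> (\<forall>t. w (t + \<phi>) = u c t)"
  define ca where "ca T x s = critical_amplitude (\<lambda>t. x s (T s / (2 * pi) * t))"
    for T :: "real \<Rightarrow> real" and x :: "real \<Rightarrow> real \<Rightarrow> real ^ 8" and s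
  \<comment> \<open>Near the bifurcation point every member of a family is a time shift of a member of \<open>u\<close>.\<close>
  have near: "\<forall>\<^sub>F s in at_right 0. s \<in> {0<..<1} \<and> ca T x s > 0 \<and> \<alpha> s - \<alpha>\<^sub>0 = \<delta> (ca T x s) \<and>
      T s / (2 * pi) = p (ca T x s) \<and> (\<exists>\<phi>. \<forall>t. x s (T s / (2 * pi) * (t + \<phi>)) = u (ca T x s) t)"
    and ca_lim: "(ca T x \<longlongrightarrow> 0) (at_right 0)"
    if br: "is_branch a \<alpha>\<^sub>0 (wave_group p0 q0) (\<alpha>, T, x)" for \<alpha> T x
  proof -
    have amp: "((\<lambda>s. amplitude (x s)) \<longlongrightarrow> 0) (at_right 0)" and al: "(\<alpha> \<longlongrightarrow> \<alpha>\<^sub>0) (at_right 0)"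
      and Tl: "(T \<longlongrightarrow> 2 * pi) (at_right 0)" using br by auto
    have ev: "\<forall>\<^sub>F s in at_right 0. s \<in> {0<..<1::real}" by (rule eventually_at_right_real) simp
    have "\<forall>\<^sub>F s in at_right 0. dist (amplitude (x s)) 0 < \<eta>" by (rule tendstoD[OF amp \<eta>])
    moreover have "\<forall>\<^sub>F s in at_right 0. dist (\<alpha> s) \<alpha>\<^sub>0 < \<eta>" by (rule tendstoD[OF al \<eta>])
    moreover have "((\<lambda>s. T s / (2 * pi)) \<longlongrightarrow> 2 * pi / (2 * pi)) (at_right 0)" by (intro tendsto_intros Tl) simp
    then have "\<forall>\<^sub>F s in at_right 0. dist (T s / (2 * pi)) 1 < \<eta>" using tendstoD[OF _ \<eta>] by force
    ultimately show "\<forall>\<^sub>F s in at_right 0. s \<in> {0<..<1} \<and> ca T x s > 0 \<and> \<alpha> s - \<alpha>\<^sub>0 = \<delta> (ca T x s) \<and>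
      T s / (2 * pi) = p (ca T x s) \<and> (\<exists>\<phi>. \<forall>t. x s (T s / (2 * pi) * (t + \<phi>)) = u (ca T x s) t)"
      using ev
    proof eventually_elim
      case (elim s)
      note bc = branch_cycle[OF br elim(4)]
      obtain v where v: "cycle_solution (\<alpha> s - \<alpha>\<^sub>0) (T s / (2 * pi)) (\<lambda>t. x s (T s / (2 * pi) * t)) v" using bc(2) by blast
      have "norm (x s t) \<le> \<eta>" for t
        using bc(4)[of t] elim(1) by (simp add: dist_real_def)
      then have "\<exists>c \<phi>. c = ca T x s \<and> c \<in> {0<..c0} \<and> \<alpha> s - \<alpha>\<^sub>0 = \<delta> c \<and> T s / (2 * pi) = p c \<and>
          (\<forall>t. x s (T s / (2 * pi) * (t + \<phi>)) = u c t)"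
        unfolding ca_def using elim(2,3) by (intro uniq[OF v bc(3) _ _ _ bc(5)]) (simp_all add: dist_real_def)
      then show ?case using elim(4) unfolding greaterThanAtMost_iff by blast
    qed
    define K where "K = 4 * pi * (norm p0 + norm q0) / nsq"
    show "(ca T x \<longlongrightarrow> 0) (at_right 0)"
    proof (rule tendsto_sandwich)
      show "\<forall>\<^sub>F s in at_right 0. 0 \<le> ca T x s"
        using nsq_pos by (intro always_eventually) (simp add: ca_def critical_amplitude_def)
      show "\<forall>\<^sub>F s in at_right 0. ca T x s \<le> K * amplitude (x s)"
        using ev
      proof eventually_elim
        case (elim s)
        obtain v where v: "cycle_solution (\<alpha> s - \<alpha>\<^sub>0) (T s / (2 * pi)) (\<lambda>t. x s (T s / (2 * pi) * t)) v"
          using branch_cycle(2)[OF br elim] by blast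
        then have "continuous_on UNIV (\<lambda>t. x s (T s / (2 * pi) * t))"
          unfolding cycle_solution_def by (auto intro!: vector_derivative_continuous_on)
        then show ?case unfolding ca_def K_def by (rule critical_amplitude_bound) (rule branch_cycle(4)[OF br elim])
      qed
      show "((\<lambda>s. K * amplitude (x s)) \<longlongrightarrow> 0) (at_right 0)"
        using tendsto_mult[OF tendsto_const amp, of K] by simp
    qed auto
  qed
  obtain \<alpha> T x where \<gamma>: "\<gamma> = (\<alpha>, T, x)" by (metis prod.exhaust)
  obtain \<beta> S y where \<gamma>': "\<gamma>' = (\<beta>, S, y)" by (metis prod.exhaust)
  have br: "is_branch a \<alpha>\<^sub>0 (wave_group p0 q0) (\<alpha>, T, x)" "is_branch a \<alpha>\<^sub>0 (wave_group p0 q0) (\<beta>, S, y)"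
    using assms \<gamma> \<gamma>' by blast+
  show "germ_le \<gamma> \<gamma>'"
    unfolding \<gamma> \<gamma>' germ_le.simps
  proof (intro allI impI)
    fix \<epsilon> :: real assume \<epsilon>: "\<epsilon> > 0"
    obtain e where e: "e > 0" and e': "\<And>s. 0 < s \<Longrightarrow> s < e \<Longrightarrow> s \<in> {0<..<1} \<and> ca S y s > 0 \<and> \<beta> s - \<alpha>\<^sub>0 = \<delta> (ca S y s) \<and>
      S s / (2 * pi) = p (ca S y s) \<and> (\<exists>\<phi>. \<forall>t. y s (S s / (2 * pi) * (t + \<phi>)) = u (ca S y s) t)"
      using near[OF br(2)] unfolding eventually_at_right_field by (metis)
    define s1 where "s1 = min e \<epsilon> / 2"
    have s1: "0 < s1" "s1 < e" "s1 < \<epsilon>" using e \<epsilon> by (auto simp: s1_def)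
    have pos: "ca S y s1 > 0" using e'[OF s1(1,2)] by blast
    have "\<forall>\<^sub>F s in at_right 0. dist (ca T x s) 0 < ca S y s1" by (rule tendstoD[OF ca_lim[OF br(1)] pos])
    then show "\<forall>\<^sub>F s in at_right 0. \<exists>s'\<in>{0<..<\<epsilon>}. \<alpha> s = \<beta> s' \<and> T s = S s' \<and> (\<exists>\<tau>. \<forall>t. x s t = y s' (t + \<tau>))"
      using near[OF br(1)]
    proof eventually_elim
      case (elim s)
      define c where "c = ca T x s"
      have c: "0 < c" "c < ca S y s1" using elim by (auto simp: c_def dist_real_def)
      have "\<forall>\<^sub>F s' in at_right 0. dist (ca S y s') 0 < c" by (rule tendstoD[OF ca_lim[OF br(2)] c(1)])
      moreover have "\<forall>\<^sub>F s' in at_right 0. s' \<in> {0<..<s1}" by (rule eventually_at_right_real[OF s1(1)])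
      ultimately have "\<forall>\<^sub>F s' in at_right (0::real). dist (ca S y s') 0 < c \<and> s' \<in> {0<..<s1}" by (rule eventually_conj)
      then obtain s2 where s2: "dist (ca S y s2) 0 < c" "s2 \<in> {0<..<s1}"
        using eventually_happens[of _ "at_right (0::real)"] by force
      have "continuous_on {s2..s1} (ca S y)"
        unfolding ca_def
        by (rule continuous_on_subset[OF critical_amplitude_continuous[OF br(2)]]) (use s2 e'[OF s1(1,2)] in auto)
      moreover have "ca S y s2 \<le> c" using s2(1) unfolding dist_real_def by linarith
      ultimately obtain s' where s': "s2 \<le> s'" "s' \<le> s1" "ca S y s' = c"
        using IVT'[of "ca S y" s2 c s1] s2 c by (auto simp: dist_real_def)
      have s'0: "0 < s'" "s' < e" "s' < \<epsilon>" using s' s2 s1 by auto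
      note E' = e'[OF s'0(1,2), unfolded s'(3)]
      obtain \<phi>' where \<phi>': "\<And>t. y s' (S s' / (2 * pi) * (t + \<phi>')) = u c t" using E' by blast
      obtain \<phi> where \<phi>: "\<And>t. x s (T s / (2 * pi) * (t + \<phi>)) = u c t" using elim unfolding c_def by blast
      have TS: "T s / (2 * pi) = p c" "S s' / (2 * pi) = p c" using elim E' by (auto simp: c_def)
      have Ts0: "T s > 0" by (rule branch_cycle(1)[OF br(1)]) (use elim in blast)
      then have p0: "p c \<noteq> 0" using TS(1) by (metis divide_pos_pos less_irrefl mult_pos_pos pi_gt_zero zero_less_numeral)
      have "x s t = y s' (t + p c * (\<phi>' - \<phi>))" for t
      proof -
        have "x s t = x s (p c * (t / p c - \<phi> + \<phi>))" using p0 by simp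
        also have "\<dots> = u c (t / p c - \<phi>)" using \<phi>[of "t / p c - \<phi>"] unfolding TS by simp
        also have "\<dots> = y s' (p c * (t / p c - \<phi> + \<phi>'))" using \<phi>'[of "t / p c - \<phi>"] unfolding TS by simp
        also have "p c * (t / p c - \<phi> + \<phi>') = t + p c * (\<phi>' - \<phi>)" using p0 by (simp add: field_simps)
        finally show ?thesis .
      qed
      moreover have "\<alpha> s = \<beta> s'"
      proof -
        have "\<alpha> s - \<alpha>\<^sub>0 = \<beta> s' - \<alpha>\<^sub>0" using elim E' by (simp add: c_def)
        then show ?thesis by simp
      qed
      moreover have "T s = S s'"
      proof -
        have "T s / (2 * pi) = S s' / (2 * pi)" unfolding TS ..
        then show ?thesis by simp
      qed
      ultimately show ?case using s'0 by auto
    qed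
  qed
qed

end

text \<open>The energy balance applies to every nonconstant solution of small amplitude at parameters close to
  \<open>\<alpha>\<^sub>0\<close>.\<close>

lemma branch_supercritical:
  assumes "is_branch a \<alpha>\<^sub>0 K \<gamma>"
  shows "supercritical \<alpha>\<^sub>0 \<gamma>"
proof -
  interpret eigenbasis "linearisation a \<alpha>\<^sub>0" eigenvec "growth a \<alpha>\<^sub>0" by (rule eigenbasis_cube)
  obtain \<alpha> T x where \<gamma>: "\<gamma> = (\<alpha>, T, x)" by (metis prod.exhaust)
  obtain \<eta> where \<eta>: "\<eta> > 0" and pos: "\<And>\<delta> T x y. T > 0 \<and> x T = x 0 \<and> y T = y 0 \<and> (\<forall>t. (x has_vector_derivative y t) (at t)) \<and>
     (\<forall>t. (y has_vector_derivative (\<delta> *\<^sub>R y t - x t * x t * y t - x t + linearisation a \<alpha>\<^sub>0 *v y t)) (at t)) \<and>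
     \<bar>\<delta>\<bar> \<le> \<eta> \<and> (\<forall>t. norm (x t) \<le> \<eta>) \<and> (\<exists>t\<in>{0..T}. x t \<noteq> x 0) \<Longrightarrow> \<delta> > 0"
    using excess_positive by blast
  have amp: "((\<lambda>s. amplitude (x s)) \<longlongrightarrow> 0) (at_right 0)" and al: "(\<alpha> \<longlongrightarrow> \<alpha>\<^sub>0) (at_right 0)"
    and sol: "\<And>s. s \<in> {0<..<1} \<Longrightarrow> periodic_vdp_solution a (\<alpha> s) (T s) (x s)"
    using assms unfolding \<gamma> by auto
  have ev: "\<forall>\<^sub>F s in at_right 0. s \<in> {0<..<1::real}" by (rule eventually_at_right_real) simp
  have "\<forall>\<^sub>F s in at_right 0. dist (amplitude (x s)) 0 < \<eta>" by (rule tendstoD[OF amp \<eta>])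
  moreover have "\<forall>\<^sub>F s in at_right 0. dist (\<alpha> s) \<alpha>\<^sub>0 < \<eta>" by (rule tendstoD[OF al \<eta>])
  ultimately have "\<forall>\<^sub>F s in at_right 0. \<alpha> s > \<alpha>\<^sub>0"
    using ev
  proof eventually_elim
    case (elim s)
    have per: "\<And>t. x s (t + T s) = x s t" and T: "T s > 0" and nc: "\<not> x s constant_on UNIV" and vdp: "vdp_solution a (\<alpha> s) (x s)"
      using sol[OF elim(3)] by (auto simp: periodic_vdp_solution_def minimal_period_def)
    obtain w where x': "\<And>t. (x s has_vector_derivative w t) (at t)"
      and w: "\<And>t. (w has_vector_derivative (\<alpha> s *\<^sub>R 1 - (x s t)\<^sup>2) * w t - x s t + (a / 2) *\<^sub>R (cube_matrix *v w t)) (at t)"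
      using vdp unfolding vdp_solution_def by blast
    have w': "(w has_vector_derivative (\<alpha> s - \<alpha>\<^sub>0) *\<^sub>R w t - x s t * x s t * w t - x s t + linearisation a \<alpha>\<^sub>0 *v w t) (at t)" for t
      using w[of t] unfolding vdp_acceleration[of _ _ _ _ \<alpha>\<^sub>0] .
    have "((\<lambda>t. x s (t + T s)) has_vector_derivative w (0 + T s)) (at 0)" by (rule has_vector_derivative_shift[OF x'])
    then have "(x s has_vector_derivative w (T s)) (at 0)" by (simp add: per)
    then have wT: "w (T s) = w 0" using x' vector_derivative_unique_at by blast
    define p where "p = T s / (2 * pi)"
    have p: "p > 0" and Tp: "T s = p * (2 * pi)" using T by (simp_all add: p_def)
    have u: "continuous_on UNIV (\<lambda>t. x s (p * t))" "periodic_2pi (\<lambda>t. x s (p * t))"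
      using per by (auto simp: periodic_2pi_def distrib_left Tp[symmetric] intro!: continuous_intros
          continuous_on_compose2[OF vector_derivative_continuous_on[OF x', of UNIV]])
    have reduce: "\<exists>t'\<in>{0..T s}. x s t' = x s t" for t
    proof -
      obtain t' where "t' \<in> {0..2 * pi}" "x s (p * t') = x s (p * (t / p))" using periodic_reduce[OF u(2), of "t / p"] by blast
      then show ?thesis using p by (intro bexI[of _ "p * t'"]) (auto simp: Tp)
    qed
    obtain m where m: "\<And>t. norm (x s (p * t)) \<le> norm (x s (p * m))" using periodic_attains_max[OF u] by blast
    have "norm (x s t) \<le> norm (x s (p * m))" for t using m[of "t / p"] p by simp
    then have le: "norm (x s t) \<le> amplitude (x s)" for t
      unfolding amplitude_def by (intro cSUP_upper bdd_aboveI[of _ "norm (x s (p * m))"]) auto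
    have small: "norm (x s t) \<le> \<eta>" for t using le[of t] elim(1) by (simp add: dist_real_def)
    have "\<exists>t\<in>{0..T s}. x s t \<noteq> x s 0"
    proof (rule ccontr)
      assume "\<not> ?thesis"
      then have "x s t = x s 0" for t using reduce[of t] by metis
      then show False using nc unfolding constant_on_def by blast
    qed
    then have "\<alpha> s - \<alpha>\<^sub>0 > 0"
      using T per[of 0] wT x' w' small elim(2) by (intro pos[of "T s" "x s" w]) (auto simp: dist_real_def)
    then show ?case by simp
  qed
  then show ?thesis by (simp add: \<gamma>)
qed

section \<open>The rotations of the cube\<close>

text \<open>All rotations with their matrices and the sign with which they act on the product of the
  three coordinates; it is \<open>- 1\<close> if two of the coordinate axes are interchanged.\<close>

definition rotations :: "((8 \<Rightarrow> 8) \<times> (real ^ 3 ^ 3) \<times> real) set" where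
  "rotations = {
     (cyc [], vector [vector [1, 0, 0], vector [0, 1, 0], vector [0, 0, 1]], 1),
     (cyc [[1,8], [2,7], [3,6], [4,5]], vector [vector [1, 0, 0], vector [0, - 1, 0], vector [0, 0, - 1]], 1),
     (cyc [[1,6], [2,5], [3,8], [4,7]], vector [vector [- 1, 0, 0], vector [0, 1, 0], vector [0, 0, - 1]], 1),
     (cyc [[1,3], [2,4], [5,7], [6,8]], vector [vector [- 1, 0, 0], vector [0, - 1, 0], vector [0, 0, 1]], 1),
     (cyc [[1,4,8,5], [2,3,7,6]], vector [vector [1, 0, 0], vector [0, 0, - 1], vector [0, 1, 0]], - 1),
     (cyc [[1,5,8,4], [2,6,7,3]], vector [vector [1, 0, 0], vector [0, 0, 1], vector [0, - 1, 0]], - 1),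
     (cyc [[1,2], [3,5], [4,6], [7,8]], vector [vector [- 1, 0, 0], vector [0, 0, 1], vector [0, 1, 0]], - 1),
     (cyc [[1,7], [2,8], [3,4], [5,6]], vector [vector [- 1, 0, 0], vector [0, 0, - 1], vector [0, - 1, 0]], - 1),
     (cyc [[1,5], [2,8], [3,7], [4,6]], vector [vector [0, 1, 0], vector [1, 0, 0], vector [0, 0, - 1]], - 1),
     (cyc [[1,2,3,4], [5,6,7,8]], vector [vector [0, - 1, 0], vector [1, 0, 0], vector [0, 0, 1]], - 1),
     (cyc [[1,4,3,2], [5,8,7,6]], vector [vector [0, 1, 0], vector [- 1, 0, 0], vector [0, 0, 1]], - 1),
     (cyc [[1,7], [2,6], [3,5], [4,8]], vector [vector [0, - 1, 0], vector [- 1, 0, 0], vector [0, 0, - 1]], - 1),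
     (cyc [[2,4,5], [3,8,6]], vector [vector [0, 0, 1], vector [1, 0, 0], vector [0, 1, 0]], 1),
     (cyc [[1,6,8], [2,7,4]], vector [vector [0, 0, - 1], vector [1, 0, 0], vector [0, - 1, 0]], 1),
     (cyc [[1,3,6], [4,7,5]], vector [vector [0, 0, - 1], vector [- 1, 0, 0], vector [0, 1, 0]], 1),
     (cyc [[1,8,3], [2,5,7]], vector [vector [0, 0, 1], vector [- 1, 0, 0], vector [0, - 1, 0]], 1),
     (cyc [[2,5,4], [3,6,8]], vector [vector [0, 1, 0], vector [0, 0, 1], vector [1, 0, 0]], 1),
     (cyc [[1,3,8], [2,7,5]], vector [vector [0, - 1, 0], vector [0, 0, - 1], vector [1, 0, 0]], 1),
     (cyc [[1,8,6], [2,4,7]], vector [vector [0, 1, 0], vector [0, 0, - 1], vector [- 1, 0, 0]], 1),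
     (cyc [[1,6,3], [4,5,7]], vector [vector [0, - 1, 0], vector [0, 0, 1], vector [- 1, 0, 0]], 1),
     (cyc [[1,2,6,5], [3,7,8,4]], vector [vector [0, 0, - 1], vector [0, 1, 0], vector [1, 0, 0]], - 1),
     (cyc [[1,4], [2,8], [3,5], [6,7]], vector [vector [0, 0, 1], vector [0, - 1, 0], vector [1, 0, 0]], - 1),
     (cyc [[1,5,6,2], [3,4,8,7]], vector [vector [0, 0, 1], vector [0, 1, 0], vector [- 1, 0, 0]], - 1),
     (cyc [[1,7], [2,3], [4,6], [5,8]], vector [vector [0, 0, - 1], vector [0, - 1, 0], vector [- 1, 0, 0]], - 1)}"

definition parity :: "8 \<Rightarrow> real" where
  "parity j = cube_vertex j $ 1 * cube_vertex j $ 2 * cube_vertex j $ 3"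

lemma vertex_eqI: "(\<And>i. cube_vertex j $ i = cube_vertex k $ i) \<Longrightarrow> j = k"
proof -
  have "\<forall>j k. cube_vertex j $ 1 = cube_vertex k $ 1 \<and> cube_vertex j $ 2 = cube_vertex k $ 2 \<and>
      cube_vertex j $ 3 = cube_vertex k $ 3 \<longrightarrow> j = k"
    unfolding forall_8 by (simp add: cube_vertex_simps)
  then show "(\<And>i. cube_vertex j $ i = cube_vertex k $ i) \<Longrightarrow> j = k" by blast
qed

lemma cube_vertex_inject: "cube_vertex j = cube_vertex k \<longleftrightarrow> j = k"
  using vertex_eqI by auto

lemma cyc_Nil: "cyc [] j = j" by (simp add: cyc_def)

lemma cyc_Cons: "cyc (c # cs) j = cycle_of_list c (cyc cs j)"
  by (simp add: cyc_def)

lemma eq_8_simps: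
  "(1::8) = 2 \<longleftrightarrow> False" "(1::8) = 3 \<longleftrightarrow> False" "(1::8) = 4 \<longleftrightarrow> False" "(1::8) = 5 \<longleftrightarrow> False" "(1::8) = 6 \<longleftrightarrow> False" "(1::8) = 7 \<longleftrightarrow> False" "(1::8) = 8 \<longleftrightarrow> False"
  "(2::8) = 1 \<longleftrightarrow> False" "(2::8) = 3 \<longleftrightarrow> False" "(2::8) = 4 \<longleftrightarrow> False" "(2::8) = 5 \<longleftrightarrow> False" "(2::8) = 6 \<longleftrightarrow> False" "(2::8) = 7 \<longleftrightarrow> False" "(2::8) = 8 \<longleftrightarrow> False"
  "(3::8) = 1 \<longleftrightarrow> False" "(3::8) = 2 \<longleftrightarrow> False" "(3::8) = 4 \<longleftrightarrow> False" "(3::8) = 5 \<longleftrightarrow> False" "(3::8) = 6 \<longleftrightarrow> False" "(3::8) = 7 \<longleftrightarrow> False" "(3::8) = 8 \<longleftrightarrow> False"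
  "(4::8) = 1 \<longleftrightarrow> False" "(4::8) = 2 \<longleftrightarrow> False" "(4::8) = 3 \<longleftrightarrow> False" "(4::8) = 5 \<longleftrightarrow> False" "(4::8) = 6 \<longleftrightarrow> False" "(4::8) = 7 \<longleftrightarrow> False" "(4::8) = 8 \<longleftrightarrow> False"
  "(5::8) = 1 \<longleftrightarrow> False" "(5::8) = 2 \<longleftrightarrow> False" "(5::8) = 3 \<longleftrightarrow> False" "(5::8) = 4 \<longleftrightarrow> False" "(5::8) = 6 \<longleftrightarrow> False" "(5::8) = 7 \<longleftrightarrow> False" "(5::8) = 8 \<longleftrightarrow> False"
  "(6::8) = 1 \<longleftrightarrow> False" "(6::8) = 2 \<longleftrightarrow> False" "(6::8) = 3 \<longleftrightarrow> False" "(6::8) = 4 \<longleftrightarrow> False" "(6::8) = 5 \<longleftrightarrow> False" "(6::8) = 7 \<longleftrightarrow> False" "(6::8) = 8 \<longleftrightarrow> False"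
  "(7::8) = 1 \<longleftrightarrow> False" "(7::8) = 2 \<longleftrightarrow> False" "(7::8) = 3 \<longleftrightarrow> False" "(7::8) = 4 \<longleftrightarrow> False" "(7::8) = 5 \<longleftrightarrow> False" "(7::8) = 6 \<longleftrightarrow> False" "(7::8) = 8 \<longleftrightarrow> False"
  "(8::8) = 1 \<longleftrightarrow> False" "(8::8) = 2 \<longleftrightarrow> False" "(8::8) = 3 \<longleftrightarrow> False" "(8::8) = 4 \<longleftrightarrow> False" "(8::8) = 5 \<longleftrightarrow> False" "(8::8) = 6 \<longleftrightarrow> False" "(8::8) = 7 \<longleftrightarrow> False"
  by simp_all

lemmas cyc_simps = cyc_Nil cyc_Cons cycle_of_list.simps comp_apply id_apply Transposition.transpose_def
  eq_8_simps if_True if_False refl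

lemma parity_simps: "parity 1 = 1" "parity 2 = - 1" "parity 3 = 1" "parity 4 = - 1" "parity 5 = - 1" "parity 6 = 1"
  "parity 7 = - 1" "parity 8 = 1"
  by (simp_all add: parity_def cube_vertex_simps)

lemma induces_iff:
  "induces A h \<longleftrightarrow> (\<forall>j. \<forall>i. A $ i $ 1 * cube_vertex j $ 1 + A $ i $ 2 * cube_vertex j $ 2 + A $ i $ 3 * cube_vertex j $ 3 = cube_vertex (h j) $ i)"
  by (simp add: induces_def vec_eq_iff matrix_vector_mult_def sum_3)

lemma rotations_induces:
  assumes "(g, A, s) \<in> rotations"
  shows "induces A g" "parity (g 1) = s"
proof -
  have 1: "\<forall>(g, A, s)\<in>rotations. induces A g"
    unfolding rotations_def ball_simps split_conv
    by (intro conjI TrueI;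
        simp only: induces_iff forall_3 vector_3 mult_1_left mult_zero_left mult_minus1 add_0_left add_0_right;
        simp only: forall_8 cyc_simps cube_vertex_simps minus_minus simp_thms)
  have 2: "\<forall>(g, A, s)\<in>rotations. parity (g 1) = s"
    unfolding rotations_def ball_simps split_conv
    by (intro conjI TrueI; simp only: cyc_simps parity_simps)
  show "induces A g" "parity (g 1) = s" using bspec[OF 1 assms] bspec[OF 2 assms] by simp_all
qed

lemma rotations_rotation:
  assumes "(g, A, s) \<in> rotations"
  shows "rotation_matrix A"
proof -
  have 1: "\<forall>(g, A, s)\<in>rotations. rotation_matrix A"
    unfolding rotations_def ball_simps split_conv
    by (intro conjI TrueI;
        simp only: rotation_matrix_def orthogonal_matrix det_3 vec_eq_iff forall_3
          matrix_matrix_mult_def transpose_def mat_def sum_3 vec_lambda_beta vector_3; simp)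
  show ?thesis using bspec[OF 1 assms] by simp
qed

lemma induces_unique:
  assumes "induces A g" "induces A h"
  shows "g = h"
  using assms cube_vertex_inject unfolding induces_def by (metis ext)

lemma induces_bij:
  assumes A: "orthogonal_matrix A" "induces A h"
  shows "bij h"
proof -
  have "inj h"
  proof (rule injI)
    fix i j assume "h i = h j"
    then have "A *v cube_vertex i = A *v cube_vertex j" using A(2) by (simp add: induces_def)
    then have "(A *v cube_vertex i - A *v cube_vertex j) \<bullet> (A *v cube_vertex i - A *v cube_vertex j) = 0" by simp
    then have "(A *v (cube_vertex i - cube_vertex j)) \<bullet> (A *v (cube_vertex i - cube_vertex j)) = 0"
      by (simp add: matrix_vector_mult_diff_distrib)
    then show "i = j" by (simp add: orthogonal_matrix_inner[OF A(1)] cube_vertex_inject)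
  qed
  then show ?thesis by (simp add: bij_def finite_UNIV_inj_surj)
qed

lemma ex_3: "(\<exists>i::3. P i) \<longleftrightarrow> P 1 \<or> P 2 \<or> P 3"
  by (metis exhaust_3)

text \<open>The first two unit vectors are half differences of vertices. Their images therefore have entries in
  \<open>{- 1, 0, 1}\<close> and, having length \<open>1\<close>, are coordinate vectors up to sign.\<close>

lemma rotation_columns:
  assumes A: "rotation_matrix A" "induces A h"
  obtains i j s t where "A *v axis 1 1 = s *\<^sub>R axis i 1" "A *v axis 2 1 = t *\<^sub>R axis j 1" "s \<in> {1, - 1}" "t \<in> {1, - 1}" "i \<noteq> j"
proof -
  have o: "orthogonal_matrix A" using A by (simp add: rotation_matrix_def)
  have e: "axis 1 1 = (1 / 2) *\<^sub>R (cube_vertex 1 - cube_vertex 2)" "axis 2 1 = (1 / 2) *\<^sub>R (cube_vertex 1 - cube_vertex 4)"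
    by (simp_all add: vec_eq_iff forall_3 axis_def cube_vertex_simps)
  have pm: "cube_vertex j $ i \<in> {1, - 1}" for j i
  proof -
    have "\<forall>j i. cube_vertex j $ i \<in> {1, - 1}" unfolding forall_8 forall_3 by (simp add: cube_vertex_simps)
    then show ?thesis by blast
  qed
  have col: "\<exists>i s. A *v u = s *\<^sub>R axis i 1 \<and> s \<in> {1, - 1}"
    if u: "u = (1 / 2) *\<^sub>R (cube_vertex k - cube_vertex l)" "u \<bullet> u = 1" for u k l
  proof -
    have "A *v u = (1 / 2) *\<^sub>R (cube_vertex (h k) - cube_vertex (h l))"
      using A(2) by (simp add: u(1) induces_def matrix_vector_mult_scaleR matrix_vector_mult_diff_distrib)
    then have ent: "(A *v u) $ i \<in> {1, 0, - 1}" for i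
      using pm[of "h k" i] pm[of "h l" i] by auto
    have "(A *v u) \<bullet> (A *v u) = 1" using orthogonal_matrix_inner[OF o] u(2) by metis
    then have "((A *v u) $ 1)\<^sup>2 + ((A *v u) $ 2)\<^sup>2 + ((A *v u) $ 3)\<^sup>2 = 1"
      by (simp add: inner_vec_def sum_3 power2_eq_square)
    then have "\<exists>i::3. (A *v u) $ i \<in> {1, - 1} \<and> (\<forall>j. j \<noteq> i \<longrightarrow> (A *v u) $ j = 0)"
      using ent[of 1] ent[of 2] ent[of 3] unfolding ex_3 forall_3 by auto
    then obtain i where i: "(A *v u) $ i \<in> {1, - 1}" "\<And>j. j \<noteq> i \<Longrightarrow> (A *v u) $ j = 0" by blast
    have "A *v u = ((A *v u) $ i) *\<^sub>R axis i 1"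
      using i(2) by (auto simp: vec_eq_iff axis_def)
    then show ?thesis using i(1) by blast
  qed
  obtain i s where 1: "A *v axis 1 1 = s *\<^sub>R axis i 1" "s \<in> {1, - 1}"
    using col[OF e(1)] by (auto simp: inner_axis_axis)
  obtain j t where 2: "A *v axis 2 1 = t *\<^sub>R axis j 1" "t \<in> {1, - 1}"
    using col[OF e(2)] by (auto simp: inner_axis_axis)
  have "(A *v axis 1 1) \<bullet> (A *v axis 2 1) = 0" by (simp add: orthogonal_matrix_inner[OF o] inner_axis_axis)
  then have "i \<noteq> j" using 1 2 by (auto simp: inner_axis_axis)
  then show ?thesis using that 1 2 by blast
qed

text \<open>The third column of a rotation matrix is the cross product of the first two, so signed coordinate vectors as
  first two columns leave \<open>24\<close> matrices, all of which are listed.\<close>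

lemma rotations_complete:
  assumes A: "rotation_matrix A" "induces A h"
  shows "\<exists>s. (h, A, s) \<in> rotations"
proof -
  obtain i j s t where ij: "A *v axis 1 1 = s *\<^sub>R axis i 1" "A *v axis 2 1 = t *\<^sub>R axis j 1" "s \<in> {1, - 1}" "t \<in> {1, - 1}" "i \<noteq> j"
    by (rule rotation_columns[OF A])
  have a3: "axis 3 1 = cross3 (axis 1 1) (axis 2 1)"
    by (simp add: vec_eq_iff forall_3 cross3_def axis_def vector_3)
  have col3: "A *v axis 3 1 = cross3 (s *\<^sub>R axis i 1) (t *\<^sub>R axis j 1)"
    unfolding a3 cross_rotation_matrix[OF A(1), symmetric] ij(1,2) ..
  have col: "A $ r $ k = (A *v axis k 1) $ r" for r k
    by (simp add: matrix_vector_mult_basis column_def)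
  have "\<exists>g s'. (g, A, s') \<in> rotations"
  proof -
    have A1: "A $ r $ 1 = (s *\<^sub>R axis i 1) $ r" and A2: "A $ r $ 2 = (t *\<^sub>R axis j 1) $ r"
      and A3: "A $ r $ 3 = (cross3 (s *\<^sub>R axis i 1) (t *\<^sub>R axis j 1)) $ r" for r
      using col[of r] ij col3 by simp_all
    define c1 where "c1 = s *\<^sub>R (axis i 1 :: real ^ 3)"
    define c2 where "c2 = t *\<^sub>R (axis j 1 :: real ^ 3)"
    have "A = vector [vector [c1 $ 1, c2 $ 1, (cross3 c1 c2) $ 1], vector [c1 $ 2, c2 $ 2, (cross3 c1 c2) $ 2],
        vector [c1 $ 3, c2 $ 3, (cross3 c1 c2) $ 3]]"
      by (simp only: vec_eq_iff forall_3 vector_3 A1 A2 A3 c1_def c2_def simp_thms)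
    also have "\<dots> \<in> (\<lambda>(g, A, s). A) ` rotations"
      using exhaust_3[of i] exhaust_3[of j] ij(3,4,5)
      unfolding rotations_def image_insert image_empty split_conv c1_def c2_def
      by (elim disjE insertE emptyE; simp add: axis_def cross3_def vector_3)
    finally have "A \<in> (\<lambda>(g, A, s). A) ` rotations" .
    then show ?thesis by force
  qed
  then obtain g s' where g: "(g, A, s') \<in> rotations" by blast
  have "g = h" by (rule induces_unique[OF rotations_induces(1)[OF g] A(2)])
  then show ?thesis using g by blast
qed

lemma S4_iff: "g \<in> S4 \<longleftrightarrow> (\<exists>A s. (g, A, s) \<in> rotations)"
proof
  assume "g \<in> S4"
  then obtain A where "rotation_matrix A" "induces A g" by (auto simp: S4_def)
  from rotations_complete[OF this] show "\<exists>A s. (g, A, s) \<in> rotations" by (rule exI)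
next
  assume "\<exists>A s. (g, A, s) \<in> rotations"
  then obtain A s where "(g, A, s) \<in> rotations" by blast
  then have "rotation_matrix A" "induces A g" by (rule rotations_rotation, rule rotations_induces(1))
  then show "g \<in> S4" using induces_bij by (auto simp: S4_def rotation_matrix_def)
qed

section \<open>Symmetry groups of waves\<close>

text \<open>A wave is the real part of \<open>exp (\<i> t) w\<close> for a complex amplitude \<open>w\<close>.\<close>

definition re_vec :: "(8 \<Rightarrow> complex) \<Rightarrow> real ^ 8" where "re_vec w = (\<chi> j. Re (w j))"
definition im_vec :: "(8 \<Rightarrow> complex) \<Rightarrow> real ^ 8" where "im_vec w = (\<chi> j. - Im (w j))"

definition amplitude_group :: "(8 \<Rightarrow> complex) \<Rightarrow> sym set" where
  "amplitude_group w = wave_group (re_vec w) (im_vec w)"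

lemma wave_amplitude: "wave (re_vec w) (im_vec w) t $ j = Re (cis t * w j)"
  by (simp add: wave_def re_vec_def im_vec_def)

lemma Re_cis_eq_iff: "(\<forall>t. Re (cis t * x) = Re (cis t * y)) \<longleftrightarrow> x = y"
proof
  assume h: "\<forall>t. Re (cis t * x) = Re (cis t * y)"
  show "x = y"
    using h[rule_format, of 0] h[rule_format, of "pi / 2"] by (simp add: complex_eq_iff)
qed simp

text \<open>Shifting the time by the fraction \<open>\<theta>\<close> of the period multiplies the amplitude by
  \<open>cis (- 2 pi \<theta>)\<close>.\<close>

lemma amplitude_group_iff:
  "(r, h, \<theta>) \<in> amplitude_group w \<longleftrightarrow> r \<in> {1, - 1} \<and> h \<in> O4 \<and> \<theta> \<in> {0..<1} \<and>
    (\<forall>j. of_int r * w j = cis (2 * pi * \<theta>) * w (h j))"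
proof -
  have "(\<forall>t. act r h (wave (re_vec w) (im_vec w) (t - 2 * pi * \<theta>)) = wave (re_vec w) (im_vec w) t) \<longleftrightarrow>
      (\<forall>j. of_int r * w j = cis (2 * pi * \<theta>) * w (h j))" if h: "h \<in> O4"
  proof -
    have b: "bij h" using h by (simp add: O4_def)
    have all: "x = y \<longleftrightarrow> (\<forall>j. x $ h j = y $ h j)" for x y :: "real ^ 8"
      unfolding vec_eq_iff using b by (metis bij_pointE)
    have "(\<forall>t. act r h (wave (re_vec w) (im_vec w) (t - 2 * pi * \<theta>)) = wave (re_vec w) (im_vec w) t) \<longleftrightarrow>
        (\<forall>t j. act r h (wave (re_vec w) (im_vec w) (t - 2 * pi * \<theta>)) $ h j = wave (re_vec w) (im_vec w) t $ h j)"
      by (simp only: all)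
    also have "\<dots> \<longleftrightarrow> (\<forall>j t. Re (cis t * (of_int r * cis (- (2 * pi * \<theta>)) * w j)) = Re (cis t * w (h j)))"
    proof -
      have *: "real_of_int r * Re (cis (t - c) * x) = Re (cis t * (of_int r * cis (- c) * x))" for t c x
      proof -
        have "cis t * (of_int r * cis (- c) * x) = of_int r * ((cis t * cis (- c)) * x)" by (simp only: mult_ac)
        also have "cis t * cis (- c) = cis (t - c)" by (simp add: cis_mult)
        finally have "cis t * (of_int r * cis (- c) * x) = of_int r * (cis (t - c) * x)" .
        moreover have "Re (of_int r * z) = real_of_int r * Re z" for z by simp
        ultimately show ?thesis by (simp only:)
      qed
      show ?thesis unfolding act_nth[OF b] wave_amplitude * by blast
    qed
    also have "\<dots> \<longleftrightarrow> (\<forall>j. of_int r * cis (- (2 * pi * \<theta>)) * w j = w (h j))"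
      unfolding Re_cis_eq_iff ..
    also have "\<dots> \<longleftrightarrow> (\<forall>j. of_int r * w j = cis (2 * pi * \<theta>) * w (h j))"
    proof -
      have "of_int r * cis (- (2 * pi * \<theta>)) * x = y \<longleftrightarrow> of_int r * x = cis (2 * pi * \<theta>) * y" for x y
      proof -
        have c: "cis (2 * pi * \<theta>) * cis (- (2 * pi * \<theta>)) = 1" by (simp add: cis_mult)
        have "of_int r * cis (- (2 * pi * \<theta>)) * x = y \<longleftrightarrow>
            cis (2 * pi * \<theta>) * (of_int r * cis (- (2 * pi * \<theta>)) * x) = cis (2 * pi * \<theta>) * y"
          by (simp add: cis_neq_zero)
        also have "cis (2 * pi * \<theta>) * (of_int r * cis (- (2 * pi * \<theta>)) * x) =
            (cis (2 * pi * \<theta>) * cis (- (2 * pi * \<theta>))) * (of_int r * x)" by (simp only: mult_ac)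
        finally show ?thesis unfolding c by simp
      qed
      then show ?thesis by simp
    qed
    finally show ?thesis .
  qed
  then show ?thesis unfolding amplitude_group_def wave_group_iff by blast
qed

lemma amplitude_group_scale:
  assumes "c \<noteq> 0"
  shows "amplitude_group (\<lambda>j. c * w j) = amplitude_group w"
proof -
  have "of_int r * (c * x) = y * (c * z) \<longleftrightarrow> of_int r * x = y * z" for r :: int and x y z
    using assms by (simp add: mult.left_commute[of _ c])
  then have "(r, h, \<theta>) \<in> amplitude_group (\<lambda>j. c * w j) \<longleftrightarrow> (r, h, \<theta>) \<in> amplitude_group w" for r h \<theta>
    unfolding amplitude_group_iff by simp
  then show ?thesis by auto
qed

section \<open>Conjugation\<close>

lemma O4I: "orthogonal_matrix A \<Longrightarrow> induces A h \<Longrightarrow> h \<in> O4"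
  using induces_bij unfolding O4_def by blast

lemma O4_comp: "g \<in> O4 \<Longrightarrow> h \<in> O4 \<Longrightarrow> g \<circ> h \<in> O4"
proof -
  assume "g \<in> O4" "h \<in> O4"
  then obtain A B where "orthogonal_matrix A" "induces A g" "orthogonal_matrix B" "induces B h"
    unfolding O4_def by blast
  then show ?thesis
    by (intro O4I[of "A ** B"]) (simp_all add: orthogonal_matrix_mul induces_def matrix_vector_mul_assoc[symmetric])
qed

lemma O4_inv: "h \<in> O4 \<Longrightarrow> inv_into UNIV h \<in> O4"
proof -
  assume h: "h \<in> O4"
  then obtain A where A: "orthogonal_matrix A" "induces A h" and b: "bij h" unfolding O4_def by blast
  have "induces (transpose A) (inv_into UNIV h)"
    unfolding induces_def
  proof
    fix j
    have "transpose A *v cube_vertex j = transpose A *v (A *v cube_vertex (inv_into UNIV h j))"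
      using A(2) b by (simp add: induces_def bij_is_surj surj_f_inv_f)
    also have "\<dots> = cube_vertex (inv_into UNIV h j)"
      using A(1) by (simp add: matrix_vector_mul_assoc orthogonal_matrix_def)
    finally show "transpose A *v cube_vertex j = cube_vertex (inv_into UNIV h j)" .
  qed
  then show ?thesis using A(1) by (intro O4I[of "transpose A"]) (simp add: orthogonal_matrix_transpose)
qed

lemma O4_bij: "h \<in> O4 \<Longrightarrow> bij h"
  by (simp add: O4_def)

lemma SG_mult: "(r, h, \<theta>) \<otimes>\<^bsub>SG\<^esub> (r', h', \<theta>') = (r * r', h \<circ> h', frac (\<theta> + \<theta>'))"
  by (simp add: SG_def)

lemma frac_frac_add: "frac (frac x + y) = frac (x + y)" for x y :: real
proof -
  have "frac x + y - frac (x + y) = of_int (\<lfloor>x + y\<rfloor> - \<lfloor>x\<rfloor>)" by (simp add: frac_def)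
  then show ?thesis by (simp only: frac_unique_iff Ints_of_int frac_ge_0 frac_lt_1 simp_thms)
qed

lemma add_frac_frac: "frac (x + frac y) = frac (x + y)" for x y :: real
  using frac_frac_add[of y x] by (simp only: add.commute)

lemma SG_inv:
  assumes "(r, h, \<theta>) \<in> carrier SG"
  shows "inv\<^bsub>SG\<^esub> (r, h, \<theta>) = (r, inv_into UNIV h, frac (- \<theta>))"
proof -
  have G: "group SG"
  proof (rule groupI)
    fix x y assume "x \<in> carrier SG" "y \<in> carrier SG"
    then show "x \<otimes>\<^bsub>SG\<^esub> y \<in> carrier SG" by (auto simp: SG_def O4_comp frac_lt_1)
  next
    show "\<one>\<^bsub>SG\<^esub> \<in> carrier SG" by (simp add: SG_def id_O4)
  next
    fix x y z
    show "x \<otimes>\<^bsub>SG\<^esub> y \<otimes>\<^bsub>SG\<^esub> z = x \<otimes>\<^bsub>SG\<^esub> (y \<otimes>\<^bsub>SG\<^esub> z)"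
      by (cases x; cases y; cases z)
         (simp add: SG_mult o_assoc frac_frac_add add_frac_frac add.assoc)
  next
    fix x assume "x \<in> carrier SG"
    then show "\<one>\<^bsub>SG\<^esub> \<otimes>\<^bsub>SG\<^esub> x = x" by (auto simp: SG_def frac_eq)
  next
    fix x assume x: "x \<in> carrier SG"
    obtain r h \<theta> where rh: "x = (r, h, \<theta>)" by (metis prod.exhaust)
    have "(r, inv_into UNIV h, frac (- \<theta>)) \<otimes>\<^bsub>SG\<^esub> x = \<one>\<^bsub>SG\<^esub>" "(r, inv_into UNIV h, frac (- \<theta>)) \<in> carrier SG"
      using x O4_bij O4_inv by (auto simp: rh SG_def frac_frac_add frac_lt_1 bij_is_inj)
    then show "\<exists>y\<in>carrier SG. y \<otimes>\<^bsub>SG\<^esub> x = \<one>\<^bsub>SG\<^esub>" by blast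
  qed
  show ?thesis
  proof (rule group.inv_equality[OF G])
    show "(r, inv_into UNIV h, frac (- \<theta>)) \<otimes>\<^bsub>SG\<^esub> (r, h, \<theta>) = \<one>\<^bsub>SG\<^esub>" "(r, inv_into UNIV h, frac (- \<theta>)) \<in> carrier SG"
      using assms O4_bij O4_inv by (auto simp: SG_def frac_frac_add frac_lt_1 bij_is_inj)
  qed fact
qed

lemma conjugate_amplitude_group:
  assumes g: "(r0, h0, \<theta>0) \<in> carrier SG"
  shows "(r0, h0, \<theta>0) <#\<^bsub>SG\<^esub> amplitude_group w #>\<^bsub>SG\<^esub> inv\<^bsub>SG\<^esub> (r0, h0, \<theta>0) = amplitude_group (w \<circ> inv_into UNIV h0)"
proof -
  have h0: "h0 \<in> O4" "bij h0" "r0 * r0 = 1" using g O4_bij by (auto simp: SG_def)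
  have el: "(r0, h0, \<theta>0) \<otimes>\<^bsub>SG\<^esub> (r, h, \<theta>) \<otimes>\<^bsub>SG\<^esub> (r0, inv_into UNIV h0, frac (- \<theta>0)) = (r, h0 \<circ> h \<circ> inv_into UNIV h0, \<theta>)"
    if "\<theta> \<in> {0..<1}" for r h \<theta>
  proof -
    have "frac (frac (\<theta>0 + \<theta>) + frac (- \<theta>0)) = frac ((\<theta>0 + \<theta>) + (- \<theta>0))"
      by (simp only: frac_frac_add add_frac_frac)
    also have "\<dots> = \<theta>" using that by (simp add: frac_eq)
    finally have "frac (frac (\<theta>0 + \<theta>) + frac (- \<theta>0)) = \<theta>" .
    moreover have "r0 * r * r0 = r" using h0(3) by (metis mult.commute mult.left_commute mult_1_right)
    ultimately show ?thesis by (simp add: SG_mult)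
  qed
  have "(r0, h0, \<theta>0) <#\<^bsub>SG\<^esub> amplitude_group w #>\<^bsub>SG\<^esub> inv\<^bsub>SG\<^esub> (r0, h0, \<theta>0) =
      (\<lambda>(r, h, \<theta>). (r, h0 \<circ> h \<circ> inv_into UNIV h0, \<theta>)) ` amplitude_group w"
  proof -
    have "(r0, h0, \<theta>0) <#\<^bsub>SG\<^esub> amplitude_group w #>\<^bsub>SG\<^esub> inv\<^bsub>SG\<^esub> (r0, h0, \<theta>0) =
        (\<lambda>k. (r0, h0, \<theta>0) \<otimes>\<^bsub>SG\<^esub> k \<otimes>\<^bsub>SG\<^esub> (r0, inv_into UNIV h0, frac (- \<theta>0))) ` amplitude_group w"
      unfolding l_coset_def r_coset_def SG_inv[OF g] by auto
    also have "\<dots> = (\<lambda>(r, h, \<theta>). (r, h0 \<circ> h \<circ> inv_into UNIV h0, \<theta>)) ` amplitude_group w"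
    proof (rule image_cong[OF refl])
      fix k assume k: "k \<in> amplitude_group w"
      obtain r h \<theta> where rh: "k = (r, h, \<theta>)" by (metis prod.exhaust)
      have "\<theta> \<in> {0..<1}" using k unfolding rh amplitude_group_iff by blast
      from el[OF this] show "(r0, h0, \<theta>0) \<otimes>\<^bsub>SG\<^esub> k \<otimes>\<^bsub>SG\<^esub> (r0, inv_into UNIV h0, frac (- \<theta>0)) =
          (case k of (r, h, \<theta>) \<Rightarrow> (r, h0 \<circ> h \<circ> inv_into UNIV h0, \<theta>))"
        unfolding rh by simp
    qed
    finally show ?thesis .
  qed
  also have "\<dots> = amplitude_group (w \<circ> inv_into UNIV h0)"
  proof (intro equalityI subsetI)
    fix x assume "x \<in> (\<lambda>(r, h, \<theta>). (r, h0 \<circ> h \<circ> inv_into UNIV h0, \<theta>)) ` amplitude_group w"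
    then obtain r h \<theta> where x: "x = (r, h0 \<circ> h \<circ> inv_into UNIV h0, \<theta>)" and rh: "(r, h, \<theta>) \<in> amplitude_group w" by auto
    then show "x \<in> amplitude_group (w \<circ> inv_into UNIV h0)"
      using h0 by (auto simp: amplitude_group_iff O4_comp O4_inv bij_is_inj)
  next
    fix x assume x: "x \<in> amplitude_group (w \<circ> inv_into UNIV h0)"
    obtain r h \<theta> where rh: "x = (r, h, \<theta>)" by (metis prod.exhaust)
    have "(r, inv_into UNIV h0 \<circ> h \<circ> h0, \<theta>) \<in> amplitude_group w"
    proof -
      have "of_int r * w j = cis (2 * pi * \<theta>) * w (inv_into UNIV h0 (h (h0 j)))" for j
        using x h0(2) unfolding rh amplitude_group_iff comp_apply by (metis bij_is_inj inv_f_f)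
      then show ?thesis using x h0 unfolding rh amplitude_group_iff by (simp add: O4_comp O4_inv)
    qed
    moreover have "h0 \<circ> (inv_into UNIV h0 \<circ> h \<circ> h0) \<circ> inv_into UNIV h0 = h"
      using h0(2) by (auto simp: fun_eq_iff bij_is_surj surj_f_inv_f)
    ultimately show "x \<in> (\<lambda>(r, h, \<theta>). (r, h0 \<circ> h \<circ> inv_into UNIV h0, \<theta>)) ` amplitude_group w"
      unfolding rh by (force intro: rev_image_eqI)
  qed
  finally show ?thesis .
qed

lemma conj_class_amplitude_group: "conj_class (amplitude_group w) = (\<lambda>h. amplitude_group (w \<circ> inv_into UNIV h)) ` O4"
proof (intro equalityI subsetI)
  fix K assume "K \<in> conj_class (amplitude_group w)"
  then obtain g where g: "g \<in> carrier SG" "K = g <#\<^bsub>SG\<^esub> amplitude_group w #>\<^bsub>SG\<^esub> inv\<^bsub>SG\<^esub> g"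
    unfolding conj_class_def by blast
  obtain r h \<theta> where rh: "g = (r, h, \<theta>)" by (metis prod.exhaust)
  have "h \<in> O4" using g(1) by (simp add: rh SG_def)
  then show "K \<in> (\<lambda>h. amplitude_group (w \<circ> inv_into UNIV h)) ` O4"
    using g conjugate_amplitude_group[of r h \<theta> w] by (auto simp: rh)
next
  fix K assume "K \<in> (\<lambda>h. amplitude_group (w \<circ> inv_into UNIV h)) ` O4"
  then obtain h where h: "h \<in> O4" "K = amplitude_group (w \<circ> inv_into UNIV h)" by blast
  then have c: "(1, h, 0) \<in> carrier SG" by (simp add: SG_def)
  show "K \<in> conj_class (amplitude_group w)"
    unfolding conj_class_def h(2) conjugate_amplitude_group[OF c, symmetric] using c by (rule imageI)
qed

section \<open>The extensions of a rotation group by the antipode\<close>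

definition rotation_phases :: "(8 \<Rightarrow> complex) \<Rightarrow> ((8 \<Rightarrow> 8) \<times> real) set" where
  "rotation_phases w = {(g, \<theta>). g \<in> S4 \<and> \<theta> \<in> {0..<1} \<and> (\<forall>j. w j = cis (2 * pi * \<theta>) * w (g j))}"

lemma antipode_simps: "antipode 1 = 7" "antipode 2 = 8" "antipode 3 = 5" "antipode 4 = 6" "antipode 5 = 3"
  "antipode 6 = 4" "antipode 7 = 1" "antipode 8 = 2"
  unfolding antipode_def by (simp_all only: cyc_simps)

lemma antipode_vertex: "cube_vertex (antipode j) $ i = - cube_vertex j $ i"
proof -
  have "\<forall>j i. cube_vertex (antipode j) $ i = - cube_vertex j $ i"
    unfolding forall_8 forall_3 by (simp add: antipode_simps cube_vertex_simps)
  then show ?thesis by blast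
qed

lemma antipode_antipode: "antipode (antipode j) = j"
  using antipode_vertex by (intro vertex_eqI) simp

lemma antipode_comp: "antipode \<circ> antipode = id"
  by (auto simp: antipode_antipode)

lemma orthogonal_matrix_uminus: "orthogonal_matrix A \<Longrightarrow> orthogonal_matrix (- A)" for A :: "real ^ 3 ^ 3"
  by (simp add: orthogonal_matrix vec_eq_iff forall_3 matrix_matrix_mult_def transpose_def mat_def sum_3)

lemma induces_antipode: "induces A h \<Longrightarrow> induces (- A) (h \<circ> antipode)"
proof -
  assume h: "induces A h"
  have "(- A) *v cube_vertex j = A *v cube_vertex (antipode j)" for j
    by (simp add: vec_eq_iff matrix_vector_mult_def sum_3 antipode_vertex)
  then show ?thesis using h by (simp add: induces_def)
qed

text \<open>The antipode is induced by \<open>- 1\<close>, which has determinant \<open>- 1\<close> in dimension three.\<close>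

lemma O4_cases:
  assumes "h \<in> O4"
  shows "h \<in> S4 \<or> h \<circ> antipode \<in> S4"
proof -
  obtain A where A: "orthogonal_matrix A" "induces A h" using assms unfolding O4_def by blast
  have "det A = 1 \<or> det A = - 1" using A(1) by (rule det_orthogonal_matrix)
  then show ?thesis
  proof
    assume "det A = 1"
    then show ?thesis using A induces_bij unfolding S4_def rotation_matrix_def by blast
  next
    assume "det A = - 1"
    then have "rotation_matrix (- A)" using orthogonal_matrix_uminus[OF A(1)] by (simp add: rotation_matrix_def det_3)
    moreover have "induces (- A) (h \<circ> antipode)" by (rule induces_antipode[OF A(2)])
    moreover have "bij (h \<circ> antipode)"
      using calculation induces_bij unfolding rotation_matrix_def by blast
    ultimately show ?thesis unfolding S4_def by blast
  qed
qed

lemma S4_O4: "g \<in> S4 \<Longrightarrow> g \<in> O4"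
  by (auto simp: S4_def O4_def rotation_matrix_def)

lemma antipode_O4: "antipode \<in> O4"
proof -
  have "induces (mat 1) id" by (simp add: induces_def)
  from induces_antipode[OF this] show ?thesis
    using orthogonal_matrix_uminus[OF orthogonal_matrix_id] by (intro O4I) (simp_all add: o_def)
qed

lemma cis_frac: "cis (2 * pi * frac x) = cis (2 * pi * x)"
proof -
  have "cis (2 * pi * x) = cis (2 * pi * frac x + 2 * pi * of_int \<lfloor>x\<rfloor>)"
    by (simp add: frac_def algebra_simps)
  also have "\<dots> = cis (2 * pi * frac x)" unfolding cis_mult[symmetric] by simp
  finally show ?thesis ..
qed

text \<open>If \<open>w\<close> is multiplied by \<open>e = \<plusminus> 1\<close> under the antipode, its group consists of the products of its
  rotations with phases and the four elements that act on \<open>w\<close> trivially together with their phases.\<close>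

lemma extension_eq:
  fixes e :: int
  assumes e: "e \<in> {1, - 1}" and w: "\<And>j. w (antipode j) = of_int e * w j"
  shows "({1} \<times> rotation_phases w) <#>\<^bsub>SG\<^esub>
     {(1, id, 0), (e, antipode, 0), (- 1, id, 1/2), (- e, antipode, 1/2)} = amplitude_group w"
proof (intro equalityI subsetI)
  fix x assume "x \<in> ({1} \<times> rotation_phases w) <#>\<^bsub>SG\<^esub>
     {(1, id, 0), (e, antipode, 0), (- 1, id, 1/2), (- e, antipode, 1/2)}"
  then obtain y z where y: "y \<in> {1} \<times> rotation_phases w" and
    z: "z \<in> {(1, id, 0), (e, antipode, 0), (- 1, id, 1/2), (- e, antipode, 1/2)}" and x: "x = y \<otimes>\<^bsub>SG\<^esub> z"
    unfolding set_mult_def by blast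
  obtain g \<theta> where g: "y = (1, g, \<theta>)" "(g, \<theta>) \<in> rotation_phases w" using y by auto
  obtain r h \<phi> where rh: "z = (r, h, \<phi>)" by (metis prod.exhaust)
  have x: "x = (r, g \<circ> h, frac (\<theta> + \<phi>))" by (simp add: x g rh SG_mult)
  note g = g(2) and rh = z[unfolded rh]
  have half: "cis (2 * pi * (\<theta> + \<phi>)) = - cis (2 * pi * \<theta>)" if "\<phi> * 2 = 1"
  proof -
    have half: "\<phi> = 1 / 2" using that by simp
    show ?thesis unfolding half by (simp add: distrib_left cis_mult[symmetric])
  qed
  have gO: "g \<in> O4" and g': "\<And>j. w j = cis (2 * pi * \<theta>) * w (g j)" using g S4_O4 unfolding rotation_phases_def by blast+
  have hO: "h \<in> O4" using rh id_O4 antipode_O4 by auto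
  have r1: "r \<in> {1, - 1}" using rh e by auto
  have eq: "of_int r * w j = cis (2 * pi * (\<theta> + \<phi>)) * w ((g \<circ> h) j)" for j
    using rh g'[of "h j", symmetric] e w[of j] by (auto simp: half)
  have f: "frac (\<theta> + \<phi>) \<in> {0..<1}" by (simp add: frac_lt_1)
  show "x \<in> amplitude_group w"
    unfolding x amplitude_group_iff cis_frac
    by (intro conjI allI r1 O4_comp[OF gO hO] f eq)
next
  fix x assume x: "x \<in> amplitude_group w"
  obtain r h \<theta> where rh: "x = (r, h, \<theta>)" by (metis prod.exhaust)
  have r: "r \<in> {1, - 1}" and h: "h \<in> O4" and \<theta>: "\<theta> \<in> {0..<1}" and eq: "\<And>j. of_int r * w j = cis (2 * pi * \<theta>) * w (h j)"
    using x unfolding rh amplitude_group_iff by blast+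
  have "\<exists>k. k \<in> {id, antipode} \<and> h \<circ> k \<in> S4"
  proof (cases "h \<in> S4")
    case True
    then show ?thesis by (intro exI[of _ id]) simp
  next
    case False
    then show ?thesis using O4_cases[OF h] by (intro exI[of _ antipode]) simp
  qed
  then obtain k where k: "k \<in> {id, antipode}" and g: "h \<circ> k \<in> S4" by blast
  have kk: "k \<circ> k = id" "k (k j) = j" for j using k antipode_comp antipode_antipode by auto
  define d where "d = (if k = id then 1 else e)"
  define s where "s = r * d"
  have wk: "w (k j) = of_int d * w j" for j using k w by (auto simp: d_def antipode_simps fun_eq_iff split: if_splits)
  have d: "d \<in> {1, - 1}" using e by (auto simp: d_def)
  define \<psi> where "\<psi> = (if s = 1 then 0 else 1 / 2 :: real)"
  define \<theta>' where "\<theta>' = frac (\<theta> + \<psi>)"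
  have half: "cis (2 * pi * (\<theta> + 1 / 2)) = - cis (2 * pi * \<theta>)"
    by (simp add: distrib_left cis_mult[symmetric])
  have s: "s \<in> {1, - 1}" using r d by (auto simp: s_def)
  have ph: "w j = cis (2 * pi * \<theta>') * w ((h \<circ> k) j)" for j
  proof -
    have "of_int r * (of_int d * w j) = cis (2 * pi * \<theta>) * w (h (k j))" using eq[of "k j"] by (simp add: wk)
    then have "of_int s * w j = cis (2 * pi * \<theta>) * w (h (k j))" by (simp add: s_def mult.assoc)
    moreover have "w j = of_int s * (of_int s * w j)" using s by auto
    ultimately have "w j = of_int s * (cis (2 * pi * \<theta>) * w (h (k j)))" by simp
    moreover have "cis (2 * pi * (\<theta> + \<psi>)) = of_int s * cis (2 * pi * \<theta>)" using s half by (auto simp: \<psi>_def)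
    ultimately show ?thesis unfolding \<theta>'_def cis_frac by simp
  qed
  have "\<theta>' \<in> {0..<1}" by (simp add: \<theta>'_def frac_lt_1)
  then have 1: "(h \<circ> k, \<theta>') \<in> rotation_phases w"
    unfolding rotation_phases_def mem_Collect_eq split_conv by (intro conjI allI g ph)
  have 2: "(r, k, \<psi>) \<in> {(1, id, 0), (e, antipode, 0), (- 1, id, 1/2), (- e, antipode, 1/2)}"
    using k r e antipode_simps(1) by (auto simp: \<psi>_def s_def d_def)
  have "frac (\<theta>' + \<psi>) = \<theta>"
  proof -
    have "frac (\<theta>' + \<psi>) = frac (\<theta> + (\<psi> + \<psi>))" by (simp add: \<theta>'_def frac_frac_add add.assoc)
    also have "\<dots> = frac \<theta>" by (auto simp: \<psi>_def frac_1_eq)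
    finally show ?thesis using \<theta> by (simp add: frac_eq)
  qed
  moreover have "h \<circ> k \<circ> k = h" unfolding comp_assoc kk by simp
  ultimately have "x = (1, h \<circ> k, \<theta>') \<otimes>\<^bsub>SG\<^esub> (r, k, \<psi>)" by (simp add: rh SG_mult)
  then show "x \<in> ({1} \<times> rotation_phases w) <#>\<^bsub>SG\<^esub>
     {(1, id, 0), (e, antipode, 0), (- 1, id, 1/2), (- e, antipode, 1/2)}"
    unfolding set_mult_def using 1 2 by blast
qed

lemma plus_ext_eq: "(\<And>j. w (antipode j) = w j) \<Longrightarrow> plus_ext (rotation_phases w) = amplitude_group w"
  using extension_eq[of 1 w] by (simp add: plus_ext_def)

lemma minus_ext_eq: "(\<And>j. w (antipode j) = - w j) \<Longrightarrow> minus_ext (rotation_phases w) = amplitude_group w"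
  using extension_eq[of "- 1" w] by (simp add: minus_ext_def)

section \<open>Amplitudes of degree one and two\<close>

text \<open>A triple \<open>c\<close> stands for the amplitude with the coefficients \<open>c\<close> with respect to the three
  coordinates or, if \<open>b\<close> holds, with respect to the products of two of them. On the
  vertices, the product of two coordinates is the third one times the product of all three.\<close>

type_synonym triple = "complex \<times> complex \<times> complex"

definition amp :: "bool \<Rightarrow> triple \<Rightarrow> 8 \<Rightarrow> complex" where
  "amp b = (\<lambda>(x, y, z) j. (if b then of_real (parity j) else 1) *
     (x * of_real (cube_vertex j $ 1) + y * of_real (cube_vertex j $ 2) + z * of_real (cube_vertex j $ 3)))"

definition smul :: "complex \<Rightarrow> triple \<Rightarrow> triple" where
  "smul k = (\<lambda>(x, y, z). (k * x, k * y, k * z))"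

definition tri :: "real ^ 3 ^ 3 \<Rightarrow> triple \<Rightarrow> triple" where
  "tri A = (\<lambda>(x, y, z). (of_real (A $ 1 $ 1) * x + of_real (A $ 1 $ 2) * y + of_real (A $ 1 $ 3) * z,
     of_real (A $ 2 $ 1) * x + of_real (A $ 2 $ 2) * y + of_real (A $ 2 $ 3) * z,
     of_real (A $ 3 $ 1) * x + of_real (A $ 3 $ 2) * y + of_real (A $ 3 $ 3) * z))"

lemma amp_smul: "amp b (smul k c) j = k * amp b c j"
  by (cases c) (simp add: amp_def smul_def algebra_simps)

lemma parity_square: "parity j * parity j = 1"
proof -
  have "\<forall>j. parity j * parity j = 1" unfolding forall_8 by (simp add: parity_simps)
  then show ?thesis by blast
qed

lemma amp_inject: "(\<forall>j. amp b c j = amp b d j) \<longleftrightarrow> c = d"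
proof
  assume h: "\<forall>j. amp b c j = amp b d j"
  obtain x y z where c: "c = (x, y, z)" by (metis prod.exhaust)
  obtain x' y' z' where d: "d = (x', y', z')" by (metis prod.exhaust)
  have "of_real (parity j) * u = of_real (parity j) * v \<longleftrightarrow> u = v" for u v :: complex and j
    using parity_square[of j] by (metis mult_cancel_left mult_zero_left of_real_eq_0_iff zero_neq_one)
  then have "x * of_real (cube_vertex j $ 1) + y * of_real (cube_vertex j $ 2) + z * of_real (cube_vertex j $ 3) =
      x' * of_real (cube_vertex j $ 1) + y' * of_real (cube_vertex j $ 2) + z' * of_real (cube_vertex j $ 3)" for j
    using h[rule_format, of j] by (cases b) (simp_all add: c d amp_def)
  from this[of 1] this[of 2] this[of 4] this[of 5]
  have e: "x + y + z = x' + y' + z'" "- x + y + z = - x' + y' + z'" "x - y + z = x' - y' + z'" "x + y - z = x' + y' - z'"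
    by (simp_all add: cube_vertex_simps)
  have "2 * x = 2 * x'" using e(1,2) by (metis (no_types) add_diff_cancel_right diff_add_cancel add.assoc add_diff_eq diff_minus_eq_add mult_2 add.commute uminus_add_conv_diff)
  moreover have "2 * y = 2 * y'" using arg_cong2[OF e(1) e(3), of "(-)"] by simp
  moreover have "2 * z = 2 * z'" using arg_cong2[OF e(1) e(4), of "(-)"] by simp
  ultimately show "c = d" by (simp add: c d)
qed simp

lemma parity_mult: "parity i * parity j = (if cube_vertex i \<bullet> cube_vertex j = 3 \<or> cube_vertex i \<bullet> cube_vertex j = - 1 then 1 else - 1)"
proof -
  have "\<forall>i j. parity i * parity j = (if cube_vertex i \<bullet> cube_vertex j = 3 \<or> cube_vertex i \<bullet> cube_vertex j = - 1 then 1 else - 1)"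
    unfolding forall_8 by (simp add: parity_simps inner_vec_def sum_3 cube_vertex_simps)
  then show ?thesis by blast
qed

lemma parity_O4: "h \<in> O4 \<Longrightarrow> parity (h j) = parity (h 1) * parity j"
proof -
  assume "h \<in> O4"
  then have "parity (h 1) * parity (h j) = parity 1 * parity j" unfolding parity_mult by (simp add: O4_inner)
  then have "parity (h 1) * (parity (h 1) * parity (h j)) = parity (h 1) * parity j" by (simp add: parity_simps)
  then show ?thesis by (simp add: parity_square mult.assoc[symmetric])
qed

lemma rotations_O4: "(g, A, s) \<in> rotations \<Longrightarrow> g \<in> O4"
  using S4_iff S4_O4 by blast

lemma rotations_sign: "(g, A, s) \<in> rotations \<Longrightarrow> s * s = 1"
  using rotations_induces(2) parity_square by metis

text \<open>An orthogonal matrix preserves the pairing of the coefficients with the coordinates of a vertex, and the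
  product of the coordinates changes by the sign \<open>s\<close>.\<close>

lemma amp_rotation:
  assumes g: "(g, A, s) \<in> rotations"
  shows "amp b (tri A c) (g j) = (if b then of_real s else 1) * amp b c j"
proof -
  obtain x y z where c: "c = (x, y, z)" by (metis prod.exhaust)
  define a where "a i k = complex_of_real (A $ i $ k)" for i k
  define v where "v i = complex_of_real (cube_vertex j $ i)" for i
  have "transpose A ** A = mat 1"
    using rotations_rotation[OF g] by (simp add: rotation_matrix_def orthogonal_matrix)
  then have "\<forall>k l. A $ 1 $ k * A $ 1 $ l + A $ 2 $ k * A $ 2 $ l + A $ 3 $ k * A $ 3 $ l = (if k = l then 1 else 0)"
    by (simp add: vec_eq_iff matrix_matrix_mult_def transpose_def mat_def sum_3)
  then have o: "a 1 k * a 1 l + a 2 k * a 2 l + a 3 k * a 3 l = (if k = l then 1 else 0)" for k l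
    unfolding a_def of_real_mult[symmetric] of_real_add[symmetric] by simp
  have v: "complex_of_real (cube_vertex (g j) $ i) = a i 1 * v 1 + a i 2 * v 2 + a i 3 * v 3" for i
    using rotations_induces(1)[OF g, unfolded induces_iff, rule_format, of i j]
    unfolding a_def v_def of_real_mult[symmetric] of_real_add[symmetric] by simp
  have "(a 1 1 * x + a 1 2 * y + a 1 3 * z) * (a 1 1 * v 1 + a 1 2 * v 2 + a 1 3 * v 3) +
      (a 2 1 * x + a 2 2 * y + a 2 3 * z) * (a 2 1 * v 1 + a 2 2 * v 2 + a 2 3 * v 3) +
      (a 3 1 * x + a 3 2 * y + a 3 3 * z) * (a 3 1 * v 1 + a 3 2 * v 2 + a 3 3 * v 3) =
      (a 1 1 * a 1 1 + a 2 1 * a 2 1 + a 3 1 * a 3 1) * (x * v 1) + (a 1 2 * a 1 2 + a 2 2 * a 2 2 + a 3 2 * a 3 2) * (y * v 2) +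
      (a 1 3 * a 1 3 + a 2 3 * a 2 3 + a 3 3 * a 3 3) * (z * v 3) + (a 1 1 * a 1 2 + a 2 1 * a 2 2 + a 3 1 * a 3 2) * (x * v 2 + y * v 1) +
      (a 1 1 * a 1 3 + a 2 1 * a 2 3 + a 3 1 * a 3 3) * (x * v 3 + z * v 1) + (a 1 2 * a 1 3 + a 2 2 * a 2 3 + a 3 2 * a 3 3) * (y * v 3 + z * v 2)"
    by (simp add: algebra_simps)
  also have "\<dots> = x * v 1 + y * v 2 + z * v 3" unfolding o by simp
  finally have lin: "(a 1 1 * x + a 1 2 * y + a 1 3 * z) * (a 1 1 * v 1 + a 1 2 * v 2 + a 1 3 * v 3) +
      (a 2 1 * x + a 2 2 * y + a 2 3 * z) * (a 2 1 * v 1 + a 2 2 * v 2 + a 2 3 * v 3) +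
      (a 3 1 * x + a 3 2 * y + a 3 3 * z) * (a 3 1 * v 1 + a 3 2 * v 2 + a 3 3 * v 3) = x * v 1 + y * v 2 + z * v 3" .
  have p: "parity (g j) = s * parity j"
    using parity_O4[OF rotations_O4[OF g]] rotations_induces(2)[OF g] by simp
  show ?thesis
    unfolding c amp_def tri_def split_conv v p a_def[symmetric] lin v_def[symmetric] by simp
qed

text \<open>A rotation with a phase belongs to the group of an amplitude exactly if the coefficients are an
  eigenvector of its matrix, up to the sign in degree two; the phase is the eigenvalue.\<close>

lemma rotation_phases_amp:
  "(g, \<theta>) \<in> rotation_phases (amp b c) \<longleftrightarrow> (\<exists>A s. (g, A, s) \<in> rotations \<and> \<theta> \<in> {0..<1} \<and>
     smul (if b then of_real s else 1) (tri A c) = smul (cis (2 * pi * \<theta>)) c)"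
proof -
  have key: "(\<forall>j. amp b c j = cis (2 * pi * \<theta>) * amp b c (g j)) \<longleftrightarrow>
      smul (if b then of_real s else 1) (tri A c) = smul (cis (2 * pi * \<theta>)) c" if g: "(g, A, s) \<in> rotations" for A s
  proof -
    let ?e = "if b then of_real s else 1 :: complex"
    have e: "?e * ?e = 1" using rotations_sign[OF g] by (simp flip: of_real_mult)
    have 1: "amp b c j = ?e * amp b (tri A c) (g j)" for j
    proof -
      have "?e * amp b (tri A c) (g j) = (?e * ?e) * amp b c j" unfolding amp_rotation[OF g] by (simp only: mult.assoc)
      then show ?thesis unfolding e by simp
    qed
    have "bij g" using O4_bij[OF rotations_O4[OF g]] .
    then have all: "(\<forall>j. P (g j)) \<longleftrightarrow> (\<forall>j. P j)" for P by (metis bij_pointE)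
    have "(\<forall>j. amp b c j = cis (2 * pi * \<theta>) * amp b c (g j)) \<longleftrightarrow>
        (\<forall>j. amp b (smul ?e (tri A c)) (g j) = amp b (smul (cis (2 * pi * \<theta>)) c) (g j))"
      by (simp only: 1 amp_smul)
    also have "\<dots> \<longleftrightarrow> smul ?e (tri A c) = smul (cis (2 * pi * \<theta>)) c"
      unfolding all[of "\<lambda>j. amp b (smul ?e (tri A c)) j = amp b (smul (cis (2 * pi * \<theta>)) c) j"] amp_inject ..
    finally show ?thesis .
  qed
  show ?thesis
    unfolding rotation_phases_def S4_iff mem_Collect_eq split_conv
  proof (intro iffI)
    assume h: "(\<exists>A s. (g, A, s) \<in> rotations) \<and> \<theta> \<in> {0..<1} \<and> (\<forall>j. amp b c j = cis (2 * pi * \<theta>) * amp b c (g j))"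
    then obtain A s where r: "(g, A, s) \<in> rotations" by blast
    have "smul (if b then of_real s else 1) (tri A c) = smul (cis (2 * pi * \<theta>)) c" "\<theta> \<in> {0..<1}"
      using h unfolding key[OF r] by simp_all
    then show "\<exists>A s. (g, A, s) \<in> rotations \<and> \<theta> \<in> {0..<1} \<and>
        smul (if b then of_real s else 1) (tri A c) = smul (cis (2 * pi * \<theta>)) c"
      using r by (intro exI[of _ A] exI[of _ s] conjI)
  next
    assume "\<exists>A s. (g, A, s) \<in> rotations \<and> \<theta> \<in> {0..<1} \<and>
        smul (if b then of_real s else 1) (tri A c) = smul (cis (2 * pi * \<theta>)) c"
    then obtain A s where r: "(g, A, s) \<in> rotations" and \<theta>: "\<theta> \<in> {0..<1}"
        and eq: "smul (if b then of_real s else 1) (tri A c) = smul (cis (2 * pi * \<theta>)) c" by (elim exE conjE)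
    show "(\<exists>A s. (g, A, s) \<in> rotations) \<and> \<theta> \<in> {0..<1} \<and>
        (\<forall>j. amp b c j = cis (2 * pi * \<theta>) * amp b c (g j))"
      unfolding key[OF r] using r \<theta> eq by (intro conjI exI[of _ A] exI[of _ s])
  qed
qed

section \<open>Phases of the rotations\<close>

text \<open>The primitive third roots of unity.\<close>

definition om :: complex where "om = Complex (- 1 / 2) (sqrt 3 / 2)"
definition omc :: complex where "omc = Complex (- 1 / 2) (- (sqrt 3 / 2))"

lemma om_mult: "om * om = omc" "omc * omc = om" "om * omc = 1" "omc * om = 1"
  by (simp_all add: om_def omc_def complex_eq_iff)

lemma om_neq: "om \<noteq> 0" "omc \<noteq> 0" "om \<noteq> omc" "omc \<noteq> om" "om \<noteq> - omc" "omc \<noteq> - om" "- om \<noteq> omc" "- omc \<noteq> om"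
  "om \<noteq> 1" "omc \<noteq> 1" "1 \<noteq> om" "1 \<noteq> omc" "om \<noteq> - 1" "omc \<noteq> - 1" "- 1 \<noteq> om" "- 1 \<noteq> omc" "- om \<noteq> 1" "- omc \<noteq> 1"
  "1 \<noteq> - om" "1 \<noteq> - omc" "om \<noteq> - om" "omc \<noteq> - omc" "- om \<noteq> om" "- omc \<noteq> omc"
  "om \<noteq> \<i>" "omc \<noteq> \<i>" "om \<noteq> - \<i>" "omc \<noteq> - \<i>" "\<i> \<noteq> om" "\<i> \<noteq> omc" "- \<i> \<noteq> om" "- \<i> \<noteq> omc"
  "- om \<noteq> \<i>" "- omc \<noteq> \<i>" "\<i> \<noteq> - om" "\<i> \<noteq> - omc"
  by (simp_all add: om_def omc_def complex_eq_iff)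

lemma i_neq: "\<i> \<noteq> - \<i>" "- \<i> \<noteq> \<i>" "1 \<noteq> (- 1 :: complex)" "- 1 \<noteq> (1 :: complex)"
  "\<i> \<noteq> - 1" "- \<i> \<noteq> - 1" "- 1 \<noteq> \<i>" "- \<i> \<noteq> 1" "1 \<noteq> - \<i>"
  by (simp_all add: complex_eq_iff)

lemma om_divide: "om / omc = omc" "omc / om = om" "1 / om = omc" "1 / omc = om" "1 / \<i> = - \<i>"
  using om_neq om_mult by (simp_all add: divide_eq_eq)

lemma cis_eq_cis_iff:
  assumes "\<theta> \<in> {0..<1}" "\<phi> \<in> {0..<1}"
  shows "cis (2 * pi * \<theta>) = cis (2 * pi * \<phi>) \<longleftrightarrow> \<theta> = \<phi>"
proof
  assume h: "cis (2 * pi * \<theta>) = cis (2 * pi * \<phi>)"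
  have "cis (2 * pi * \<theta> - 2 * pi * \<phi>) = 1" unfolding cis_divide[symmetric] h by simp
  then have "cos (2 * pi * \<theta> - 2 * pi * \<phi>) = 1" by (simp add: complex_eq_iff)
  then obtain n :: int where "2 * pi * \<theta> - 2 * pi * \<phi> = of_int n * 2 * pi" using cos_one_2pi_int by metis
  then have "2 * pi * (\<theta> - \<phi>) = 2 * pi * of_int n" by (simp add: algebra_simps)
  then have n: "\<theta> - \<phi> = of_int n" by simp
  then have "of_int n < (1 :: real)" "(- 1 :: real) < of_int n" using assms by auto
  then have "n = 0" by linarith
  then show "\<theta> = \<phi>" using n by simp
qed simp

definition phases :: "triple \<Rightarrow> triple \<Rightarrow> real set" where
  "phases d c = {\<theta> \<in> {0..<1}. d = smul (cis (2 * pi * \<theta>)) c}"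

definition angle :: "complex \<Rightarrow> real set" where "angle u = {\<theta> \<in> {0..<1}. u = cis (2 * pi * \<theta>)}"

lemma phases_simps:
  "phases (u, v, w) (1, y, z) = (if v = u * y \<and> w = u * z then angle u else {})"
  "phases (u, v, w) (0, 0, 1) = (if u = 0 \<and> v = 0 then angle w else {})"
  by (auto simp: phases_def angle_def smul_def)

lemma angle_cis: "\<phi> \<in> {0..<1} \<Longrightarrow> angle (cis (2 * pi * \<phi>)) = {\<phi>}"
  by (auto simp: angle_def cis_eq_cis_iff)

lemma angle_simps: "angle 1 = {0}" "angle (- 1) = {1 / 2}" "angle \<i> = {1 / 4}" "angle (- \<i>) = {3 / 4}"
  "angle om = {1 / 3}" "angle omc = {2 / 3}" "angle 0 = {}"
proof -
  have "cis (2 * pi * (1 / 4)) = \<i>" by (simp add: complex_eq_iff)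
  moreover have "cis (2 * pi * (3 / 4)) = - \<i>"
  proof -
    have "cis (2 * pi * (3 / 4)) = cis pi * cis (pi / 2)" unfolding cis_mult by simp
    then show ?thesis by (simp add: complex_eq_iff)
  qed
  moreover have "cis (2 * pi * (1 / 3)) = om" using cos_120 sin_120 by (simp add: om_def complex_eq_iff)
  moreover have "cis (2 * pi * (2 / 3)) = omc"
  proof -
    have "cis (2 * pi * (2 / 3)) = cis (2 * pi * (1 / 3)) * cis (2 * pi * (1 / 3))" unfolding cis_mult by simp
    then show ?thesis using calculation(3) om_mult by simp
  qed
  ultimately show "angle \<i> = {1 / 4}" "angle (- \<i>) = {3 / 4}" "angle om = {1 / 3}" "angle omc = {2 / 3}"
    using angle_cis[of "1 / 4"] angle_cis[of "3 / 4"] angle_cis[of "1 / 3"] angle_cis[of "2 / 3"] by simp_all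
  show "angle 1 = {0}" "angle (- 1) = {1 / 2}" using angle_cis[of 0] angle_cis[of "1 / 2"] by simp_all
  show "angle 0 = {}" by (auto simp: angle_def)
qed

lemma rotation_phases_UN:
  "rotation_phases (amp b c) = (\<Union>(g, A, s)\<in>rotations. {g} \<times> phases (smul (if b then of_real s else 1) (tri A c)) c)"
proof (intro equalityI subsetI)
  fix x assume x: "x \<in> rotation_phases (amp b c)"
  obtain g \<theta> where g: "x = (g, \<theta>)" by (metis prod.exhaust)
  obtain A s where "(g, A, s) \<in> rotations" "\<theta> \<in> phases (smul (if b then of_real s else 1) (tri A c)) c"
    using x unfolding g rotation_phases_amp phases_def by blast
  then show "x \<in> (\<Union>(g, A, s)\<in>rotations. {g} \<times> phases (smul (if b then of_real s else 1) (tri A c)) c)"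
    unfolding g by (intro UN_I[of "(g, A, s)"]) simp_all
next
  fix x assume "x \<in> (\<Union>(g, A, s)\<in>rotations. {g} \<times> phases (smul (if b then of_real s else 1) (tri A c)) c)"
  then obtain g A s \<theta> where x: "x = (g, \<theta>)" and r: "(g, A, s) \<in> rotations"
    and \<theta>: "\<theta> \<in> phases (smul (if b then of_real s else 1) (tri A c)) c"
    by auto
  show "x \<in> rotation_phases (amp b c)"
    unfolding x rotation_phases_amp
    using r \<theta> unfolding phases_def mem_Collect_eq by (intro exI[of _ A] exI[of _ s] conjI) blast+
qed

lemma tri_vector: "tri (vector [vector [a, b, c], vector [d, e, f], vector [g, h, i]]) (x, y, z) =
  (of_real a * x + of_real b * y + of_real c * z, of_real d * x + of_real e * y + of_real f * z,
   of_real g * x + of_real h * y + of_real i * z)"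
  by (simp add: tri_def vector_3)

lemma smul_simps: "smul k (x, y, z) = (k * x, k * y, k * z)"
  by (simp add: smul_def)

lemmas phase_eval = rotations_def UN_insert UN_empty split_conv tri_vector smul_simps

lemma phases_D4z: "rotation_phases (amp False (0, 0, 1)) = L_D4z"
  unfolding rotation_phases_UN phase_eval L_D4z_def by (simp add: phases_simps angle_simps) blast

lemma phases_D4d: "rotation_phases (amp True (0, 0, 1)) = L_D4d"
  unfolding rotation_phases_UN phase_eval L_D4d_def by (simp add: phases_simps angle_simps) blast

lemma phases_D3z: "rotation_phases (amp False (1, 1, 1)) = L_D3z"
  unfolding rotation_phases_UN phase_eval L_D3z_def by (simp add: phases_simps angle_simps i_neq) blast

lemma phases_D3: "rotation_phases (amp True (1, 1, 1)) = L_D3"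
  unfolding rotation_phases_UN phase_eval L_D3_def by (simp add: phases_simps angle_simps i_neq) blast

lemma phases_D2d: "rotation_phases (amp b (1, if b then 1 else - 1, 0)) = L_D2d"
  unfolding rotation_phases_UN phase_eval L_D2d_def by (cases b; simp add: phases_simps angle_simps i_neq; blast)

lemma phases_Z4c: "rotation_phases (amp b (1, if b then \<i> else - \<i>, 0)) = L_Z4c"
  unfolding rotation_phases_UN phase_eval L_Z4c_def by (cases b; simp add: phases_simps angle_simps i_neq; blast)

lemma phases_Z3t: "rotation_phases (amp b (1, om, omc)) = L_Z3t"
  unfolding rotation_phases_UN phase_eval L_Z3t_def
  by (cases b; simp add: phases_simps angle_simps om_mult om_neq; blast)

section \<open>The groups in degrees zero and three\<close>

lemma parity_antipode: "parity (antipode j) = - parity j"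
  by (simp add: parity_def antipode_vertex)

lemma amp_antipode: "amp b c (antipode j) = (if b then 1 else - 1) * amp b c j"
  by (cases c) (simp add: amp_def parity_antipode antipode_vertex algebra_simps)

lemma phases_S4: "rotation_phases (\<lambda>j. 1) = L_S4"
proof -
  have "\<theta> \<in> {0..<1} \<and> 1 = cis (2 * pi * \<theta>) \<longleftrightarrow> \<theta> = 0" for \<theta>
    using cis_eq_cis_iff[of 0 \<theta>] by auto
  then show ?thesis unfolding rotation_phases_def L_S4_def by auto
qed

text \<open>Half of \<open>x + A x\<close> is the projection of \<open>x\<close> to the axis.\<close>

lemma half_turn_eq:
  assumes w: "w \<bullet> w = 8" and A: "half_turn A w"
  shows "A *v x = ((w \<bullet> x) / 4) *\<^sub>R w - x"
proof -
  define v where "v = ((w \<bullet> x) / 8) *\<^sub>R w"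
  have "orthogonal (x - v) w" using w by (simp add: v_def orthogonal_def inner_diff_left inner_diff_right inner_commute)
  then have 1: "A *v (x - v) = - (x - v)" using A by (simp add: half_turn_def)
  have "A *v w = w" using A by (simp add: half_turn_def)
  then have "A *v v = v" unfolding v_def matrix_vector_mult_scaleR by simp
  then have "A *v x - v = v - x" using 1 unfolding matrix_vector_mult_diff_distrib by simp
  then have "A *v x = v + v - x" by (simp add: algebra_simps)
  also have "v + v = ((w \<bullet> x) / 4) *\<^sub>R w" by (simp add: v_def flip: scaleR_add_left)
  finally show ?thesis .
qed

lemma half_turnI:
  assumes "rotation_matrix A" "w \<bullet> w = 8" "\<And>x. A *v x = ((w \<bullet> x) / 4) *\<^sub>R w - x"
  shows "half_turn A w"
proof -
  have "A *v w = w" using assms(3)[of w] assms(2) by (simp add: scaleR_2)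
  moreover have "A *v u = - u" if "orthogonal u w" for u
    using assms(3)[of u] that by (simp add: orthogonal_def inner_commute)
  ultimately show ?thesis using assms(1) by (simp add: half_turn_def)
qed

text \<open>The half-turn moves the vertex \<open>1\<close> to a vertex that differs from it in one or three coordinates.\<close>

lemma edge_half_turn_parity:
  assumes "edge_half_turn g"
  shows "parity (g 1) = - 1"
proof -
  obtain A i j where A: "induces A g" and e: "{i, j} \<in> cube_edges" and h: "half_turn A (cube_vertex i + cube_vertex j)"
    using assms unfolding edge_half_turn_def by blast
  define w where "w = cube_vertex i + cube_vertex j"
  have ww: "w \<bullet> w = 8 \<and> (\<forall>v. v = ((w \<bullet> cube_vertex 1) / 4) *\<^sub>R w - cube_vertex 1 \<longrightarrow> v $ 1 * v $ 2 * v $ 3 = - 1)"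
    using e unfolding cube_edges_def w_def insert_iff doubleton_eq_iff empty_iff
    by (elim disjE; simp add: inner_vec_def sum_3 cube_vertex_simps)
  have "cube_vertex (g 1) = A *v cube_vertex 1" using A by (simp add: induces_def)
  also have "\<dots> = ((w \<bullet> cube_vertex 1) / 4) *\<^sub>R w - cube_vertex 1"
    using half_turn_eq[of w A] ww h by (simp add: w_def)
  finally show ?thesis using ww unfolding parity_def by blast
qed

text \<open>A quarter-turn about a coordinate axis has the diagonal entry \<open>1\<close> there and \<open>0\<close> elsewhere. Rotations of sign \<open>1\<close>
  either permute the three axes cyclically, with vanishing diagonal, or are diagonal.\<close>

lemma face_quarter_turn_parity:
  assumes "face_quarter_turn g"
  shows "parity (g 1) = - 1"
proof -
  obtain A k where A: "induces A g" and q: "quarter_turn A (axis k 1)"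
    using assms unfolding face_quarter_turn_def by blast
  obtain s where g: "(g, A, s) \<in> rotations"
    using rotations_complete[OF _ A] q unfolding quarter_turn_def by blast
  have "A *v axis k 1 = axis k 1" using q by (simp add: quarter_turn_def)
  then have "(A *v axis k 1) $ k = axis k (1 :: real) $ k" by simp
  then have 1: "A $ k $ k = 1" by (simp add: matrix_vector_mult_basis column_def)
  have 2: "A $ l $ l = 0" if "l \<noteq> k" for l
  proof -
    have "orthogonal (axis l (1 :: real)) (axis k 1)" using that by (simp add: orthogonal_def inner_axis_axis)
    then have "orthogonal (A *v axis l 1) (axis l 1)" using q by (simp add: quarter_turn_def)
    then show ?thesis by (simp add: orthogonal_def matrix_vector_mult_basis column_def inner_axis)
  qed
  have "\<forall>(g, A, s)\<in>rotations. \<forall>k. A $ k $ k = 1 \<longrightarrow> (\<forall>l. l \<noteq> k \<longrightarrow> A $ l $ l = 0) \<longrightarrow> s = - 1"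
    unfolding rotations_def ball_simps split_conv forall_3 by (simp add: vector_3)
  from bspec[OF this g] have "s = - 1" using 1 2 by blast
  then show ?thesis using rotations_induces(2)[OF g] by simp
qed

text \<open>The rotations that interchange two axes and fix the third one pointwise are quarter-turns; those that
  reverse the third one are half-turns about the axis of an edge.\<close>

lemma rotation_odd:
  assumes g: "(g, A, - 1) \<in> rotations"
  shows "face_quarter_turn g \<or> edge_half_turn g"
proof -
  define Q where "Q A k \<longleftrightarrow> A *v axis k 1 = axis k 1 \<and> (\<forall>u. u $ k = 0 \<longrightarrow> (A *v u) \<bullet> u = 0)"
    for A :: "real ^ 3 ^ 3" and k
  define H where "H A i j \<longleftrightarrow> (\<forall>x. A *v x = (((cube_vertex i + cube_vertex j) \<bullet> x) / 4) *\<^sub>R (cube_vertex i + cube_vertex j) - x)"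
    for A i j
  have "\<forall>(g, A, s)\<in>rotations. s = 1 \<or> Q A 1 \<or> Q A 2 \<or> Q A 3 \<or> H A 1 2 \<or> H A 3 4 \<or> H A 1 4 \<or> H A 2 3 \<or> H A 1 5 \<or> H A 2 6"
    unfolding rotations_def ball_simps split_conv
    by (intro conjI TrueI; simp add: Q_def H_def vec_eq_iff forall_3 inner_vec_def matrix_vector_mult_def sum_3 vector_3
        axis_def cube_vertex_simps algebra_simps add_divide_distrib diff_divide_distrib)
  from bspec[OF this g] have "Q A 1 \<or> Q A 2 \<or> Q A 3 \<or> H A 1 2 \<or> H A 3 4 \<or> H A 1 4 \<or> H A 2 3 \<or> H A 1 5 \<or> H A 2 6" by simp
  moreover have "face_quarter_turn g" if "Q A k" for k
  proof -
    have "quarter_turn A (axis k 1)"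
      using that rotations_rotation[OF g] by (auto simp: quarter_turn_def Q_def orthogonal_def inner_axis)
    then show ?thesis using rotations_induces(1)[OF g] unfolding face_quarter_turn_def by blast
  qed
  moreover have "edge_half_turn g" if "H A i j" "{i, j} \<in> cube_edges" for i j
  proof -
    have "(cube_vertex i + cube_vertex j) \<bullet> (cube_vertex i + cube_vertex j) = 8"
      using that(2) unfolding cube_edges_def insert_iff doubleton_eq_iff empty_iff
      by (elim disjE; simp add: inner_vec_def sum_3 cube_vertex_simps)
    then have "half_turn A (cube_vertex i + cube_vertex j)"
      using that(1) rotations_rotation[OF g] unfolding H_def by (intro half_turnI) auto
    then show ?thesis using rotations_induces(1)[OF g] that(2) unfolding edge_half_turn_def by blast
  qed
  moreover have "{1, 2} \<in> cube_edges" "{3, 4} \<in> cube_edges" "{1, 4} \<in> cube_edges" "{2, 3} \<in> cube_edges"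
      "{1, 5} \<in> cube_edges" "{2, 6} \<in> cube_edges"
    unfolding cube_edges_def by (simp_all only: insert_commute insert_iff simp_thms)
  ultimately show ?thesis by blast
qed

lemma rotation_odd_iff: "g \<in> S4 \<Longrightarrow> face_quarter_turn g \<or> edge_half_turn g \<longleftrightarrow> parity (g 1) = - 1"
proof -
  assume "g \<in> S4"
  then obtain A s where g: "(g, A, s) \<in> rotations" unfolding S4_iff by blast
  show ?thesis
    using edge_half_turn_parity face_quarter_turn_parity rotation_odd[of g A] g rotations_induces(2)[OF g] by metis
qed

lemma phases_S4m: "rotation_phases (\<lambda>j. of_real (parity j)) = L_S4m"
proof -
  have "(\<theta> \<in> {0..<1} \<and> (\<forall>j. of_real (parity j) = cis (2 * pi * \<theta>) * of_real (parity (g j)))) \<longleftrightarrow>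
      \<theta> = (if face_quarter_turn g \<or> edge_half_turn g then 1/2 else 0)" if g: "g \<in> S4" for g \<theta>
  proof -
    let ?p = "complex_of_real (parity (g 1))"
    have sign: "of_real q = \<zeta> * of_real (p * q) \<longleftrightarrow> \<zeta> = of_real p"
      if "p = 1 \<or> p = - 1" "q = 1 \<or> q = - 1" for p q :: real and \<zeta> :: complex
    proof
      have 1: "(p * q) * (p * q) = 1" and 2: "q * (p * q) = p" and 3: "p * (p * q) = q" using that by auto
      { assume h: "of_real q = \<zeta> * of_real (p * q)"
        have "\<zeta> = \<zeta> * of_real ((p * q) * (p * q))" unfolding 1 by simp
        also have "\<dots> = \<zeta> * of_real (p * q) * of_real (p * q)" by (simp only: of_real_mult mult.assoc)
        also have "\<dots> = of_real (q * (p * q))" unfolding h[symmetric] by (simp only: of_real_mult)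
        finally show "\<zeta> = of_real p" unfolding 2 . }
      show "of_real q = \<zeta> * of_real (p * q)" if z: "\<zeta> = of_real p"
        unfolding z of_real_mult[symmetric] 3 ..
    qed
    have pm: "parity j = 1 \<or> parity j = - 1" for j
      using parity_square[of j] by (simp add: square_eq_1_iff)
    have eqv: "of_real (parity j) = cis (2 * pi * \<theta>) * of_real (parity (g j)) \<longleftrightarrow> cis (2 * pi * \<theta>) = ?p" for j
      unfolding parity_O4[OF S4_O4[OF g], of j] by (rule sign[OF pm pm])
    have "(\<theta> \<in> {0..<1} \<and> (\<forall>j. of_real (parity j) = cis (2 * pi * \<theta>) * of_real (parity (g j)))) \<longleftrightarrow>
        \<theta> \<in> angle ?p" unfolding eqv angle_def by auto
    also have "\<dots> \<longleftrightarrow> \<theta> = (if parity (g 1) = - 1 then 1/2 else 0)"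
      using pm[of "g 1"] by (auto simp: angle_simps)
    finally show ?thesis unfolding rotation_odd_iff[OF g] .
  qed
  then have mem: "(g, \<theta>) \<in> rotation_phases (\<lambda>j. of_real (parity j)) \<longleftrightarrow>
      g \<in> S4 \<and> \<theta> = (if face_quarter_turn g \<or> edge_half_turn g then 1/2 else 0)" for g \<theta>
    unfolding rotation_phases_def by blast
  show ?thesis
  proof (intro equalityI subsetI)
    fix x assume "x \<in> rotation_phases (\<lambda>j. of_real (parity j))"
    then show "x \<in> L_S4m" by (cases x) (simp only: mem L_S4m_def mem_Collect_eq, blast)
  next
    fix x assume "x \<in> L_S4m"
    then obtain g where "g \<in> S4" "x = (g, if face_quarter_turn g \<or> edge_half_turn g then 1/2 else 0)"
      unfolding L_S4m_def by blast
    then show "x \<in> rotation_phases (\<lambda>j. of_real (parity j))" by (simp only: mem simp_thms)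
  qed
qed

section \<open>The orbits of amplitudes\<close>

text \<open>The representative of a complex line with first nonzero coordinate \<open>1\<close>.\<close>

definition norm_line :: "triple \<Rightarrow> triple" where
  "norm_line = (\<lambda>(x, y, z). if x \<noteq> 0 then (1, y / x, z / x) else if y \<noteq> 0 then (0, 1, z / y) else (0, 0, 1))"

lemma norm_line_smul: "k \<noteq> 0 \<Longrightarrow> norm_line (smul k c) = norm_line c"
  by (cases c) (simp add: norm_line_def smul_def)

lemma norm_line_ex:
  assumes "c \<noteq> (0, 0, 0)"
  shows "\<exists>k. k \<noteq> 0 \<and> c = smul k (norm_line c)"
proof -
  obtain x y z where c: "c = (x, y, z)" by (metis prod.exhaust)
  then show ?thesis
    using assms by (intro exI[of _ "if x \<noteq> 0 then x else if y \<noteq> 0 then y else z"]) (auto simp: norm_line_def smul_def)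
qed

text \<open>Complex lines rather than triples, because proportional amplitudes have the same group.\<close>

definition orbit :: "triple \<Rightarrow> triple set" where
  "orbit c = (\<lambda>(g, A, s). norm_line (tri A c)) ` rotations"

lemmas orbit_eval = orbit_def rotations_def image_insert image_empty split_conv tri_vector norm_line_def

lemma orbit_D4: "orbit (0, 0, 1) = {(1, 0, 0), (0, 1, 0), (0, 0, 1)}"
  unfolding orbit_eval by (simp, intro equalityI; simp)

lemma orbit_D3: "orbit (1, 1, 1) = {(1, 1, 1), (1, 1, - 1), (1, - 1, 1), (1, - 1, - 1)}"
  unfolding orbit_eval by (simp, intro equalityI; simp)

lemma orbit_D2:
  "e \<in> {1, - 1} \<Longrightarrow> orbit (1, e, 0) = {(1, 1, 0), (1, - 1, 0), (1, 0, 1), (1, 0, - 1), (0, 1, 1), (0, 1, - 1)}"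
  unfolding orbit_eval by (elim insertE emptyE; simp; intro equalityI; simp)

lemma orbit_Z4:
  "e \<in> {\<i>, - \<i>} \<Longrightarrow> orbit (1, e, 0) = {(1, \<i>, 0), (1, - \<i>, 0), (1, 0, \<i>), (1, 0, - \<i>), (0, 1, \<i>), (0, 1, - \<i>)}"
  unfolding orbit_eval by (elim insertE emptyE; simp; intro equalityI; simp)

lemma orbit_Z3:
  "orbit (1, om, omc) = {(1, om, omc), (1, om, - omc), (1, - om, omc), (1, - om, - omc),
     (1, omc, om), (1, omc, - om), (1, - omc, om), (1, - omc, - om)}"
  unfolding orbit_eval by (simp add: om_divide om_neq, intro equalityI; simp)

text \<open>One triple for each of the five groups. Two of them depend on the degree, because in degree two a
  rotation that interchanges two axes acts with an additional sign.\<close>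

definition bases :: "bool \<Rightarrow> triple set" where
  "bases b = {(0, 0, 1), (1, 1, 1), (1, if b then 1 else - 1, 0), (1, if b then \<i> else - \<i>, 0), (1, om, omc)}"

text \<open>The five orbits have \<open>3, 4, 6, 6\<close> and \<open>8\<close> elements and are disjoint.\<close>

lemma card_orbits: "card (\<Union>c\<in>bases b. orbit c) = 27"
proof -
  have "(if b then 1 else - 1) \<in> {1, - 1 :: complex}" "(if b then \<i> else - \<i>) \<in> {\<i>, - \<i>}" by simp_all
  note o = orbit_D2[OF this(1)] orbit_Z4[OF this(2)]
  have "card ((orbit (0, 0, 1) \<union> orbit (1, 1, 1)) \<union> (orbit (1, if b then 1 else - 1, 0) \<union> orbit (1, if b then \<i> else - \<i>, 0) \<union> orbit (1, om, omc))) = 27"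
    unfolding o orbit_D4 orbit_D3 orbit_Z3 by (simp add: om_neq i_neq card_insert_if)
  then show ?thesis unfolding bases_def UN_insert UN_empty by (simp only: Un_assoc Un_empty_right)
qed

text \<open>The antipode acts on all amplitudes of one degree by the same sign, so only the rotations matter for the
  group of an amplitude.\<close>

lemma amp_O4:
  assumes h: "h \<in> O4"
  obtains g A s \<epsilon> where "(g, A, s) \<in> rotations" "\<epsilon> \<in> {1, - 1}" "\<And>c j. amp b (tri A c) (h j) = \<epsilon> * amp b c j"
proof -
  consider "h \<in> S4" | "h \<circ> antipode \<in> S4" using O4_cases[OF h] by blast
  then show ?thesis
  proof cases
    case 1
    then obtain A s where r: "(h, A, s) \<in> rotations" unfolding S4_iff by blast
    show ?thesis
      using rotations_sign[OF r] by (intro that[OF r _ amp_rotation[OF r]]) (auto simp: square_eq_1_iff)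
  next
    case 2
    then obtain A s where r: "(h \<circ> antipode, A, s) \<in> rotations" unfolding S4_iff by blast
    let ?e = "(if b then of_real s else 1) * (if b then 1 else - 1) :: complex"
    have "amp b (tri A c) (h j) = ?e * amp b c j" for c j
      using amp_rotation[OF r, of b c "antipode j"] by (simp add: antipode_antipode amp_antipode)
    then show ?thesis
      using rotations_sign[OF r] by (intro that[OF r, of ?e]) (auto simp: square_eq_1_iff)
  qed
qed

lemma amplitude_group_smul: "k \<noteq> 0 \<Longrightarrow> amplitude_group (amp b (smul k c)) = amplitude_group (amp b c)"
proof -
  assume k: "k \<noteq> 0"
  have "amp b (smul k c) = (\<lambda>j. k * amp b c j)" by (rule ext) (rule amp_smul)
  then show ?thesis by (simp only: amplitude_group_scale[OF k])
qed

lemma tri_smul: "tri A (smul k c) = smul k (tri A c)"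
  by (cases c) (simp add: tri_def smul_def algebra_simps)

lemma tri_transpose:
  assumes "(g, A, s) \<in> rotations"
  shows "tri A (tri (transpose A) c) = c"
proof -
  obtain x y z where c: "c = (x, y, z)" by (metis prod.exhaust)
  have "\<forall>(g, A, s)\<in>rotations. tri A (tri (transpose A) (x, y, z)) = (x, y, z)"
    unfolding rotations_def ball_simps split_conv by (simp add: tri_def transpose_def vector_3)
  from bspec[OF this assms] show ?thesis by (simp add: c)
qed

lemma tri_neq_0:
  assumes g: "(g, A, s) \<in> rotations" and c: "c \<noteq> (0, 0, 0)"
  shows "tri A c \<noteq> (0, 0, 0)"
proof
  assume z: "tri A c = (0, 0, 0)"
  have "amp True c j = amp True (0, 0, 0) j" for j
  proof -
    have "of_real s * amp True c j = of_real s * amp True (0, 0, 0) j"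
      using amp_rotation[OF g, of True c j] by (simp add: z amp_def split_beta)
    moreover have "s \<noteq> 0" using rotations_sign[OF g] by auto
    ultimately show ?thesis by simp
  qed
  then show False using c amp_inject by blast
qed

lemma amplitude_group_norm_line: "c \<noteq> (0, 0, 0) \<Longrightarrow> amplitude_group (amp b (norm_line c)) = amplitude_group (amp b c)"
  using norm_line_ex amplitude_group_smul by metis

lemma conj_class_amp:
  assumes c: "c \<noteq> (0, 0, 0)"
  shows "conj_class (amplitude_group (amp b c)) = (\<lambda>d. amplitude_group (amp b d)) ` orbit c"
proof -
  have eq: "amplitude_group (amp b c \<circ> inv_into UNIV h) = amplitude_group (amp b (norm_line (tri A c)))"
    if h: "bij h" and r: "(g, A, s) \<in> rotations" and \<epsilon>: "\<epsilon> \<in> {1, - 1}"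
      and amp: "\<And>c j. amp b (tri A c) (h j) = \<epsilon> * amp b c j" for h g A s \<epsilon>
  proof -
    have "amp b (tri A c) i = \<epsilon> * (amp b c \<circ> inv_into UNIV h) i" for i
      using amp[of c "inv_into UNIV h i"] h by (simp add: bij_is_surj surj_f_inv_f)
    then have "amp b (tri A c) = (\<lambda>i. \<epsilon> * (amp b c \<circ> inv_into UNIV h) i)" by (rule ext)
    then have "amplitude_group (amp b (tri A c)) = amplitude_group (\<lambda>i. \<epsilon> * (amp b c \<circ> inv_into UNIV h) i)"
      by (rule arg_cong)
    also have "\<dots> = amplitude_group (amp b c \<circ> inv_into UNIV h)"
      using \<epsilon> by (intro amplitude_group_scale) auto
    finally show ?thesis unfolding amplitude_group_norm_line[OF tri_neq_0[OF r c]] ..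
  qed
  show ?thesis
    unfolding conj_class_amplitude_group
  proof (intro equalityI subsetI)
    fix K assume "K \<in> (\<lambda>h. amplitude_group (amp b c \<circ> inv_into UNIV h)) ` O4"
    then obtain h where h: "h \<in> O4" and K: "K = amplitude_group (amp b c \<circ> inv_into UNIV h)" by blast
    obtain g A s \<epsilon> where r: "(g, A, s) \<in> rotations" "\<epsilon> \<in> {1, - 1}" "\<And>c j. amp b (tri A c) (h j) = \<epsilon> * amp b c j"
      using amp_O4[OF h] by metis
    have "norm_line (tri A c) \<in> orbit c" unfolding orbit_def using r(1) by force
    then show "K \<in> (\<lambda>d. amplitude_group (amp b d)) ` orbit c"
      unfolding K eq[OF O4_bij[OF h] r] by (rule imageI)
  next
    fix K assume "K \<in> (\<lambda>d. amplitude_group (amp b d)) ` orbit c"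
    then obtain g A s where r: "(g, A, s) \<in> rotations" and K: "K = amplitude_group (amp b (norm_line (tri A c)))"
      unfolding orbit_def by auto
    have \<epsilon>: "(if b then of_real s else 1) \<in> {1, - 1 :: complex}"
      using rotations_sign[OF r] by (auto simp: square_eq_1_iff)
    show "K \<in> (\<lambda>h. amplitude_group (amp b c \<circ> inv_into UNIV h)) ` O4"
      unfolding K eq[OF O4_bij[OF rotations_O4[OF r]] r \<epsilon> amp_rotation[OF r], symmetric]
      using rotations_O4[OF r] by (rule imageI)
  qed
qed

section \<open>Amplitudes that are determined by their symmetry\<close>

text \<open>In the space of amplitudes of one degree, the group of \<open>c\<close> has a fixed space of complex dimension one.\<close>

definition pinned :: "bool \<Rightarrow> triple \<Rightarrow> bool" where
  "pinned b c \<longleftrightarrow> c \<noteq> (0, 0, 0) \<and>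
     (\<forall>d. amplitude_group (amp b c) \<subseteq> amplitude_group (amp b d) \<longrightarrow> (\<exists>k. d = smul k c))"

text \<open>A rotation carries the amplitudes with the group of \<open>c\<close> to those with the conjugate group.\<close>

lemma pinned_tri:
  assumes g: "(g, A, s) \<in> rotations" and c: "pinned b c"
  shows "pinned b (tri A c)"
  unfolding pinned_def
proof (intro conjI allI impI)
  show "tri A c \<noteq> (0, 0, 0)" using tri_neq_0[OF g] c by (simp add: pinned_def)
  fix d assume le: "amplitude_group (amp b (tri A c)) \<subseteq> amplitude_group (amp b d)"
  define d' where "d' = tri (transpose A) d"
  have d: "d = tri A d'" unfolding d'_def tri_transpose[OF g] ..
  let ?\<epsilon> = "if b then of_real s else 1 :: complex"
  have \<epsilon>: "?\<epsilon> \<noteq> 0" using rotations_sign[OF g] by auto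
  have gO: "g \<in> O4" by (rule rotations_O4[OF g])
  have "amplitude_group (amp b c) \<subseteq> amplitude_group (amp b d')"
  proof
    fix x assume x: "x \<in> amplitude_group (amp b c)"
    obtain r h \<theta> where rh: "x = (r, h, \<theta>)" by (metis prod.exhaust)
    define h' where "h' = g \<circ> h \<circ> inv_into UNIV g"
    have h'g: "h' (g j) = g (h j)" for j
      using O4_bij[OF gO] by (simp add: h'_def bij_is_inj)
    have shift: "(of_int r * amp b e j = cis (2 * pi * \<theta>) * amp b e (h j)) \<longleftrightarrow>
        (of_int r * amp b (tri A e) (g j) = cis (2 * pi * \<theta>) * amp b (tri A e) (h' (g j)))" for e j
    proof -
      have "of_int r * (?\<epsilon> * x) = cis (2 * pi * \<theta>) * (?\<epsilon> * y) \<longleftrightarrow> of_int r * x = cis (2 * pi * \<theta>) * y" for x y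
        by (simp only: mult.left_commute[of _ ?\<epsilon>] mult_left_cancel[OF \<epsilon>])
      then show ?thesis unfolding h'g amp_rotation[OF g] by simp
    qed
    have all: "(\<forall>j. P j) \<longleftrightarrow> (\<forall>j. P (g j))" for P using O4_bij[OF gO] by (metis bij_pointE)
    have rt: "r \<in> {1, - 1}" "h \<in> O4" "\<theta> \<in> {0..<1}"
      and e: "\<forall>j. of_int r * amp b c j = cis (2 * pi * \<theta>) * amp b c (h j)"
      using x unfolding rh amplitude_group_iff by simp_all
    have h': "h' \<in> O4" unfolding h'_def using gO rt(2) by (intro O4_comp O4_inv)
    have "(r, h', \<theta>) \<in> amplitude_group (amp b (tri A c))"
      unfolding amplitude_group_iff
      using rt h' e all[of "\<lambda>j. of_int r * amp b (tri A c) j = cis (2 * pi * \<theta>) * amp b (tri A c) (h' j)"]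
      unfolding shift by blast
    then have "(r, h', \<theta>) \<in> amplitude_group (amp b (tri A d'))" using le d by blast
    then have "\<forall>j. of_int r * amp b d' j = cis (2 * pi * \<theta>) * amp b d' (h j)"
      unfolding amplitude_group_iff shift by blast
    then show "x \<in> amplitude_group (amp b d')"
      unfolding rh amplitude_group_iff using rt by blast
  qed
  then obtain k where "d' = smul k c" using c unfolding pinned_def by blast
  then show "\<exists>k. d = smul k (tri A c)" using d tri_smul by metis
qed

lemma smul_smul: "smul k (smul l c) = smul (k * l) c"
  by (cases c) (simp add: smul_def)

lemma pinned_smul:
  assumes k: "k \<noteq> 0" and c: "pinned b (smul k c)"
  shows "pinned b c"
  unfolding pinned_def
proof (intro conjI allI impI)
  show "c \<noteq> (0, 0, 0)" using c by (auto simp: pinned_def smul_def)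
  fix d assume "amplitude_group (amp b c) \<subseteq> amplitude_group (amp b d)"
  then obtain l where "d = smul l (smul k c)" using c amplitude_group_smul[OF k] unfolding pinned_def by metis
  then show "\<exists>k. d = smul k c" unfolding smul_smul by (rule exI)
qed

lemma unit_cis:
  assumes "norm (\<zeta> :: complex) = 1"
  obtains \<theta> where "\<theta> \<in> {0..<1}" "cis (2 * pi * \<theta>) = \<zeta>"
proof (rule that)
  show "frac (Arg \<zeta> / (2 * pi)) \<in> {0..<1}" by (simp add: frac_lt_1)
  have "\<zeta> \<noteq> 0" using assms by auto
  then have "cis (Arg \<zeta>) = \<zeta>" using assms by (simp add: cis_Arg sgn_div_norm)
  then show "cis (2 * pi * frac (Arg \<zeta> / (2 * pi))) = \<zeta>" unfolding cis_frac by simp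
qed

text \<open>A single element of the group suffices if the corresponding eigenvalue of its matrix is simple. The
  phase \<open>\<theta>\<close> is the argument of that eigenvalue, corrected by the sign in degree two.\<close>

lemma pinnedI:
  assumes g: "(g, A, s) \<in> rotations" and c: "c \<noteq> (0, 0, 0)" "tri A c = smul \<mu> c" and \<mu>: "norm \<mu> = 1"
    and eig: "\<And>d. tri A d = smul \<mu> d \<Longrightarrow> \<exists>k. d = smul k c"
  shows "pinned b c"
  unfolding pinned_def
proof (intro conjI allI impI c)
  let ?\<epsilon> = "if b then of_real s else 1 :: complex"
  have "s = 1 \<or> s = - 1" using rotations_sign[OF g] by (simp add: square_eq_1_iff)
  then have \<epsilon>: "?\<epsilon> * ?\<epsilon> = 1" "norm ?\<epsilon> = 1" by auto
  obtain \<theta> where \<theta>: "\<theta> \<in> {0..<1}" "cis (2 * pi * \<theta>) = ?\<epsilon> * \<mu>"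
    using unit_cis[of "?\<epsilon> * \<mu>"] \<epsilon>(2) \<mu> by (metis norm_mult mult_1)
  have iff: "(1, g, \<theta>) \<in> amplitude_group (amp b e) \<longleftrightarrow> tri A e = smul \<mu> e" for e
  proof -
    have "of_int 1 * x = ?\<epsilon> * \<mu> * y \<longleftrightarrow> ?\<epsilon> * x = \<mu> * y" for x y
      using \<epsilon>(1) by (metis mult.assoc mult_1 of_int_1)
    then have "(1, g, \<theta>) \<in> amplitude_group (amp b e) \<longleftrightarrow> (\<forall>j. amp b (tri A e) (g j) = amp b (smul \<mu> e) (g j))"
      unfolding amplitude_group_iff amp_rotation[OF g] amp_smul \<theta>(2) using \<theta>(1) rotations_O4[OF g] by simp
    also have "\<dots> \<longleftrightarrow> (\<forall>j. amp b (tri A e) j = amp b (smul \<mu> e) j)"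
      using O4_bij[OF rotations_O4[OF g]] by (metis bij_pointE)
    finally show ?thesis unfolding amp_inject .
  qed
  fix d assume "amplitude_group (amp b c) \<subseteq> amplitude_group (amp b d)"
  then show "\<exists>k. d = smul k c" using iff[of c] iff[of d] c(2) eig by blast
qed

lemma pinned_bases:
  assumes "c \<in> bases b"
  shows "pinned b c"
proof -
  have r1: "(cyc [[1,2,3,4], [5,6,7,8]], vector [vector [0, - 1, 0], vector [1, 0, 0], vector [0, 0, 1]], - 1) \<in> rotations"
    and r2: "(cyc [[2,5,4], [3,6,8]], vector [vector [0, 1, 0], vector [0, 0, 1], vector [1, 0, 0]], 1) \<in> rotations"
    and r3: "(cyc [[1,7], [2,6], [3,5], [4,8]], vector [vector [0, - 1, 0], vector [- 1, 0, 0], vector [0, 0, - 1]], - 1) \<in> rotations"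
    and r4: "(cyc [[1,5], [2,8], [3,7], [4,6]], vector [vector [0, 1, 0], vector [1, 0, 0], vector [0, 0, - 1]], - 1) \<in> rotations"
    unfolding rotations_def insert_iff by simp_all
  have entries: "of_real 0 * x + u = u" "u + of_real 0 * x = u" "of_real 1 * x = x" "of_real (- 1) * x = - x" "1 * x = x" for x u :: complex
    by simp_all
  have self_neg: "- x = x \<Longrightarrow> x = 0" for x :: complex by (simp add: complex_eq_iff)
  have "pinned b (0, 0, 1)"
  proof (rule pinnedI[OF r1, of _ 1])
    fix d assume "tri (vector [vector [0, - 1, 0], vector [1, 0, 0], vector [0, 0, 1]]) d = smul 1 d"
    moreover obtain x y z where d: "d = (x, y, z)" by (metis prod.exhaust)
    ultimately have "- y = x \<and> x = y \<and> z = z"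
      unfolding d tri_vector smul_simps prod.inject entries by fast
    then have "x = 0 \<and> y = 0" using self_neg by metis
    then show "\<exists>k. d = smul k (0, 0, 1)" unfolding d by (intro exI[of _ z]) (simp add: smul_def)
  qed (simp_all add: tri_vector smul_def)
  moreover have "pinned b (1, 1, 1)"
  proof (rule pinnedI[OF r2, of _ 1])
    fix d assume "tri (vector [vector [0, 1, 0], vector [0, 0, 1], vector [1, 0, 0]]) d = smul 1 d"
    moreover obtain x y z where d: "d = (x, y, z)" by (metis prod.exhaust)
    ultimately have "y = x \<and> z = y \<and> x = z"
      unfolding d tri_vector smul_simps prod.inject entries by fast
    then have "y = x \<and> z = x" using self_neg by metis
    then show "\<exists>k. d = smul k (1, 1, 1)" unfolding d by (intro exI[of _ x]) (simp add: smul_def)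
  qed (simp_all add: tri_vector smul_def)
  moreover have "pinned b (1, - 1, 0)"
  proof (rule pinnedI[OF r3, of _ 1])
    fix d assume "tri (vector [vector [0, - 1, 0], vector [- 1, 0, 0], vector [0, 0, - 1]]) d = smul 1 d"
    moreover obtain x y z where d: "d = (x, y, z)" by (metis prod.exhaust)
    ultimately have "- y = x \<and> - x = y \<and> - z = z"
      unfolding d tri_vector smul_simps prod.inject entries by fast
    then have "y = - x \<and> z = 0" using self_neg by metis
    then show "\<exists>k. d = smul k (1, - 1, 0)" unfolding d by (intro exI[of _ x]) (simp add: smul_def)
  qed (simp_all add: tri_vector smul_def)
  moreover have "pinned b (1, 1, 0)"
  proof (rule pinnedI[OF r4, of _ 1])
    fix d assume "tri (vector [vector [0, 1, 0], vector [1, 0, 0], vector [0, 0, - 1]]) d = smul 1 d"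
    moreover obtain x y z where d: "d = (x, y, z)" by (metis prod.exhaust)
    ultimately have "y = x \<and> x = y \<and> - z = z"
      unfolding d tri_vector smul_simps prod.inject entries by fast
    then have "y = x \<and> z = 0" using self_neg by metis
    then show "\<exists>k. d = smul k (1, 1, 0)" unfolding d by (intro exI[of _ x]) (simp add: smul_def)
  qed (simp_all add: tri_vector smul_def)
  moreover have "pinned b (1, e, 0)" if e: "e \<in> {\<i>, - \<i>}" for e
  proof (rule pinnedI[OF r1, of _ "- e"])
    show "norm (- e) = 1" using e by auto
    fix d assume "tri (vector [vector [0, - 1, 0], vector [1, 0, 0], vector [0, 0, 1]]) d = smul (- e) d"
    moreover obtain x y z where d: "d = (x, y, z)" by (metis prod.exhaust)
    ultimately have eqs: "- y = - e * x \<and> x = - e * y \<and> z = - e * z"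
      unfolding d tri_vector smul_simps prod.inject entries by fast
    have y: "y = e * x" using eqs by (metis minus_minus mult_minus_left)
    have "z = - (e * z)" using eqs by (metis mult_minus_left)
    then have z: "(1 + e) * z = 0" by (metis distrib_right mult_1 add.left_inverse neg_eq_iff_add_eq_0)
    have "1 + e \<noteq> 0" using e by (auto simp: complex_eq_iff)
    then have "z = 0" using z by simp
    then show "\<exists>k. d = smul k (1, e, 0)" unfolding d y by (intro exI[of _ x]) (simp add: smul_def)
  qed (use e in \<open>auto simp: tri_vector smul_def\<close>)
  moreover have "pinned b (1, om, omc)"
  proof (rule pinnedI[OF r2, of _ om])
    show "norm om = 1"
    proof -
      have "norm om ^ 2 = 1" unfolding cmod_power2 by (simp add: om_def power2_eq_square)
      then show ?thesis by (simp add: power2_eq_1_iff) (metis norm_ge_zero neg_0_le_iff_le not_one_le_zero)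
    qed
    fix d assume "tri (vector [vector [0, 1, 0], vector [0, 0, 1], vector [1, 0, 0]]) d = smul om d"
    moreover obtain x y z where d: "d = (x, y, z)" by (metis prod.exhaust)
    ultimately have "y = om * x \<and> z = om * y \<and> x = om * z"
      unfolding d tri_vector smul_simps prod.inject entries by fast
    then have "y = om * x" "z = (om * om) * x" unfolding mult.assoc by blast+
    then show "\<exists>k. d = smul k (1, om, omc)"
      unfolding d om_mult by (intro exI[of _ x]) (simp add: smul_def mult.commute)
  qed (simp_all add: tri_vector smul_def om_mult)
  ultimately show ?thesis using assms unfolding bases_def by (cases b) auto
qed

lemma pinned_orbit:
  assumes c: "c \<in> bases b" and d: "d \<in> orbit c"
  shows "pinned b d" "norm_line d = d"
proof -
  obtain g A s where r: "(g, A, s) \<in> rotations" and d: "d = norm_line (tri A c)"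
    using d unfolding orbit_def by auto
  have p: "pinned b (tri A c)" by (rule pinned_tri[OF r pinned_bases[OF c]])
  then have "tri A c \<noteq> (0, 0, 0)" by (simp add: pinned_def)
  then obtain k where k: "k \<noteq> 0" "tri A c = smul k (norm_line (tri A c))" using norm_line_ex by blast
  show "pinned b d" using p k pinned_smul unfolding d by metis
  show "norm_line d = d" using k norm_line_smul unfolding d by metis
qed

text \<open>Amplitudes with the same group are proportional, so different lines have different groups.\<close>

lemma card_amplitude_groups: "card ((\<lambda>d. amplitude_group (amp b d)) ` (\<Union>c\<in>bases b. orbit c)) = 27"
proof -
  have "inj_on (\<lambda>d. amplitude_group (amp b d)) (\<Union>c\<in>bases b. orbit c)"
  proof (rule inj_onI)
    fix d d' assume d: "d \<in> (\<Union>c\<in>bases b. orbit c)" "d' \<in> (\<Union>c\<in>bases b. orbit c)"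
      and eq: "amplitude_group (amp b d) = amplitude_group (amp b d')"
    have p: "pinned b d" "pinned b d'" "norm_line d = d" "norm_line d' = d'" using d pinned_orbit by blast+
    then obtain k where k: "d' = smul k d" using eq unfolding pinned_def by blast
    have "k \<noteq> 0" using p(2) unfolding k pinned_def by (cases d) (auto simp: smul_def)
    then show "d = d'" using norm_line_smul[of k d] p(3,4) k by simp
  qed
  then show ?thesis by (simp only: card_image card_orbits)
qed

lemma conj_classes_minus:
  "(\<Union>L\<in>{L_D4z, L_D3z, L_D2d, L_Z4c, L_Z3t}. conj_class (minus_ext L)) =
    (\<lambda>d. amplitude_group (amp False d)) ` (\<Union>c\<in>bases False. orbit c)"
proof -
  have ph: "rotation_phases (amp False (1, - 1, 0)) = L_D2d" "rotation_phases (amp False (1, - \<i>, 0)) = L_Z4c"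
    using phases_D2d[of False] phases_Z4c[of False] by simp_all
  have ext: "minus_ext (rotation_phases (amp False c)) = amplitude_group (amp False c)" for c
    by (rule minus_ext_eq) (simp add: amp_antipode)
  have cl: "conj_class (minus_ext (rotation_phases (amp False c))) = (\<lambda>d. amplitude_group (amp False d)) ` orbit c"
    if "c \<in> bases False" for c
    unfolding ext by (rule conj_class_amp) (use pinned_bases[OF that] in \<open>simp add: pinned_def\<close>)
  have "(\<Union>L\<in>{L_D4z, L_D3z, L_D2d, L_Z4c, L_Z3t}. conj_class (minus_ext L)) =
      (\<Union>c\<in>bases False. conj_class (minus_ext (rotation_phases (amp False c))))"
    unfolding bases_def UN_insert UN_empty if_False phases_D4z phases_D3z ph phases_Z3t ..
  also have "\<dots> = (\<Union>c\<in>bases False. (\<lambda>d. amplitude_group (amp False d)) ` orbit c)"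
    by (intro SUP_cong cl refl)
  finally show ?thesis unfolding image_UN .
qed

lemma conj_classes_plus:
  "(\<Union>L\<in>{L_D4d, L_D3, L_D2d, L_Z4c, L_Z3t}. conj_class (plus_ext L)) =
    (\<lambda>d. amplitude_group (amp True d)) ` (\<Union>c\<in>bases True. orbit c)"
proof -
  have ph: "rotation_phases (amp True (1, 1, 0)) = L_D2d" "rotation_phases (amp True (1, \<i>, 0)) = L_Z4c"
    using phases_D2d[of True] phases_Z4c[of True] by simp_all
  have ext: "plus_ext (rotation_phases (amp True c)) = amplitude_group (amp True c)" for c
    by (rule plus_ext_eq) (simp add: amp_antipode)
  have cl: "conj_class (plus_ext (rotation_phases (amp True c))) = (\<lambda>d. amplitude_group (amp True d)) ` orbit c"
    if "c \<in> bases True" for c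
    unfolding ext by (rule conj_class_amp) (use pinned_bases[OF that] in \<open>simp add: pinned_def\<close>)
  have "(\<Union>L\<in>{L_D4d, L_D3, L_D2d, L_Z4c, L_Z3t}. conj_class (plus_ext L)) =
      (\<Union>c\<in>bases True. conj_class (plus_ext (rotation_phases (amp True c))))"
    unfolding bases_def UN_insert UN_empty if_True phases_D4d phases_D3 ph phases_Z3t ..
  also have "\<dots> = (\<Union>c\<in>bases True. (\<lambda>d. amplitude_group (amp True d)) ` orbit c)"
    by (intro SUP_cong cl refl)
  finally show ?thesis unfolding image_UN .
qed

section \<open>The critical amplitudes\<close>

definition kernel_amp :: "real \<Rightarrow> real \<Rightarrow> (8 \<Rightarrow> complex) set" where
  "kernel_amp a \<alpha>\<^sub>0 = {w. linearisation a \<alpha>\<^sub>0 *v re_vec w = 0 \<and> linearisation a \<alpha>\<^sub>0 *v im_vec w = 0}"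

lemma kernel_expansion:
  assumes a: "a \<noteq> 0" and x: "linearisation a (k * a) *v x = 0"
  shows "x $ j = (\<Sum>m\<in>UNIV. if walsh_degree m = k then (walsh m \<bullet> x) / 8 * walsh m $ j else 0)"
proof -
  interpret eigenbasis "linearisation a (k * a)" eigenvec "growth a (k * a)" by (rule eigenbasis_cube)
  have "x $ j = (\<Sum>m\<in>UNIV. (eigenvec m \<bullet> x) *\<^sub>R eigenvec m) $ j" unfolding expansion ..
  also have "\<dots> = (\<Sum>m\<in>UNIV. (eigenvec m \<bullet> x) * eigenvec m $ j)" by simp
  also have "\<dots> = (\<Sum>m\<in>UNIV. if walsh_degree m = k then (walsh m \<bullet> x) / 8 * walsh m $ j else 0)"
  proof (rule sum.cong[OF refl])
    fix m
    have "eigenvec m \<bullet> x = 0" if "walsh_degree m \<noteq> k"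
      using x a that unfolding kernel_iff by (auto simp: growth_def)
    moreover have "(eigenvec m \<bullet> x) * eigenvec m $ j = (walsh m \<bullet> x) / 8 * walsh m $ j"
      by (simp add: eigenvec_def)
    ultimately show "(eigenvec m \<bullet> x) * eigenvec m $ j = (if walsh_degree m = k then (walsh m \<bullet> x) / 8 * walsh m $ j else 0)"
      by auto
  qed
  finally show ?thesis .
qed

lemma linearisation_walsh: "linearisation a (walsh_degree m * a) *v walsh m = 0"
  unfolding linearisation_mult cube_matrix_walsh by (simp add: vec_eq_iff)

text \<open>On the monomials of degree \<open>d\<close> the linearisation at \<open>k a\<close> is \<open>a (k - d)\<close>, which vanishes only for \<open>d = k\<close>.\<close>

lemma kernel_amp_iff:
  assumes a: "a \<noteq> 0"
  shows "w \<in> kernel_amp a (k * a) \<longleftrightarrow>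
    (\<exists>f. \<forall>j. w j = (\<Sum>m\<in>UNIV. if walsh_degree m = k then f m * of_real (walsh m $ j) else 0))"
proof
  assume w: "w \<in> kernel_amp a (k * a)"
  define f where "f m = Complex ((walsh m \<bullet> re_vec w) / 8) (- ((walsh m \<bullet> im_vec w) / 8))" for m
  have "w j = (\<Sum>m\<in>UNIV. if walsh_degree m = k then f m * of_real (walsh m $ j) else 0)" for j
  proof (rule complex_eqI)
    have "Re (w j) = re_vec w $ j" by (simp add: re_vec_def)
    also have "\<dots> = (\<Sum>m\<in>UNIV. if walsh_degree m = k then (walsh m \<bullet> re_vec w) / 8 * walsh m $ j else 0)"
      using w unfolding kernel_amp_def by (intro kernel_expansion[OF a]) simp
    finally show "Re (w j) = Re (\<Sum>m\<in>UNIV. if walsh_degree m = k then f m * of_real (walsh m $ j) else 0)"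
      by (simp add: f_def if_distrib[of Re] cong: if_cong)
    have "Im (w j) = - (im_vec w $ j)" by (simp add: im_vec_def)
    also have "im_vec w $ j = (\<Sum>m\<in>UNIV. if walsh_degree m = k then (walsh m \<bullet> im_vec w) / 8 * walsh m $ j else 0)"
      using w unfolding kernel_amp_def by (intro kernel_expansion[OF a]) simp
    finally show "Im (w j) = Im (\<Sum>m\<in>UNIV. if walsh_degree m = k then f m * of_real (walsh m $ j) else 0)"
      unfolding sum_negf[symmetric] by (simp add: f_def if_distrib[of Im] if_distrib[of uminus] cong: if_cong)
  qed
  then show "\<exists>f. \<forall>j. w j = (\<Sum>m\<in>UNIV. if walsh_degree m = k then f m * of_real (walsh m $ j) else 0)" by blast
next
  assume "\<exists>f. \<forall>j. w j = (\<Sum>m\<in>UNIV. if walsh_degree m = k then f m * of_real (walsh m $ j) else 0)"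
  then obtain f where f: "\<And>j. w j = (\<Sum>m\<in>UNIV. if walsh_degree m = k then f m * of_real (walsh m $ j) else 0)" by blast
  have kill: "linearisation a (k * a) *v (\<Sum>m\<in>UNIV. (if walsh_degree m = k then c m else 0) *\<^sub>R walsh m) = 0" for c
  proof -
    have "linearisation a (k * a) *v (\<Sum>m\<in>UNIV. (if walsh_degree m = k then c m else 0) *\<^sub>R walsh m) =
        (\<Sum>m\<in>UNIV. linearisation a (k * a) *v ((if walsh_degree m = k then c m else 0) *\<^sub>R walsh m))"
      by (rule linear_sum) (rule matrix_vector_mul_linear)
    also have "\<dots> = 0"
      by (rule sum.neutral) (auto simp: matrix_vector_mult_scaleR linearisation_walsh)
    finally show ?thesis .
  qed
  have "re_vec w = (\<Sum>m\<in>UNIV. (if walsh_degree m = k then Re (f m) else 0) *\<^sub>R walsh m)"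
    unfolding vec_eq_iff re_vec_def vec_lambda_beta f by (simp add: if_distrib cong: if_cong) (intro allI sum.cong refl; simp)
  moreover have "im_vec w = (\<Sum>m\<in>UNIV. (if walsh_degree m = k then - Im (f m) else 0) *\<^sub>R walsh m)"
    unfolding vec_eq_iff im_vec_def vec_lambda_beta f Im_sum sum_negf[symmetric] sum_component by (intro allI sum.cong refl) simp
  ultimately show "w \<in> kernel_amp a (k * a)" unfolding kernel_amp_def by (simp add: kill)
qed

lemma ex_coefficient: "(\<exists>f. w = (\<lambda>j. f m * u j)) \<longleftrightarrow> (\<exists>k. w = (\<lambda>j. k * u j))"
proof
  assume "\<exists>f. w = (\<lambda>j. f m * u j)"
  then obtain f where "w = (\<lambda>j. f m * u j)" ..
  then show "\<exists>k. w = (\<lambda>j. k * u j)" by (rule exI[of _ "f m"])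
next
  assume "\<exists>k. w = (\<lambda>j. k * u j)"
  then obtain k where "w = (\<lambda>j. k * u j)" ..
  then show "\<exists>f. w = (\<lambda>j. f m * u j)" by (rule exI[of _ "\<lambda>_. k"])
qed

lemma kernel_degree_0:
  assumes "a \<noteq> 0"
  shows "w \<in> kernel_amp a 0 \<longleftrightarrow> (\<exists>k. w = (\<lambda>j. k * 1))"
proof -
  have "w \<in> kernel_amp a (0 * a) \<longleftrightarrow> (\<exists>f. w = (\<lambda>j. f (1 :: 8) * 1))"
    unfolding kernel_amp_iff[OF assms] sum_8 walsh_degree_simps walsh_simps fun_eq_iff by simp
  also have "\<dots> \<longleftrightarrow> (\<exists>k. w = (\<lambda>j. k * 1))" by (rule ex_coefficient)
  finally show ?thesis by simp
qed

lemma kernel_degree_1: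
  assumes "a \<noteq> 0"
  shows "w \<in> kernel_amp a a \<longleftrightarrow> (\<exists>c. w = amp False c)"
proof -
  have "w \<in> kernel_amp a (1 * a) \<longleftrightarrow> (\<exists>c. w = amp False c)"
  proof
    assume "w \<in> kernel_amp a (1 * a)"
    then obtain f where "\<forall>j. w j = (\<Sum>m\<in>UNIV. if walsh_degree m = 1 then f m * of_real (walsh m $ j) else 0)"
      unfolding kernel_amp_iff[OF assms] by blast
    then have "w = amp False (f 2, f 3, f 4)"
      unfolding sum_8 walsh_degree_simps walsh_simps fun_eq_iff by (simp add: amp_def)
    then show "\<exists>c. w = amp False c" ..
  next
    assume "\<exists>c. w = amp False c"
    then obtain x y z where "w = amp False (x, y, z)" by auto
    then show "w \<in> kernel_amp a (1 * a)"
      unfolding kernel_amp_iff[OF assms] sum_8 walsh_degree_simps walsh_simps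
      by (intro exI[of _ "\<lambda>m. if m = 2 then x else if m = 3 then y else z"]) (simp add: amp_def eq_8_simps)
  qed
  then show ?thesis by simp
qed

text \<open>The product of two coordinates of a vertex is the product of all three times the remaining one, since
  the coordinates are \<open>1\<close> or \<open>- 1\<close>.\<close>

lemma kernel_degree_2:
  assumes "a \<noteq> 0"
  shows "w \<in> kernel_amp a (2 * a) \<longleftrightarrow> (\<exists>c. w = amp True c)"
proof -
  have "\<forall>j. parity j * cube_vertex j $ 1 = cube_vertex j $ 2 * cube_vertex j $ 3 \<and>
      parity j * cube_vertex j $ 2 = cube_vertex j $ 3 * cube_vertex j $ 1 \<and>
      parity j * cube_vertex j $ 3 = cube_vertex j $ 1 * cube_vertex j $ 2"
    unfolding forall_8 by (simp add: parity_simps cube_vertex_simps)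
  then have p: "cube_vertex j $ 2 * cube_vertex j $ 3 = parity j * cube_vertex j $ 1"
      "cube_vertex j $ 3 * cube_vertex j $ 1 = parity j * cube_vertex j $ 2"
      "cube_vertex j $ 1 * cube_vertex j $ 2 = parity j * cube_vertex j $ 3" for j by simp_all
  show ?thesis
  proof
    assume "w \<in> kernel_amp a (2 * a)"
    then obtain f where "\<forall>j. w j = (\<Sum>m\<in>UNIV. if walsh_degree m = 2 then f m * of_real (walsh m $ j) else 0)"
      unfolding kernel_amp_iff[OF assms] by blast
    then have "w = amp True (f 5, f 6, f 7)"
      unfolding sum_8 walsh_degree_simps walsh_simps fun_eq_iff p by (simp add: amp_def algebra_simps)
    then show "\<exists>c. w = amp True c" ..
  next
    assume "\<exists>c. w = amp True c"
    then obtain x y z where "w = amp True (x, y, z)" by auto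
    then show "w \<in> kernel_amp a (2 * a)"
      unfolding kernel_amp_iff[OF assms] sum_8 walsh_degree_simps walsh_simps p
      by (intro exI[of _ "\<lambda>m. if m = 5 then x else if m = 6 then y else z"]) (simp add: amp_def eq_8_simps algebra_simps)
  qed
qed

lemma kernel_degree_3:
  assumes "a \<noteq> 0"
  shows "w \<in> kernel_amp a (3 * a) \<longleftrightarrow> (\<exists>k. w = (\<lambda>j. k * of_real (parity j)))"
proof -
  have "w \<in> kernel_amp a (3 * a) \<longleftrightarrow> (\<exists>f. w = (\<lambda>j. f (8 :: 8) * of_real (parity j)))"
    unfolding kernel_amp_iff[OF assms] sum_8 walsh_degree_simps walsh_simps fun_eq_iff parity_def[symmetric] by simp
  also have "\<dots> \<longleftrightarrow> (\<exists>k. w = (\<lambda>j. k * of_real (parity j)))" by (rule ex_coefficient)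
  finally show ?thesis .
qed

text \<open>A complex multiple of the amplitude is a real multiple of the wave shifted in time.\<close>

lemma critical_pair_amplitude:
  assumes w: "w \<in> kernel_amp a \<alpha>\<^sub>0" "w i \<noteq> 0"
    and spanned: "\<And>w'. w' \<in> kernel_amp a \<alpha>\<^sub>0 \<Longrightarrow> amplitude_group w \<subseteq> amplitude_group w' \<Longrightarrow> \<exists>k. w' = (\<lambda>j. k * w j)"
  shows "critical_pair a \<alpha>\<^sub>0 (re_vec w) (im_vec w)"
  unfolding critical_pair_def
proof (intro conjI allI impI)
  show "linearisation a \<alpha>\<^sub>0 *v re_vec w = 0" "linearisation a \<alpha>\<^sub>0 *v im_vec w = 0"
    using w(1) by (simp_all add: kernel_amp_def)
  show "re_vec w \<noteq> 0 \<or> im_vec w \<noteq> 0"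
    using w(2) by (auto simp: vec_eq_iff re_vec_def im_vec_def complex_eq_iff)
  fix p' q' assume h: "linearisation a \<alpha>\<^sub>0 *v p' = 0 \<and> linearisation a \<alpha>\<^sub>0 *v q' = 0 \<and>
      wave_group (re_vec w) (im_vec w) \<subseteq> wave_group p' q'"
  define w' where "w' j = Complex (p' $ j) (- (q' $ j))" for j
  have p': "re_vec w' = p'" and q': "im_vec w' = q'" by (simp_all add: vec_eq_iff re_vec_def im_vec_def w'_def)
  obtain k where k: "w' = (\<lambda>j. k * w j)"
    using spanned[of w'] h unfolding kernel_amp_def amplitude_group_def p' q' mem_Collect_eq by blast
  show "\<exists>c d. p' = c *\<^sub>R re_vec w + d *\<^sub>R im_vec w \<and> q' = c *\<^sub>R im_vec w - d *\<^sub>R re_vec w"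
    unfolding p'[symmetric] q'[symmetric] k
    by (intro exI[of _ "Re k"] exI[of _ "Im k"]) (simp add: vec_eq_iff re_vec_def im_vec_def)
qed

lemma pinned_critical_pair:
  assumes c: "pinned b c" and k: "\<And>w. w \<in> kernel_amp a \<alpha>\<^sub>0 \<longleftrightarrow> (\<exists>c. w = amp b c)"
  shows "critical_pair a \<alpha>\<^sub>0 (re_vec (amp b c)) (im_vec (amp b c))"
proof -
  have "\<exists>i. amp b c i \<noteq> amp b (0, 0, 0) i" using c amp_inject unfolding pinned_def by blast
  then obtain i where i: "amp b c i \<noteq> 0" by (auto simp: amp_def)
  show ?thesis
  proof (rule critical_pair_amplitude[where i = i])
    show "amp b c \<in> kernel_amp a \<alpha>\<^sub>0" unfolding k by blast
    show "amp b c i \<noteq> 0" by (rule i)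
    fix w' assume w': "w' \<in> kernel_amp a \<alpha>\<^sub>0" "amplitude_group (amp b c) \<subseteq> amplitude_group w'"
    then obtain d where d: "w' = amp b d" unfolding k by blast
    then obtain l where "d = smul l c" using w'(2) c unfolding pinned_def by blast
    then show "\<exists>k. w' = (\<lambda>j. k * amp b c j)" unfolding d by (intro exI[of _ l]) (simp add: fun_eq_iff amp_smul)
  qed
qed

section \<open>Counting branches\<close>

lemma eventually_unit: "\<forall>\<^sub>F s in at_right 0. s \<in> {0<..<1 :: real}"
  unfolding eventually_at_right_field by (intro exI[of _ 1]) auto

lemma germ_le_refl: "germ_le \<gamma> \<gamma>"
proof -
  obtain \<alpha> T x where \<gamma>: "\<gamma> = (\<alpha>, T, x)" by (metis prod.exhaust)
  show ?thesis
    unfolding \<gamma> germ_le.simps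
  proof (intro allI impI)
    fix \<epsilon> :: real assume "\<epsilon> > 0"
    then have "\<forall>\<^sub>F s in at_right 0. s \<in> {0<..<\<epsilon>}" unfolding eventually_at_right_field by (intro exI[of _ \<epsilon>]) auto
    then show "\<forall>\<^sub>F s in at_right 0. \<exists>s'\<in>{0<..<\<epsilon>}. \<alpha> s = \<alpha> s' \<and> T s = T s' \<and> (\<exists>\<tau>. \<forall>t. x s t = x s' (t + \<tau>))"
      by eventually_elim (metis add.right_neutral)
  qed
qed

lemma germ_le_trans:
  assumes "germ_le \<gamma> \<gamma>'" "germ_le \<gamma>' \<gamma>''"
  shows "germ_le \<gamma> \<gamma>''"
proof -
  obtain \<alpha> T x where \<gamma>: "\<gamma> = (\<alpha>, T, x)" by (metis prod.exhaust)
  obtain \<alpha>' T' x' where \<gamma>': "\<gamma>' = (\<alpha>', T', x')" by (metis prod.exhaust)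
  obtain \<alpha>'' T'' x'' where \<gamma>'': "\<gamma>'' = (\<alpha>'', T'', x'')" by (metis prod.exhaust)
  show ?thesis
    unfolding \<gamma> \<gamma>'' germ_le.simps
  proof (intro allI impI)
    fix \<epsilon> :: real assume \<epsilon>: "\<epsilon> > 0"
    obtain \<delta> where \<delta>: "\<delta> > 0" "\<And>s. 0 < s \<Longrightarrow> s < \<delta> \<Longrightarrow> \<exists>s'\<in>{0<..<\<epsilon>}. \<alpha>' s = \<alpha>'' s' \<and> T' s = T'' s' \<and> (\<exists>\<tau>. \<forall>t. x' s t = x'' s' (t + \<tau>))"
    proof -
      have "\<forall>\<^sub>F s in at_right 0. \<exists>s'\<in>{0<..<\<epsilon>}. \<alpha>' s = \<alpha>'' s' \<and> T' s = T'' s' \<and> (\<exists>\<tau>. \<forall>t. x' s t = x'' s' (t + \<tau>))"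
        using assms(2) \<epsilon> unfolding \<gamma>' \<gamma>'' germ_le.simps by blast
      then show ?thesis using that unfolding eventually_at_right_field by auto
    qed
    have "\<forall>\<^sub>F s in at_right 0. \<exists>s'\<in>{0<..<\<delta>}. \<alpha> s = \<alpha>' s' \<and> T s = T' s' \<and> (\<exists>\<tau>. \<forall>t. x s t = x' s' (t + \<tau>))"
      using assms(1) \<delta>(1) unfolding \<gamma> \<gamma>' germ_le.simps by blast
    then show "\<forall>\<^sub>F s in at_right 0. \<exists>s'\<in>{0<..<\<epsilon>}. \<alpha> s = \<alpha>'' s' \<and> T s = T'' s' \<and> (\<exists>\<tau>. \<forall>t. x s t = x'' s' (t + \<tau>))"
    proof eventually_elim
      case (elim s)
      then obtain s' \<tau> where s': "s' \<in> {0<..<\<delta>}" "\<alpha> s = \<alpha>' s'" "T s = T' s'" and x: "\<And>t. x s t = x' s' (t + \<tau>)" by blast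
      then obtain s'' \<tau>' where s'': "s'' \<in> {0<..<\<epsilon>}" "\<alpha>' s' = \<alpha>'' s''" "T' s' = T'' s''" and x': "\<And>t. x' s' t = x'' s'' (t + \<tau>')"
        using \<delta>(2)[of s'] by auto
      have "x s t = x'' s'' (t + (\<tau> + \<tau>'))" for t unfolding x x' by (simp only: add.assoc)
      then show ?case using s' s'' by (intro bexI[of _ s'']) auto
    qed
  qed
qed

lemma equiv_same_branch: "equiv UNIV same_branch"
  unfolding same_branch_def
  by (intro equivI refl_onI symI transI) (auto intro: germ_le_refl germ_le_trans)

lemma sym_group_shift: "sym_group (\<lambda>t. x (t + \<tau>)) T = sym_group x T"
proof -
  have "(\<forall>t. act r h (x (t - \<theta> * T + \<tau>)) = x (t + \<tau>)) \<longleftrightarrow> (\<forall>t. act r h (x (t - \<theta> * T)) = x t)" for r h \<theta>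
  proof safe
    fix t assume "\<forall>t. act r h (x (t - \<theta> * T + \<tau>)) = x (t + \<tau>)"
    from spec[OF this, of "t - \<tau>"] show "act r h (x (t - \<theta> * T)) = x t" by (simp add: algebra_simps)
  next
    fix t assume "\<forall>t. act r h (x (t - \<theta> * T)) = x t"
    from spec[OF this, of "t + \<tau>"] show "act r h (x (t - \<theta> * T + \<tau>)) = x (t + \<tau>)" by (simp add: algebra_simps)
  qed
  then have "(r, h, \<theta>) \<in> sym_group (\<lambda>t. x (t + \<tau>)) T \<longleftrightarrow> (r, h, \<theta>) \<in> sym_group x T" for r h \<theta>
    unfolding sym_group_iff by blast
  then show ?thesis by (intro equalityI subsetI) (metis prod.exhaust)+
qed

text \<open>Families with a common solution have the same group, since a time shift does not change the group.\<close>

lemma germ_le_symmetry: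
  assumes "is_branch a \<alpha>\<^sub>0 K \<gamma>" "is_branch a \<alpha>\<^sub>0 K' \<gamma>'" "germ_le \<gamma> \<gamma>'"
  shows "K = K'"
proof -
  obtain \<alpha> T x where \<gamma>: "\<gamma> = (\<alpha>, T, x)" by (metis prod.exhaust)
  obtain \<alpha>' T' x' where \<gamma>': "\<gamma>' = (\<alpha>', T', x')" by (metis prod.exhaust)
  have "\<forall>\<^sub>F s in at_right 0. \<exists>s'\<in>{0<..<1}. \<alpha> s = \<alpha>' s' \<and> T s = T' s' \<and> (\<exists>\<tau>. \<forall>t. x s t = x' s' (t + \<tau>))"
    using assms(3) unfolding \<gamma> \<gamma>' germ_le.simps by simp
  then have "\<forall>\<^sub>F s in at_right (0::real). K = K'"
    using eventually_unit
  proof eventually_elim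
    case (elim s)
    then obtain s' \<tau> where s': "s' \<in> {0<..<1}" "T s = T' s'" and x: "\<And>t. x s t = x' s' (t + \<tau>)" by blast
    have "K = sym_group (x s) (T s)" using assms(1) elim(2) by (simp add: \<gamma>)
    also have "x s = (\<lambda>t. x' s' (t + \<tau>))" using x by (rule ext)
    also have "sym_group (\<lambda>t. x' s' (t + \<tau>)) (T s) = sym_group (x' s') (T' s')" unfolding sym_group_shift s'(2) ..
    also have "\<dots> = K'" using assms(2) s'(1) by (simp add: \<gamma>')
    finally show ?case .
  qed
  then show ?thesis by simp
qed

text \<open>Each group carries one branch, and branches with different groups are different.\<close>

lemma supercritical_bifurcationsI:
  assumes critical: "\<And>K. K \<in> \<K> \<Longrightarrow> \<exists>p q. critical_pair a \<alpha>\<^sub>0 p q \<and> K = wave_group p q"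
  shows "supercritical_bifurcations a \<alpha>\<^sub>0 \<K> (card \<K>)"
proof -
  have ex: "\<exists>\<gamma>. is_branch a \<alpha>\<^sub>0 K \<gamma>" if "K \<in> \<K>" for K
    using critical[OF that] cube_branch.branch_exists cube_branch.intro by blast
  then obtain B where B: "\<And>K. K \<in> \<K> \<Longrightarrow> is_branch a \<alpha>\<^sub>0 K (B K)" by metis
  have same: "(\<gamma>, \<gamma>') \<in> same_branch" if "K \<in> \<K>" "is_branch a \<alpha>\<^sub>0 K \<gamma>" "is_branch a \<alpha>\<^sub>0 K \<gamma>'" for K \<gamma> \<gamma>'
    using critical[OF that(1)] that(2,3) cube_branch.branch_unique cube_branch.intro unfolding same_branch_def by blast
  have "bij_betw (\<lambda>K. same_branch `` {B K}) \<K> (branches a \<alpha>\<^sub>0 \<K> // same_branch)"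
  proof (rule bij_betwI')
    fix K K' assume K: "K \<in> \<K>" "K' \<in> \<K>"
    show "same_branch `` {B K} = same_branch `` {B K'} \<longleftrightarrow> K = K'"
    proof
      assume "same_branch `` {B K} = same_branch `` {B K'}"
      then have "(B K, B K') \<in> same_branch" using eq_equiv_class[OF _ equiv_same_branch] by blast
      then show "K = K'" using germ_le_symmetry[OF B[OF K(1)] B[OF K(2)]] by (simp add: same_branch_def)
    qed simp
  next
    fix K assume "K \<in> \<K>"
    then have "B K \<in> branches a \<alpha>\<^sub>0 \<K>" using B unfolding branches_def by blast
    then show "same_branch `` {B K} \<in> branches a \<alpha>\<^sub>0 \<K> // same_branch" by (rule quotientI)
  next
    fix X assume "X \<in> branches a \<alpha>\<^sub>0 \<K> // same_branch"
    then obtain \<gamma> where \<gamma>: "\<gamma> \<in> branches a \<alpha>\<^sub>0 \<K>" "X = same_branch `` {\<gamma>}" by (rule quotientE)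
    then obtain K where K: "K \<in> \<K>" "is_branch a \<alpha>\<^sub>0 K \<gamma>" unfolding branches_def by blast
    show "\<exists>K\<in>\<K>. X = same_branch `` {B K}"
      using equiv_class_eq[OF equiv_same_branch same[OF K B[OF K(1)]]] \<gamma>(2) K(1) by blast
  qed
  from bij_betw_same_card[OF this] have "card (branches a \<alpha>\<^sub>0 \<K> // same_branch) = card \<K>" ..
  then show ?thesis
    unfolding supercritical_bifurcations_def using ex branch_supercritical unfolding branches_def by blast
qed

theorem theorem2p1:
  fixes a :: real
  assumes "a > 0"
  shows
    "supercritical_bifurcations a 0 {plus_ext L_S4} 1 \<and>
     supercritical_bifurcations a a
       (\<Union>L\<in>{L_D4z, L_D3z, L_D2d, L_Z4c, L_Z3t}. conj_class (minus_ext L)) 27 \<and>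
     supercritical_bifurcations a (2 * a)
       (\<Union>L\<in>{L_D4d, L_D3, L_D2d, L_Z4c, L_Z3t}. conj_class (plus_ext L)) 27 \<and>
     supercritical_bifurcations a (3 * a) {minus_ext L_S4m} 1"
proof (intro conjI)
  have a: "a \<noteq> 0" using assms by simp
  have one: "supercritical_bifurcations a \<alpha>\<^sub>0 {amplitude_group w} 1"
    if w: "w 1 = 1" and k: "\<And>w'. w' \<in> kernel_amp a \<alpha>\<^sub>0 \<longleftrightarrow> (\<exists>k. w' = (\<lambda>j. k * w j))" for \<alpha>\<^sub>0 w
  proof -
    have "w = (\<lambda>j. 1 * w j)" by simp
    then have "critical_pair a \<alpha>\<^sub>0 (re_vec w) (im_vec w)"
      using k w by (intro critical_pair_amplitude[where i = 1]) (blast, simp, blast)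
    then show ?thesis
      using supercritical_bifurcationsI[of "{amplitude_group w}" a \<alpha>\<^sub>0] unfolding amplitude_group_def by auto
  qed
  have many: "supercritical_bifurcations a \<alpha>\<^sub>0 ((\<lambda>d. amplitude_group (amp b d)) ` (\<Union>c\<in>bases b. orbit c)) 27"
    if k: "\<And>w. w \<in> kernel_amp a \<alpha>\<^sub>0 \<longleftrightarrow> (\<exists>c. w = amp b c)" for \<alpha>\<^sub>0 b
    unfolding card_amplitude_groups[of b, symmetric]
  proof (rule supercritical_bifurcationsI)
    fix K assume "K \<in> (\<lambda>d. amplitude_group (amp b d)) ` (\<Union>c\<in>bases b. orbit c)"
    then obtain c d where "c \<in> bases b" "d \<in> orbit c" and K: "K = amplitude_group (amp b d)" by blast
    then have "critical_pair a \<alpha>\<^sub>0 (re_vec (amp b d)) (im_vec (amp b d))"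
      by (intro pinned_critical_pair[OF _ k] pinned_orbit)
    then show "\<exists>p q. critical_pair a \<alpha>\<^sub>0 p q \<and> K = wave_group p q" unfolding K amplitude_group_def by blast
  qed
  have "plus_ext L_S4 = amplitude_group (\<lambda>j. 1)"
    unfolding phases_S4[symmetric] by (rule plus_ext_eq) simp
  then show "supercritical_bifurcations a 0 {plus_ext L_S4} 1"
    using one[OF _ kernel_degree_0[OF a]] by simp
  show "supercritical_bifurcations a a (\<Union>L\<in>{L_D4z, L_D3z, L_D2d, L_Z4c, L_Z3t}. conj_class (minus_ext L)) 27"
    unfolding conj_classes_minus by (rule many[OF kernel_degree_1[OF a]])
  show "supercritical_bifurcations a (2 * a) (\<Union>L\<in>{L_D4d, L_D3, L_D2d, L_Z4c, L_Z3t}. conj_class (plus_ext L)) 27"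
    unfolding conj_classes_plus by (rule many[OF kernel_degree_2[OF a]])
  have "minus_ext L_S4m = amplitude_group (\<lambda>j. of_real (parity j))"
    unfolding phases_S4m[symmetric] by (rule minus_ext_eq) (simp add: parity_antipode)
  then show "supercritical_bifurcations a (3 * a) {minus_ext L_S4m} 1"
    using one[OF _ kernel_degree_3[OF a]] by (simp add: parity_simps)
qed

end
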